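(* Let $\mathfrak{g}$ be a finite-dimensional semisimple Lie algebra or a symmetric Kac--Moody algebra. Let $\lambda_1,\lambda_2,\mu_1,\mu_2\in P^+$ and $w\in W$ be such that $\lambda_1-\lambda_2=w(\mu_2-\mu_1)\in P_w^+$. Then there is a canonical morphism $K(\lambda_1,w,\mu_1)\to K(\lambda_2,w,\mu_2)$ (and hence a surjective map of $U\mathfrak{g}$-modules). In particular, $K(\lambda_1,w,\mu_1)\ominus K(\lambda_2,w,\mu_2)$ is Schur positive.
   Context: Base field $\mathbb{C}$. A symmetric Kac--Moody algebra is one whose generalized Cartan matrix is symmetric. $\Delta_{re}^{\pm}$ are the sets of positive/negative real roots, $\alpha^\vee$ the coroot of a real root $\alpha$, $W$ the Weyl group, $P$ the integral weights, $P^+$ the dominant integral weights. $V(\lambda)$ is the irreducible integrable highest weight module of highest weight $\lambda\in P^+$, and $v_{\sigma\lambda}$ ($\sigma\in W$) is a nonzero vector of weight $\sigma\lambda$ in $V(\lambda)$ (unique up to scalar). For $w\in W$: $I(w):=\{\alpha\in\Delta_{re}^+: w^{-1}\alpha\in\Delta_{re}^-\}$ and $P_w^+:=\{\lambda\in P:\langle\lambda,\alpha^\vee\rangle\ge0\text{ for all }\alpha\in I(w)\}$. Kostant--Kumar module: $K(\lambda,w,\mu)=U\mathfrak{g}(v_\lambda\otimes v_{w\mu})\subseteq V(\lambda)\otimes V(\mu)$. A canonical morphism $K(\lambda_1,w_1,\mu_1)\to K(\lambda_2,w_2,\mu_2)$ is a $U\mathfrak{g}$-linear map sending the cyclic generator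 $v_{\lambda_1}\otimes v_{w_1\mu_1}$ to the cyclic generator $v_{\lambda_2}\otimes v_{w_2\mu_2}$ (generators being defined up to nonzero scalars). For integrable modules $V,V'$ in category $\mathcal{O}$, $V\ominus V'$ is Schur positive if there is a $U\mathfrak{g}$-linear surjection $V\twoheadrightarrow V'$. *)

theory Defs
  imports "HOL-Analysis.Analysis" "HOL-Library.Function_Algebras" "HOL-Library.Poly_Mapping"
begin

section \<open>Complex vector spaces\<close>

class complex_vector = ab_group_add +
  fixes scaleC :: "complex \<Rightarrow> 'a \<Rightarrow> 'a"  (infixr "*\<^sub>C" 75)
  assumes scaleC_add_right: "a *\<^sub>C (x + y) = a *\<^sub>C x + a *\<^sub>C y"
    and scaleC_add_left: "(a + b) *\<^sub>C x = a *\<^sub>C x + b *\<^sub>C x"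
    and scaleC_scaleC: "a *\<^sub>C b *\<^sub>C x = (a * b) *\<^sub>C x"
    and scaleC_one: "1 *\<^sub>C x = x"

global_interpretation cvec: vector_space "scaleC :: complex \<Rightarrow> 'a \<Rightarrow> 'a::complex_vector"
  by unfold_locales (simp_all add: scaleC_add_right scaleC_add_left scaleC_scaleC scaleC_one)

abbreviation clinear :: "('a::complex_vector \<Rightarrow> 'b::complex_vector) \<Rightarrow> bool"
  where "clinear \<equiv> Vector_Spaces.linear scaleC scaleC"

lemma clinearI:
  assumes "\<And>x y. f (x + y) = f x + f y" and "\<And>c x. f (c *\<^sub>C x) = c *\<^sub>C f x"
  shows "clinear f"
  using assms by unfold_locales auto

lemma clinear_add: "clinear f \<Longrightarrow> f (x + y) = f x + f y"
  and clinear_scale: "clinear f \<Longrightarrow> f (c *\<^sub>C x) = c *\<^sub>C f x"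
  by (auto simp: Vector_Spaces.linear_iff)

definition cbilinear :: "('a::complex_vector \<Rightarrow> 'b::complex_vector \<Rightarrow> 'c::complex_vector) \<Rightarrow> bool"
  where "cbilinear f \<longleftrightarrow> (\<forall>y. clinear (\<lambda>x. f x y)) \<and> (\<forall>x. clinear (f x))"

definition finite_dim :: "'a::complex_vector set \<Rightarrow> bool"
  where "finite_dim S \<longleftrightarrow> (\<exists>B. finite B \<and> S \<subseteq> cvec.span B)"

instantiation complex :: complex_vector
begin
definition scaleC_complex :: "complex \<Rightarrow> complex \<Rightarrow> complex"
  where "scaleC_complex a x = a * x"
instance by standard (simp_all add: scaleC_complex_def algebra_simps)
end

instantiation "fun" :: (type, complex_vector) complex_vector
begin
definition scaleC_fun :: "complex \<Rightarrow> ('a \<Rightarrow> 'b) \<Rightarrow> 'a \<Rightarrow> 'b"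
  where "scaleC_fun a f = (\<lambda>x. a *\<^sub>C f x)"
instance
  by standard
    (simp_all add: scaleC_fun_def fun_eq_iff scaleC_add_right scaleC_add_left scaleC_scaleC scaleC_one)
end

instantiation poly_mapping :: (type, complex_vector) complex_vector
begin
definition scaleC_poly_mapping :: "complex \<Rightarrow> ('a \<Rightarrow>\<^sub>0 'b) \<Rightarrow> 'a \<Rightarrow>\<^sub>0 'b"
  where "scaleC_poly_mapping a = Poly_Mapping.map (scaleC a)"
lemma lookup_scaleC: "Poly_Mapping.lookup (a *\<^sub>C p) k = a *\<^sub>C Poly_Mapping.lookup p k"
  by (simp add: scaleC_poly_mapping_def Poly_Mapping.map.rep_eq when_def)

instance
  by standard
    (simp_all add: poly_mapping_eq_iff fun_eq_iff lookup_scaleC lookup_add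
      scaleC_add_right scaleC_add_left scaleC_scaleC scaleC_one)
end


section \<open>Tensor products of complex vector spaces\<close>

text \<open>The free vector space on the pairs, modulo the span of the bilinearity relations.\<close>

abbreviation free_pair :: "'a \<Rightarrow> 'b \<Rightarrow> ('a \<times> 'b) \<Rightarrow>\<^sub>0 complex"
  where "free_pair v w \<equiv> Poly_Mapping.single (v, w) 1"

definition tensor_relators :: "(('a::complex_vector \<times> 'b::complex_vector) \<Rightarrow>\<^sub>0 complex) set"
  where "tensor_relators =
      {free_pair (v + v') w - free_pair v w - free_pair v' w |v v' w. True}
    \<union> {free_pair v (w + w') - free_pair v w - free_pair v w' |v w w'. True}
    \<union> {free_pair (c *\<^sub>C v) w - c *\<^sub>C free_pair v w |c v w. True}
    \<union> {free_pair v (c *\<^sub>C w) - c *\<^sub>C free_pair v w |c v w. True}"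

definition tensor_eq ::
    "(('a::complex_vector \<times> 'b::complex_vector) \<Rightarrow>\<^sub>0 complex) \<Rightarrow> (('a \<times> 'b) \<Rightarrow>\<^sub>0 complex) \<Rightarrow> bool"
  where "tensor_eq p q \<longleftrightarrow> p - q \<in> cvec.span tensor_relators"

lemma equivp_tensor_eq: "equivp (tensor_eq :: (('a::complex_vector \<times> 'b::complex_vector) \<Rightarrow>\<^sub>0 complex) \<Rightarrow> _)"
  (is "equivp ?R")
proof (rule equivpI)
  show "reflp ?R" by (simp add: reflp_def tensor_eq_def cvec.span_zero)
  show "symp ?R"
  proof (rule sympI)
    fix p q :: "('a \<times> 'b) \<Rightarrow>\<^sub>0 complex"
    assume "tensor_eq p q"
    from cvec.span_neg[OF this[unfolded tensor_eq_def]] show "tensor_eq q p"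
      by (simp add: tensor_eq_def)
  qed
  show "transp ?R"
  proof (rule transpI)
    fix p q r :: "('a \<times> 'b) \<Rightarrow>\<^sub>0 complex"
    assume "tensor_eq p q" "tensor_eq q r"
    from cvec.span_add[OF this[unfolded tensor_eq_def]] show "tensor_eq p r"
      by (simp add: tensor_eq_def)
  qed
qed

quotient_type (overloaded) ('a, 'b) tensor (infixr "\<otimes>\<^sub>C" 75) =
  "('a::complex_vector \<times> 'b::complex_vector) \<Rightarrow>\<^sub>0 complex" / tensor_eq
  by (rule equivp_tensor_eq)

instantiation tensor :: (complex_vector, complex_vector) complex_vector
begin
lift_definition zero_tensor :: "'a \<otimes>\<^sub>C 'b" is 0 .
lift_definition plus_tensor :: "'a \<otimes>\<^sub>C 'b \<Rightarrow> 'a \<otimes>\<^sub>C 'b \<Rightarrow> 'a \<otimes>\<^sub>C 'b" is "(+)"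
  unfolding tensor_eq_def by (subst add_diff_add) (rule cvec.span_add)
lift_definition uminus_tensor :: "'a \<otimes>\<^sub>C 'b \<Rightarrow> 'a \<otimes>\<^sub>C 'b" is uminus
  unfolding tensor_eq_def by (subst minus_diff_minus) (rule cvec.span_neg)
lift_definition minus_tensor :: "'a \<otimes>\<^sub>C 'b \<Rightarrow> 'a \<otimes>\<^sub>C 'b \<Rightarrow> 'a \<otimes>\<^sub>C 'b" is "(-)"
  unfolding tensor_eq_def by (drule (1) cvec.span_diff) (simp add: diff_diff_eq2 diff_diff_eq add_diff_eq diff_add_eq add.commute)
lift_definition scaleC_tensor :: "complex \<Rightarrow> 'a \<otimes>\<^sub>C 'b \<Rightarrow> 'a \<otimes>\<^sub>C 'b" is scaleC
  unfolding tensor_eq_def by (subst cvec.scale_right_diff_distrib[symmetric]) (rule cvec.span_scale)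
instance
proof
  fix a b :: complex and x y z :: "'a \<otimes>\<^sub>C 'b"
  show "x + y + z = x + (y + z)" by transfer (simp add: add.assoc tensor_eq_def cvec.span_zero)
  show "x + y = y + x" by transfer (simp add: add.commute tensor_eq_def cvec.span_zero)
  show "0 + x = x" by transfer (simp add: tensor_eq_def cvec.span_zero)
  show "- x + x = 0" by transfer (simp add: tensor_eq_def cvec.span_zero)
  show "x - y = x + - y" by transfer (simp add: tensor_eq_def cvec.span_zero)
  show "a *\<^sub>C (x + y) = a *\<^sub>C x + a *\<^sub>C y"
    by transfer (simp add: tensor_eq_def cvec.span_zero scaleC_add_right)
  show "(a + b) *\<^sub>C x = a *\<^sub>C x + b *\<^sub>C x"
    by transfer (simp add: tensor_eq_def cvec.span_zero scaleC_add_left)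
  show "a *\<^sub>C b *\<^sub>C x = (a * b) *\<^sub>C x"
    by transfer (simp add: tensor_eq_def cvec.span_zero scaleC_scaleC)
  show "1 *\<^sub>C x = x" by transfer (simp add: tensor_eq_def cvec.span_zero scaleC_one)
qed
end

lift_definition pure_tensor :: "'a::complex_vector \<Rightarrow> 'b::complex_vector \<Rightarrow> 'a \<otimes>\<^sub>C 'b"  (infixr "\<otimes>" 75)
  is free_pair .

lemma tensor_add_left: "(v + v') \<otimes> w = v \<otimes> w + v' \<otimes> w"
  by transfer
    (simp add: tensor_eq_def diff_diff_eq[symmetric], rule cvec.span_base,
      unfold tensor_relators_def, blast)

lemma tensor_add_right: "v \<otimes> (w + w') = v \<otimes> w + v \<otimes> w'"
  by transfer
    (simp add: tensor_eq_def diff_diff_eq[symmetric], rule cvec.span_base,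
      unfold tensor_relators_def, blast)

lemma tensor_scale_left: "(c *\<^sub>C v) \<otimes> w = c *\<^sub>C (v \<otimes> w)"
  by transfer (unfold tensor_eq_def, rule cvec.span_base, unfold tensor_relators_def, blast)

lemma tensor_scale_right: "v \<otimes> (c *\<^sub>C w) = c *\<^sub>C (v \<otimes> w)"
  by transfer (unfold tensor_eq_def, rule cvec.span_base, unfold tensor_relators_def, blast)

lemmas tensor_simps = tensor_add_left tensor_add_right tensor_scale_left tensor_scale_right

lemma tensor_induct [case_names add scale pure]:
  assumes add: "\<And>s t. P s \<Longrightarrow> P t \<Longrightarrow> P (s + t)"
    and scale: "\<And>c t. P t \<Longrightarrow> P (c *\<^sub>C t)"
    and pure: "\<And>v w. P (v \<otimes> w)"
  shows "P t"
proof -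
  have zero: "P 0" using scale[OF pure, of 0 0 0] by simp
  have single: "P (abs_tensor (Poly_Mapping.single k c))" for k c
  proof -
    obtain v w where k: "k = (v, w)" by (cases k)
    have "Poly_Mapping.single k c = c *\<^sub>C free_pair v w"
      by (simp add: k poly_mapping_eq_iff fun_eq_iff lookup_scaleC lookup_single when_def scaleC_complex_def)
    then show ?thesis
      using scale[OF pure, of c v w] by (simp add: pure_tensor.abs_eq scaleC_tensor.abs_eq)
  qed
  have "Poly_Mapping.keys p \<subseteq> S \<Longrightarrow> P (abs_tensor p)" if "finite S" for S p
    using that
  proof (induction S arbitrary: p rule: finite_induct)
    case empty
    then have "p = 0" by simp
    with zero show ?case by (simp add: zero_tensor_def)
  next
    case (insert k S)
    let ?s = "Poly_Mapping.single k (Poly_Mapping.lookup p k)"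
    have "Poly_Mapping.keys (p - ?s) \<subseteq> S"
      using insert.prems by (auto simp: in_keys_iff lookup_minus lookup_single when_def split: if_splits)
    from add[OF insert.IH[OF this] single] show ?case
      by (metis plus_tensor.abs_eq diff_add_cancel)
  qed
  then have "P (abs_tensor p)" for p by (meson finite_keys subset_refl)
  then show ?thesis by (metis Quotient3_abs_rep[OF Quotient3_tensor])
qed

definition free_lift :: "('a \<Rightarrow> 'b \<Rightarrow> 'c::complex_vector) \<Rightarrow> (('a \<times> 'b) \<Rightarrow>\<^sub>0 complex) \<Rightarrow> 'c"
  where "free_lift \<beta> p = (\<Sum>k\<in>Poly_Mapping.keys p. Poly_Mapping.lookup p k *\<^sub>C \<beta> (fst k) (snd k))"

text \<open>The linear map out of the tensor product induced by \<open>\<beta>\<close>; it is meaningful only for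
  bilinear \<open>\<beta>\<close>, for which the choice of representative does not matter
  (see \<open>tensor_lift_pure\<close> and \<open>clinear_tensor_lift\<close>).\<close>

definition tensor_lift ::
    "('a::complex_vector \<Rightarrow> 'b::complex_vector \<Rightarrow> 'c::complex_vector) \<Rightarrow> 'a \<otimes>\<^sub>C 'b \<Rightarrow> 'c"
  where "tensor_lift \<beta> t = free_lift \<beta> (rep_tensor t)"

lemma free_lift_superset:
  assumes "finite S" "Poly_Mapping.keys p \<subseteq> S"
  shows "free_lift \<beta> p = (\<Sum>k\<in>S. Poly_Mapping.lookup p k *\<^sub>C \<beta> (fst k) (snd k))"
  unfolding free_lift_def using assms
  by (intro sum.mono_neutral_left) (auto simp: in_keys_iff)

lemma clinear_free_lift: "clinear (free_lift \<beta>)"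
proof (rule clinearI)
  fix p q :: "('a \<times> 'b) \<Rightarrow>\<^sub>0 complex" and c
  let ?S = "Poly_Mapping.keys p \<union> Poly_Mapping.keys q"
  show "free_lift \<beta> (p + q) = free_lift \<beta> p + free_lift \<beta> q"
    using Poly_Mapping.keys_add[of p q]
    by (subst (1 2 3) free_lift_superset[of ?S])
      (auto simp: lookup_add scaleC_add_left sum.distrib)
  have "Poly_Mapping.keys (c *\<^sub>C p) \<subseteq> Poly_Mapping.keys p"
    by (auto simp: in_keys_iff lookup_scaleC)
  then show "free_lift \<beta> (c *\<^sub>C p) = c *\<^sub>C free_lift \<beta> p"
    by (subst (1 2) free_lift_superset[of "Poly_Mapping.keys p"])
      (auto simp: lookup_scaleC cvec.scale_sum_right scaleC_complex_def)
qed

lemma free_lift_pair: "free_lift \<beta> (free_pair v w) = \<beta> v w"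
  by (simp add: free_lift_def)

lemma free_lift_cong:
  assumes "cbilinear \<beta>" "tensor_eq p q"
  shows "free_lift \<beta> p = free_lift \<beta> q"
proof -
  note lin = clinear_free_lift[of \<beta>]
  have diff: "free_lift \<beta> (p - q) = free_lift \<beta> p - free_lift \<beta> q" for p q
    using clinear_add[OF lin, of "p - q" q] by (simp add: algebra_simps)
  have b: "clinear (\<lambda>x. \<beta> x y)" "clinear (\<beta> x)" for x y
    using assms(1) by (auto simp: cbilinear_def)
  have "free_lift \<beta> r = 0" if "r \<in> tensor_relators" for r
    using that unfolding tensor_relators_def
    by (auto simp: diff free_lift_pair clinear_scale[OF lin]
        clinear_add[OF b(1)] clinear_add[OF b(2)] clinear_scale[OF b(1)] clinear_scale[OF b(2)])
  then have "tensor_relators \<subseteq> {r. free_lift \<beta> r = 0}" by auto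
  moreover have "cvec.subspace {r. free_lift \<beta> r = 0}"
    unfolding cvec.subspace_def using clinear_add[OF lin] clinear_scale[OF lin]
    by (auto simp: free_lift_def)
  ultimately have "cvec.span tensor_relators \<subseteq> {r. free_lift \<beta> r = 0}"
    by (rule cvec.span_minimal)
  with assms(2) show ?thesis by (auto simp: tensor_eq_def diff)
qed

lemma tensor_lift_abs:
  assumes "cbilinear \<beta>"
  shows "tensor_lift \<beta> (abs_tensor p) = free_lift \<beta> p"
  unfolding tensor_lift_def
  by (rule free_lift_cong[OF assms]) (rule rep_abs_rsp_left[OF Quotient3_tensor], simp add: tensor_eq_def cvec.span_zero)

lemma tensor_lift_pure: "cbilinear \<beta> \<Longrightarrow> tensor_lift \<beta> (v \<otimes> w) = \<beta> v w"
  by (simp add: pure_tensor.abs_eq tensor_lift_abs free_lift_pair)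

lemma clinear_tensor_lift:
  assumes "cbilinear \<beta>"
  shows "clinear (tensor_lift \<beta>)"
proof (rule clinearI)
  fix s t :: "'a \<otimes>\<^sub>C 'b" and c
  obtain p q where [simp]: "s = abs_tensor p" "t = abs_tensor q"
    by (metis Quotient3_abs_rep[OF Quotient3_tensor])
  show "tensor_lift \<beta> (s + t) = tensor_lift \<beta> s + tensor_lift \<beta> t"
    by (simp add: plus_tensor.abs_eq tensor_lift_abs[OF assms] clinear_add[OF clinear_free_lift])
  show "tensor_lift \<beta> (c *\<^sub>C s) = c *\<^sub>C tensor_lift \<beta> s"
    by (simp add: scaleC_tensor.abs_eq tensor_lift_abs[OF assms] clinear_scale[OF clinear_free_lift])
qed


section \<open>Lie algebras and their modules\<close>

definition lie_algebra :: "('g::complex_vector \<Rightarrow> 'g \<Rightarrow> 'g) \<Rightarrow> bool"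
  where "lie_algebra br \<longleftrightarrow> cbilinear br \<and> (\<forall>x. br x x = 0) \<and>
    (\<forall>x y z. br x (br y z) + br y (br z x) + br z (br x y) = 0)"

definition lie_subalgebra :: "('g::complex_vector \<Rightarrow> 'g \<Rightarrow> 'g) \<Rightarrow> 'g set \<Rightarrow> bool"
  where "lie_subalgebra br S \<longleftrightarrow> cvec.subspace S \<and> (\<forall>x\<in>S. \<forall>y\<in>S. br x y \<in> S)"

definition lie_ideal :: "('g::complex_vector \<Rightarrow> 'g \<Rightarrow> 'g) \<Rightarrow> 'g set \<Rightarrow> bool"
  where "lie_ideal br S \<longleftrightarrow> cvec.subspace S \<and> (\<forall>x. \<forall>y\<in>S. br x y \<in> S)"

definition lie_generated :: "('g::complex_vector \<Rightarrow> 'g \<Rightarrow> 'g) \<Rightarrow> 'g set \<Rightarrow> 'g set"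
  where "lie_generated br X = \<Inter> {S. lie_subalgebra br S \<and> X \<subseteq> S}"

definition lie_derived :: "('g::complex_vector \<Rightarrow> 'g \<Rightarrow> 'g) \<Rightarrow> 'g set \<Rightarrow> 'g set"
  where "lie_derived br S = cvec.span {br x y |x y. x \<in> S \<and> y \<in> S}"

definition lie_solvable :: "('g::complex_vector \<Rightarrow> 'g \<Rightarrow> 'g) \<Rightarrow> 'g set \<Rightarrow> bool"
  where "lie_solvable br S \<longleftrightarrow> (\<exists>n. (lie_derived br ^^ n) S = {0})"

definition lie_semisimple :: "('g::complex_vector \<Rightarrow> 'g \<Rightarrow> 'g) \<Rightarrow> bool"
  where "lie_semisimple br \<longleftrightarrow> (\<forall>I. lie_ideal br I \<and> lie_solvable br I \<longrightarrow> I = {0})"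

definition lie_module ::
    "('g::complex_vector \<Rightarrow> 'g \<Rightarrow> 'g) \<Rightarrow> ('g \<Rightarrow> 'v::complex_vector \<Rightarrow> 'v) \<Rightarrow> bool"
  where "lie_module br \<rho> \<longleftrightarrow> cbilinear \<rho> \<and>
    (\<forall>x y v. \<rho> (br x y) v = \<rho> x (\<rho> y v) - \<rho> y (\<rho> x v))"

definition submodule :: "('g \<Rightarrow> 'v::complex_vector \<Rightarrow> 'v) \<Rightarrow> 'v set \<Rightarrow> bool"
  where "submodule \<rho> M \<longleftrightarrow> cvec.subspace M \<and> (\<forall>x. \<forall>v\<in>M. \<rho> x v \<in> M)"

text \<open>The enveloping algebra is spanned by the monomials \<open>x\<^sub>1 \<cdots> x\<^sub>n\<close>, so \<open>(U\<gg>)v\<close> is the span of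
  the vectors \<open>x\<^sub>1(x\<^sub>2(\<cdots>(x\<^sub>n v)))\<close>, and a \<open>U\<gg>\<close>-linear map is a linear map commuting with
  the action of the Lie algebra.\<close>

definition U_span :: "('g \<Rightarrow> 'v::complex_vector \<Rightarrow> 'v) \<Rightarrow> 'v \<Rightarrow> 'v set"
  where "U_span \<rho> v = cvec.span {foldr \<rho> xs v |xs. True}"

definition U_linear :: "('g \<Rightarrow> 'v::complex_vector \<Rightarrow> 'v) \<Rightarrow> 'v set \<Rightarrow>
    ('g \<Rightarrow> 'u::complex_vector \<Rightarrow> 'u) \<Rightarrow> 'u set \<Rightarrow> ('v \<Rightarrow> 'u) \<Rightarrow> bool"
  where "U_linear \<rho> M \<rho>' M' \<phi> \<longleftrightarrow> \<phi> ` M \<subseteq> M' \<and>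
    (\<forall>v\<in>M. \<forall>v'\<in>M. \<phi> (v + v') = \<phi> v + \<phi> v') \<and>
    (\<forall>c. \<forall>v\<in>M. \<phi> (c *\<^sub>C v) = c *\<^sub>C \<phi> v) \<and>
    (\<forall>x. \<forall>v\<in>M. \<phi> (\<rho> x v) = \<rho>' x (\<phi> v))"

definition tensor_act :: "('g \<Rightarrow> 'v::complex_vector \<Rightarrow> 'v) \<Rightarrow> ('g \<Rightarrow> 'u::complex_vector \<Rightarrow> 'u) \<Rightarrow>
    'g \<Rightarrow> 'v \<otimes>\<^sub>C 'u \<Rightarrow> 'v \<otimes>\<^sub>C 'u"
  where "tensor_act \<rho> \<sigma> x = tensor_lift (\<lambda>v u. \<rho> x v \<otimes> u + v \<otimes> \<sigma> x u)"

lemma submodule_U_span: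
  assumes "\<And>x. clinear (\<rho> x)"
  shows "submodule \<rho> (U_span \<rho> v)"
  unfolding submodule_def
proof safe
  show "cvec.subspace (U_span \<rho> v)" by (simp add: U_span_def)
  fix x y assume "y \<in> U_span \<rho> v"
  then show "\<rho> x y \<in> U_span \<rho> v"
    unfolding U_span_def
  proof (induction rule: cvec.span_induct_alt)
    case base
    have "\<rho> x 0 = 0" using clinear_scale[OF assms, of x 0 0] by simp
    then show ?case by (simp add: cvec.span_zero)
  next
    case (step c w z)
    then obtain xs where "w = foldr \<rho> xs v" by blast
    then have "\<rho> x w = foldr \<rho> (x # xs) v" by simp
    then have "\<rho> x w \<in> cvec.span {foldr \<rho> xs v |xs. True}" by (blast intro: cvec.span_base)
    with step.IH show ?case
      by (simp add: clinear_add[OF assms] clinear_scale[OF assms] cvec.span_add cvec.span_scale)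
  qed
qed

lemma U_span_minimal:
  assumes "submodule \<rho> M" "v \<in> M"
  shows "U_span \<rho> v \<subseteq> M"
proof -
  have "foldr \<rho> xs v \<in> M" for xs
    using assms by (induction xs) (auto simp: submodule_def)
  then show ?thesis
    using assms(1) unfolding U_span_def submodule_def by (intro cvec.span_minimal) auto
qed

lemma
  assumes "lie_module br \<rho>" "lie_module br \<sigma>"
  shows tensor_act_pure: "tensor_act \<rho> \<sigma> x (v \<otimes> u) = \<rho> x v \<otimes> u + v \<otimes> \<sigma> x u"
    and clinear_tensor_act: "clinear (tensor_act \<rho> \<sigma> x)"
proof -
  have "clinear (\<rho> x)" "clinear (\<sigma> x)"
    using assms by (auto simp: lie_module_def cbilinear_def)
  then have "cbilinear (\<lambda>v u. \<rho> x v \<otimes> u + v \<otimes> \<sigma> x u)"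
    unfolding cbilinear_def
    by (auto intro!: clinearI simp: clinear_add clinear_scale tensor_simps scaleC_add_right add_ac)
  from tensor_lift_pure[OF this] clinear_tensor_lift[OF this]
  show "tensor_act \<rho> \<sigma> x (v \<otimes> u) = \<rho> x v \<otimes> u + v \<otimes> \<sigma> x u" "clinear (tensor_act \<rho> \<sigma> x)"
    by (simp_all add: tensor_act_def)
qed

lemma lie_module_tensor_act:
  assumes "lie_module br \<rho>" "lie_module br \<sigma>"
  shows "lie_module br (tensor_act \<rho> \<sigma>)"
proof -
  note lin = clinear_tensor_act[OF assms] and pure = tensor_act_pure[OF assms]
  have diff: "tensor_act \<rho> \<sigma> x (s - t) = tensor_act \<rho> \<sigma> x s - tensor_act \<rho> \<sigma> x t" for x s t
    using clinear_add[OF lin, of x "s - t" t] by (simp add: algebra_simps)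
  have l: "\<rho> (x + y) v = \<rho> x v + \<rho> y v" "\<rho> (c *\<^sub>C x) v = c *\<^sub>C \<rho> x v"
      "\<sigma> (x + y) u = \<sigma> x u + \<sigma> y u" "\<sigma> (c *\<^sub>C x) u = c *\<^sub>C \<sigma> x u"
      "\<rho> (br x y) v = \<rho> x (\<rho> y v) - \<rho> y (\<rho> x v)" "\<sigma> (br x y) u = \<sigma> x (\<sigma> y u) - \<sigma> y (\<sigma> x u)"
    for x y c v u
    using assms by (auto simp: lie_module_def cbilinear_def Vector_Spaces.linear_iff)
  have td: "(v - v') \<otimes> u = v \<otimes> u - v' \<otimes> u" "v \<otimes> (u - u') = v \<otimes> u - v \<otimes> u'"
    for v v' :: 'b and u u' :: 'c
    using tensor_add_left[of "v - v'" v' u] tensor_add_right[of v "u - u'" u']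
    by (simp_all add: algebra_simps)
  have add: "tensor_act \<rho> \<sigma> (x + y) t = tensor_act \<rho> \<sigma> x t + tensor_act \<rho> \<sigma> y t" for x y t
    by (induction t rule: tensor_induct)
      (simp_all add: clinear_add[OF lin] clinear_scale[OF lin] pure l tensor_simps scaleC_add_right)
  have scale: "tensor_act \<rho> \<sigma> (c *\<^sub>C x) t = c *\<^sub>C tensor_act \<rho> \<sigma> x t" for c x t
    by (induction t rule: tensor_induct)
      (simp_all add: clinear_add[OF lin] clinear_scale[OF lin] pure l tensor_simps
        scaleC_add_right scaleC_scaleC mult.commute)
  have "tensor_act \<rho> \<sigma> (br x y) t =
      tensor_act \<rho> \<sigma> x (tensor_act \<rho> \<sigma> y t) - tensor_act \<rho> \<sigma> y (tensor_act \<rho> \<sigma> x t)" for x y t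
  proof (induction t rule: tensor_induct)
    case (add s t)
    then show ?case by (simp add: clinear_add[OF lin])
  next
    case (scale c t)
    then show ?case by (simp add: clinear_scale[OF lin] cvec.scale_right_diff_distrib)
  next
    case (pure v u)
    show ?case by (simp add: clinear_add[OF lin] tensor_act_pure[OF assms] l td)
  qed
  with lin add scale show ?thesis
    by (auto simp: lie_module_def cbilinear_def intro!: clinearI)
qed


section \<open>Kac--Moody algebras\<close>

text \<open>The Lie algebra lives on the type \<open>'g\<close>, and \<open>cartan\<close> is the inclusion into it of the
  Cartan subalgebra, which is the type \<open>'h\<close>. Elements of the dual of the Cartan subalgebra are
  the linear maps \<open>'h \<Rightarrow> complex\<close>.\<close>

record ('i, 'h, 'g) kac_moody =
  gcm :: "'i \<Rightarrow> 'i \<Rightarrow> int"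
  simple_root :: "'i \<Rightarrow> 'h \<Rightarrow> complex"
  simple_coroot :: "'i \<Rightarrow> 'h"
  bracket :: "'g \<Rightarrow> 'g \<Rightarrow> 'g"
  cartan :: "'h \<Rightarrow> 'g"
  gen_e :: "'i \<Rightarrow> 'g"
  gen_f :: "'i \<Rightarrow> 'g"

definition generalized_cartan_matrix :: "('i \<Rightarrow> 'i \<Rightarrow> int) \<Rightarrow> bool"
  where "generalized_cartan_matrix A \<longleftrightarrow> (\<forall>i. A i i = 2) \<and>
    (\<forall>i j. i \<noteq> j \<longrightarrow> A i j \<le> 0) \<and> (\<forall>i j. A i j = 0 \<longrightarrow> A j i = 0)"

definition realization ::
    "('i::finite \<Rightarrow> 'i \<Rightarrow> int) \<Rightarrow> ('i \<Rightarrow> 'h::complex_vector \<Rightarrow> complex) \<Rightarrow> ('i \<Rightarrow> 'h) \<Rightarrow> bool"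
  where "realization A \<alpha> \<alpha>v \<longleftrightarrow>
    finite_dim (UNIV :: 'h set) \<and>
    cvec.dim (UNIV :: 'h set) + rank (\<chi> i j. of_int (A i j) :: complex^'i^'i) = 2 * CARD('i) \<and>
    (\<forall>i. clinear (\<alpha> i)) \<and>
    inj \<alpha> \<and> cvec.independent (range \<alpha>) \<and>
    inj \<alpha>v \<and> cvec.independent (range \<alpha>v) \<and>
    (\<forall>i j. \<alpha> j (\<alpha>v i) = of_int (A i j))"

text \<open>The Kac--Moody algebra of a generalized Cartan matrix: the quotient of the Lie algebra
  presented by the generators and relations below by its largest ideal meeting the Cartan
  subalgebra trivially; that is, these generators generate, these relations hold, and no such
  nonzero ideal is left.\<close>

definition kac_moody_algebra ::
    "('i::finite, 'h::complex_vector, 'g::complex_vector) kac_moody \<Rightarrow> bool"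
  where "kac_moody_algebra \<gg> \<longleftrightarrow>
    generalized_cartan_matrix (gcm \<gg>) \<and>
    realization (gcm \<gg>) (simple_root \<gg>) (simple_coroot \<gg>) \<and>
    lie_algebra (bracket \<gg>) \<and>
    clinear (cartan \<gg>) \<and> inj (cartan \<gg>) \<and>
    (\<forall>h h'. bracket \<gg> (cartan \<gg> h) (cartan \<gg> h') = 0) \<and>
    (\<forall>i j. bracket \<gg> (gen_e \<gg> i) (gen_f \<gg> j) =
        (if i = j then cartan \<gg> (simple_coroot \<gg> i) else 0)) \<and>
    (\<forall>h i. bracket \<gg> (cartan \<gg> h) (gen_e \<gg> i) = simple_root \<gg> i h *\<^sub>C gen_e \<gg> i) \<and>
    (\<forall>h i. bracket \<gg> (cartan \<gg> h) (gen_f \<gg> i) = - (simple_root \<gg> i h *\<^sub>C gen_f \<gg> i)) \<and>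
    lie_generated (bracket \<gg>) (range (cartan \<gg>) \<union> range (gen_e \<gg>) \<union> range (gen_f \<gg>)) = UNIV \<and>
    (\<forall>I. lie_ideal (bracket \<gg>) I \<and> I \<inter> range (cartan \<gg>) = {0} \<longrightarrow> I = {0})"

definition symmetric_kac_moody :: "('i, 'h, 'g) kac_moody \<Rightarrow> bool"
  where "symmetric_kac_moody \<gg> \<longleftrightarrow> (\<forall>i j. gcm \<gg> i j = gcm \<gg> j i)"

definition finite_dim_semisimple :: "('i, 'h, 'g::complex_vector) kac_moody \<Rightarrow> bool"
  where "finite_dim_semisimple \<gg> \<longleftrightarrow> finite_dim (UNIV :: 'g set) \<and> lie_semisimple (bracket \<gg>)"


section \<open>Weyl group, roots and weights\<close>

definition simple_reflection ::
    "('i, 'h, 'g) kac_moody \<Rightarrow> 'i \<Rightarrow> ('h \<Rightarrow> complex) \<Rightarrow> 'h \<Rightarrow> complex"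
  where "simple_reflection \<gg> i \<mu> = \<mu> - \<mu> (simple_coroot \<gg> i) *\<^sub>C simple_root \<gg> i"

text \<open>The generators are involutions, so closure under composition gives a group.\<close>

inductive_set weyl_group ::
    "('i, 'h, 'g) kac_moody \<Rightarrow> (('h \<Rightarrow> complex) \<Rightarrow> 'h \<Rightarrow> complex) set"
  for \<gg> :: "('i, 'h, 'g) kac_moody"
  where
    weyl_id: "id \<in> weyl_group \<gg>"
  | weyl_step: "w \<in> weyl_group \<gg> \<Longrightarrow> simple_reflection \<gg> i \<circ> w \<in> weyl_group \<gg>"

text \<open>The contragredient action of the Weyl group on the Cartan subalgebra itself:
  \<open>\<langle>w \<mu>, w h\<rangle> = \<langle>\<mu>, h\<rangle>\<close>.\<close>

definition weyl_on_cartan ::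
    "(('h \<Rightarrow> complex) \<Rightarrow> 'h \<Rightarrow> complex) \<Rightarrow> 'h::complex_vector \<Rightarrow> 'h"
  where "weyl_on_cartan w h = (THE h'. \<forall>\<mu>. clinear \<mu> \<longrightarrow> w \<mu> h' = \<mu> h)"

definition real_roots :: "('i, 'h, 'g) kac_moody \<Rightarrow> ('h \<Rightarrow> complex) set"
  where "real_roots \<gg> = {w (simple_root \<gg> i) |w i. w \<in> weyl_group \<gg>}"

definition positive_cone :: "('i::finite, 'h, 'g) kac_moody \<Rightarrow> ('h \<Rightarrow> complex) set"
  where "positive_cone \<gg> = {\<Sum>i\<in>UNIV. of_nat (n i) *\<^sub>C simple_root \<gg> i |n. True}"

definition positive_real_roots :: "('i::finite, 'h, 'g) kac_moody \<Rightarrow> ('h \<Rightarrow> complex) set"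
  where "positive_real_roots \<gg> = real_roots \<gg> \<inter> positive_cone \<gg>"

definition negative_real_roots :: "('i::finite, 'h, 'g) kac_moody \<Rightarrow> ('h \<Rightarrow> complex) set"
  where "negative_real_roots \<gg> = real_roots \<gg> \<inter> uminus ` positive_cone \<gg>"

text \<open>If \<open>\<alpha> = w \<alpha>\<^sub>i\<close> then the coroot of \<open>\<alpha>\<close> is \<open>w\<close> applied to the \<open>i\<close>-th simple coroot; the
  result does not depend on the choice of \<open>w\<close> and \<open>i\<close>.\<close>

definition coroot :: "('i, 'h::complex_vector, 'g) kac_moody \<Rightarrow> ('h \<Rightarrow> complex) \<Rightarrow> 'h"
  where "coroot \<gg> \<alpha> = (SOME c. \<exists>w\<in>weyl_group \<gg>. \<exists>i.
    \<alpha> = w (simple_root \<gg> i) \<and> c = weyl_on_cartan w (simple_coroot \<gg> i))"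

definition integral_weights :: "('i, 'h::complex_vector, 'g) kac_moody \<Rightarrow> ('h \<Rightarrow> complex) set"
  where "integral_weights \<gg> = {\<mu>. clinear \<mu> \<and> (\<forall>i. \<mu> (simple_coroot \<gg> i) \<in> \<int>)}"

definition dominant_weights :: "('i, 'h::complex_vector, 'g) kac_moody \<Rightarrow> ('h \<Rightarrow> complex) set"
  where "dominant_weights \<gg> =
    {\<mu> \<in> integral_weights \<gg>. \<forall>i. 0 \<le> Re (\<mu> (simple_coroot \<gg> i))}"

definition inversions :: "('i::finite, 'h, 'g) kac_moody \<Rightarrow>
    (('h \<Rightarrow> complex) \<Rightarrow> 'h \<Rightarrow> complex) \<Rightarrow> ('h \<Rightarrow> complex) set"
  where "inversions \<gg> w = {\<alpha> \<in> positive_real_roots \<gg>. inv w \<alpha> \<in> negative_real_roots \<gg>}"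

text \<open>An integral weight is integer-valued on all real coroots, so the real part below is the
  pairing itself.\<close>

definition dominant_weights_wrt :: "('i::finite, 'h::complex_vector, 'g) kac_moody \<Rightarrow>
    (('h \<Rightarrow> complex) \<Rightarrow> 'h \<Rightarrow> complex) \<Rightarrow> ('h \<Rightarrow> complex) set"
  where "dominant_weights_wrt \<gg> w =
    {\<mu> \<in> integral_weights \<gg>. \<forall>\<alpha>\<in>inversions \<gg> w. 0 \<le> Re (\<mu> (coroot \<gg> \<alpha>))}"


section \<open>Integrable highest weight modules and Kostant--Kumar modules\<close>

definition weight_space :: "('i, 'h, 'g) kac_moody \<Rightarrow> ('g \<Rightarrow> 'v::complex_vector \<Rightarrow> 'v) \<Rightarrow>
    'v set \<Rightarrow> ('h \<Rightarrow> complex) \<Rightarrow> 'v set"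
  where "weight_space \<gg> \<rho> M \<mu> = {v \<in> M. \<forall>h. \<rho> (cartan \<gg> h) v = \<mu> h *\<^sub>C v}"

definition diagonalizable :: "('i, 'h, 'g) kac_moody \<Rightarrow> ('g \<Rightarrow> 'v::complex_vector \<Rightarrow> 'v) \<Rightarrow>
    'v set \<Rightarrow> bool"
  where "diagonalizable \<gg> \<rho> M \<longleftrightarrow> M = cvec.span (\<Union>\<mu>. weight_space \<gg> \<rho> M \<mu>)"

definition integrable_module :: "('i, 'h, 'g) kac_moody \<Rightarrow> ('g \<Rightarrow> 'v::complex_vector \<Rightarrow> 'v) \<Rightarrow>
    'v set \<Rightarrow> bool"
  where "integrable_module \<gg> \<rho> M \<longleftrightarrow> submodule \<rho> M \<and> diagonalizable \<gg> \<rho> M \<and>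
    (\<forall>i. \<forall>v\<in>M. (\<exists>n. (\<rho> (gen_e \<gg> i) ^^ n) v = 0) \<and> (\<exists>n. (\<rho> (gen_f \<gg> i) ^^ n) v = 0))"

definition category_O :: "('i::finite, 'h, 'g) kac_moody \<Rightarrow> ('g \<Rightarrow> 'v::complex_vector \<Rightarrow> 'v) \<Rightarrow>
    'v set \<Rightarrow> bool"
  where "category_O \<gg> \<rho> M \<longleftrightarrow> submodule \<rho> M \<and> diagonalizable \<gg> \<rho> M \<and>
    (\<forall>\<mu>. finite_dim (weight_space \<gg> \<rho> M \<mu>)) \<and>
    (\<exists>F. finite F \<and>
      (\<forall>\<mu>. weight_space \<gg> \<rho> M \<mu> \<noteq> {0} \<longrightarrow> (\<exists>\<nu>\<in>F. \<nu> - \<mu> \<in> positive_cone \<gg>)))"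

definition irreducible_module :: "('g \<Rightarrow> 'v::complex_vector \<Rightarrow> 'v) \<Rightarrow> bool"
  where "irreducible_module \<rho> \<longleftrightarrow> (UNIV :: 'v set) \<noteq> {0} \<and>
    (\<forall>M. submodule \<rho> M \<longrightarrow> M = {0} \<or> M = UNIV)"

definition highest_weight_module :: "('i, 'h, 'g) kac_moody \<Rightarrow> ('h \<Rightarrow> complex) \<Rightarrow>
    ('g \<Rightarrow> 'v::complex_vector \<Rightarrow> 'v) \<Rightarrow> bool"
  where "highest_weight_module \<gg> \<mu> \<rho> \<longleftrightarrow>
    (\<exists>v. v \<noteq> 0 \<and> v \<in> weight_space \<gg> \<rho> UNIV \<mu> \<and> (\<forall>i. \<rho> (gen_e \<gg> i) v = 0) \<and>
      U_span \<rho> v = UNIV)"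

text \<open>\<open>\<rho>\<close> is (a model of) the module \<open>V(\<mu>)\<close>.\<close>

definition is_V :: "('i, 'h, 'g::complex_vector) kac_moody \<Rightarrow> ('h \<Rightarrow> complex) \<Rightarrow>
    ('g \<Rightarrow> 'v::complex_vector \<Rightarrow> 'v) \<Rightarrow> bool"
  where "is_V \<gg> \<mu> \<rho> \<longleftrightarrow> lie_module (bracket \<gg>) \<rho> \<and> irreducible_module \<rho> \<and>
    integrable_module \<gg> \<rho> UNIV \<and> highest_weight_module \<gg> \<mu> \<rho>"

text \<open>\<open>v\<close> is a choice of the nonzero vector \<open>v\<^sub>\<mu>\<close> of weight \<open>\<mu>\<close>.\<close>

definition is_weight_vector :: "('i, 'h, 'g) kac_moody \<Rightarrow> ('g \<Rightarrow> 'v::complex_vector \<Rightarrow> 'v) \<Rightarrow>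
    ('h \<Rightarrow> complex) \<Rightarrow> 'v \<Rightarrow> bool"
  where "is_weight_vector \<gg> \<rho> \<mu> v \<longleftrightarrow> v \<noteq> 0 \<and> v \<in> weight_space \<gg> \<rho> UNIV \<mu>"

text \<open>\<open>K(\<lambda>, w, \<mu>)\<close>, when \<open>\<rho>\<close> and \<open>\<sigma>\<close> are \<open>V(\<lambda>)\<close> and \<open>V(\<mu>)\<close>, and \<open>v\<close> and \<open>u\<close> are
  weight vectors of weights \<open>\<lambda>\<close> and \<open>w \<mu>\<close>.\<close>

definition kostant_kumar :: "('g \<Rightarrow> 'v::complex_vector \<Rightarrow> 'v) \<Rightarrow> ('g \<Rightarrow> 'u::complex_vector \<Rightarrow> 'u) \<Rightarrow>
    'v \<Rightarrow> 'u \<Rightarrow> ('v \<otimes>\<^sub>C 'u) set"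
  where "kostant_kumar \<rho> \<sigma> v u = U_span (tensor_act \<rho> \<sigma>) (v \<otimes> u)"

definition canonical_morphism ::
    "('g \<Rightarrow> 'v::complex_vector \<Rightarrow> 'v) \<Rightarrow> ('g \<Rightarrow> 'u::complex_vector \<Rightarrow> 'u) \<Rightarrow> 'v \<Rightarrow> 'u \<Rightarrow>
     ('g \<Rightarrow> 'v'::complex_vector \<Rightarrow> 'v') \<Rightarrow> ('g \<Rightarrow> 'u'::complex_vector \<Rightarrow> 'u') \<Rightarrow> 'v' \<Rightarrow> 'u' \<Rightarrow>
     ('v \<otimes>\<^sub>C 'u \<Rightarrow> 'v' \<otimes>\<^sub>C 'u') \<Rightarrow> bool"
  where "canonical_morphism \<rho> \<sigma> v u \<rho>' \<sigma>' v' u' \<phi> \<longleftrightarrow>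
    U_linear (tensor_act \<rho> \<sigma>) (kostant_kumar \<rho> \<sigma> v u)
      (tensor_act \<rho>' \<sigma>') (kostant_kumar \<rho>' \<sigma>' v' u') \<phi> \<and>
    \<phi> (v \<otimes> u) = v' \<otimes> u'"

text \<open>Schur positivity of \<open>M \<ominus> M'\<close>, a notion for integrable modules in category O.\<close>

definition schur_positive :: "('i::finite, 'h, 'g) kac_moody \<Rightarrow>
    ('g \<Rightarrow> 'v::complex_vector \<Rightarrow> 'v) \<Rightarrow> 'v set \<Rightarrow> ('g \<Rightarrow> 'u::complex_vector \<Rightarrow> 'u) \<Rightarrow> 'u set \<Rightarrow> bool"
  where "schur_positive \<gg> \<rho> M \<rho>' M' \<longleftrightarrow>
    integrable_module \<gg> \<rho> M \<and> category_O \<gg> \<rho> M \<and>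
    integrable_module \<gg> \<rho>' M' \<and> category_O \<gg> \<rho>' M' \<and>
    (\<exists>\<phi>. U_linear \<rho> M \<rho>' M' \<phi> \<and> \<phi> ` M = M')"

end

theory Submission imports Defs
begin

text \<open>With \<open>\<nu> = \<Lambda>\<^sub>1 - \<Lambda>\<^sub>2 = w \<omega>\<close> and \<open>\<omega> = \<mu>\<^sub>2 - \<mu>\<^sub>1\<close>, let \<open>M\<close> be an integrable module with a nonzero vector of weight
 \<open>\<omega>\<close> all of whose weights have norm at most \<open>|\<omega>|\<close>: a maximal integrable highest weight module if \<open>\<gg>\<close> is
 finite-dimensional, and the zero modes of the lattice vertex operators on a Fock space if \<open>\<gg>\<close> is symmetric.
 Such an \<open>M\<close> yields invariant pairings of \<open>V(\<mu>\<^sub>1)\<close>, \<open>M\<close> and the dual of \<open>V(\<mu>\<^sub>2)\<close>, and of \<open>V(\<Lambda>\<^sub>1)\<close>, the dual of \<open>M\<close>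
 and the dual of \<open>V(\<Lambda>\<^sub>2)\<close>, because the defining relations of the highest weight vectors are known. Reflecting
 along a reduced word of \<open>w\<close>, where the dominance of \<open>\<nu>\<close> on the inversions of \<open>w\<close> controls the sl2-strings,
 the composite pairing sends \<open>v\<^bsub>\<Lambda>1\<^esub> \<otimes> v\<^bsub>w \<mu>1\<^esub>\<close> to a nonzero multiple of \<open>v\<^bsub>\<Lambda>2\<^esub> \<otimes> v\<^bsub>w \<mu>2\<^esub>\<close>, so that every relation
 of the first vector holds for the second.

 That an integrable representation of the Chevalley generators lifts to \<open>\<gg>\<close>, which has no ideal meeting the
 Cartan subalgebra trivially, is shown with the Casimir operator as in the theorem of Gabber and Kac.\<close>

section \<open>Linear algebra\<close>

text \<open>The obstacle is that no presentation of a Kostant--Kumar module by relations is at hand.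
  For \<open>a\<close> and \<open>b\<close> in the restricted duals of the target factors, composing
  the two pairings through M gives a form on the source tensor product that is invariant when
  \<open>a\<close> and \<open>b\<close> move along. At the source generator it is a fixed nonzero
  multiple of \<open>a(v2) b(u2)\<close>; invariance carries this equality through the enveloping
  algebra, and such \<open>a\<close> and \<open>b\<close> separate points. The norm bound makes the
  pairings exist: a weight of norm \<open>|\<omega>|\<close> is extremal in M, because an sl2-string
  continued past the reflected weight would increase the norm. This yields the exponents that the
  highest weight relations demand. In infinite dimension \<omega> need not be conjugate to a
  dominant weight, so highest weight modules do not suffice. There M consists of the states for
  which half the squared norm plus the oscillator degree equals \<open>|\<omega>|^2 / 2\<close>, and
  the bound holds because degrees are nonnegative.\<close>

notation scaleC (infixr "*." 75)

instantiation prod :: (complex_vector, complex_vector) complex_vector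
begin
definition scaleC_prod :: "complex => 'a \<times> 'b => 'a \<times> 'b" where "scaleC_prod c p = (c *. fst p, c *. snd p)"
instance
proof
 fix a b :: complex and x y :: "'a \<times> 'b"
 show "a *. (x + y) = a *. x + a *. y"
  by (simp only: scaleC_prod_def fst_add snd_add scaleC_add_right plus_prod_def fst_conv snd_conv)
 show "(a + b) *. x = a *. x + b *. x" by (simp only: scaleC_prod_def scaleC_add_left plus_prod_def fst_conv snd_conv)
 show "a *. b *. x = (a * b) *. x" by (simp only: scaleC_prod_def scaleC_scaleC fst_conv snd_conv)
 show "1 *. x = x" by (simp only: scaleC_prod_def scaleC_one fst_conv snd_conv prod.collapse)
qed
end

lemma fst_scaleC [simp]: "fst (c *. p) = c *. fst p" and snd_scaleC [simp]: "snd (c *. p) = c *. snd p"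
 by (simp_all add: scaleC_prod_def)

lemma scaleC_Pair [simp]: "c *. (a, b) = (c *. a, c *. b)" by (simp add: scaleC_prod_def)

lemma scaleC_minus1 [simp]: "(- 1) *. x = - (x :: 'a::complex_vector)" by (metis cvec.scale_minus_left scaleC_one)

lemma clinear_0: "clinear f ==> f 0 = 0" using clinear_scale[of f 0 0] by simp

lemma clinear_neg: "clinear f ==> f (- x) = - f x" using clinear_scale[of f "- 1" x] by simp

lemma clinear_diff: "clinear f ==> f (x - y) = f x - f y" using clinear_add[of f x "- y"] clinear_neg[of f y] by simp

interpretation cpair: vector_space_pair
 "scaleC :: complex => 'a => 'a::complex_vector" "scaleC :: complex => 'b => 'b::complex_vector" by unfold_locales

lemma clinear_sum: "clinear f ==> f (sum g A) = (SUM a:A. f (g a))" by (rule cpair.linear_sum)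

lemma clinear_negate: "clinear f ==> clinear (%x. - f x)" by (rule clinearI) (simp_all add: clinear_add clinear_scale)

lemma clinear_compose: "clinear f ==> clinear g ==> clinear (%x. f (g x))"
 by (rule clinearI) (simp_all add: clinear_add clinear_scale)

lemma clinear_funpow: "clinear f ==> clinear (f ^^ n)" for f :: "'a::complex_vector => 'a"
proof (induction n)
 case 0
 show ?case by (rule clinearI) simp_all
next case (Suc n)
 have eq: "f ^^ Suc n = (%x. f ((f ^^ n) x))" by (simp add: fun_eq_iff)
 show ?case unfolding eq by (rule clinear_compose[OF Suc.prems Suc.IH[OF Suc.prems]])
qed

lemmas clinear_simps = clinear_0 clinear_add clinear_neg clinear_diff clinear_scale clinear_sum

lemma cbilinear_left: "cbilinear \<beta> ==> clinear (%x. \<beta> x y)" unfolding cbilinear_def by blast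

lemma cbilinear_right: "cbilinear \<beta> ==> clinear (\<beta> x)" unfolding cbilinear_def by blast

lemma cbilinear_add1: "cbilinear \<beta> ==> \<beta> (x + x') y = \<beta> x y + \<beta> x' y"
 by (rule clinear_add[OF cbilinear_left])

lemma cbilinear_add2: "cbilinear \<beta> ==> \<beta> x (y + y') = \<beta> x y + \<beta> x y'"
 by (rule clinear_add[OF cbilinear_right])

lemma cbilinear_scale1: "cbilinear \<beta> ==> \<beta> (c *. x) y = c *. \<beta> x y" by (rule clinear_scale[OF cbilinear_left])

lemma cbilinear_scale2: "cbilinear \<beta> ==> \<beta> x (c *. y) = c *. \<beta> x y" by (rule clinear_scale[OF cbilinear_right])

lemma cbilinear_01: "cbilinear \<beta> ==> \<beta> 0 y = 0" by (rule clinear_0[OF cbilinear_left])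

lemma cbilinear_02: "cbilinear \<beta> ==> \<beta> x 0 = 0" by (rule clinear_0[OF cbilinear_right])

lemma cbilinear_neg1: "cbilinear \<beta> ==> \<beta> (- x) y = - \<beta> x y" by (rule clinear_neg[OF cbilinear_left])

lemma cbilinear_neg2: "cbilinear \<beta> ==> \<beta> x (- y) = - \<beta> x y" by (rule clinear_neg[OF cbilinear_right])

lemma cbilinear_diff1: "cbilinear \<beta> ==> \<beta> (x - x') y = \<beta> x y - \<beta> x' y"
 by (rule clinear_diff[OF cbilinear_left])

lemma cbilinear_diff2: "cbilinear \<beta> ==> \<beta> x (y - y') = \<beta> x y - \<beta> x y'"
 by (rule clinear_diff[OF cbilinear_right])

lemma cbilinear_sum1: "cbilinear \<beta> ==> \<beta> (sum g S) y = (SUM s:S. \<beta> (g s) y)"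
 by (rule clinear_sum[OF cbilinear_left])

lemma cbilinear_sum2: "cbilinear \<beta> ==> \<beta> x (sum h S) = (SUM s:S. \<beta> x (h s))"
 by (rule clinear_sum[OF cbilinear_right])

lemmas cbilinear_simps = cbilinear_add1 cbilinear_add2 cbilinear_scale1 cbilinear_scale2 cbilinear_01 cbilinear_02
 cbilinear_neg1 cbilinear_neg2 cbilinear_diff1 cbilinear_diff2 cbilinear_sum1 cbilinear_sum2

lemma cbilinearI:
 assumes "!!x x' y. \<beta> (x + x') y = \<beta> x y + \<beta> x' y" "!!x y y'. \<beta> x (y + y') = \<beta> x y + \<beta> x y'"
  "!!c x y. \<beta> (c *. x) y = c *. \<beta> x y" "!!c x y. \<beta> x (c *. y) = c *. \<beta> x y"
 shows "cbilinear \<beta>" unfolding cbilinear_def by (intro conjI allI clinearI) (fact assms)+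

lemma sum_fun_apply: "(SUM a:A. f a) x = (SUM a:A. f a x)" by (induction A rule: infinite_finite_induct) auto

lemma scaleC_fun_apply [simp]: "(c *. f) x = c *. f x" by (simp add: scaleC_fun_def)

lemma scaleC_complex [simp]: "c *. (z::complex) = c * z" by (simp add: scaleC_complex_def)

lemma basis_extend:
 assumes "S \<subseteq> V" "cvec.independent S"
 shows "EX B. S \<subseteq> B & B \<subseteq> V & cvec.independent B & V \<subseteq> cvec.span B"
 by (rule cvec.maximal_independent_subset_extend[OF assms]) (intro exI conjI)

lemma basis_ex: "\<exists>B\<subseteq>V. cvec.independent B & V \<subseteq> cvec.span B"
 using basis_extend[of "{}" V] cvec.independent_empty by blast

text \<open>The subspace is a graph over its first projection, and a basis of that projection
  extends the map to the whole space. Maps prescribed on generators are built this way below: being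
  well defined becomes the vanishing of a second component.\<close>

lemma graph_clinear:
 fixes \<Gamma> :: "('a::complex_vector \<times> 'b::complex_vector) set"
 assumes sub: "cvec.subspace \<Gamma>" and inj: "!!y. (0, y) : \<Gamma> ==> y = 0"
 obtains \<tau> where "clinear \<tau>" "!!x y. (x, y) : \<Gamma> ==> y = \<tau> x"
proof -
 obtain B where B: "B \<subseteq> fst ` \<Gamma>" "cvec.independent B" "fst ` \<Gamma> \<subseteq> cvec.span B"
  using basis_ex[of "fst ` \<Gamma>"] by blast
 define g where "g b = (SOME y. (b, y) : \<Gamma>)" for b
 have g: "(b, g b) : \<Gamma>" if "b : B" for b unfolding g_def by (rule someI_ex) (use B(1) that in force)
 define \<tau> where "\<tau> = cpair.construct B g"
 have lin: "clinear \<tau>" unfolding \<tau>_def by (rule cpair.linear_construct[OF B(2)])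
 have base: "\<tau> b = g b" if "b : B" for b unfolding \<tau>_def by (rule cpair.construct_basis[OF B(2) that])
 have "(x, \<tau> x) : \<Gamma>" if "x : cvec.span B" for x using that proof (induction rule: cvec.span_induct_alt)
  case base
  show ?case using cvec.subspace_0[OF sub] by (simp add: clinear_0[OF lin] zero_prod_def)
 next case (step c b z)
  have "c *. (b, g b) + (z, \<tau> z) : \<Gamma>" by (intro cvec.subspace_add[OF sub] cvec.subspace_scale[OF sub] g step)
  then show ?case using base[OF step(1)] by (simp add: clinear_simps[OF lin])
 qed
 moreover have "y = \<tau> x" if "(x, y) : \<Gamma>" for x y proof -
  have "x : cvec.span B" using that B(3) by force
  then have "(x, \<tau> x) : \<Gamma>" by fact
  with that have "(x, y) - (x, \<tau> x) : \<Gamma>" by (rule cvec.subspace_diff[OF sub])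
  then have "(0, y - \<tau> x) : \<Gamma>" by simp
  from inj[OF this] show ?thesis by simp
 qed
 ultimately show ?thesis using lin that by blast
qed

text \<open>Take nested bases of \<open>K\<close>, of \<open>T\<close> and of the whole space; \<pi>
  keeps the vectors of the second that are not in the first and kills the others. Its image is a
  copy of \<open>T\<close> modulo \<open>K\<close> inside the original type.\<close>

lemma projection_exists:
 fixes C :: "'a::complex_vector set"
 assumes "cvec.subspace K" "cvec.subspace T" "K \<subseteq> T"
 obtains \<pi> where "clinear \<pi>" "!!x. \<pi> x : T" "!!x. \<pi> (\<pi> x) = \<pi> x"
  "!!x. x : T ==> x - \<pi> x : K" "!!x. x : K ==> \<pi> x = 0"
proof -
 obtain B where B: "B \<subseteq> K" "cvec.independent B" "K \<subseteq> cvec.span B" using basis_ex[of K] by blast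
 obtain B' where B': "B \<subseteq> B'" "B' \<subseteq> T" "cvec.independent B'" "T \<subseteq> cvec.span B'"
  using basis_extend[OF order_trans[OF B(1) assms(3)] B(2)] by blast
 obtain B2 where B2: "B' \<subseteq> B2" "cvec.independent B2" "UNIV \<subseteq> cvec.span B2"
  using basis_extend[OF subset_UNIV B'(3)] by blast
 define \<pi> where "\<pi> = cpair.construct B2 (%b. if b : B' - B then b else 0)"
 have lin: "clinear \<pi>" unfolding \<pi>_def by (rule cpair.linear_construct[OF B2(2)])
 have base: "\<pi> b = (if b : B' - B then b else 0)" if "b : B2" for b
  unfolding \<pi>_def by (rule cpair.construct_basis[OF B2(2) that])
 have K0: "\<pi> x = 0" if "x : K" for x proof -
  have "x : cvec.span B" using that B(3) by blast
  then show ?thesis proof (induction rule: cvec.span_induct_alt)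
   case (step c b z)
   then have "b : B2" "\<pi> b = 0" using base[of b] B'(1) B2(1) by auto
   with step show ?case by (simp add: clinear_simps[OF lin])
  qed (simp add: clinear_0[OF lin])
 qed
 have T1: "\<pi> x : T" for x proof -
  have "x : cvec.span B2" using B2(3) by blast
  then show ?thesis proof (induction rule: cvec.span_induct_alt)
   case (step c b z)
   then have "\<pi> b : T" using base[of b] B'(2) cvec.subspace_0[OF assms(2)] by auto
   with step show ?case by (simp add: clinear_simps[OF lin] cvec.subspace_add[OF assms(2)] cvec.subspace_scale[OF assms(2)])
  qed (simp add: clinear_0[OF lin] cvec.subspace_0[OF assms(2)])
 qed
 have K1: "x - \<pi> x : K" if "x : T" for x proof -
  have "x : cvec.span B'" using that B'(4) by blast
  then show ?thesis proof (induction rule: cvec.span_induct_alt)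
   case (step c b z)
   from step(1) B2(1) have "b : B2" by blast
   from base[OF this] step(1) have "b - \<pi> b : K" using B(1) cvec.subspace_0[OF assms(1)] by (cases "b : B") auto
   then have "c *. (b - \<pi> b) + (z - \<pi> z) : K"
    by (intro cvec.subspace_add[OF assms(1)] cvec.subspace_scale[OF assms(1)] step)
   then show ?case by (simp add: clinear_simps[OF lin] cvec.scale_right_diff_distrib algebra_simps)
  qed (simp add: clinear_0[OF lin] cvec.subspace_0[OF assms(1)])
 qed
 have "\<pi> (\<pi> x) = \<pi> x" for x proof -
  have "x : cvec.span B2" using B2(3) by blast
  then show ?thesis proof (induction rule: cvec.span_induct_alt)
   case (step c b z)
   then have "\<pi> (\<pi> b) = \<pi> b" using base[of b] by (auto simp: clinear_0[OF lin])
   with step show ?case by (simp add: clinear_simps[OF lin])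
  qed (simp add: clinear_0[OF lin])
 qed
 with lin K0 K1 T1 that show ?thesis by blast
qed

text \<open>Subtracting \<open>wt k0 h\<close> from \<open>H h\<close>, for an \<open>h\<close> that
  separates \<open>k\<close> from \<open>k0\<close>, removes the term \<open>k0\<close> and rescales
  the term \<open>k\<close> by a nonzero number; induction on the number of terms does the
  rest.\<close>

lemma weight_components:
 fixes H :: "'h => 'v::complex_vector => 'v" and wt :: "'k => 'h => complex"
 assumes "finite K" "inj_on wt K" "cvec.subspace S" and lin: "!!h. clinear (H h)" and stab: "!!h x. x : S ==> H h x : S"
  and "!!k h. k : K ==> H h (v k) = wt k h *. v k" and "(SUM k:K. v k) : S" "k : K"
 shows "v k : S" using assms(1,2,6,7,8)
proof (induction K arbitrary: v k rule: finite_induct)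
 case (insert k0 K)
 let ?u = "SUM k:insert k0 K. v k"
 have inK: "v k : S" if "k : K" for k proof -
  have "wt k ~= wt k0" using insert that by (auto simp: inj_on_def)
  then obtain h where h: "wt k h ~= wt k0 h" by auto
  let ?v' = "%k. (wt k h - wt k0 h) *. v k"
  have "H h ?u - wt k0 h *. ?u = (SUM k:insert k0 K. H h (v k) - wt k0 h *. v k)"
   by (simp only: clinear_sum[OF lin] cvec.scale_sum_right sum_subtractf)
  also have "... = (SUM k:insert k0 K. ?v' k)" by (rule sum.cong) (simp_all only: insert.prems(2) cvec.scale_left_diff_distrib)
  also have "... = (SUM k:K. ?v' k)" using insert by simp
  finally have "(SUM k:K. ?v' k) : S" using cvec.subspace_diff[OF assms(3) stab[OF insert.prems(3), of h]
     cvec.subspace_scale[OF assms(3) insert.prems(3), of "wt k0 h"]] by simp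
  moreover have "H h' (?v' k) = wt k h' *. ?v' k" if "k : K" for k h'
   using insert.prems(2)[of k h'] that by (simp add: clinear_scale[OF lin] scaleC_scaleC mult.commute)
  ultimately have "?v' k : S" using insert.IH[of ?v' k] insert.prems(1) that by (auto simp: inj_on_def)
  then have "(1 / (wt k h - wt k0 h)) *. ?v' k : S" by (rule cvec.subspace_scale[OF assms(3)])
  then show ?thesis using h by (simp add: scaleC_scaleC scaleC_one)
 qed
 then have "(SUM k:K. v k) : S" by (rule cvec.subspace_sum[OF assms(3)])
 with insert.prems(3) have "?u - (SUM k:K. v k) : S" by (rule cvec.subspace_diff[OF assms(3)])
 then have "v k0 : S" using insert by simp
 with inK insert.prems(4) show ?case by auto
qed simp

text \<open>Independence provides a \<open>y\<close> on which \<open>l b0\<close> is not the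
  combination of the other functionals predicted by the dual vectors found so far. Correcting
  \<open>y\<close> by these vectors gives the dual vector of \<open>b0\<close>, and multiples of it
  are then subtracted from the old ones.\<close>

lemma dual_family:
 fixes l :: "'b => 'y::complex_vector => complex"
 assumes "finite B" "cvec.subspace Y" "!!b. clinear (l b)"
  and "!!c. (!!y. y : Y ==> (SUM b:B. c b * l b y) = 0) ==> (ALL b:B. c b = 0)"
 shows "EX u. ALL b:B. u b : Y & (ALL b':B. l b' (u b) = (if b' = b then 1 else 0))" using assms(1,4)
proof (induction B rule: finite_induct)
 case (insert b0 B)
 have "ALL b:B. c b = 0" if "!!y. y : Y ==> (SUM b:B. c b * l b y) = 0" for c proof -
  have "ALL b:insert b0 B. (if b = b0 then 0 else c b) = 0" proof (rule insert.prems)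
   fix y assume "y : Y"
   then show "(SUM b:insert b0 B. (if b = b0 then 0 else c b) * l b y) = 0" using that[of y] insert.hyps
    by (simp, subst sum.cong[OF refl, of B _ "%b. c b * l b y"]) auto
  qed
  then have "(if b = b0 then 0 else c b) = 0" if "b : B" for b using that by blast
  then show ?thesis using insert.hyps by metis
 qed
 then obtain u where u: "!!b. b : B ==> u b : Y" "!!b b'. b : B ==> b' : B ==> l b' (u b) = (if b' = b then 1 else 0)"
  using insert.IH by blast
 have "EX y:Y. l b0 y - (SUM b:B. l b0 (u b) * l b y) ~= 0" proof (rule ccontr)
  assume a: "\<not> ?thesis"
  let ?c = "%b. if b = b0 then 1 else - l b0 (u b)"
  have "ALL b:insert b0 B. ?c b = 0" proof (rule insert.prems)
   fix y assume "y : Y"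
   moreover have "(SUM b:B. ?c b * l b y) = (SUM b:B. - (l b0 (u b) * l b y))" using insert.hyps by (intro sum.cong) auto
   ultimately show "(SUM b:insert b0 B. ?c b * l b y) = 0" using a insert.hyps by (simp add: sum_negf)
  qed
  then show False by (metis insertI1 zero_neq_one)
 qed
 then obtain y where y: "y : Y" "l b0 y - (SUM b:B. l b0 (u b) * l b y) ~= 0" by blast
 define y' where "y' = y - (SUM b:B. l b y *. u b)"
 have y'Y: "y' : Y" unfolding y'_def using y u assms(2) by (intro cvec.subspace_diff cvec.subspace_sum cvec.subspace_scale) auto
 have y'0: "l b y' = 0" if "b : B" for b proof -
  have "l b y' = l b y - (SUM b':B. l b' y * l b (u b'))" unfolding y'_def by (simp add: clinear_simps[OF assms(3)])
  also have "(SUM b':B. l b' y * l b (u b')) = (SUM b':B. if b' = b then l b y else 0)" using u(2) that by (intro sum.cong) auto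
  finally show ?thesis using that insert.hyps by simp
 qed
 have y'1: "l b0 y' ~= 0" using y(2) unfolding y'_def by (simp add: clinear_simps[OF assms(3)] mult.commute)
 define y0 where "y0 = (1 / l b0 y') *. y'"
 have y0: "y0 : Y" "l b0 y0 = 1" "!!b. b : B ==> l b y0 = 0" using y'Y y'0 y'1 assms(2) unfolding y0_def
  by (auto simp: clinear_simps[OF assms(3)] cvec.subspace_scale)
 define u' where "u' b = (if b = b0 then y0 else u b - l b0 (u b) *. y0)" for b
 have "u' b : Y & (ALL b':insert b0 B. l b' (u' b) = (if b' = b then 1 else 0))" if "b : insert b0 B" for b proof (cases "b = b0")
  case True then show ?thesis using y0 insert.hyps by (auto simp: u'_def)
 next case False
  then have "b : B" using that by auto
  then show ?thesis using False y0 u insert.hyps assms(2)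
   by (auto simp: u'_def clinear_simps[OF assms(3)] cvec.subspace_diff cvec.subspace_scale)
 qed
 then show ?case by blast
qed simp

section \<open>Spaces of linear maps\<close>

text \<open>A type of its own makes Hom spaces and duals instances of \<open>complex_vector\<close>,
  so that every result on modules applies to them.\<close>

typedef (overloaded) ('a, 'b) clin = "{f :: 'a::complex_vector => 'b::complex_vector. clinear f}" morphisms app Clin
 by (rule exI[of _ "%_. 0"]) (auto intro!: clinearI)

setup_lifting type_definition_clin

lemma clinear_app: "clinear (app f)" using app by blast

lemmas app_simps = clinear_simps[OF clinear_app]

instantiation clin :: (complex_vector, complex_vector) complex_vector
begin
lift_definition zero_clin :: "('a, 'b) clin" is "%_. 0" by (auto intro!: clinearI)
lift_definition plus_clin :: "('a, 'b) clin => ('a, 'b) clin => ('a, 'b) clin" is "%f g x. f x + g x"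
 by (auto intro!: clinearI simp: clinear_add clinear_scale scaleC_add_right)
lift_definition uminus_clin :: "('a, 'b) clin => ('a, 'b) clin" is "%f x. - f x"
 by (auto intro!: clinearI simp: clinear_add clinear_scale)
lift_definition minus_clin :: "('a, 'b) clin => ('a, 'b) clin => ('a, 'b) clin" is "%f g x. f x - g x"
 by (auto intro!: clinearI simp: clinear_add clinear_scale cvec.scale_right_diff_distrib)
lift_definition scaleC_clin :: "complex => ('a, 'b) clin => ('a, 'b) clin" is "%c f x. c *. f x"
 by (auto intro!: clinearI simp: clinear_add clinear_scale scaleC_add_right scaleC_scaleC mult.commute)
instance by standard (transfer; simp add: fun_eq_iff scaleC_add_right scaleC_add_left scaleC_scaleC scaleC_one)+
end

lemma app_zero [simp]: "app 0 x = 0" by transfer simp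
lemma app_plus [simp]: "app (f + g) x = app f x + app g x" by transfer simp
lemma app_uminus [simp]: "app (- f) x = - app f x" by transfer simp
lemma app_minus [simp]: "app (f - g) x = app f x - app g x" by transfer simp
lemma app_scaleC [simp]: "app (c *. f) x = c *. app f x" by transfer simp
lemma app_sum [simp]: "app (sum f A) x = (SUM a:A. app (f a) x)" by (induction A rule: infinite_finite_induct) auto
lemma app_Clin [simp]: "clinear f ==> app (Clin f) = f" by (simp add: Clin_inverse)
lemma clin_eqI: "(!!x. app f x = app g x) ==> f = g" by transfer auto

lemma clinear_app_left: "clinear (%f. app f x)" by (rule clinearI) simp_all

section \<open>Modules\<close>

lemma lie_module_linear: "lie_module br \<rho> ==> clinear (\<rho> x)" by (auto simp: lie_module_def cbilinear_def)

lemma lie_module_bilinear: "lie_module br \<rho> ==> cbilinear \<rho>" by (auto simp: lie_module_def)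

lemma lie_module_bracket: "lie_module br \<rho> ==> \<rho> (br x y) v = \<rho> x (\<rho> y v) - \<rho> y (\<rho> x v)"
 by (auto simp: lie_module_def)

definition hom_act :: "('g => 'v::complex_vector => 'v) => ('g => 'u::complex_vector => 'u) => 'g => ('v, 'u) clin => ('v, 'u) clin"
 where "hom_act \<rho> \<sigma> x \<phi> = Clin (%v. \<sigma> x (app \<phi> v) - app \<phi> (\<rho> x v))"

lemma app_hom_act:
 assumes "lie_module br \<rho>" "lie_module br \<sigma>"
 shows "app (hom_act \<rho> \<sigma> x \<phi>) v = \<sigma> x (app \<phi> v) - app \<phi> (\<rho> x v)"
proof -
 have "clinear (%v. \<sigma> x (app \<phi> v) - app \<phi> (\<rho> x v))"
  using lie_module_linear[OF assms(1), of x] lie_module_linear[OF assms(2), of x]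
  by (intro clinearI) (simp_all add: clinear_simps app_simps cvec.scale_right_diff_distrib algebra_simps)
 then show ?thesis by (simp add: hom_act_def)
qed

lemma lie_module_hom_act:
 assumes "lie_module br \<rho>" "lie_module br \<sigma>"
 shows "lie_module br (hom_act \<rho> \<sigma>)" unfolding lie_module_def
proof (intro conjI allI)
 note r = cbilinear_simps[OF lie_module_bilinear[OF assms(1)]]
 note s = cbilinear_simps[OF lie_module_bilinear[OF assms(2)]]
 note a = app_hom_act[OF assms]
 show "cbilinear (hom_act \<rho> \<sigma>)"
  by (rule cbilinearI; rule clin_eqI) (simp_all add: a r s app_simps cvec.scale_right_diff_distrib)
 show "hom_act \<rho> \<sigma> (br x y) \<phi> =
  hom_act \<rho> \<sigma> x (hom_act \<rho> \<sigma> y \<phi>) - hom_act \<rho> \<sigma> y (hom_act \<rho> \<sigma> x \<phi>)" for x y \<phi>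
  by (rule clin_eqI) (simp add: a r s app_simps lie_module_bracket[OF assms(1)] lie_module_bracket[OF assms(2)] algebra_simps)
qed

definition pair_act :: "('g => 'v => 'v) => ('g => 'u => 'u) => 'g => 'v \<times> 'u => 'v \<times> 'u"
 where "pair_act \<rho> \<sigma> x p = (\<rho> x (fst p), \<sigma> x (snd p))"

lemma lie_module_pair_act:
 assumes "lie_module br \<rho>" "lie_module br \<sigma>"
 shows "lie_module br (pair_act \<rho> \<sigma>)" unfolding lie_module_def
proof (intro conjI allI)
 note r = cbilinear_simps[OF lie_module_bilinear[OF assms(1)]]
 note s = cbilinear_simps[OF lie_module_bilinear[OF assms(2)]]
 show "cbilinear (pair_act \<rho> \<sigma>)" by (rule cbilinearI) (simp_all add: pair_act_def r s)
 show "pair_act \<rho> \<sigma> (br x y) v =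
  pair_act \<rho> \<sigma> x (pair_act \<rho> \<sigma> y v) - pair_act \<rho> \<sigma> y (pair_act \<rho> \<sigma> x v)" for x y v
  by (simp add: pair_act_def lie_module_bracket[OF assms(1)] lie_module_bracket[OF assms(2)])
qed

section \<open>Representations of sl2\<close>

locale sl2 =
 fixes E F H :: "'v::complex_vector => 'v"
 assumes lin: "clinear E" "clinear F" "clinear H" and EF: "E (F v) = F (E v) + H v" and HE: "H (E v) = E (H v) + 2 *. E v"
  and HF: "H (F v) = F (H v) - 2 *. F v"
begin

lemmas lins = clinear_simps[OF lin(1)] clinear_simps[OF lin(2)] clinear_simps[OF lin(3)]

lemma swap: "sl2 F E (%v. - H v)" by (rule sl2.intro) (simp_all add: lin EF HE HF lins clinear_negate)

lemma H_F_pow: "H v = m *. v ==> H ((F ^^ k) v) = (m - 2 * of_nat k) *. (F ^^ k) v"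
proof (induction k)
 case (Suc k)
 have "H ((F ^^ Suc k) v) = (m - 2 * of_nat k) *. (F ^^ Suc k) v - 2 *. (F ^^ Suc k) v" using Suc by (simp add: HF lins)
 also have "... = (m - 2 * of_nat k - 2) *. (F ^^ Suc k) v" by (simp only: cvec.scale_left_diff_distrib)
 also have "m - 2 * of_nat k - 2 = m - 2 * of_nat (Suc k)" by simp
 finally show ?case .
qed simp

lemma E_F_pow: "H v = m *. v ==> E ((F ^^ Suc k) v) = (F ^^ Suc k) (E v) + (of_nat (Suc k) * (m - of_nat k)) *. (F ^^ k) v"
proof (induction k)
 case 0 then show ?case by (simp add: EF)
next case (Suc k)
 have "E ((F ^^ Suc (Suc k)) v) = F (E ((F ^^ Suc k) v)) + H ((F ^^ Suc k) v)" by (simp add: EF)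
 also have "... = (F ^^ Suc (Suc k)) (E v) + (of_nat (Suc k) * (m - of_nat k)) *. (F ^^ Suc k) v
   + (m - 2 * of_nat (Suc k)) *. (F ^^ Suc k) v" using Suc.IH[OF Suc.prems] H_F_pow[OF Suc.prems, of "Suc k"]
  by (simp add: lins del: of_nat_Suc)
 also have "... = (F ^^ Suc (Suc k)) (E v) + (of_nat (Suc k) * (m - of_nat k) + (m - 2 * of_nat (Suc k))) *. (F ^^ Suc k) v"
  by (simp only: add.assoc cvec.scale_left_distrib)
 also have "of_nat (Suc k) * (m - of_nat k) + (m - 2 * of_nat (Suc k)) = of_nat (Suc (Suc k)) * (m - of_nat (Suc k))"
  by (simp add: algebra_simps)
 finally show ?case .
qed

lemma E_F_pow_highest: "H v = m *. v ==> E v = 0 ==> E ((F ^^ Suc k) v) = (of_nat (Suc k) * (m - of_nat k)) *. (F ^^ k) v"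
 using E_F_pow[of v m k] by (simp add: clinear_0[OF clinear_funpow[OF lin(2)]] clinear_0[OF lin(2)] del: of_nat_Suc)

text \<open>Applying \<open>F\<close> to the formula for \<open>E (F ^^ Suc r) t\<close> shows that
  \<open>F ^^ Suc (Suc r)\<close> kills \<open>E t\<close>, whose weight is \<open>D + 2\<close>;
  hence \<open>E t = 0\<close> by the outer induction. What remains of the formula is a nonzero
  multiple of \<open>(F ^^ r) t\<close>, which the inner induction handles.\<close>

lemma pow_inj:
 assumes "H t = of_int D *. t" "(E ^^ N) t = 0" "(F ^^ r) t = 0" "int r <= D"
 shows "t = 0" using assms
proof (induction N arbitrary: t D r)
 case (Suc N)
 note IH = Suc.IH
 show ?case using Suc.prems(3,4) proof (induction r)
  case (Suc r)
  have "H (E t) = of_int (D + 2) *. E t" using Suc.prems \<open>H t = _\<close> by (simp add: HE lins cvec.scale_left_distrib)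
  moreover have "(E ^^ N) (E t) = 0" using \<open>(E ^^ Suc N) t = 0\<close> by (simp add: funpow_swap1)
  moreover have "(F ^^ Suc (Suc r)) (E t) = 0" proof -
   have "0 = F (E ((F ^^ Suc r) t))" using Suc.prems by (simp add: lins del: funpow.simps)
   also have "... = (F ^^ Suc (Suc r)) (E t) + (of_nat (Suc r) * (of_int D - of_nat r)) *. (F ^^ Suc r) t"
    using E_F_pow[OF \<open>H t = _\<close>, of r] by (simp add: lins del: of_nat_Suc)
   finally show ?thesis using Suc.prems by (simp del: funpow.simps)
  qed
  ultimately have "E t = 0" using IH[of "E t" "D + 2" "Suc (Suc r)"] Suc.prems by auto
  then have "(of_nat (Suc r) * (of_int D - of_nat r)) *. (F ^^ r) t = 0"
   using E_F_pow_highest[OF \<open>H t = _\<close>, of r] Suc.prems by (simp add: lins del: funpow.simps)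
  moreover have "(of_nat (Suc r) * (of_int D - of_nat r) :: complex) ~= 0" proof -
   have "D - int r ~= 0" using Suc.prems by simp
   then have "of_int (D - int r) ~= (0::complex)" using of_int_eq_0_iff by blast
   then show ?thesis by (simp del: of_nat_Suc)
  qed
  ultimately have "(F ^^ r) t = 0" by simp
  then show ?case using Suc by simp
 qed simp
qed simp

lemma highest_weight:
 assumes "H v = m *. v" "E v = 0" "(F ^^ N) v = 0" "v ~= 0"
 obtains n :: nat where "m = of_nat n" "(F ^^ Suc n) v = 0"
proof -
 define N' where "N' = (LEAST N. (F ^^ N) v = 0)"
 have 0: "(F ^^ N') v = 0" unfolding N'_def by (rule LeastI[of _ N]) fact
 then obtain k where k: "N' = Suc k" using assms(4) by (cases N') auto
 have "(F ^^ k) v ~= 0" using not_less_Least[of k "%N. (F ^^ N) v = 0"] k unfolding N'_def by auto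
 moreover have "(of_nat (Suc k) * (m - of_nat k)) *. (F ^^ k) v = 0"
  using E_F_pow_highest[OF assms(1,2), of k] 0 k by (simp add: lins del: funpow.simps)
 ultimately have "(of_nat (Suc k) * (m - of_nat k) :: complex) = 0" by simp
 then have "m = of_nat k" by (simp del: of_nat_Suc)
 with 0 k that show ?thesis by blast
qed

lemma E_pow_F_pow_highest:
 assumes "H v = m *. v" "E v = 0"
 shows "(E ^^ k) ((F ^^ k) v) = (\<Prod>j<k. of_nat (Suc j) * (m - of_nat j)) *. v"
proof (induction k)
 case (Suc k)
 have "(E ^^ Suc k) ((F ^^ Suc k) v) = (E ^^ k) (E ((F ^^ Suc k) v))" by (simp add: funpow_swap1)
 also have "... = (of_nat (Suc k) * (m - of_nat k)) *. (E ^^ k) ((F ^^ k) v)"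
  by (simp only: E_F_pow_highest[OF assms] clinear_scale[OF clinear_funpow[OF lin(1)]])
 finally show ?case using Suc by (simp add: scaleC_scaleC mult_ac del: of_nat_Suc)
qed (simp add: scaleC_one)

lemma E_pow_F_pow_coeff: "k <= n ==> (\<Prod>j<k. of_nat (Suc j) * (of_nat n - of_nat j :: complex)) ~= 0"
 by (auto simp del: of_nat_Suc)

end

text \<open>Every vector of an integrable module is a combination of the vectors \<open>E\<^sup>j a\<close> with \<open>F a = 0\<close>,
 and on such an \<open>a\<close> the image \<open>T a\<close> is killed by a power of \<open>E\<close> that is injective on its weight space.\<close>

lemma sl2_negative_hom:
 assumes "sl2 E F H" "sl2 E' F' H'" and T: "clinear T" "!!v. T (E v) = E' (T v)"
  and wt: "!!v m. H v = m *. v ==> H' (T v) = (m + of_int c) *. T v" and c: "c < 0"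
  and nilE: "!!v. EX n. (E ^^ n) v = 0" and nilF': "!!v. EX n. (F' ^^ n) v = 0" and b: "H b = of_int m *. b" "(F ^^ N) b = 0"
 shows "T b = 0"
proof -
 interpret A: sl2 E F H by fact
 interpret B: sl2 E' F' H' by fact
 interpret A': sl2 F E "%v. - H v" by (rule A.swap)
 interpret B': sl2 F' E' "%v. - H' v" by (rule B.swap)
 have TE: "T ((E ^^ n) v) = (E' ^^ n) (T v)" for n v by (induction n) (simp_all add: T)
 show ?thesis using b proof (induction N arbitrary: b m)
  case 0 then show ?case by (simp add: clinear_0[OF T(1)])
 next case (Suc N)
  define a where "a = (F ^^ N) b"
  show ?case proof (cases "a = 0")
   case True then show ?thesis using Suc unfolding a_def by blast
  next case False
   have Fa: "F a = 0" using Suc.prems by (simp add: a_def)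
   have wa: "H a = (of_int m - 2 * of_nat N) *. a" unfolding a_def by (rule A.H_F_pow) (use Suc.prems in simp)
   then have wa': "- H a = (2 * of_nat N - of_int m) *. a" by (simp add: cvec.scale_left_diff_distrib)
   obtain n where "(E ^^ n) a = 0" using nilE by blast
   then obtain d where d: "(2 * of_nat N - of_int m :: complex) = of_nat d" "(E ^^ Suc d) a = 0"
    using A'.highest_weight[OF wa' Fa _ False] by blast
   have "of_int (2 * int N - m) = (of_int (int d) :: complex)" using d(1) by simp
   then have d': "2 * int N - m = int d" by (metis of_int_eq_iff)
   have Ta: "T a = 0" proof -
    have "H' (T a) = (of_int m - 2 * of_nat N + of_int c) *. T a" by (rule wt[OF wa])
    then have "- H' (T a) = of_int (2 * int N - m - c) *. T a"
     by (simp add: cvec.scale_minus_left[symmetric] del: cvec.scale_minus_left)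
    moreover obtain n where "(F' ^^ n) (T a) = 0" using nilF' by blast
    moreover have "(E' ^^ Suc d) (T a) = 0" using d(2) TE[of "Suc d" a] by (simp add: clinear_0[OF T(1)])
    ultimately show ?thesis using B'.pow_inj[of "T a" "2 * int N - m - c" n "Suc d"] d' c by simp
   qed
   show ?thesis proof (cases "N <= d")
    case True
    let ?k = "\<Prod>j<N. of_nat (Suc j) * (of_nat d - of_nat j :: complex)"
    have k0: "?k ~= 0" by (rule A.E_pow_F_pow_coeff[OF True])
    let ?b' = "b - (1 / ?k) *. (E ^^ N) a"
    have "(F ^^ N) ((E ^^ N) a) = ?k *. a" by (rule A'.E_pow_F_pow_highest) (use wa' d Fa in auto)
    then have "(F ^^ N) ?b' = 0"
     using k0 by (simp add: clinear_simps[OF clinear_funpow[OF A.lin(2)]] a_def[symmetric] scaleC_scaleC scaleC_one)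
    moreover have "H ?b' = of_int m *. ?b'" proof -
     have "- H ((E ^^ N) a) = (of_nat d - 2 * of_nat N) *. (E ^^ N) a" by (rule A'.H_F_pow) (use wa' d in auto)
     moreover have "of_nat d - 2 * of_nat N = (- of_int m :: complex)" using d(1) by (simp add: algebra_simps)
     ultimately have "H ((E ^^ N) a) = of_int m *. (E ^^ N) a" by (metis cvec.scale_minus_left neg_equal_iff_equal)
     then show ?thesis using Suc.prems
      by (simp add: clinear_simps[OF A.lin(3)] cvec.scale_right_diff_distrib scaleC_scaleC mult.commute)
    qed
    ultimately have "T ?b' = 0" using Suc.IH by blast
    then show ?thesis by (simp add: clinear_simps[OF T(1)] TE Ta clinear_0[OF clinear_funpow[OF B.lin(1)]])
   \<comment> \<open>Here \<open>2 * int N - m = int d\<close> with \<open>d < N\<close> forces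
     \<open>m > N\<close>, and \<open>F ^^ Suc N\<close> is injective on vectors of weight
     \<open>m\<close>.\<close>
   next case False
    then have "int (Suc N) <= m" using d' by simp
    moreover obtain n where "(E ^^ n) b = 0" using nilE by blast
    ultimately have "b = 0" using A.pow_inj[OF Suc.prems(1) _ Suc.prems(2)] by blast
    then show ?thesis by (simp add: clinear_0[OF T(1)])
   qed
  qed
 qed
qed

section \<open>Words in the generators\<close>

text \<open>Right-nested brackets: the innermost letter is the generator itself and not an operator,
  so the empty word has no natural value and gets the default 0.\<close>

primrec wrd :: "('i => 'y => 'y) => ('i => 'y) => 'i list => 'y::zero" where "wrd P a [] = 0"
| "wrd P a (i # w) = (if w = [] then a i else P i (wrd P a w))"

definition uvec :: "'i => 'i => nat" where "uvec i j = (if j = i then 1 else 0)"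

definition cnt :: "'i list => 'i => nat" where "cnt w i = count_list w i"

lemma cnt_Nil [simp]: "cnt [] = 0" by (simp add: cnt_def fun_eq_iff)
lemma cnt_Cons: "cnt (i # w) = cnt w + uvec i" by (auto simp: cnt_def uvec_def fun_eq_iff)
lemma cnt_append: "cnt (u @ w) = cnt u + cnt w" by (auto simp: cnt_def fun_eq_iff)
lemma cnt_eq_0 [simp]: "cnt w = 0 \<longleftrightarrow> w = []" by (cases w) (auto simp: cnt_Cons fun_eq_iff uvec_def)
lemma uvec_self [simp]: "uvec i i = 1" by (simp add: uvec_def)
lemma uvec_neq_0 [simp]: "uvec i ~= 0" "0 ~= uvec i" by (metis uvec_self zero_fun_apply zero_neq_one)+

definition height :: "('i::finite => nat) => nat" where "height n = (SUM i:UNIV. n i)"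

lemma height_add [simp]: "height (m + n) = height m + height n" by (simp add: height_def sum.distrib)
lemma height_uvec [simp]: "height (uvec i) = 1" by (simp add: height_def uvec_def)
lemma height_eq_0 [simp]: "height n = 0 \<longleftrightarrow> n = 0" by (auto simp: height_def fun_eq_iff)

lemma height_cnt: "height (cnt w) = length w"
proof (induction w)
 case (Cons a w)
 have "height (cnt (a # w)) = height (cnt w) + 1" unfolding cnt_Cons height_add height_uvec ..
 with Cons show ?case by simp
qed (simp add: height_def)

lemma diff_uvec: "0 < n i ==> n - uvec i + uvec i = (n :: 'i => nat)" by (auto simp: fun_eq_iff uvec_def)

lemma finite_below: "finite {n :: 'i::finite => nat. n <= m}"
proof (rule finite_subset)
 show "{n. n <= m} \<subseteq> PiE UNIV (%i. {..m i})" by (auto simp: le_fun_def PiE_iff)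
 show "finite (PiE UNIV (%i. {..m i}))" by (rule finite_PiE) auto
qed

lemma cnt_unit: "cnt w = uvec k \<longleftrightarrow> w = [k]" for k :: "'i::finite"
proof
 assume a: "cnt w = uvec k"
 then obtain j u where w: "w = j # u" by (cases w) auto
 with a have "height (cnt u + uvec j) = height (uvec k)" by (simp add: cnt_Cons)
 then have "height (cnt u) = 0" by (simp only: height_add height_uvec)
 then have "u = []" by simp
 with a w have "uvec j = uvec k" by (simp add: cnt_Cons)
 then have "uvec j k = uvec k k" by (rule fun_cong)
 then have "j = k" by (simp add: uvec_def split: if_splits)
 with w \<open>u = []\<close> show "w = [k]" by simp
qed (simp add: cnt_Cons)

lemma subspace_preimage:
 fixes f :: "'a::complex_vector => 'b::complex_vector"
 assumes f: "clinear f" and S: "cvec.subspace S"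
 shows "cvec.subspace {y. f y : S}" by (rule cvec.subspaceI)
  (simp_all add: clinear_simps[OF f] cvec.subspace_0[OF S] cvec.subspace_add[OF S] cvec.subspace_scale[OF S])

lemma subspace_zeros:
 fixes f :: "'a::complex_vector => 'b::complex_vector"
 assumes f: "clinear f"
 shows "cvec.subspace {y. f y = 0}"
proof (rule cvec.subspaceI)
 show "0 : {y. f y = 0}" using clinear_0[OF f] by simp
 show "x + y : {y. f y = 0}" if "x : {y. f y = 0}" "y : {y. f y = 0}" for x y using that clinear_add[OF f, of x y] by simp
 show "c *. x : {y. f y = 0}" if "x : {y. f y = 0}" for c x using that clinear_scale[OF f, of c x] by simp
qed

lemma subspace_eigen:
 fixes f :: "'a::complex_vector => 'a"
 assumes f: "clinear f"
 shows "cvec.subspace {y. f y = c *. y}"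
proof -
 have "clinear (%y. f y - c *. y)" using f by (intro clinearI) (simp_all add: clinear_add[OF f] clinear_scale[OF f]
   scaleC_add_right cvec.scale_right_diff_distrib cvec.scale_left_commute)
 from subspace_zeros[OF this] show ?thesis by simp
qed

lemma subspace_range:
 assumes "clinear f"
 shows "cvec.subspace (range f)" by (rule cpair.linear_subspace_image[OF assms cvec.subspace_UNIV])

text \<open>\<open>P\<close>, \<open>Q\<close>, \<open>R\<close> imitate the brackets with
  \<open>e\<close>, \<open>f\<close> and the Cartan subalgebra, and \<open>a\<close>,
  \<open>b\<close>, \<open>c\<close> imitate these elements, in a space without a bracket. The
  triangular decomposition is thus proved once and serves for the algebra, for the graph of the
  invariant form in the sum of the algebra and its dual, and for the graph of a
  representation.\<close>

locale adj =
 fixes sr :: "'i::finite => 'h::complex_vector => complex" and cr :: "'i => 'h"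
  and P Q :: "'i => 'y::complex_vector => 'y" and R :: "'h => 'y => 'y" and a b :: "'i => 'y" and c :: "'h => 'y"
 assumes P_lin: "!!i. clinear (P i)" and Q_lin: "!!i. clinear (Q i)" and R_lin: "!!h. clinear (R h)" and c_lin: "clinear c"
  and PQ: "!!i j y. P i (Q j y) = Q j (P i y) + (if i = j then R (cr i) y else 0)"
  and RP: "!!h i y. R h (P i y) = P i (R h y) + sr i h *. P i y" and RQ: "!!h i y. R h (Q i y) = Q i (R h y) - sr i h *. Q i y"
  and Pc: "!!i h. P i (c h) = - (sr i h *. a i)" and Qc: "!!i h. Q i (c h) = sr i h *. b i"
  and Pb: "!!i j. P i (b j) = (if i = j then c (cr i) else 0)" and Qa: "!!i j. Q i (a j) = - (if i = j then c (cr i) else 0)"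
  and Ra: "!!h i. R h (a i) = sr i h *. a i" and Rb: "!!h i. R h (b i) = - (sr i h *. b i)" and Rc: "!!h h'. R h (c h') = 0"
begin

lemmas Pl = clinear_simps[OF P_lin]
lemmas Ql = clinear_simps[OF Q_lin]
lemmas Rl = clinear_simps[OF R_lin]
lemmas cl = clinear_simps[OF c_lin]

text \<open>The Chevalley involution. Interpreting the locale a second time through it turns each
  fact about one triangular half into its mirror image.\<close>

lemma swap: "adj sr cr Q P (%h y. - R h y) b a (%h. - c h)" by (rule adj.intro)
  (auto simp: P_lin Q_lin R_lin c_lin clinear_negate PQ RP RQ Pc Qc Pb Qa Ra Rb Rc Pl Ql Rl)

definition wt :: "('i => int) => 'h => complex" where "wt z h = (SUM i:UNIV. of_int (z i) * sr i h)"

definition PS :: "('i => nat) => 'y set" where "PS n = cvec.span {wrd P a w |w. w ~= [] & cnt w = n}"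
definition QS :: "('i => nat) => 'y set" where "QS n = cvec.span {wrd Q b w |w. w ~= [] & cnt w = n}"
definition D :: "'y set" where "D = cvec.span (range c \<union> {wrd P a w |w. w ~= []} \<union> {wrd Q b w |w. w ~= []})"

lemma wrd_P_in: "w ~= [] ==> wrd P a w : PS (cnt w)" unfolding PS_def by (rule cvec.span_base) blast
lemma wrd_Q_in: "w ~= [] ==> wrd Q b w : QS (cnt w)" unfolding QS_def by (rule cvec.span_base) blast

lemma PS_0: "PS 0 = {0}" and QS_0: "QS 0 = {0}" by (auto simp: PS_def QS_def)

lemma subspace_PS: "cvec.subspace (PS n)" and subspace_QS: "cvec.subspace (QS n)" by (simp_all add: PS_def QS_def)

lemma PS_minimal: "cvec.subspace S ==> (!!w. w ~= [] ==> cnt w = n ==> wrd P a w : S) ==> PS n \<subseteq> S"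
 unfolding PS_def by (rule cvec.span_minimal) auto

lemma QS_minimal: "cvec.subspace S ==> (!!w. w ~= [] ==> cnt w = n ==> wrd Q b w : S) ==> QS n \<subseteq> S"
 unfolding QS_def by (rule cvec.span_minimal) auto

lemma P_PS: "y : PS n ==> n ~= 0 ==> P i y : PS (n + uvec i)"
proof -
 have "PS n \<subseteq> {y. P i y : PS (n + uvec i)}" proof (rule PS_minimal[OF subspace_preimage[OF P_lin subspace_PS]])
  fix w assume "w ~= []" "cnt w = n"
  then show "wrd P a w : {y. P i y : PS (n + uvec i)}" using wrd_P_in[of "i # w"] by (simp add: cnt_Cons)
 qed
 then show "y : PS n ==> P i y : PS (n + uvec i)" by blast
qed

lemma Q_QS: "y : QS n ==> n ~= 0 ==> Q i y : QS (n + uvec i)"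
proof -
 interpret s: adj sr cr Q P "%h y. - R h y" b a "%h. - c h" by (rule swap)
 show "y : QS n ==> n ~= 0 ==> Q i y : QS (n + uvec i)" using s.P_PS[of y n i] by (simp add: s.PS_def QS_def)
qed

lemma wt_add: "wt (z + z') h = wt z h + wt z' h" by (simp add: wt_def sum.distrib algebra_simps)
lemma wt_0 [simp]: "wt 0 h = 0" by (simp add: wt_def)
lemma wt_uminus: "wt (- z) h = - wt z h" by (simp add: wt_def sum_negf)
lemma wt_unit: "wt (%j. int (uvec i j)) h = sr i h"
proof -
 have "wt (%j. int (uvec i j)) h = (SUM j:UNIV. if j = i then sr j h else 0)"
  unfolding wt_def by (rule sum.cong) (auto simp: uvec_def)
 then show ?thesis by simp
qed

lemma wt_cnt_Cons: "wt (%j. int (cnt (i # w) j)) h = sr i h + wt (%j. int (cnt w j)) h"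
 using wt_add[of "%j. int (cnt w j)" "%j. int (uvec i j)" h] by (simp add: wt_unit cnt_Cons plus_fun_def)

lemma R_wrd_P: "w ~= [] ==> R h (wrd P a w) = wt (%j. int (cnt w j)) h *. wrd P a w"
proof (induction w)
 case (Cons i w)
 show ?case proof (cases "w = []")
  case True then show ?thesis by (simp add: Ra wt_cnt_Cons) (simp add: wt_def)
 next case False
  then show ?thesis using Cons by (simp add: RP Pl wt_cnt_Cons cvec.scale_left_distrib)
 qed
qed simp

lemma R_wrd_Q: "w ~= [] ==> R h (wrd Q b w) = - wt (%j. int (cnt w j)) h *. wrd Q b w"
proof -
 interpret s: adj sr cr Q P "%h y. - R h y" b a "%h. - c h" by (rule swap)
 assume "w ~= []"
 then have "- R h (wrd Q b w) = wt (%j. int (cnt w j)) h *. wrd Q b w" using s.R_wrd_P[of w h] by (simp add: s.wt_def wt_def)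
 then show ?thesis by (metis add.inverse_inverse cvec.scale_minus_left)
qed

lemma R_PS: "y : PS n ==> R h y = wt (%j. int (n j)) h *. y"
 using PS_minimal[OF subspace_eigen[OF R_lin], of n h "wt (%j. int (n j)) h"] R_wrd_P by blast

lemma R_QS: "y : QS n ==> R h y = - wt (%j. int (n j)) h *. y"
 using QS_minimal[OF subspace_eigen[OF R_lin], of n h "- wt (%j. int (n j)) h"] R_wrd_Q by blast

lemma P_wrd_Q_0: "w ~= [] ==> cnt w k = 0 ==> P k (wrd Q b w) = 0"
proof (induction w)
 case (Cons i w)
 then have "i ~= k" "cnt w k = 0" by (auto simp: cnt_def split: if_splits)
 with Cons show ?case by (auto simp: Pb PQ Ql)
qed simp

text \<open>The word \<open>[k]\<close> is excluded because \<open>P k (b k)\<close> falls into the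
  image of \<open>c\<close>. For a two-letter word ending in \<open>k\<close> the operator
  \<open>Q i\<close> brings that Cartan element back to a multiple of \<open>b i\<close>.\<close>

lemma P_wrd_Q: "w ~= [] ==> w ~= [k] ==> 0 < cnt w k ==> P k (wrd Q b w) : QS (cnt w - uvec k)"
proof (induction w)
 case (Cons i w)
 have w: "w ~= []" using Cons.prems by (auto simp: cnt_def split: if_splits)
 let ?x = "wrd Q b w"
 have 1: "(if k = i then R (cr k) ?x else 0) : QS (cnt (i # w) - uvec k)" proof (cases "k = i")
  case True
  then have "cnt (i # w) - uvec k = cnt w" by (simp add: cnt_Cons fun_eq_iff)
  then show ?thesis using True w R_wrd_Q[of w "cr k"] wrd_Q_in[of w] by (simp add: QS_def cvec.span_scale cvec.span_neg)
 next case False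
  then show ?thesis by (simp add: QS_def cvec.span_zero)
 qed
 have 2: "Q i (P k ?x) : QS (cnt (i # w) - uvec k)" proof (cases "w = [k]")
  case True
  then have "cnt (i # w) - uvec k = cnt [i]" by (simp add: cnt_Cons fun_eq_iff)
  then show ?thesis using True wrd_Q_in[of "[i]"] by (simp add: Pb Qc QS_def cvec.span_scale)
 next case F: False
  show ?thesis proof (cases "cnt w k = 0")
   case True then show ?thesis using P_wrd_Q_0[OF w True] by (simp add: Ql QS_def cvec.span_zero)
  next case False
   then have "P k ?x : QS (cnt w - uvec k)" by (intro Cons.IH w F) simp
   moreover have "cnt w - uvec k ~= 0" using diff_uvec[of "cnt w" k] False F cnt_unit[of w k] by auto
   ultimately have "Q i (P k ?x) : QS (cnt w - uvec k + uvec i)" by (rule Q_QS)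
   moreover have "cnt w - uvec k + uvec i = cnt (i # w) - uvec k"
    using False by (auto simp: cnt_Cons fun_eq_iff uvec_def)
   ultimately show ?thesis by simp
  qed
 qed
 have "P k (wrd Q b (i # w)) = Q i (P k ?x) + (if k = i then R (cr k) ?x else 0)" using w by (simp add: PQ)
 with cvec.subspace_add[OF subspace_QS 2 1] show ?case by (simp only:)
qed simp

lemma P_QS_0: "y : QS n ==> n k = 0 ==> P k y = 0" using QS_minimal[OF subspace_zeros[OF P_lin], of n k] P_wrd_Q_0 by blast

lemma P_QS: "y : QS n ==> 0 < n k ==> n ~= uvec k ==> P k y : QS (n - uvec k)"
proof -
 assume n: "0 < n k" "n ~= uvec k"
 have "QS n \<subseteq> {y. P k y : QS (n - uvec k)}" proof (rule QS_minimal[OF subspace_preimage[OF P_lin subspace_QS]])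
  fix w assume w: "w ~= []" "cnt w = n"
  with n have "w ~= [k]" by (auto simp: cnt_Cons)
  then show "wrd Q b w : {y. P k y : QS (n - uvec k)}" using P_wrd_Q[of w k] w n by auto
 qed
 then show "y : QS n ==> P k y : QS (n - uvec k)" by blast
qed

lemma QS_unit: "QS (uvec k) = cvec.span {b k}" and PS_unit: "PS (uvec k) = cvec.span {a k}"
proof -
 have "{w. w ~= [] & cnt w = uvec k} = {[k]}" by (auto simp: cnt_unit)
 then have "{wrd Q b w |w. w ~= [] & cnt w = uvec k} = {b k}" "{wrd P a w |w. w ~= [] & cnt w = uvec k} = {a k}"
  by (auto simp: cnt_unit)
 then show "QS (uvec k) = cvec.span {b k}" "PS (uvec k) = cvec.span {a k}" by (simp_all add: QS_def PS_def)
qed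

lemma D_base: "c h : D" "w ~= [] ==> wrd P a w : D" "w ~= [] ==> wrd Q b w : D" unfolding D_def by (auto intro: cvec.span_base)

lemma a_in_D: "a i : D" and b_in_D: "b i : D" using D_base(2)[of "[i]"] D_base(3)[of "[i]"] by simp_all

lemma subspace_D: "cvec.subspace D" by (simp add: D_def)

lemma QS_sub_D: "QS n \<subseteq> D" and PS_sub_D: "PS n \<subseteq> D"
 unfolding QS_def PS_def by (rule cvec.span_minimal[OF _ subspace_D], use D_base in blast)+

lemma D_P: "y : D ==> P k y : D" unfolding D_def
proof (induction rule: cvec.span_induct_alt)
 case base then show ?case by (simp add: Pl cvec.span_zero)
next case (step s x z)
 have "P k x : D" using step(1) proof (elim UnE CollectE imageE exE conjE)
  fix h assume "x = c h"
  then show ?thesis using a_in_D subspace_D by (simp add: Pc cvec.subspace_neg cvec.subspace_scale)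
 next fix w assume "x = wrd P a w" "w ~= []"
  then show ?thesis using D_base(2)[of "k # w"] by simp
 next fix w assume w: "x = wrd Q b w" "w ~= []"
  consider "w = [k]" | "cnt w k = 0" | "w ~= [k]" "0 < cnt w k" by blast
  then show ?thesis proof cases
   case 1 then show ?thesis using w D_base by (simp add: Pb)
  next case 2
   then show ?thesis using w P_wrd_Q_0 subspace_D by (simp add: cvec.subspace_0)
  next case 3
   then show ?thesis using w P_wrd_Q QS_sub_D by blast
  qed
 qed
 with step show ?case by (simp add: Pl cvec.span_add cvec.span_scale D_def)
qed

lemma D_swap: "adj.D Q P b a (%h. - c h) = D"
proof -
 interpret s: adj sr cr Q P "%h y. - R h y" b a "%h. - c h" by (rule swap)
 have r: "range (%h. - c h) = range c" proof -
  have "- c h = c (- h)" for h by (simp add: cl)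
  moreover have "c h = - c (- h)" for h by (simp add: cl)
  ultimately show ?thesis by (metis (no_types, lifting) image_cong image_eqI rangeE subsetI subset_antisym rangeI)
 qed
 show ?thesis unfolding s.D_def D_def r by (simp add: Un_ac)
qed

lemma D_Q: "y : D ==> Q k y : D"
proof -
 interpret s: adj sr cr Q P "%h y. - R h y" b a "%h. - c h" by (rule swap)
 show "y : D ==> Q k y : D" using s.D_P[of y k] by (simp add: D_swap)
qed

lemma D_R: "y : D ==> R h y : D" unfolding D_def
proof (induction rule: cvec.span_induct_alt)
 case (step s x z)
 have "R h x : D" using step(1)
  by (auto simp: Rc R_wrd_P R_wrd_Q D_base subspace_D cvec.subspace_0 cvec.subspace_neg cvec.subspace_scale)
 with step show ?case by (simp add: Rl cvec.span_add cvec.span_scale D_def)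
qed (simp add: Rl cvec.span_zero)

definition gr :: "('i => int) => 'y set" where "gr z = (if z = 0 then range c else if ALL i. 0 <= z i then PS (%i. nat (z i))
  else if ALL i. z i <= 0 then QS (%i. nat (- z i)) else {0})"

lemma subspace_gr: "cvec.subspace (gr z)"
 unfolding gr_def by (auto intro: subspace_range[OF c_lin] subspace_PS subspace_QS cvec.subspace_single_0)

lemma R_gr:
 assumes y: "y : gr z"
 shows "R h y = wt z h *. y"
proof -
 consider "z = 0" | "z ~= 0" "ALL i. 0 <= z i" | "z ~= 0" "\<not> (ALL i. 0 <= z i)" "ALL i. z i <= 0"
  | "z ~= 0" "\<not> (ALL i. 0 <= z i)" "\<not> (ALL i. z i <= 0)" by blast
 then show ?thesis proof cases
  case 1 then show ?thesis using y by (auto simp: gr_def Rc)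
 next case 2
  then have "y : PS (%i. nat (z i))" using y by (simp add: gr_def)
  moreover have "(%j. int (nat (z j))) = z" using 2 by (simp add: fun_eq_iff)
  ultimately show ?thesis using R_PS by simp
 next case 3
  with y have "y : QS (%i. nat (- z i))" unfolding gr_def if_not_P[OF 3(1)] if_not_P[OF 3(2)] if_P[OF 3(3)] by blast
  moreover have "(%j. int (nat (- z j))) = - z" using 3 by (simp add: fun_eq_iff)
  ultimately show ?thesis using R_QS[of y "%i. nat (- z i)" h] by (simp add: wt_uminus)
 next case 4
  with y have "y = 0" unfolding gr_def if_not_P[OF 4(1)] if_not_P[OF 4(2)] if_not_P[OF 4(3)] by blast
  then show ?thesis by (simp add: Rl)
 qed
qed

lemma gr_PS: "n ~= 0 ==> gr (%j. int (n j)) = PS n" by (auto simp: gr_def fun_eq_iff)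

lemma gr_QS: "n ~= 0 ==> gr (%j. - int (n j)) = QS n" by (auto simp: gr_def fun_eq_iff)

lemma D_decomp:
 assumes "y : D"
 shows "EX Z g. finite Z & (ALL z:Z. g z : gr z) & y = (SUM z:Z. g z)" using assms unfolding D_def
proof (induction rule: cvec.span_induct_alt)
 case base then show ?case by (intro exI[of _ "{}"]) auto
next case (step s x y)
 then obtain Z g where Z: "finite Z" "ALL z:Z. g z : gr z" "y = (SUM z:Z. g z)" by blast
 obtain z0 where z0: "x : gr z0" using step(1) proof (elim UnE CollectE imageE exE conjE)
  fix h assume "x = c h"
  then show ?thesis using that[of 0] by (simp add: gr_def)
 next fix w assume "x = wrd P a w" "w ~= []"
  then show ?thesis using that[of "%j. int (cnt w j)"] wrd_P_in[of w] by (simp add: gr_PS)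
 next fix w assume "x = wrd Q b w" "w ~= []"
  then show ?thesis using that[of "%j. - int (cnt w j)"] wrd_Q_in[of w] by (simp add: gr_QS)
 qed
 define g' where "g' z = (if z : Z then g z else 0) + (if z = z0 then s *. x else 0)" for z
 have "s *. x + y = (SUM z:insert z0 Z. g' z)" proof -
  have "(SUM z:insert z0 Z. g' z) = (SUM z:insert z0 Z. if z : Z then g z else 0) + s *. x"
   using Z(1) by (simp add: g'_def sum.distrib)
  also have "(SUM z:insert z0 Z. if z : Z then g z else 0) = (SUM z:Z. g z)" using Z(1) by (intro sum.mono_neutral_cong_right) auto
  finally show ?thesis using Z(3) by (simp add: add.commute)
 qed
 moreover have "ALL z:insert z0 Z. g' z : gr z" using Z(2) z0 subspace_gr
  by (auto simp: g'_def cvec.subspace_0 cvec.subspace_add cvec.subspace_scale)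
 ultimately show ?case using Z(1) by (intro exI[of _ "insert z0 Z"] exI[of _ g']) auto
qed

end

section \<open>Symmetrizable Kac--Moody algebras\<close>

lemma span_UN_decomp:
 fixes S :: "'k => 'v::complex_vector set"
 assumes S: "!!k. cvec.subspace (S k)" and x: "x : cvec.span (\<Union>k\<in>I. S k)"
 shows "EX K g. finite K & K \<subseteq> I & (ALL k:K. g k : S k) & x = (SUM k:K. g k)" using x
proof (induction rule: cvec.span_induct_alt)
 case base then show ?case by (intro exI[of _ "{}"]) auto
next case (step s x y)
 then obtain K g where K: "finite K" "K \<subseteq> I" "ALL k:K. g k : S k" "y = (SUM k:K. g k)" by blast
 from step(1) obtain k0 where k0: "k0 : I" "x : S k0" by blast
 define g' where "g' k = (if k : K then g k else 0) + (if k = k0 then s *. x else 0)" for k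
 have "s *. x + y = (SUM k:insert k0 K. g' k)" proof -
  have "(SUM k:insert k0 K. g' k) = (SUM k:insert k0 K. if k : K then g k else 0) + s *. x"
   using K(1) by (simp add: g'_def sum.distrib)
  also have "(SUM k:insert k0 K. if k : K then g k else 0) = (SUM k:K. g k)" using K(1) by (intro sum.mono_neutral_cong_right) auto
  finally show ?thesis using K(4) by (simp add: add.commute)
 qed
 moreover have "ALL k:insert k0 K. g' k : S k" proof
  fix k assume "k : insert k0 K"
  have "(if k : K then g k else 0) : S k" using K(3) cvec.subspace_0[OF S] by auto
  moreover have "(if k = k0 then s *. x else 0) : S k" using k0 cvec.subspace_0[OF S] cvec.subspace_scale[OF S] by auto
  ultimately show "g' k : S k" unfolding g'_def by (rule cvec.subspace_add[OF S])
 qed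
 ultimately show ?case using K k0 by (intro exI[of _ "insert k0 K"] exI[of _ g']) auto
qed

lemma functional_exists:
 fixes x :: "'v::complex_vector"
 assumes "x ~= 0"
 obtains l :: "'v => complex" where "clinear l" "l x = k"
proof -
 have i: "cvec.independent {x}" using assms by simp
 show ?thesis by (rule that[OF cpair.linear_construct[OF i] cpair.construct_basis[OF i]]) simp
qed

locale km0 =
 fixes A :: "'i::finite => 'i => int" and sr :: "'i => 'h::complex_vector => complex" and cr :: "'i => 'h"
  and br :: "'g::complex_vector => 'g => 'g" and ch :: "'h => 'g" and e f :: "'i => 'g"
 assumes A_diag: "!!i. A i i = 2" and A_off: "!!i j. i ~= j ==> A i j <= 0"
  and sr_lin: "!!i. clinear (sr i)" and sr_cr: "!!i j. sr j (cr i) = of_int (A i j)"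
  and sr_ind: "inj sr" "cvec.independent (range sr)" and cr_ind: "inj cr" "cvec.independent (range cr)"
  and lie: "lie_algebra br" and ch_lin: "clinear ch" and ch_inj: "inj ch" and ch_ch: "!!h h'. br (ch h) (ch h') = 0"
  and e_f: "!!i j. br (e i) (f j) = (if i = j then ch (cr i) else 0)" and h_e: "!!h i. br (ch h) (e i) = sr i h *. e i"
  and h_f: "!!h i. br (ch h) (f i) = - (sr i h *. f i)"
  and generated: "lie_generated br (range ch \<union> range e \<union> range f) = UNIV"
  and no_ideal: "!!I. lie_ideal br I ==> I \<inter> range ch = {0} ==> I = {0}"
begin

lemma br_bilinear: "cbilinear br" using lie by (simp add: lie_algebra_def)
lemmas br_simps = cbilinear_simps[OF br_bilinear]

lemma br_self: "br x x = 0" using lie by (simp add: lie_algebra_def)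

lemma br_anti: "br x y = - br y x"
proof -
 have "br (x + y) (x + y) = br x x + br x y + (br y x + br y y)" by (simp only: br_simps add_ac)
 then have "br x y + br y x = 0" by (simp only: br_self add_0_left add_0_right)
 then show ?thesis by (simp only: eq_neg_iff_add_eq_0)
qed

lemma jacobi: "br x (br y z) = br (br x y) z + br y (br x z)"
proof -
 have "br x (br y z) + br y (br z x) + br z (br x y) = 0" using lie by (auto simp: lie_algebra_def)
 then show ?thesis using br_anti[of z x] br_anti[of z "br x y"] by (simp add: br_simps algebra_simps eq_neg_iff_add_eq_0)
qed

lemma ad_module: "lie_module br br" unfolding lie_module_def
proof (intro conjI allI br_bilinear)
 show "br (br x y) v = br x (br y v) - br y (br x v)" for x y v using jacobi[of x y v] by simp
qed

lemma f_e: "br (f i) (e j) = - (if i = j then ch (cr i) else 0)" using br_anti[of "f i" "e j"] by (simp add: e_f)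
lemma e_h: "br (e i) (ch h) = - (sr i h *. e i)" using br_anti[of "e i" "ch h"] by (simp add: h_e)
lemma f_h: "br (f i) (ch h) = sr i h *. f i" using br_anti[of "f i" "ch h"] by (simp add: h_f)

lemma module_gen:
 assumes "lie_module br \<rho>"
 shows "\<rho> (e i) (\<rho> (f j) y) = \<rho> (f j) (\<rho> (e i) y) + (if i = j then \<rho> (ch (cr i)) y else 0)"
  "\<rho> (ch h) (\<rho> (e i) y) = \<rho> (e i) (\<rho> (ch h) y) + sr i h *. \<rho> (e i) y"
  "\<rho> (ch h) (\<rho> (f i) y) = \<rho> (f i) (\<rho> (ch h) y) - sr i h *. \<rho> (f i) y"
  "\<rho> (ch h) (\<rho> (ch h') y) = \<rho> (ch h') (\<rho> (ch h) y)"
proof -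
 note r = cbilinear_simps[OF lie_module_bilinear[OF assms]]
 note b = lie_module_bracket[OF assms]
 have "\<rho> (br (e i) (f j)) y = (if i = j then \<rho> (ch (cr i)) y else 0)" by (simp add: e_f r)
 with b[of "e i" "f j" y]
 show "\<rho> (e i) (\<rho> (f j) y) = \<rho> (f j) (\<rho> (e i) y) + (if i = j then \<rho> (ch (cr i)) y else 0)"
  by (simp add: algebra_simps)
 show "\<rho> (ch h) (\<rho> (e i) y) = \<rho> (e i) (\<rho> (ch h) y) + sr i h *. \<rho> (e i) y"
  using b[of "ch h" "e i" y] by (simp add: h_e r algebra_simps)
 show "\<rho> (ch h) (\<rho> (f i) y) = \<rho> (f i) (\<rho> (ch h) y) - sr i h *. \<rho> (f i) y"
  using b[of "ch h" "f i" y] by (simp add: h_f r algebra_simps)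
 show "\<rho> (ch h) (\<rho> (ch h') y) = \<rho> (ch h') (\<rho> (ch h) y)" using b[of "ch h" "ch h'" y] by (simp add: ch_ch r)
qed

lemma gen_induct [case_names h e f add scale br]:
 assumes "!!h. Pr (ch h)" "!!i. Pr (e i)" "!!i. Pr (f i)" and "!!x y. Pr x ==> Pr y ==> Pr (x + y)" "!!c x. Pr x ==> Pr (c *. x)"
  and "!!x y. Pr x ==> Pr y ==> Pr (br x y)"
 shows "Pr x"
proof -
 have "Pr 0" using assms(5)[OF assms(2), of 0] by simp
 then have "cvec.subspace {x. Pr x}" by (intro cvec.subspaceI) (simp_all add: assms(4,5))
 then have "lie_subalgebra br {x. Pr x}" by (simp add: lie_subalgebra_def assms(6))
 moreover have "range ch \<union> range e \<union> range f \<subseteq> {x. Pr x}" using assms(1-3) by auto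
 ultimately have "lie_generated br (range ch \<union> range e \<union> range f) \<subseteq> {x. Pr x}"
  unfolding lie_generated_def by blast
 then show ?thesis using generated by auto
qed

lemma submodule_gen:
 assumes m: "lie_module br \<rho>" and S: "cvec.subspace S"
  and "!!i y. y : S ==> \<rho> (e i) y : S" "!!i y. y : S ==> \<rho> (f i) y : S" "!!h y. y : S ==> \<rho> (ch h) y : S"
 shows "y : S ==> \<rho> x y : S"
proof -
 note r = cbilinear_simps[OF lie_module_bilinear[OF m]]
 have "ALL y:S. \<rho> x y : S" proof (induction x rule: gen_induct)
  case (add x y) then show ?case by (simp add: r cvec.subspace_add[OF S])
 next case (scale c x)
  then show ?case by (simp add: r cvec.subspace_scale[OF S])
 next case (br x y)
  then show ?case by (simp add: lie_module_bracket[OF m] cvec.subspace_diff[OF S])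
 qed (simp_all add: assms(3-5))
 then show "y : S ==> \<rho> x y : S" by blast
qed

lemma ideal_gen:
 assumes "cvec.subspace S"
  and "!!i y. y : S ==> br (e i) y : S" "!!i y. y : S ==> br (f i) y : S" "!!h y. y : S ==> br (ch h) y : S"
 shows "lie_ideal br S" unfolding lie_ideal_def using submodule_gen[OF ad_module assms] assms(1) by blast

lemma swap0: "km0 A sr cr br (%h. - ch h) f e"
proof (rule km0.intro)
 have "range (%h. - ch h) = range ch" proof (intro subset_antisym subsetI)
  fix x assume "x : range (%h. - ch h)"
  then obtain h where "x = ch (- h)" by (auto simp: clinear_neg[OF ch_lin])
  then show "x : range ch" by blast
 next fix x assume "x : range ch"
  then obtain h where "x = - ch (- h)" by (auto simp: clinear_neg[OF ch_lin])
  then show "x : range (%h. - ch h)" by blast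
 qed
 then show "lie_generated br (range (%h. - ch h) \<union> range f \<union> range e) = UNIV"
  "!!I. lie_ideal br I ==> I \<inter> range (%h. - ch h) = {0} ==> I = {0}" using generated no_ideal by (simp_all add: Un_ac)
 show "inj (%h. - ch h)" using ch_inj by (auto simp: inj_on_def)
qed (fact A_diag A_off sr_lin sr_cr sr_ind cr_ind lie
   | simp only: clinear_negate[OF ch_lin] br_simps ch_ch f_e h_e h_f minus_zero minus_minus if_distrib[of uminus])+

sublocale ad: adj sr cr "%i. br (e i)" "%i. br (f i)" "%h. br (ch h)" e f ch by (rule adj.intro)
  (simp_all add: cbilinear_right[OF br_bilinear] ch_lin module_gen[OF ad_module] e_f f_e h_e h_f e_h f_h ch_ch)

abbreviation "wt \<equiv> ad.wt"

text \<open>The triangular decomposition: the span of the Cartan part and of the nested brackets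
  contains the generators and is stable under them.\<close>

lemma D_UNIV: "ad.D = UNIV"
proof -
 have "x : ad.D" for x proof (induction x rule: gen_induct)
  case (br x y)
  show ?case by (rule submodule_gen[OF ad_module ad.subspace_D ad.D_P ad.D_Q ad.D_R br(2)])
 qed (auto simp: ad.D_base ad.a_in_D ad.b_in_D cvec.subspace_add[OF ad.subspace_D] cvec.subspace_scale[OF ad.subspace_D])
 then show ?thesis by blast
qed

lemma sr_sum_0:
 assumes a: "!!h. (SUM i:UNIV. c i * sr i h) = 0"
 shows "c j = 0"
proof -
 have "(SUM v:range sr. c (inv sr v) *. v) = (SUM i:UNIV. c i *. sr i)" using sr_ind(1) by (simp add: sum.reindex)
 also have "... = 0" using a by (simp add: fun_eq_iff sum_fun_apply)
 finally have "c (inv sr (sr j)) = 0" by (intro cvec.independentD[OF sr_ind(2), of "range sr" "%v. c (inv sr v)"]) auto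
 then show ?thesis using sr_ind(1) by simp
qed

lemma wt_inj: "inj (wt)"
proof (rule injI)
 fix z z' assume "wt z = wt z'"
 then have "(SUM i:UNIV. of_int (z i - z' i) * sr i h) = 0" for h by (simp add: ad.wt_def fun_eq_iff algebra_simps sum_subtractf)
 then have "of_int (z i - z' i) = (0::complex)" for i by (rule sr_sum_0)
 then show "z = z'" by (simp add: fun_eq_iff)
qed

lemma wt_neq_0: "z ~= 0 ==> EX h. wt z h ~= 0" using injD[OF wt_inj, of z 0] by (auto simp: fun_eq_iff)

lemma clinear_wt: "clinear (wt z)" by (rule clinearI) (simp_all add: ad.wt_def clinear_add[OF sr_lin] clinear_scale[OF sr_lin]
   algebra_simps sum.distrib sum_distrib_left)

definition W :: "('i => int) => 'g set" where "W z = {x. ALL h. br (ch h) x = wt z h *. x}"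

lemma subspace_W: "cvec.subspace (W z)" unfolding W_def
 by (rule cvec.subspaceI) (simp_all add: br_simps scaleC_add_right cvec.scale_left_commute)

lemma W_indep:
 assumes "finite Z" "!!z. z : Z ==> g z : W z" "(SUM z:Z. g z) = 0" "z : Z"
 shows "g z = 0"
proof -
 have "g z : {0}" proof (rule weight_components[where H = "%h. br (ch h)" and wt = wt and K = Z])
  show "inj_on wt Z" using wt_inj by (rule inj_on_subset) simp
 qed (use assms in \<open>auto simp: cvec.subspace_single_0 cbilinear_right[OF br_bilinear] br_simps W_def\<close>)
 then show ?thesis by simp
qed

text \<open>Decompose \<open>x\<close> into graded pieces and subtract \<open>x\<close> in degree
  \<open>z\<close>. The pieces now add up to 0 and lie in independent weight spaces, so the piece of
  degree \<open>z\<close> was \<open>x\<close>.\<close>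

lemma W_eq_gr: "W z = ad.gr z"
proof (intro subset_antisym subsetI)
 fix x assume x: "x : W z"
 obtain Z g where Z: "finite Z" "ALL z:Z. g z : ad.gr z" "x = (SUM z:Z. g z)" using ad.D_decomp[of x] D_UNIV by blast
 define g' where "g' y = (if y : Z then g y else 0) - (if y = z then x else 0)" for y
 have "(SUM y:insert z Z. g' y) = (SUM y:insert z Z. if y : Z then g y else 0) - x" using Z(1) by (simp add: g'_def sum_subtractf)
 also have "(SUM y:insert z Z. if y : Z then g y else 0) = (SUM z:Z. g z)" using Z(1) by (intro sum.mono_neutral_cong_right) auto
 finally have "(SUM y:insert z Z. g' y) = 0" using Z(3) by simp
 moreover have "g' y : W y" if "y : insert z Z" for y proof -
  have "(if y : Z then g y else 0) : W y" using Z(2) cvec.subspace_0[OF subspace_W] by (auto simp: W_def ad.R_gr)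
  moreover have "(if y = z then x else 0) : W y" using x cvec.subspace_0[OF subspace_W] by auto
  ultimately show ?thesis unfolding g'_def by (rule cvec.subspace_diff[OF subspace_W])
 qed
 ultimately have "g' z = 0" using W_indep[of "insert z Z" g' z] Z(1) by blast
 then have "x = (if z : Z then g z else 0)" by (simp add: g'_def)
 then show "x : ad.gr z" using Z(2) cvec.subspace_0[OF ad.subspace_gr] by auto
qed (simp add: W_def ad.R_gr)

lemma W_decomp: "EX Z g. finite Z & (ALL z:Z. g z : W z) & x = (SUM z:Z. g z)" using ad.D_decomp[of x] D_UNIV by (simp add: W_eq_gr)

lemma W_br: "x : W z ==> y : W z' ==> br x y : W (z + z')"
 by (simp add: W_def jacobi[of "ch _" x y] br_simps ad.wt_add scaleC_add_left)

lemma W_0: "W 0 = range ch" by (simp add: W_eq_gr ad.gr_def)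

lemma W_mixed: "0 < z i ==> z j < 0 ==> W z = {0}" using W_eq_gr[of z] by (auto simp: ad.gr_def not_le[symmetric])

abbreviation "up n \<equiv> (%j. int (n j))"
abbreviation "dn n \<equiv> (%j. - int (n j))"

lemma W_up: "n ~= 0 ==> W (up n) = ad.PS n" by (simp add: W_eq_gr ad.gr_PS)
lemma W_dn: "n ~= 0 ==> W (dn n) = ad.QS n" by (simp add: W_eq_gr ad.gr_QS)

lemma e_W: "e i : W (up (uvec i))" and f_W: "f i : W (dn (uvec i))"
 by (simp_all add: W_up W_dn ad.PS_unit ad.QS_unit cvec.span_base)

lemma W_up_unit: "x : W (up (uvec i)) ==> EX k. x = k *. e i" by (auto simp: W_up ad.PS_unit cvec.span_singleton)
lemma W_dn_unit: "x : W (dn (uvec i)) ==> EX k. x = k *. f i" by (auto simp: W_dn ad.QS_unit cvec.span_singleton)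

lemma cr_neq_0: "cr i ~= 0" using cr_ind(2) cvec.dependent_zero by (metis rangeI)

lemma e_neq_0: "e i ~= 0" and f_neq_0: "f i ~= 0"
proof -
 have "ch (cr i) ~= 0" using cr_neq_0 ch_inj clinear_0[OF ch_lin] by (metis injD)
 then have "br (e i) (f i) ~= 0" by (simp add: e_f)
 then show "e i ~= 0" "f i ~= 0" by (auto simp: br_simps)
qed

text \<open>The pairs \<open>(x, t z x)\<close> with \<open>x\<close> in \<open>W z\<close> span a
  graph because the root spaces are independent.\<close>

lemma glue:
 fixes t :: "('i => int) => 'g => 'x::complex_vector"
 assumes t: "!!z. clinear (t z)"
 obtains \<tau> where "clinear \<tau>" "!!z x. x : W z ==> \<tau> x = t z x"
proof -
 define S where "S z = (%x. (x, t z x)) ` W z" for z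
 have lin: "clinear (%x. (x, t z x))" for z by (rule clinearI) (simp_all add: clinear_simps[OF t])
 have S: "cvec.subspace (S z)" for z unfolding S_def by (rule cpair.linear_subspace_image[OF lin subspace_W])
 have inj: "y = 0" if y: "(0, y) : cvec.span (\<Union>z\<in>UNIV. S z)" for y proof -
  obtain Z g where Z: "finite Z" "ALL z:Z. g z : S z" "(0, y) = (SUM z:Z. g z)" using span_UN_decomp[OF S y] by blast
  have g: "fst (g z) : W z" "snd (g z) = t z (fst (g z))" if "z : Z" for z using Z(2) that unfolding S_def by auto
  have z0: "(SUM z:Z. fst (g z)) = 0" unfolding fst_sum[symmetric] Z(3)[symmetric] by simp
  have "fst (g z) = 0" if "z : Z" for z by (rule W_indep[OF Z(1) g(1) z0 that])
  then have s0: "snd (g z) = 0" if "z : Z" for z using g(2)[OF that] that by (simp add: clinear_0[OF t])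
  have "y = snd (0 :: 'g, y)" by simp
  also have "... = (SUM z:Z. snd (g z))" unfolding Z(3) snd_sum ..
  finally show "y = 0" using s0 by simp
 qed
 obtain \<tau> where "clinear \<tau>" "!!x y. (x, y) : cvec.span (\<Union>z\<in>UNIV. S z) ==> y = \<tau> x"
  using graph_clinear[OF cvec.subspace_span inj] by blast
 moreover have "(x, t z x) : cvec.span (\<Union>z\<in>UNIV. S z)" if "x : W z" for z x
  using that by (intro cvec.span_base) (auto simp: S_def)
 ultimately show ?thesis using that by metis
qed

lemma eq_on_W:
 assumes "clinear \<phi>" "clinear \<psi>" "!!z y. y : W z ==> \<phi> y = \<psi> y"
 shows "\<phi> y = \<psi> y"
proof -
 obtain Z g where Z: "finite Z" "ALL z:Z. g z : W z" "y = (SUM z:Z. g z)" using W_decomp[of y] by blast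
 have "(SUM z:Z. \<phi> (g z)) = (SUM z:Z. \<psi> (g z))" by (rule sum.cong) (use Z(2) assms(3) in auto)
 then show ?thesis unfolding Z(3) clinear_sum[OF assms(1)] clinear_sum[OF assms(2)] .
qed

lemma finite_dim_W:
 assumes n: "n ~= 0"
 shows "EX B. finite B & W (up n) \<subseteq> cvec.span B"
proof -
 have "{w. cnt w = n} \<subseteq> {w. set w \<subseteq> UNIV & length w = height n}" by (auto simp: height_cnt)
 then have "finite {w :: 'i list. cnt w = n}" by (rule finite_subset) (rule finite_lists_length_eq, simp)
 then have "finite {wrd (%i. br (e i)) e w |w. w ~= [] & cnt w = n}" by simp
 then show ?thesis using n by (auto simp: W_up ad.PS_def)
qed

definition pr :: "('i => int) => 'i => int" where "pr z i = (SUM j:UNIV. z j * A i j)"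

lemma pr_add: "pr (z + z') i = pr z i + pr z' i" by (simp add: pr_def algebra_simps sum.distrib)
lemma pr_uminus: "pr (- z) i = - pr z i" by (simp add: pr_def sum_negf)
lemma pr_unit: "pr (up (uvec j)) i = A i j"
proof -
 have "pr (up (uvec j)) i = (SUM k:UNIV. if k = j then A i k else 0)"
  unfolding pr_def by (rule sum.cong) (auto simp: uvec_def)
 then show ?thesis by simp
qed

lemma wt_cr: "wt z (cr i) = of_int (pr z i)" by (simp add: ad.wt_def pr_def sr_cr)

end

locale km = km0 A sr cr br ch e f for A :: "'i::finite => 'i => int" and sr :: "'i => 'h::complex_vector => complex" and cr
  and br :: "'g::complex_vector => 'g => 'g" and ch e f +
 fixes d :: "'i => real"
 assumes d_pos: "!!i. 0 < d i" and d_sym: "!!i j. d i * A i j = d j * A j i"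
begin

lemma swap: "km A sr cr br (%h. - ch h) f e d" by (intro km.intro swap0 km_axioms.intro d_pos d_sym)

abbreviation "dc i \<equiv> complex_of_real (d i)"

lemma co_exists: "EX co. (ALL i. clinear (co i)) & (ALL i j. co i (cr j) = (if i = j then 1 else 0 :: complex))"
proof -
 define co where "co i = cpair.construct (range cr) (%v. if v = cr i then 1 else 0 :: complex)" for i
 have "clinear (co i)" for i unfolding co_def by (rule cpair.linear_construct[OF cr_ind(2)])
 moreover have "co i (cr j) = (if i = j then 1 else 0)" for i j
  unfolding co_def by (subst cpair.construct_basis[OF cr_ind(2)]) (auto simp: inj_eq[OF cr_ind(1)])
 ultimately show ?thesis by blast
qed

text \<open>A symmetric form on the Cartan subalgebra is only needed up to its values on the coroots.\<close>

lemma cartan_form_exists: "\<exists>H :: 'h => 'h => complex. cbilinear H \<and>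
  (ALL h i. H h (cr i) = sr i h / dc i) & (ALL h i. H (cr i) h = sr i h / dc i)"
proof -
 obtain co :: "'i => 'h => complex" where co: "!!i. clinear (co i)" "!!i j. co i (cr j) = (if i = j then 1 else 0)"
  using co_exists by blast
 \<comment> \<open>The \<open>co i\<close> are coordinates dual to the coroots. If one argument is a
   coroot, the first sum is the wanted value plus a term that the double sum cancels.\<close>
 define H where "H h k = (SUM i:UNIV. (co i h * sr i k + co i k * sr i h) / dc i)
   - (SUM i:UNIV. SUM j:UNIV. co i h * co j k * of_int (A i j) / dc j)" for h k
 have d0: "complex_of_real (d i) ~= 0" for i using d_pos[of i] by simp
 have sym: "of_int (A i j) / dc j = of_int (A j i) / dc i" for i j proof -
  have "complex_of_real (d i * of_int (A i j)) = complex_of_real (d j * of_int (A j i))" by (simp add: d_sym)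
  then show ?thesis using d0 by (simp add: field_simps)
 qed
 have "cbilinear H" by (rule cbilinearI) (simp_all add: H_def clinear_add[OF co(1)] clinear_scale[OF co(1)] clinear_add[OF sr_lin]
    clinear_scale[OF sr_lin] algebra_simps add_divide_distrib sum.distrib sum_distrib_left)
 moreover have "H h (cr j) = sr j h / dc j" for h j proof -
  have "(SUM i:UNIV. (co i h * sr i (cr j) + co i (cr j) * sr i h) / dc i) =
   (SUM i:UNIV. co i h * of_int (A j i) / dc i) + (SUM i:UNIV. if i = j then sr i h / dc i else 0)"
   unfolding sum.distrib[symmetric] by (rule sum.cong) (auto simp: sr_cr co add_divide_distrib)
  moreover have "(SUM i:UNIV. SUM k:UNIV. co i h * co k (cr j) * of_int (A i k) / dc k) =
   (SUM i:UNIV. co i h * of_int (A j i) / dc i)" proof (rule sum.cong[OF refl])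
   fix i
   have "(SUM k:UNIV. co i h * co k (cr j) * of_int (A i k) / dc k) =
    (SUM k:UNIV. if k = j then co i h * (of_int (A i k) / dc k) else 0)" by (rule sum.cong) (auto simp: co)
   then show "(SUM k:UNIV. co i h * co k (cr j) * of_int (A i k) / dc k) = co i h * of_int (A j i) / dc i"
    using sym[of i j] by (simp add: times_divide_eq_right[symmetric] mult.assoc del: times_divide_eq_right)
  qed
  ultimately show ?thesis by (simp add: H_def)
 qed
 moreover have "H (cr j) h = sr j h / dc j" for h j proof -
  have "(SUM i:UNIV. (co i (cr j) * sr i h + co i h * sr i (cr j)) / dc i) =
   (SUM i:UNIV. co i h * of_int (A j i) / dc i) + (SUM i:UNIV. if i = j then sr i h / dc i else 0)"
   unfolding sum.distrib[symmetric] by (rule sum.cong) (auto simp: sr_cr co add_divide_distrib)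
  moreover have "(SUM i:UNIV. SUM k:UNIV. co i (cr j) * co k h * of_int (A i k) / dc k) =
   (SUM k:UNIV. co k h * of_int (A j k) / dc k)" proof -
   have "(SUM i:UNIV. SUM k:UNIV. co i (cr j) * co k h * of_int (A i k) / dc k) =
    (SUM i:UNIV. if i = j then SUM k:UNIV. co k h * of_int (A j k) / dc k else 0)" by (rule sum.cong) (auto simp: co)
   then show ?thesis by simp
  qed
  ultimately show ?thesis by (simp add: H_def)
 qed
 ultimately show ?thesis by blast
qed

end

section \<open>The invariant form\<close>

context km
begin

definition coad :: "'g => ('g, complex) clin => ('g, complex) clin" where "coad = hom_act br (%_ _. 0)"

lemma trivial_module: "lie_module br (%_ _. 0)" unfolding lie_module_def by (auto intro!: cbilinearI)

lemma coad_module: "lie_module br coad" unfolding coad_def by (rule lie_module_hom_act[OF ad_module trivial_module])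

lemma app_coad: "app (coad x \<phi>) y = - app \<phi> (br x y)"
 unfolding coad_def using app_hom_act[OF ad_module trivial_module] by simp

lemmas coad_simps = cbilinear_simps[OF lie_module_bilinear[OF coad_module]]

lemma clin_eq_on_W: "(!!z y. y : W z ==> app \<phi> y = app \<psi> y) ==> \<phi> = \<psi>"
 by (rule clin_eqI) (rule eq_on_W[OF clinear_app clinear_app])

lemma glue_functional:
 assumes "!!z. clinear (t z)"
 shows "\<exists>\<phi> :: ('g, complex) clin. ALL z. ALL y:W z. app \<phi> y = t z y"
proof -
 obtain \<tau> where "clinear \<tau>" "!!z x. x : W z ==> \<tau> x = t z x" using glue[of t] assms by blast
 then have "ALL z. ALL y:W z. app (Clin \<tau>) y = t z y" by simp
 then show ?thesis by blast
qed

lemma line_functional: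
 assumes "v ~= 0" and "v : W z0"
 shows "\<exists>\<phi> :: ('g, complex) clin. app \<phi> v = k & (ALL z. z ~= z0 --> (ALL y:W z. app \<phi> y = 0))"
proof -
 obtain l :: "'g => complex" where l: "clinear l" "l v = k" using functional_exists[OF assms(1)] by blast
 have "clinear (if z = z0 then l else (%_. 0))" for z using l by (auto intro: clinearI)
 from glue_functional[of "%z. if z = z0 then l else (%_. 0)", OF this]
 obtain \<phi> :: "('g, complex) clin" where "!!z y. y : W z ==> app \<phi> y = (if z = z0 then l else (%_. 0)) y" by blast
 then show ?thesis using assms(2) l(2) by (intro exI[of _ \<phi>]) auto
qed

lemma W_shift: "y : W z ==> br (e i) y : W (up (uvec i) + z)" "y : W z ==> br (f i) y : W (dn (uvec i) + z)"
 using W_br[OF e_W] W_br[OF f_W] by blast+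

lemma up_dn_0: "up (uvec i) + z = 0 \<longleftrightarrow> z = dn (uvec i)" "dn (uvec i) + z = 0 \<longleftrightarrow> z = up (uvec i)"
 by (auto simp: fun_eq_iff add_eq_0_iff)

lemma W_root_diff: "i ~= j ==> up (uvec i) + z = up (uvec j) ==> W z = {0}"
 "i ~= j ==> dn (uvec i) + z = dn (uvec j) ==> W z = {0}"
proof -
 assume ij: "i ~= j"
 show "up (uvec i) + z = up (uvec j) ==> W z = {0}" proof (rule W_mixed)
  assume a: "up (uvec i) + z = up (uvec j)"
  show "0 < z j" using fun_cong[OF a, of j] ij by (simp add: uvec_def)
  show "z i < 0" using fun_cong[OF a, of i] ij by (simp add: uvec_def)
 qed
 show "dn (uvec i) + z = dn (uvec j) ==> W z = {0}" proof (rule W_mixed)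
  assume a: "dn (uvec i) + z = dn (uvec j)"
  show "0 < z i" using fun_cong[OF a, of i] ij by (simp add: uvec_def)
  show "z j < 0" using fun_cong[OF a, of j] ij by (simp add: uvec_def)
 qed
qed

lemma W_zero_cases: "y : W 0 ==> EX k. y = ch k" by (auto simp: W_0)

text \<open>The form is the graph of an equivariant map to the dual: the submodule \<open>\<Gamma>\<close> of \<open>\<gg> \<oplus> \<gg>\<^sup>*\<close>
 generated by the pairs of Chevalley generators and the functionals they should represent meets
 \<open>0 \<oplus> \<gg>\<^sup>*\<close> in \<open>0\<close>, because the functionals in that intersection kill the ideal generated by the
 Cartan subalgebra, which is everything.\<close>

lemma invariant_form_exists: "\<exists>B :: 'g => 'g => complex. cbilinear B & (ALL z x y. B (br z x) y = - B x (br z y)) \<and>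
  (ALL i. B (e i) (f i) = 1 / dc i) & (ALL i. B (f i) (e i) = 1 / dc i) \<and> (ALL h i. B (ch h) (ch (cr i)) = sr i h / dc i)"
proof -
 obtain H :: "'h => 'h => complex" where H: "cbilinear H" "!!h i. H h (cr i) = sr i h / dc i" "!!h i. H (cr i) h = sr i h / dc i"
  using cartan_form_exists by blast
 note Hs = cbilinear_simps[OF H(1)]
 \<comment> \<open>\<open>ea i\<close> is the functional that \<open>e i\<close> has to represent:
   it lives on the root space of \<open>f i\<close>, and the value \<open>1 / dc i\<close> is the
   one compatible with the form on the Cartan subalgebra. \<open>fb\<close> and \<open>hb'\<close>
   do the same for \<open>f\<close> and \<open>ch\<close>.\<close>
 have "ALL i. \<exists>\<phi> :: ('g, complex) clin. app \<phi> (f i) = 1 / dc i \<and>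
   (ALL z. z ~= dn (uvec i) --> (ALL y:W z. app \<phi> y = 0))" using line_functional[OF f_neq_0 f_W] by blast
 then obtain ea :: "'i => ('g, complex) clin" where ea: "!!i. app (ea i) (f i) = 1 / dc i"
  "!!i z y. z ~= dn (uvec i) ==> y : W z ==> app (ea i) y = 0" by metis
 have "ALL i. \<exists>\<phi> :: ('g, complex) clin. app \<phi> (e i) = 1 / dc i \<and>
   (ALL z. z ~= up (uvec i) --> (ALL y:W z. app \<phi> y = 0))" using line_functional[OF e_neq_0 e_W] by blast
 then obtain fb :: "'i => ('g, complex) clin" where fb: "!!i. app (fb i) (e i) = 1 / dc i"
  "!!i z y. z ~= up (uvec i) ==> y : W z ==> app (fb i) y = 0" by metis
 obtain p where p: "clinear p" "p \<circ> ch = id" using cpair.linear_injective_left_inverse[OF ch_lin ch_inj] by blast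
 have p_ch: "p (ch k) = k" for k using p(2) by (metis comp_apply id_apply)
 have "ALL h. \<exists>\<phi> :: ('g, complex) clin. ALL z. ALL y:W z. app \<phi> y = (if z = 0 then %y. H h (p y) else (%_. 0)) y"
 proof
  fix h
  have "clinear (if z = 0 then %y. H h (p y) else (%_. 0))" for z :: "'i => int"
   using clinear_compose[OF cbilinear_right[OF H(1)] p(1)] by (auto intro: clinearI)
  from glue_functional[OF this]
  show "\<exists>\<phi> :: ('g, complex) clin. ALL z. ALL y:W z. app \<phi> y = (if z = 0 then %y. H h (p y) else (%_. 0)) y" .
 qed
 then obtain hb' :: "'h => ('g, complex) clin"
  where hb': "!!h z y. y : W z ==> app (hb' h) y = (if z = 0 then %y. H h (p y) else (%_. 0)) y" by metis
 have hb: "app (hb' h) (ch k) = H h k" for h k using hb'[of "ch k" 0 h] by (simp add: W_0 p_ch)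
 have hb0: "y : W z ==> z ~= 0 ==> app (hb' h) y = 0" for h y z using hb'[of y z h] by simp
 have hb_lin: "clinear hb'" by (rule clinearI; rule clin_eq_on_W) (simp_all add: hb' Hs)
 let ?P = "pair_act br coad"
 have Pm: "lie_module br ?P" by (rule lie_module_pair_act[OF ad_module coad_module])
 \<comment> \<open>\<open>r1\<close> to \<open>r7\<close> are the relations of the locale
   \<open>adj\<close> in the second component of the pairs, each checked on one root space at a
   time.\<close>
 have r1: "coad (e i) (hb' h) = - (sr i h *. ea i)" for i h proof (rule clin_eq_on_W)
  fix z y assume y: "y : W z"
  show "app (coad (e i) (hb' h)) y = app (- (sr i h *. ea i)) y" proof (cases "z = dn (uvec i)")
   case True
   then obtain k where "y = k *. f i" using W_dn_unit y by blast
   then show ?thesis by (simp add: app_coad br_simps e_f app_simps hb H ea)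
  next case False
   then show ?thesis using hb0[OF W_shift(1)[OF y]] ea(2)[OF _ y] by (simp add: app_coad up_dn_0)
  qed
 qed
 have r2: "coad (f i) (hb' h) = sr i h *. fb i" for i h proof (rule clin_eq_on_W)
  fix z y assume y: "y : W z"
  show "app (coad (f i) (hb' h)) y = app (sr i h *. fb i) y" proof (cases "z = up (uvec i)")
   case True
   then obtain k where "y = k *. e i" using W_up_unit y by blast
   then show ?thesis by (simp add: app_coad br_simps f_e app_simps hb H fb)
  next case False
   then show ?thesis using hb0[OF W_shift(2)[OF y]] fb(2)[OF _ y] by (simp add: app_coad up_dn_0)
  qed
 qed
 have r3: "coad (e i) (fb j) = (if i = j then hb' (cr i) else 0)" for i j proof (rule clin_eq_on_W)
  fix z y assume y: "y : W z"
  show "app (coad (e i) (fb j)) y = app (if i = j then hb' (cr i) else 0) y" proof (cases "up (uvec i) + z = up (uvec j)")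
   case True
   show ?thesis proof (cases "i = j")
    case True
    with \<open>up (uvec i) + z = up (uvec j)\<close> have "z = 0" by simp
    then obtain k where "y = ch k" using y W_zero_cases by blast
    then show ?thesis using True by (simp add: app_coad e_h app_simps hb H fb)
   next case False
    then have "y = 0" using W_root_diff(1) True y by blast
    then show ?thesis by (simp add: app_simps)
   qed
  next case False
   then have "app (coad (e i) (fb j)) y = 0" using fb(2)[OF _ W_shift(1)[OF y]] by (simp add: app_coad)
   moreover have "app (hb' (cr i)) y = 0" if "i = j" using hb0[OF y] False that by auto
   ultimately show ?thesis by simp
  qed
 qed
 have r4: "coad (f i) (ea j) = - (if i = j then hb' (cr i) else 0)" for i j proof (rule clin_eq_on_W)
  fix z y assume y: "y : W z"
  show "app (coad (f i) (ea j)) y = app (- (if i = j then hb' (cr i) else 0)) y"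
  proof (cases "dn (uvec i) + z = dn (uvec j)")
   case True
   show ?thesis proof (cases "i = j")
    case True
    with \<open>dn (uvec i) + z = dn (uvec j)\<close> have "z = 0" by simp
    then obtain k where "y = ch k" using y W_zero_cases by blast
    then show ?thesis using True by (simp add: app_coad f_h app_simps hb H ea)
   next case False
    then have "y = 0" using W_root_diff(2) True y by blast
    then show ?thesis by (simp add: app_simps)
   qed
  next case False
   then have "app (coad (f i) (ea j)) y = 0" using ea(2)[OF _ W_shift(2)[OF y]] by (simp add: app_coad)
   moreover have "app (hb' (cr i)) y = 0" if "i = j" using hb0[OF y] False that by auto
   ultimately show ?thesis by simp
  qed
 qed
 have r5: "coad (ch h) (ea i) = sr i h *. ea i" for h i proof (rule clin_eq_on_W)
  fix z y assume y: "y : W z"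
  show "app (coad (ch h) (ea i)) y = app (sr i h *. ea i) y" proof (cases "z = dn (uvec i)")
   case True
   then obtain k where "y = k *. f i" using W_dn_unit y by blast
   then show ?thesis by (simp add: app_coad br_simps h_f app_simps)
  next case False
   have "br (ch h) y = wt z h *. y" using y by (simp add: W_def)
   then show ?thesis using ea(2)[OF False y] by (simp add: app_coad app_simps)
  qed
 qed
 have r6: "coad (ch h) (fb i) = - (sr i h *. fb i)" for h i proof (rule clin_eq_on_W)
  fix z y assume y: "y : W z"
  show "app (coad (ch h) (fb i)) y = app (- (sr i h *. fb i)) y" proof (cases "z = up (uvec i)")
   case True
   then obtain k where "y = k *. e i" using W_up_unit y by blast
   then show ?thesis by (simp add: app_coad br_simps h_e app_simps)
  next case False
   have "br (ch h) y = wt z h *. y" using y by (simp add: W_def)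
   then show ?thesis using fb(2)[OF False y] by (simp add: app_coad app_simps)
  qed
 qed
 have r7: "coad (ch h) (hb' h') = 0" for h h' proof (rule clin_eq_on_W)
  fix z y assume y: "y : W z"
  have "br (ch h) y = wt z h *. y" using y by (simp add: W_def)
  then show "app (coad (ch h) (hb' h')) y = app 0 y" using hb0[OF y, of h'] by (cases "z = 0") (simp_all add: app_coad app_simps)
 qed
 interpret pa: adj sr cr "%i. ?P (e i)" "%i. ?P (f i)" "%h. ?P (ch h)" "%i. (e i, ea i)" "%i. (f i, fb i)" "%h. (ch h, hb' h)"
 proof (rule adj.intro)
  show "clinear (%h. (ch h, hb' h))" by (rule clinearI) (simp_all add: clinear_add[OF ch_lin] clinear_add[OF hb_lin]
     clinear_scale[OF ch_lin] clinear_scale[OF hb_lin])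
 qed (simp_all add: lie_module_linear[OF Pm] module_gen[OF Pm],
   simp_all add: pair_act_def e_f f_e h_e h_f e_h f_h ch_ch r1 r2 r3 r4 r5 r6 r7 zero_prod_def)
 have Dsub: "p : pa.D ==> ?P x p : pa.D" for x p by (rule submodule_gen[OF Pm pa.subspace_D pa.D_P pa.D_Q pa.D_R])
 define I where "I = {\<phi>. (0, \<phi>) : pa.D}"
 have I_coad: "coad x \<phi> : I" if "\<phi> : I" for x \<phi>
  using Dsub[of "(0, \<phi>)" x] that by (simp add: I_def pair_act_def br_simps)
 \<comment> \<open>Split \<open>(0, \<phi>)\<close> into weight pieces. Their first components
   vanish; the piece of degree 0 is some \<open>(ch h, hb' h)\<close> and so has
   \<open>h = 0\<close>; a functional of nonzero weight kills the Cartan subalgebra.\<close>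
 have I_ch: "app \<phi> (ch k) = 0" if \<phi>: "\<phi> : I" for \<phi> k proof -
  obtain Z g where Z: "finite Z" "ALL z:Z. g z : pa.gr z" "(0, \<phi>) = (SUM z:Z. g z)"
   using pa.D_decomp[OF \<phi>[unfolded I_def mem_Collect_eq]] by (elim exE conjE)
  have R: "?P (ch h) (g z) = wt z h *. g z" if "z : Z" for z h using pa.R_gr Z(2) that by blast
  have g1: "fst (g z) : W z" if "z : Z" for z using arg_cong[OF R[OF that], of fst] by (simp add: W_def pair_act_def)
  have z0: "(SUM z:Z. fst (g z)) = 0" unfolding fst_sum[symmetric] Z(3)[symmetric] by simp
  have f0: "fst (g z) = 0" if "z : Z" for z by (rule W_indep[OF Z(1) g1 z0 that])
  have s0: "app (snd (g z)) (ch k) = 0" if z: "z : Z" for z proof (cases "z = 0")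
   case True
   then have "pa.gr z = range (%h. (ch h, hb' h))" by (simp add: pa.gr_def)
   then obtain h where h: "g z = (ch h, hb' h)" using Z(2) z by blast
   then have "ch h = ch 0" using f0[OF z] by (simp add: clinear_0[OF ch_lin])
   then have "h = 0" using ch_inj by (simp add: inj_eq)
   then show ?thesis using h by (simp add: clinear_0[OF hb_lin])
  next case False
   then obtain h where h: "wt z h ~= 0" using wt_neq_0 by blast
   have "app (coad (ch h) (snd (g z))) (ch k) = app (wt z h *. snd (g z)) (ch k)"
    using arg_cong[OF R[OF z, of h], of snd] by (simp add: pair_act_def)
   then show ?thesis using h by (simp add: app_coad ch_ch app_simps)
  qed
  have "\<phi> = snd (0 :: 'g, \<phi>)" by simp
  also have "... = (SUM z:Z. snd (g z))" unfolding Z(3) snd_sum ..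
  finally show ?thesis using s0 by simp
 qed
 \<comment> \<open>The common zeros of \<open>I\<close> form an ideal containing the Cartan
   subalgebra, and with it \<open>e i\<close> and \<open>f i\<close>, which are multiples of their
   brackets with \<open>ch (cr i)\<close>.\<close>
 define N where "N = {y. \<forall>\<phi>\<in>I. app \<phi> y = 0}"
 have N_sub: "cvec.subspace N" by (rule cvec.subspaceI) (auto simp: N_def app_simps)
 have N_br: "br x y : N" if "y : N" for x y proof -
  have "app \<phi> (br x y) = 0" if "\<phi> : I" for \<phi> proof -
   have "app (coad x \<phi>) y = 0" using I_coad[OF that, of x] \<open>y \<in> N\<close> by (simp add: N_def)
   then show ?thesis by (simp add: app_coad)
  qed
  then show ?thesis by (simp add: N_def)
 qed
 have N_ch: "ch k : N" for k using I_ch by (simp add: N_def)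
 have "e i : N" "f i : N" for i proof -
  have "br (e i) (ch (cr i)) : N" "br (f i) (ch (cr i)) : N" using N_br N_ch by blast+
  then have "(- 2) *. e i : N" "2 *. f i : N" by (simp_all add: e_h f_h sr_cr A_diag)
  then have "(- 1/2) *. (- 2) *. e i : N" "(1/2) *. 2 *. f i : N" by - (rule cvec.subspace_scale[OF N_sub], assumption)+
  then show "e i : N" "f i : N" by (simp_all add: scaleC_scaleC scaleC_one)
 qed
 then have N_UNIV: "x : N" for x by (induction x rule: gen_induct)
   (auto simp: N_ch N_br cvec.subspace_add[OF N_sub] cvec.subspace_scale[OF N_sub])
 have inj: "\<phi> = 0" if "(0, \<phi>) : pa.D" for \<phi>
  by (rule clin_eqI) (use N_UNIV that in \<open>auto simp: N_def I_def\<close>)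
 obtain \<tau> where \<tau>: "clinear \<tau>" "!!x y. (x, y) : pa.D ==> y = \<tau> x"
  using graph_clinear[OF pa.subspace_D inj] by blast
 have ex: "\<exists>\<phi>. (x, \<phi>) : pa.D" for x proof (induction x rule: gen_induct)
  case (h h) then show ?case using pa.D_base(1) by blast
 next case (e i)
  then show ?case using pa.a_in_D by blast
 next case (f i)
  then show ?case using pa.b_in_D by blast
 next case (add x y)
  then obtain \<phi> \<psi> where "(x, \<phi>) : pa.D" "(y, \<psi>) : pa.D" by blast
  from cvec.subspace_add[OF pa.subspace_D this] show ?case unfolding plus_prod_def fst_conv snd_conv by (rule exI)
 next case (scale c x)
  then obtain \<phi> where "(x, \<phi>) : pa.D" by blast
  from cvec.subspace_scale[OF pa.subspace_D this, of c] show ?case unfolding scaleC_Pair by (rule exI)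
 next case (br x y)
  then obtain \<psi> where "(y, \<psi>) : pa.D" by blast
  from Dsub[OF this, of x] have "(br x y, coad x \<psi>) : pa.D" by (simp only: pair_act_def fst_conv snd_conv)
  then show ?case by (rule exI)
 qed
 have \<tau>D: "(x, \<tau> x) : pa.D" for x proof -
  obtain \<phi> where "(x, \<phi>) : pa.D" using ex[of x] by blast
  with \<tau>(2)[OF this] show ?thesis by (simp only:)
 qed
 have \<tau>_coad: "\<tau> (br z x) = coad z (\<tau> x)" for z x proof -
  have "?P z (x, \<tau> x) = (br z x, coad z (\<tau> x))" by (simp only: pair_act_def fst_conv snd_conv)
  then have "(br z x, coad z (\<tau> x)) : pa.D" using Dsub[OF \<tau>D, of z x] by (simp only:)
  from \<tau>(2)[OF this] show ?thesis by (rule sym)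
 qed
 define B where "B x y = app (\<tau> x) y" for x y
 have "cbilinear B" by (rule cbilinearI) (simp_all add: B_def clinear_add[OF \<tau>(1)] clinear_scale[OF \<tau>(1)] app_simps)
 moreover have "B (br z x) y = - B x (br z y)" for z x y by (simp add: B_def \<tau>_coad app_coad)
 moreover have "B (e i) (f i) = 1 / dc i" for i unfolding B_def using \<tau>(2)[OF pa.a_in_D[of i]] ea(1)[of i] by simp
 moreover have "B (f i) (e i) = 1 / dc i" for i unfolding B_def using \<tau>(2)[OF pa.b_in_D[of i]] fb(1)[of i] by simp
 moreover have "B (ch h) (ch (cr i)) = sr i h / dc i" for h i
  unfolding B_def \<tau>(2)[OF pa.D_base(1)[of h], symmetric] by (simp add: hb H(2))
 ultimately show ?thesis by blast
qed

definition form :: "'g => 'g => complex" where "form = (SOME B. cbilinear B & (ALL z x y. B (br z x) y = - B x (br z y)) \<and>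
  (ALL i. B (e i) (f i) = 1 / dc i) & (ALL i. B (f i) (e i) = 1 / dc i) \<and> (ALL h i. B (ch h) (ch (cr i)) = sr i h / dc i))"

lemma form_bilinear: "cbilinear form" and form_inv: "form (br z x) y = - form x (br z y)"
 and form_e_f: "form (e i) (f i) = 1 / dc i" and form_f_e: "form (f i) (e i) = 1 / dc i"
 and form_ch: "form (ch h) (ch (cr i)) = sr i h / dc i" using someI_ex[OF invariant_form_exists, folded form_def] by blast+

lemmas form_simps = cbilinear_simps[OF form_bilinear]

lemma form_orth: "x : W z ==> y : W z' ==> z + z' ~= 0 ==> form x y = 0"
proof -
 assume x: "x : W z" and y: "y : W z'" and "z + z' ~= 0"
 then obtain h where h: "wt (z + z') h ~= 0" using wt_neq_0 by blast
 have "form (br (ch h) x) y = - form x (br (ch h) y)" by (rule form_inv)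
 then have "wt (z + z') h * form x y = 0" using x y by (simp add: W_def form_simps ad.wt_add distrib_right)
 then show ?thesis using h by simp
qed

text \<open>Such a family spans an ideal, and by independence of the root spaces this ideal meets
  the Cartan subalgebra only in its part of degree 0. The defining property of the algebra excludes
  it.\<close>

lemma no_graded_ideal:
 assumes N: "!!z. cvec.subspace (N z)" "!!z. N z \<subseteq> W z" "N 0 = {0}"
  and "!!z i x. x : N z ==> br (e i) x : N (up (uvec i) + z)" and "!!z i x. x : N z ==> br (f i) x : N (dn (uvec i) + z)"
 shows "N z = {0}"
proof -
 define I where "I = cvec.span (\<Union>z. N z)"
 have sub: "cvec.subspace I" by (simp add: I_def)
 have base: "x : N z ==> x : I" for x z unfolding I_def by (rule cvec.span_base) blast
 have stab: "T y : I" if "clinear T" "!!z x. x : N z ==> T x : I" "y : I" for T y proof -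
  have "I \<subseteq> {y. T y : I}" unfolding I_def by (rule cvec.span_minimal[OF _ subspace_preimage[OF that(1)]])
    (use that(2) in \<open>auto simp: I_def\<close>)
  then show ?thesis using that(3) by blast
 qed
 have "lie_ideal br I" proof (rule ideal_gen[OF sub])
  show "br (e i) y : I" if "y : I" for i y using stab[OF cbilinear_right[OF br_bilinear] _ that] assms(4) base by blast
  show "br (f i) y : I" if "y : I" for i y using stab[OF cbilinear_right[OF br_bilinear] _ that] assms(5) base by blast
  show "br (ch h) y : I" if "y : I" for h y proof (rule stab[OF cbilinear_right[OF br_bilinear] _ that])
   fix z x assume x: "x : N z"
   then have "br (ch h) x = wt z h *. x" using N(2) by (auto simp: W_def)
   then show "br (ch h) x : I" using base[OF x] cvec.subspace_scale[OF sub] by simp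
  qed
 qed
 moreover have "I \<inter> range ch = {0}" proof -
  have "x = 0" if "x : I" "x : range ch" for x proof -
   have x0: "x : W 0" using that by (simp add: W_0)
   obtain Z g where Z: "finite Z" "ALL z:Z. g z : N z" "x = (SUM z:Z. g z)"
    using span_UN_decomp[of N x UNIV, OF N(1)] \<open>x \<in> I\<close> unfolding I_def by blast
   have Z0: "x = (SUM z:Z - {0}. g z)" unfolding Z(3) by (rule sum.mono_neutral_right) (use Z N(3) in auto)
   define g' where "g' z = (if z = 0 then - x else g z)" for z
   have "(SUM z:insert 0 (Z - {0}). g' z) = g' 0 + (SUM z:Z - {0}. g' z)" using Z(1) by (intro sum.insert) auto
   also have "g' 0 = - x" by (simp add: g'_def)
   also have "(SUM z:Z - {0}. g' z) = (SUM z:Z - {0}. g z)" by (rule sum.cong) (auto simp: g'_def)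
   finally have "(SUM z:insert 0 (Z - {0}). g' z) = 0" by (simp only: Z0[symmetric] ab_left_minus)
   moreover have "g' z : W z" if "z : insert 0 (Z - {0})" for z
    using that Z(2) N(2) x0 cvec.subspace_neg[OF subspace_W] by (auto simp: g'_def)
   ultimately have "g' 0 = 0" using W_indep[of "insert 0 (Z - {0})" g' 0] Z(1) by blast
   then show "x = 0" by (simp add: g'_def)
  qed
  moreover have "0 : I \<inter> range ch" using cvec.subspace_0[OF sub] cvec.subspace_0[OF subspace_range[OF ch_lin]] by blast
  ultimately show ?thesis by blast
 qed
 ultimately have "I = {0}" by (rule no_ideal)
 then show ?thesis using base[of _ z] cvec.subspace_0[OF N(1)] by blast
qed

text \<open>The radical in nonzero degrees is a graded ideal. It could leak into degree 0 only from
  the degree of some \<open>f i\<close> or \<open>e i\<close>; there the root space is a line on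
  which \<open>b\<close> is nonzero, so the radical is already 0.\<close>

lemma nondegenerate:
 assumes b: "cbilinear b" "!!x y z. b (br z x) y = - b x (br z y)" "!!i. b (e i) (f i) ~= (0 :: complex)" "!!i. b (f i) (e i) ~= 0"
  and orth: "!!x y z z'. x : W z ==> y : W z' ==> z + z' ~= 0 ==> b x y = 0"
 shows "x : W z ==> z ~= 0 ==> (!!y. y : W (- z) ==> b x y = 0) ==> x = 0"
proof -
 note bs = cbilinear_simps[OF b(1)]
 assume x: "x : W z" and z: "z ~= 0" and 0: "!!y. y : W (- z) ==> b x y = 0"
 define N where "N z = (if z = 0 then {0} else {x : W z. ALL y. b x y = 0})" for z
 have xN: "x : N z" proof -
  have "b x y = 0" for y proof (rule eq_on_W[where \<psi> = "%_. 0"])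
   show "b x y = 0" if "y : W z'" for z' y proof (cases "z' = - z")
    case True then show ?thesis using 0 that by simp
   next case False
    then have "z + z' ~= 0" by (metis add.inverse_unique)
    then show ?thesis using orth x that by blast
   qed
  qed (auto intro: cbilinear_right[OF b(1)] clinearI)
  then show ?thesis using x z by (simp add: N_def)
 qed
 have "N z = {0}" proof (rule no_graded_ideal)
  show "cvec.subspace (N z)" for z unfolding N_def by (auto intro!: cvec.subspaceI cvec.subspace_single_0 simp: bs
     cvec.subspace_0[OF subspace_W] cvec.subspace_add[OF subspace_W] cvec.subspace_scale[OF subspace_W])
  show "N z \<subseteq> W z" for z using cvec.subspace_0[OF subspace_W] by (auto simp: N_def)
  show "N 0 = {0}" by (simp add: N_def)
  show "br (e i) x : N (up (uvec i) + z)" if "x : N z" for z i x proof (cases "up (uvec i) + z = 0")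
   case True
   then have z: "z = dn (uvec i)" by (simp add: up_dn_0)
   then have "z ~= 0" by (auto simp: fun_eq_iff uvec_def split: if_splits)
   then have x: "x : W z" "!!y. b x y = 0" using that by (auto simp: N_def)
   then obtain k where k: "x = k *. f i" using z W_dn_unit by blast
   then have "k = 0" using x(2)[of "e i"] b(4)[of i] by (simp add: bs)
   then show ?thesis using k by (simp add: br_simps N_def True)
  next case False
   have x: "x : W z" "!!y. b x y = 0" using that cvec.subspace_0[OF subspace_W] by (auto simp: N_def bs split: if_splits)
   then show ?thesis using False W_shift(1) by (simp add: N_def b(2))
  qed
  show "br (f i) x : N (dn (uvec i) + z)" if "x : N z" for z i x proof (cases "dn (uvec i) + z = 0")
   case True
   then have z: "z = up (uvec i)" by (simp add: up_dn_0)
   then have "z ~= 0" by (auto simp: fun_eq_iff uvec_def split: if_splits)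
   then have x: "x : W z" "!!y. b x y = 0" using that by (auto simp: N_def)
   then obtain k where k: "x = k *. e i" using z W_up_unit by blast
   then have "k = 0" using x(2)[of "f i"] b(3)[of i] by (simp add: bs)
   then show ?thesis using k by (simp add: br_simps N_def True)
  next case False
   have x: "x : W z" "!!y. b x y = 0" using that cvec.subspace_0[OF subspace_W] by (auto simp: N_def bs split: if_splits)
   then show ?thesis using False W_shift(2) by (simp add: N_def b(2))
  qed
 qed
 then show "x = 0" using xN by blast
qed

lemma form_nondeg_left: "x : W z ==> z ~= 0 ==> (!!y. y : W (- z) ==> form x y = 0) ==> x = 0"
 by (rule nondegenerate[OF form_bilinear form_inv _ _ form_orth]) (use d_pos in \<open>simp_all add: form_e_f form_f_e less_imp_neq[symmetric]\<close>)

lemma form_nondeg_right: "y : W z ==> z ~= 0 ==> (!!x. x : W (- z) ==> form x y = 0) ==> y = 0"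
proof (rule nondegenerate[where b = "%x y. form y x"])
 show "cbilinear (%x y. form y x)" by (rule cbilinearI) (simp_all add: form_simps)
 show "form y x = 0" if "x : W z" "y : W z'" "z + z' ~= 0" for x y z z'
  by (rule form_orth[OF that(2,1)]) (use that(3) in \<open>simp add: add.commute\<close>)
qed (use d_pos in \<open>simp_all add: form_inv form_e_f form_f_e less_imp_neq[symmetric]\<close>)

end

section \<open>Dual bases and the partial Casimir operator\<close>

lemma independent_sum_0:
 assumes "cvec.independent B" "finite B" "(SUM b:B. c b *. b) = (0::'a::complex_vector)" "b : B"
 shows "c b = 0" using cvec.independentD[OF assms(1,2) subset_refl assms(3,4)] .

lemma span_finite_sum:
 assumes "finite B" "x : cvec.span B"
 obtains c where "x = (SUM b:B. c b *. (b::'a::complex_vector))" using assms cvec.span_finite[OF assms(1)] by auto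

context km
begin

lemma up_neq_0: "n ~= 0 ==> up n ~= 0" "n ~= 0 ==> dn n ~= 0" by (auto simp: fun_eq_iff)

lemma neg_up: "- up n = dn n" "- dn n = up n" by (auto simp: fun_eq_iff)

text \<open>Nondegeneracy makes the functionals \<open>form b\<close> independent on the opposite
  root space, which is what \<open>dual_family\<close> asks for.\<close>

lemma dual_bases:
 assumes n: "n ~= 0"
 shows "EX B u. finite B & B \<subseteq> W (up n) & (ALL b:B. u b : W (dn n)) \<and>
  (ALL x:W (up n). (SUM b:B. form x (u b) *. b) = x) & (ALL y:W (dn n). (SUM b:B. form b y *. u b) = y)"
proof -
 obtain B where B: "B \<subseteq> W (up n)" "cvec.independent B" "W (up n) \<subseteq> cvec.span B"
  using basis_ex[of "W (up n)"] by blast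
 obtain T where T: "finite T" "W (up n) \<subseteq> cvec.span T" using finite_dim_W[OF n] by blast
 have fB: "finite B" using cvec.independent_span_bound[OF T(1) B(2)] B(1) T(2) by blast
 note fl = cbilinear_right[OF form_bilinear]
 have "ALL b:B. c b = 0" if c: "!!y. y : W (dn n) ==> (SUM b:B. c b * form b y) = 0" for c proof -
  have "(SUM b:B. c b *. b) = 0" proof (rule form_nondeg_left[OF _ up_neq_0(1)[OF n]])
   show "(SUM b:B. c b *. b) : W (up n)"
    by (rule cvec.subspace_sum[OF subspace_W], rule cvec.subspace_scale[OF subspace_W]) (use B(1) in blast)
   show "form (SUM b:B. c b *. b) y = 0" if "y : W (- up n)" for y using c[of y] that by (simp add: neg_up form_simps)
  qed
  then show ?thesis using independent_sum_0[OF B(2) fB] by blast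
 qed
 from dual_family[of B "W (dn n)" form, OF fB subspace_W fl this]
 obtain u where u: "!!b. b : B ==> u b : W (dn n)" "!!b b'. b : B ==> b' : B ==> form b' (u b) = (if b' = b then 1 else 0)" by blast
 have e1: "x = (SUM b:B. form x (u b) *. b)" if "x : W (up n)" for x proof -
  have "x : cvec.span B" using that B(3) by blast
  then obtain c where c: "x = (SUM b:B. c b *. b)" using span_finite_sum[OF fB] by blast
  have "form x (u b) = c b" if b: "b : B" for b proof -
   have "form x (u b) = (SUM b':B. c b' * form b' (u b))" by (simp add: c form_simps)
   also have "... = (SUM b':B. if b' = b then c b' else 0)" by (rule sum.cong) (auto simp: u b)
   finally show ?thesis using fB b by simp
  qed
  then have "(SUM b:B. form x (u b) *. b) = (SUM b:B. c b *. b)" by (intro sum.cong) auto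
  then show ?thesis using c by simp
 qed
 have e2: "y = (SUM b:B. form b y *. u b)" if y: "y : W (dn n)" for y proof -
  let ?y = "y - (SUM b:B. form b y *. u b)"
  have bz: "form b' ?y = 0" if b': "b' : B" for b' proof -
   have "(SUM b:B. form b y * form b' (u b)) = (SUM b:B. if b = b' then form b y else 0)" by (rule sum.cong) (auto simp: u b')
   then show ?thesis using fB b' by (simp add: form_simps)
  qed
  have "?y = 0" proof (rule form_nondeg_right[OF _ up_neq_0(2)[OF n]])
   show "?y : W (dn n)" by (rule cvec.subspace_diff[OF subspace_W y], rule cvec.subspace_sum[OF subspace_W],
      rule cvec.subspace_scale[OF subspace_W]) (use u in blast)
   show "form x ?y = 0" if "x : W (- dn n)" for x proof -
    have "x : W (up n)" using that by (simp add: neg_up)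
    from e1[OF this, symmetric] have xe: "(SUM b:B. form x (u b) *. b) = x" .
    have "form (SUM b:B. form x (u b) *. b) ?y = (SUM b:B. form x (u b) *. form b ?y)"
     by (simp only: cbilinear_sum1[OF form_bilinear] cbilinear_scale1[OF form_bilinear])
    also have "... = 0" by (intro sum.neutral ballI) (simp only: bz cvec.scale_zero_right)
    finally show ?thesis unfolding xe .
   qed
  qed
  then show ?thesis by simp
 qed
 show ?thesis
  by (intro exI[of _ B] exI[of _ u] conjI ballI) (fact fB, fact B(1), erule u(1), erule e1[symmetric], erule e2[symmetric])
qed

definition Bs :: "('i => nat) => 'g set" where
 "Bs n = (SOME B. EX u. finite B & B \<subseteq> W (up n) & (ALL b:B. u b : W (dn n)) \<and>
  (ALL x:W (up n). (SUM b:B. form x (u b) *. b) = x) & (ALL y:W (dn n). (SUM b:B. form b y *. u b) = y))"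
definition du :: "('i => nat) => 'g => 'g" where
 "du n = (SOME u. finite (Bs n) & Bs n \<subseteq> W (up n) & (ALL b:Bs n. u b : W (dn n)) \<and>
  (ALL x:W (up n). (SUM b:Bs n. form x (u b) *. b) = x) & (ALL y:W (dn n). (SUM b:Bs n. form b y *. u b) = y))"

lemma
 assumes "n ~= 0"
 shows finite_Bs: "finite (Bs n)" and Bs_W: "b : Bs n ==> b : W (up n)" and du_W: "b : Bs n ==> du n b : W (dn n)"
  and up_expand: "x : W (up n) ==> (SUM b:Bs n. form x (du n b) *. b) = x"
  and dn_expand: "y : W (dn n) ==> (SUM b:Bs n. form b y *. du n b) = y"
proof -
 note 1 = someI_ex[OF dual_bases[OF assms], folded Bs_def]
 note 2 = someI_ex[OF 1, folded du_def]
 from 2 show "finite (Bs n)" "b : Bs n ==> b : W (up n)" "b : Bs n ==> du n b : W (dn n)"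
  "x : W (up n) ==> (SUM b:Bs n. form x (du n b) *. b) = x" "y : W (dn n) ==> (SUM b:Bs n. form b y *. du n b) = y" by blast+
qed

text \<open>The positive root part of the Casimir element, with the two tensor factors fed into
  \<open>\<beta>\<close>. It is cut down to a finite set \<open>N\<close> of degrees, since only
  degrees up to the depth of a vector act on it while the full sum may be infinite.\<close>

definition CS :: "('i => nat) set => ('g => 'g => 'x::complex_vector) => 'x" where
 "CS N \<beta> = (\<Sum>\<alpha>\<in>N. SUM b:Bs \<alpha>. \<beta> (du \<alpha> b) b)"

lemma up_shift: "up (n + uvec i) + dn (uvec i) = up n" "up n + dn (n + uvec i) = dn (uvec i)"
 "dn (n + uvec i) = dn n + dn (uvec i)" "up (n + m) = up n + up m" "dn (n + m) = dn n + dn m" "up n + dn n = 0"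
 by (auto simp: fun_eq_iff)

text \<open>Expand \<open>br b (f i)\<close> in the basis of degree \<open>n\<close>, move
  \<open>f i\<close> across the form, and contract with the basis of degree
  \<open>n + uvec i\<close>. This is the invariance of the Casimir tensor, one degree at a
  time.\<close>

lemma dual_shift:
 fixes \<beta> :: "'g => 'g => 'x::complex_vector"
 assumes \<beta>: "cbilinear \<beta>" and n: "n ~= 0"
 shows "(SUM b:Bs (n + uvec i). \<beta> (du (n + uvec i) b) (br b (f i))) = - (SUM b:Bs n. \<beta> (br (du n b) (f i)) b)"
proof -
 let ?m = "n + uvec i"
 have m: "?m ~= 0" using n by (auto simp: fun_eq_iff)
 note bs = cbilinear_simps[OF \<beta>]
 have c: "form (br b (f i)) y = form b (br (f i) y)" for b y
  using form_inv[of "f i" b y] br_anti[of b "f i"] by (simp add: form_simps)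
 have "(SUM b:Bs ?m. \<beta> (du ?m b) (br b (f i)))
  = (SUM b:Bs ?m. \<beta> (du ?m b) (SUM b':Bs n. form (br b (f i)) (du n b') *. b'))" proof (rule sum.cong[OF refl])
  fix b assume "b : Bs ?m"
  then have "br b (f i) : W (up n)" using W_br[OF Bs_W[OF m] f_W, of b i] unfolding up_shift(1) by blast
  from up_expand[OF n this]
  show "\<beta> (du ?m b) (br b (f i)) = \<beta> (du ?m b) (SUM b':Bs n. form (br b (f i)) (du n b') *. b')" by simp
 qed
 also have "... = (SUM b':Bs n. SUM b:Bs ?m. form b (br (f i) (du n b')) *. \<beta> (du ?m b) b')"
  by (simp only: bs c, rule sum.swap)
 also have "... = (SUM b':Bs n. - \<beta> (br (du n b') (f i)) b')" proof (rule sum.cong[OF refl])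
  fix b' assume "b' : Bs n"
  then have "br (f i) (du n b') : W (dn ?m)"
   using W_br[OF f_W du_W[OF n], of b' i] unfolding up_shift(3) add.commute[of "dn n"] by blast
  from dn_expand[OF m this]
  have "(SUM b:Bs ?m. form b (br (f i) (du n b')) *. \<beta> (du ?m b) b') = \<beta> (br (f i) (du n b')) b'"
   by (simp only: bs[symmetric])
  then show "(SUM b:Bs ?m. form b (br (f i) (du n b')) *. \<beta> (du ?m b) b') = - \<beta> (br (du n b') (f i)) b'"
   using br_anti[of "f i" "du n b'"] by (simp add: bs)
 qed
 finally show ?thesis by (simp add: sum_negf)
qed

text \<open>The boundary case in which the bracket with \<open>f i\<close> falls into the Cartan
  subalgebra; \<open>dc i\<close> is the inverse of \<open>form (e i) (f i)\<close>.\<close>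

lemma dual_shift_0:
 fixes \<beta> :: "'g => 'g => 'x::complex_vector"
 assumes \<beta>: "cbilinear \<beta>"
 shows "(SUM b:Bs (uvec i). \<beta> (du (uvec i) b) (br b (f i))) = dc i *. \<beta> (f i) (ch (cr i))"
proof -
 note bs = cbilinear_simps[OF \<beta>]
 have d0: "dc i ~= 0" using d_pos[of i] by simp
 have "\<beta> (du (uvec i) b) (br b (f i)) = dc i *. form b (f i) *. \<beta> (du (uvec i) b) (ch (cr i))"
  if b: "b : Bs (uvec i)" for b proof -
  obtain k where k: "b = k *. e i" using W_up_unit Bs_W[OF uvec_neq_0(1) b] by blast
  show ?thesis using d0 by (simp add: k br_simps e_f form_simps form_e_f bs scaleC_scaleC)
 qed
 then have "(SUM b:Bs (uvec i). \<beta> (du (uvec i) b) (br b (f i)))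
  = dc i *. \<beta> (SUM b:Bs (uvec i). form b (f i) *. du (uvec i) b) (ch (cr i))" by (simp add: bs cvec.scale_sum_right)
 then show ?thesis using dn_expand[OF uvec_neq_0(1) f_W, of i] by simp
qed

lemma CS_shift:
 fixes \<beta> :: "'g => 'g => 'x::complex_vector"
 assumes \<beta>: "cbilinear \<beta>" and S: "finite S" "0 ~: S"
 shows "CS (insert (uvec i) ((%\<alpha>. \<alpha> + uvec i) ` S)) (%x z. \<beta> x (br z (f i)))
  = dc i *. \<beta> (f i) (ch (cr i)) - CS S (%x z. \<beta> (br x (f i)) z)"
proof -
 have n: "uvec i ~: (%\<alpha>. \<alpha> + uvec i) ` S" using S(2) by auto
 have inj: "inj_on (%\<alpha>. \<alpha> + uvec i) S" by (auto intro: inj_onI)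
 have "CS (insert (uvec i) ((%\<alpha>. \<alpha> + uvec i) ` S)) (%x z. \<beta> x (br z (f i)))
  = dc i *. \<beta> (f i) (ch (cr i)) + (\<Sum>\<alpha>\<in>S. SUM b:Bs (\<alpha> + uvec i). \<beta> (du (\<alpha> + uvec i) b) (br b (f i)))"
  unfolding CS_def sum.insert[OF finite_imageI[OF S(1)] n] dual_shift_0[OF \<beta>] sum.reindex[OF inj] comp_def ..
 also have "(\<Sum>\<alpha>\<in>S. SUM b:Bs (\<alpha> + uvec i). \<beta> (du (\<alpha> + uvec i) b) (br b (f i))) = - CS S (%x z. \<beta> (br x (f i)) z)"
  unfolding CS_def sum_negf[symmetric] proof (rule sum.cong[OF refl])
  fix \<alpha> assume "\<alpha> : S"
  then have "\<alpha> ~= 0" using S(2) by blast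
  from dual_shift[OF \<beta> this] show "(SUM b:Bs (\<alpha> + uvec i). \<beta> (du (\<alpha> + uvec i) b) (br b (f i)))
   = (SUM b:Bs \<alpha>. - \<beta> (br (du \<alpha> b) (f i)) b)" by (simp only: sum_negf)
 qed
 finally show ?thesis unfolding add_uminus_conv_diff .
qed

lemma CS_cong:
 assumes "!!\<alpha> b. \<alpha> : N ==> b : Bs \<alpha> ==> \<beta> (du \<alpha> b) b = \<gamma> (du \<alpha> b) b"
 shows "CS N \<beta> = CS N \<gamma>" unfolding CS_def by (intro sum.cong refl assms)

lemma CS_mono:
 assumes "finite N'" "N \<subseteq> N'" "!!\<alpha> b. \<alpha> : N' - N ==> b : Bs \<alpha> ==> \<beta> (du \<alpha> b) b = 0"
 shows "CS N' \<beta> = CS N \<beta>"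
 unfolding CS_def by (rule sum.mono_neutral_right[OF assms(1,2)]) (use assms(3) in \<open>auto intro: sum.neutral\<close>)

lemma CS_add: "CS N (%x z. \<beta> x z + \<gamma> x z) = CS N \<beta> + CS N \<gamma>" by (simp add: CS_def sum.distrib)

lemma CS_linear: "clinear T ==> T (CS N \<beta>) = CS N (%x z. T (\<beta> x z))" by (simp add: CS_def clinear_sum[of T])

definition Nz :: "('i => nat) => ('i => nat) set" where "Nz m = {\<alpha>. \<alpha> ~= 0 & \<alpha> <= m}"

lemma finite_Nz: "finite (Nz m)" unfolding Nz_def by (rule finite_subset[OF _ finite_below[of m]]) auto

lemma Nz_shift: "insert (uvec i) ((%\<alpha>. \<alpha> + uvec i) ` Nz m) \<subseteq> Nz (m + uvec i)"
 by (auto simp: Nz_def le_fun_def fun_eq_iff intro: exI[of _ i])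

text \<open>The degrees missed by the shift do not involve \<open>i\<close>, so they drop out of
  sums over \<open>br q (f i)\<close> by \<open>br_f_0\<close>.\<close>

lemma Nz_shift_rest:
 assumes "\<alpha> : Nz (m + uvec i) - insert (uvec i) ((%\<alpha>. \<alpha> + uvec i) ` Nz m)"
 shows "\<alpha> i = 0"
proof (rule ccontr)
 assume "\<alpha> i ~= 0"
 then have a: "\<alpha> - uvec i + uvec i = \<alpha>" by (intro diff_uvec) simp
 have "\<alpha> <= m + uvec i" "\<alpha> ~= uvec i" using assms by (auto simp: Nz_def)
 then have "\<alpha> - uvec i : Nz m" using a by (auto simp: Nz_def le_fun_def le_diff_conv)
 then have "\<alpha> - uvec i + uvec i : (%\<alpha>. \<alpha> + uvec i) ` Nz m" by (rule imageI)
 then show False using assms a by simp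
qed

lemma br_f_0:
 assumes x: "x : W (up n)" and n: "n ~= 0" "n i = 0"
 shows "br x (f i) = 0"
proof -
 obtain j where "n j ~= 0" using n(1) by (auto simp: fun_eq_iff)
 then have "W (up n + dn (uvec i)) = {0}" using n(2) by (intro W_mixed[of _ j i]) (auto simp: uvec_def)
 then show ?thesis using W_br[OF x f_W[of i]] by blast
qed

subsection \<open>The quadratic form\<close>

text \<open>The invariant form on the root lattice, normalized by the squared length
  \<open>2 * d i\<close> of the simple root \<open>i\<close>.\<close>

definition bf :: "('i => int) => ('i => int) => real" where "bf z z' = (SUM i:UNIV. z i * d i * pr z' i)"
text \<open>\<open>2 (\<rho>, n) - (n, n)\<close> for a \<rho> with value 1 on every simple coroot;
  it vanishes at the simple roots.\<close>

definition sq :: "('i => nat) => real" where "sq n = 2 * (SUM i:UNIV. n i * d i) - bf (up n) (up n)"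

lemma bf_alt: "bf z z' = (SUM i:UNIV. SUM j:UNIV. z i * z' j * (d i * A i j))"
 by (simp add: bf_def pr_def sum_distrib_left algebra_simps)

lemma bf_sym: "bf z z' = bf z' z" unfolding bf_alt by (subst sum.swap) (simp add: d_sym mult_ac)

lemma bf_add1: "bf (z + y) z' = bf z z' + bf y z'" by (simp add: bf_def algebra_simps sum.distrib)
lemma bf_add2: "bf z' (z + y) = bf z' z + bf z' y" by (simp add: bf_def pr_add algebra_simps sum.distrib)
lemma bf_unit1: "bf (up (uvec i)) z = d i * pr z i"
proof -
 have "bf (up (uvec i)) z = (SUM k:UNIV. if k = i then d k * pr z k else 0)"
  unfolding bf_def by (rule sum.cong) (auto simp: uvec_def)
 then show ?thesis by simp
qed
lemma bf_unit2: "bf z (up (uvec i)) = d i * pr z i" using bf_unit1 bf_sym by metis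

lemma sum_unit: "(SUM j:UNIV. real (uvec i j) * g j) = g i" for i :: 'i
proof -
 have "(SUM j:UNIV. real (uvec i j) * g j) = (SUM j:UNIV. if j = i then g j else 0)"
  by (rule sum.cong) (auto simp: uvec_def)
 then show ?thesis by simp
qed

lemma sq_0: "sq 0 = 0" by (simp add: sq_def bf_def)

lemma sq_unit: "sq (uvec i) = 0" by (simp add: sq_def bf_unit1 pr_unit A_diag sum_unit)

lemma sq_step: "sq (m + uvec i) = sq m - 2 * d i * pr (up m) i"
proof -
 have "(SUM j:UNIV. real ((m + uvec i) j) * d j) = (SUM j:UNIV. real (m j) * d j) + d i"
  by (simp add: sum.distrib algebra_simps sum_unit[unfolded mult.commute[of "real _"]])
 then show ?thesis unfolding sq_def up_shift(4) bf_add1 bf_add2 bf_unit1 bf_unit2 pr_add pr_unit A_diag by (simp add: algebra_simps)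
qed

text \<open>Rewritten as the sum of \<open>n i * d i * (2 - pr (up n) i)\<close>, every term is
  nonnegative and one is positive. This is the numerical core of the argument of Gabber and
  Kac.\<close>

lemma sq_antidominant:
 assumes n: "n ~= 0" and p: "!!i. pr (up n) i <= 0"
 shows "0 < sq n"
proof -
 obtain j where j: "0 < n j" using n by (auto simp: fun_eq_iff)
 have "0 <= real (n i) * d i * (2 - pr (up n) i)" for i using d_pos[of i] p[of i] by simp
 moreover have "0 < real (n j) * d j * (2 - pr (up n) j)" proof -
  have "0 < 2 - real_of_int (pr (up n) j)" using p[of j] by linarith
  then show ?thesis using d_pos[of j] j by simp
 qed
 ultimately have "0 < (SUM i:UNIV. real (n i) * d i * (2 - pr (up n) i))" by (intro sum_pos2[of _ j]) auto
 also have "... = sq n" by (simp add: sq_def bf_def algebra_simps sum_subtractf sum_distrib_left)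
 finally show ?thesis .
qed

text \<open>The elements \<open>[e, y]\<close> of the Cartan subalgebra for opposite roots are known up to the
 centre, which is all that is needed.\<close>

lemma cartan_value:
 assumes "x : W (up m)" "y : W (dn m)"
 obtains h where "br x y = ch h" "!!i. sr i h = of_real (d i * pr (up m) i) * form x y"
proof -
 have "br x y : W 0" using W_br[OF assms] unfolding up_shift .
 then obtain h where h: "br x y = ch h" using W_zero_cases by blast
 have "sr i h = of_real (d i * pr (up m) i) * form x y" for i proof -
  have "br (ch (cr i)) y = - of_int (pr (up m) i) *. y"
   using assms(2) wt_cr[of "dn m" i] pr_uminus[of "up m" i] by (simp add: W_def neg_up)
  then have "form x (br (ch (cr i)) y) = - of_int (pr (up m) i) * form x y" by (simp add: form_simps)
  moreover have "form (br y x) (ch (cr i)) = - form x (br y (ch (cr i)))" by (rule form_inv)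
  moreover have "br y (ch (cr i)) = - br (ch (cr i)) y" "br x y = - br y x" by (rule br_anti)+
  ultimately have "form (br x y) (ch (cr i)) = of_int (pr (up m) i) * form x y" by (simp add: form_simps)
  then have "sr i h / dc i = of_int (pr (up m) i) * form x y" by (simp add: h form_ch)
  then show ?thesis using d_pos[of i] by (simp add: field_simps)
 qed
 then show ?thesis using h that by blast
qed

text \<open>Moving the outer \<open>e k\<close> of a nested bracket across the form shows that
  \<open>x\<close> is orthogonal to all such brackets of the opposite degree. For a single letter,
  \<open>x\<close> is a multiple of \<open>f k\<close>, and its bracket with \<open>e k\<close>
  vanishes only if \<open>x\<close> does.\<close>

lemma singular_zero:
 assumes x: "x : W (dn n)" and n: "n ~= 0" and s: "!!k. br (e k) x = 0"
 shows "x = 0"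
proof (rule form_nondeg_left[OF x up_neq_0(2)[OF n]])
 fix y assume "y : W (- dn n)"
 then have y: "y : ad.PS n" by (simp add: neg_up W_up[OF n])
 have fl: "clinear (form x)" by (rule cbilinear_right[OF form_bilinear])
 have "ad.PS n \<subseteq> {y. form x y = 0}" proof (rule ad.PS_minimal)
  show "cvec.subspace {y. form x y = 0}" by (rule subspace_zeros[OF fl])
  fix w :: "'i list" assume w: "w ~= []" "cnt w = n"
  then obtain k v where kv: "w = k # v" by (cases w) auto
  show "wrd (%i. br (e i)) e w : {y. form x y = 0}" proof (cases "v = []")
   case True
   then have "x : W (dn (uvec k))" using w x by (simp add: kv cnt_Cons)
   then obtain c where c: "x = c *. f k" using W_dn_unit by blast
   then have "c *. ch (cr k) = 0" using s[of k] by (simp add: br_simps e_f)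
   moreover have "ch (cr k) ~= 0" using cr_neq_0 ch_inj clinear_0[OF ch_lin] by (metis injD)
   ultimately have "x = 0" using c by simp
   then show ?thesis by (simp add: form_simps)
  next case False
   have "form (br (e k) x) z = - form x (br (e k) z)" for z by (rule form_inv)
   then show ?thesis using False s[of k] by (simp add: kv form_simps)
  qed
 qed
 then show "form x y = 0" using y by blast
qed

end

section \<open>Highest weight vectors and the Casimir operator\<close>

abbreviation Fw :: "('i => 'y => 'y) => 'i list => 'y => 'y" where "Fw F w y \<equiv> foldr F w y"

definition dep :: "('i => 'y::complex_vector => 'y) => 'y => ('i => nat) => 'y set"
 where "dep F y n = cvec.span {Fw F w y |w. cnt w = n}"

lemma subspace_dep: "cvec.subspace (dep F y n)" by (simp add: dep_def)

lemma Fw_in_dep: "cnt w = n ==> Fw F w y : dep F y n" unfolding dep_def by (rule cvec.span_base) blast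

lemma dep_minimal: "cvec.subspace S ==> (!!w. cnt w = n ==> Fw F w y : S) ==> dep F y n \<subseteq> S"
 unfolding dep_def by (rule cvec.span_minimal) auto

lemma dep_0: "dep F y 0 = cvec.span {y}"
proof -
 have "{Fw F w y |w. cnt w = 0} = {y}" by auto
 then show ?thesis by (simp add: dep_def)
qed

lemma F_dep:
 assumes "clinear (F i)" "x : dep F y n"
 shows "F i x : dep F y (n + uvec i)"
proof -
 have "dep F y n \<subseteq> {x. F i x : dep F y (n + uvec i)}"
 proof (rule dep_minimal[OF subspace_preimage[OF assms(1) subspace_dep]])
  fix w assume "cnt w = n"
  then have "cnt (i # w) = n + uvec i" by (simp only: cnt_Cons)
  from Fw_in_dep[OF this, of F y] show "Fw F w y : {x. F i x : dep F y (n + uvec i)}" by simp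
 qed
 then show ?thesis using assms(2) by blast
qed

text \<open>Operators \<open>E\<close>, \<open>F\<close>, \<open>H\<close> satisfying the Chevalley relations other than the Serre relations.\<close>

locale chev =
 fixes sr :: "'i::finite => 'h::complex_vector => complex" and cr :: "'i => 'h"
  and E F :: "'i => 'y::complex_vector => 'y" and H :: "'h => 'y => 'y"
 assumes E_lin: "!!i. clinear (E i)" and F_lin: "!!i. clinear (F i)" and H_bil: "cbilinear H"
  and EF: "!!i j y. E i (F j y) = F j (E i y) + (if i = j then H (cr i) y else 0)"
  and HE: "!!h i y. H h (E i y) = E i (H h y) + sr i h *. E i y" and HF: "!!h i y. H h (F i y) = F i (H h y) - sr i h *. F i y"
  and HH: "!!h h' y. H h (H h' y) = H h' (H h y)"
begin

lemmas El = clinear_simps[OF E_lin]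
lemmas Fl = clinear_simps[OF F_lin]
lemmas Hl = cbilinear_simps[OF H_bil]

lemma chev_swap: "chev sr cr F E (%h y. - H h y)"
proof (rule chev.intro)
 show "cbilinear (%h y. - H h y)" by (rule cbilinearI) (simp_all add: Hl)
 show "F i (E j y) = E j (F i y) + (if i = j then - H (cr i) y else 0)" for i j y using EF[of j i y] by (simp add: algebra_simps)
qed (simp_all add: E_lin F_lin HE HF Hl El Fl HH)

lemma H_pow: "H h y = c *. y ==> H h ((F i ^^ n) y) = (c - of_nat n * sr i h) *. (F i ^^ n) y"
proof (induction n)
 case (Suc n)
 then have "H h ((F i ^^ Suc n) y) = F i ((c - of_nat n * sr i h) *. (F i ^^ n) y) - sr i h *. F i ((F i ^^ n) y)" by (simp add: HF)
 moreover have "c - of_nat (Suc n) * sr i h = (c - of_nat n * sr i h) - sr i h" by (simp add: distrib_right)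
 ultimately show ?case by (simp only: Fl cvec.scale_left_diff_distrib funpow.simps comp_apply)
qed simp

end

locale hw = chev sr cr E F H for sr :: "'i::finite => 'h::complex_vector => complex" and cr :: "'i => 'h"
  and E F :: "'i => 'y::complex_vector => 'y" and H :: "'h => 'y => 'y" +
 fixes y :: 'y and \<Lambda> :: "'h => complex"
 assumes Ey: "!!i. E i y = 0" and Hy: "!!h. H h y = \<Lambda> h *. y"
begin

definition dwt :: "('i => nat) => 'h => complex" where "dwt n h = \<Lambda> h - (SUM i:UNIV. of_nat (n i) * sr i h)"

lemma dwt_step: "dwt (n + uvec i) h = dwt n h - sr i h"
proof -
 have "(SUM j:UNIV. of_nat (uvec i j) * sr j h) = (SUM j:UNIV. if j = i then sr j h else 0)"
  by (rule sum.cong) (auto simp: uvec_def)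
 then show ?thesis by (simp add: dwt_def algebra_simps sum.distrib)
qed

lemma H_Fw: "H h (Fw F w y) = dwt (cnt w) h *. Fw F w y"
proof (induction w)
 case Nil then show ?case by (simp add: Hy dwt_def)
next case (Cons i w)
 show ?case unfolding cnt_Cons dwt_step by (simp add: HF Cons.IH Fl cvec.scale_left_diff_distrib)
qed

lemma H_dep:
 assumes x: "x : dep F y n"
 shows "H h x = dwt n h *. x"
proof -
 have "dep F y n \<subseteq> {x. H h x = dwt n h *. x}"
  by (rule dep_minimal[OF subspace_eigen[OF cbilinear_right[OF H_bil]]]) (use H_Fw in auto)
 then show ?thesis using x by blast
qed

lemma E_Fw: "(cnt w k = 0 --> E k (Fw F w y) = 0) & (0 < cnt w k --> E k (Fw F w y) : dep F y (cnt w - uvec k))"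
proof (induction w)
 case Nil then show ?case by (simp add: Ey)
next case (Cons i w)
 have r: "E k (Fw F (i # w) y) = F i (E k (Fw F w y)) + (if k = i then dwt (cnt w) (cr k) *. Fw F w y else 0)"
  by (simp add: EF H_Fw)
 have n: "cnt (i # w) k = cnt w k + uvec i k" by (simp only: cnt_Cons plus_fun_apply)
 have "E k (Fw F (i # w) y) : dep F y (cnt (i # w) - uvec k)" if "0 < cnt (i # w) k" unfolding r
 proof (rule cvec.subspace_add[OF subspace_dep])
  show "F i (E k (Fw F w y)) : dep F y (cnt (i # w) - uvec k)" proof (cases "cnt w k = 0")
   case True
   then have "E k (Fw F w y) = 0" using Cons.IH by blast
   then show ?thesis by (simp add: Fl cvec.subspace_0[OF subspace_dep])
  next case False
   then have m: "F i (E k (Fw F w y)) : dep F y (cnt w - uvec k + uvec i)"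
    using Cons.IH False F_dep[of F i "E k (Fw F w y)", OF F_lin] by blast
   have "cnt (i # w) - uvec k = cnt w - uvec k + uvec i"
    unfolding cnt_Cons using False by (auto simp: fun_eq_iff uvec_def)
   then show ?thesis using m by metis
  qed
  show "(if k = i then dwt (cnt w) (cr k) *. Fw F w y else 0) : dep F y (cnt (i # w) - uvec k)" proof (cases "k = i")
   case True
   then have c: "cnt (i # w) - uvec k = cnt w" unfolding cnt_Cons by (auto simp: fun_eq_iff)
   show ?thesis unfolding c using True cvec.subspace_scale[OF subspace_dep Fw_in_dep[OF refl]] by auto
  qed (simp add: cvec.subspace_0[OF subspace_dep])
 qed
 moreover have "E k (Fw F (i # w) y) = 0" if "cnt (i # w) k = 0" proof -
  have "cnt w k = 0" "k ~= i" using that unfolding n by (auto simp: uvec_def split: if_splits)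
  then show ?thesis unfolding r using Cons.IH by (simp add: Fl)
 qed
 ultimately show ?case by blast
qed

lemma E_dep_0:
 assumes x: "x : dep F y n" and n: "n k = 0"
 shows "E k x = 0"
proof -
 have "dep F y n \<subseteq> {x. E k x = 0}" by (rule dep_minimal[OF subspace_zeros[OF E_lin]]) (use E_Fw n in auto)
 then show ?thesis using x by blast
qed

lemma E_dep:
 assumes x: "x : dep F y n" and n: "0 < n k"
 shows "E k x : dep F y (n - uvec k)"
proof -
 have "dep F y n \<subseteq> {x. E k x : dep F y (n - uvec k)}"
 proof (rule dep_minimal[OF subspace_preimage[OF E_lin subspace_dep]])
  fix w assume w: "cnt w = n"
  have "E k (Fw F w y) : dep F y (cnt w - uvec k)" using E_Fw[of w k] n unfolding w by blast
  then show "Fw F w y : {x. E k x : dep F y (n - uvec k)}" unfolding w by blast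
 qed
 then show ?thesis using x by blast
qed

definition U :: "'y set" where "U = cvec.span {Fw F w y |w. True}"

lemma subspace_U: "cvec.subspace U" by (simp add: U_def)

lemma dep_U: "dep F y n \<subseteq> U" unfolding dep_def U_def by (rule cvec.span_mono) blast

lemma y_U: "y : U" unfolding U_def by (rule cvec.span_base) (auto intro: exI[of _ "[]"])

lemma U_eq: "U = cvec.span (\<Union>n\<in>UNIV. dep F y n)"
proof (rule subset_antisym)
 show "U \<subseteq> cvec.span (\<Union>n\<in>UNIV. dep F y n)"
  unfolding U_def by (rule cvec.span_mono) (use Fw_in_dep[OF refl] in blast)
 show "cvec.span (\<Union>n\<in>UNIV. dep F y n) \<subseteq> U" by (rule cvec.span_minimal[OF _ subspace_U]) (use dep_U in blast)
qed

lemma U_decomp: "x : U ==> EX K g. finite K & (ALL n:K. g n : dep F y n) & x = (SUM n:K. g n)"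
 using span_UN_decomp[of "dep F y" x UNIV, OF subspace_dep] unfolding U_eq by blast

lemma U_stable:
 assumes "clinear T" "!!n x. x : dep F y n ==> T x : U" "x : U"
 shows "T x : U"
proof -
 have "U \<subseteq> {x. T x : U}" unfolding U_eq
  by (rule cvec.span_minimal[OF _ subspace_preimage[OF assms(1)]]) (use assms(2) in \<open>auto simp: U_eq[symmetric] subspace_U\<close>)
 then show ?thesis using assms(3) by blast
qed

lemma U_F: "x : U ==> F i x : U"
proof (rule U_stable[OF F_lin])
 show "F i x : U" if "x : dep F y n" for n x using F_dep[of F i, OF F_lin that] dep_U by blast
qed

lemma U_H: "x : U ==> H h x : U"
proof (rule U_stable[OF cbilinear_right[OF H_bil]])
 fix n x assume x: "x : dep F y n"
 then show "H h x : U" using cvec.subspace_scale[OF subspace_U] dep_U[of n] by (simp add: H_dep[OF x] subset_iff)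
qed

lemma U_E: "x : U ==> E i x : U"
proof (rule U_stable[OF E_lin])
 fix n x assume x: "x : dep F y n"
 show "E i x : U" proof (cases "n i = 0")
  case True then show ?thesis using E_dep_0[OF x True] cvec.subspace_0[OF subspace_U] by simp
 next case False
  then show ?thesis using E_dep[OF x, of i] dep_U by blast
 qed
qed

end

lemma (in km) chev_module:
 assumes "lie_module br \<rho>"
 shows "chev sr cr (%i. \<rho> (e i)) (%i. \<rho> (f i)) (%h. \<rho> (ch h))"
proof (rule chev.intro)
 show "cbilinear (%h. \<rho> (ch h))"
  by (rule cbilinearI) (simp_all add: clinear_simps[OF ch_lin] cbilinear_simps[OF lie_module_bilinear[OF assms]])
qed (simp_all add: lie_module_linear[OF assms] module_gen[OF assms])

locale hwm = km A sr cr br ch e f d + hw sr cr "%i. \<rho> (e i)" "%i. \<rho> (f i)" "%h. \<rho> (ch h)" y \<Lambda>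
 for A :: "'i::finite => 'i => int" and sr :: "'i => 'h::complex_vector => complex" and cr
  and br :: "'g::complex_vector => 'g => 'g" and ch e f d and \<rho> :: "'g => 'y::complex_vector => 'y" and y \<Lambda> +
 assumes mod: "lie_module br \<rho>"
begin

abbreviation "F \<equiv> (%i. \<rho> (f i))"

lemmas \<rho>s = cbilinear_simps[OF lie_module_bilinear[OF mod]]
lemmas \<rho>b = lie_module_bracket[OF mod]

lemma dwt_wt: "dwt n h = \<Lambda> h - wt (up n) h" by (simp add: dwt_def ad.wt_def)

lemma PS_kills:
 assumes x: "!!k. \<rho> (e k) x = 0" and p: "p : W (up n)" "n ~= 0"
 shows "\<rho> p x = 0"
proof -
 have w: "\<rho> (wrd (%i. br (e i)) e w) x = 0" for w by (induction w) (simp_all add: \<rho>s \<rho>b x)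
 have "ad.PS n \<subseteq> {p. \<rho> p x = 0}"
  by (rule ad.PS_minimal[OF subspace_zeros[OF cbilinear_left[OF lie_module_bilinear[OF mod]]]]) (simp add: w)
 then show ?thesis using p by (auto simp: W_up)
qed

text \<open>The element \<open>p\<close> would lift the vector outside the cone below the top
  weight. The induction commutes \<open>p\<close> past the first letter, which lowers its degree by
  that letter.\<close>

lemma up_kills: "p : W (up n) ==> n ~= 0 ==> \<not> n <= cnt w ==> \<rho> p (Fw F w y) = 0"
proof (induction w arbitrary: n p)
 case Nil
 from PS_kills[of y, OF Ey Nil(1,2)] show ?case by simp
next case (Cons i w)
 have r: "\<rho> p (Fw F (i # w) y) = \<rho> (br p (f i)) (Fw F w y) + F i (\<rho> p (Fw F w y))" by (simp add: \<rho>b)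
 have le: "cnt w <= cnt (i # w)" unfolding cnt_Cons by (simp add: le_fun_def)
 then have "\<not> n <= cnt w" using Cons.prems(3) order_trans by blast
 then have z: "\<rho> p (Fw F w y) = 0" using Cons by blast
 have "\<rho> (br p (f i)) (Fw F w y) = 0" proof (cases "n i = 0")
  case True then show ?thesis using br_f_0[OF Cons.prems(1,2)] by (simp add: \<rho>s)
 next case False
  then have n: "n - uvec i + uvec i = n" by (intro diff_uvec) simp
  have "br p (f i) : W (up n + dn (uvec i))" using W_br Cons.prems(1) f_W by blast
  moreover have "up n + dn (uvec i) = up (n - uvec i)" using up_shift(1)[of "n - uvec i" i] unfolding n .
  ultimately have b: "br p (f i) : W (up (n - uvec i))" by (simp only:)
  have nle: "\<not> n - uvec i <= cnt w" proof
   assume "n - uvec i <= cnt w"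
   then have "n - uvec i + uvec i <= cnt w + uvec i" by (rule add_right_mono)
   then show False using Cons.prems(3) unfolding n cnt_Cons by blast
  qed
  have "n - uvec i ~= 0" proof
   assume "n - uvec i = 0"
   then show False using nle by (simp add: le_fun_def)
  qed
  then show ?thesis using Cons.IH[OF b _ nle] by blast
 qed
 then show ?case unfolding r z by (simp add: \<rho>s)
qed

definition lam :: "'i => complex" where "lam i = \<Lambda> (cr i)"
text \<open>Half of \<open>|\<Lambda> + \<rho>|^2 - |\<Lambda> + \<rho> - n|^2\<close>: the change
  of the diagonal part of the Casimir element between the top and depth \<open>n\<close>.\<close>

definition kap :: "('i => nat) => complex" where "kap n = (SUM i:UNIV. of_nat (n i) * dc i * lam i) + of_real (sq n) / 2"

lemma kap_step: "kap (n + uvec i) = kap n + dc i * dwt n (cr i)"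
proof -
 have "(SUM j:UNIV. of_nat (uvec i j) * dc j * lam j) = (SUM j:UNIV. if j = i then dc j * lam j else 0)"
  by (rule sum.cong) (auto simp: uvec_def)
 then show ?thesis by (simp add: kap_def dwt_wt wt_cr lam_def sq_step algebra_simps sum.distrib diff_divide_distrib)
qed

text \<open>Commute \<open>f i\<close> to the left through the Casimir sum. By
  \<open>CS_shift\<close> the bracket terms cancel in pairs, and the boundary term with the coroot
  is the increment \<open>kap_step\<close>.\<close>

lemma casimir_Fw: "CS (Nz (cnt w)) (%p q. \<rho> p (\<rho> q (Fw F w y))) = kap (cnt w) *. Fw F w y"
proof (induction w)
 case Nil
 have "Nz (0 :: 'i => nat) = {}" by (auto simp: Nz_def le_fun_def fun_eq_iff)
 then have "CS (Nz 0) (%p q. \<rho> p (\<rho> q y)) = 0" by (simp only: CS_def sum.empty)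
 moreover have "kap 0 = 0" unfolding kap_def sq_0 by simp
 ultimately show ?case unfolding cnt_Nil foldr_Nil id_apply by (simp only: cvec.scale_zero_left)
next case (Cons i w)
 let ?x = "Fw F w y" and ?m = "cnt w"
 let ?N = "insert (uvec i) ((%\<alpha>. \<alpha> + uvec i) ` Nz ?m)"
 have nz: "0 ~: Nz ?m" by (simp add: Nz_def)
 have bil: "cbilinear (%p q. \<rho> p (\<rho> q ?x))" by (rule cbilinearI) (simp_all add: \<rho>s)
 have 1: "CS (Nz (?m + uvec i)) (%p q. \<rho> p (\<rho> (br q (f i)) ?x)) = CS ?N (%p q. \<rho> p (\<rho> (br q (f i)) ?x))"
 proof (rule CS_mono[OF finite_Nz Nz_shift])
  fix \<alpha> b assume a: "\<alpha> : Nz (?m + uvec i) - ?N" "b : Bs \<alpha>"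
  then have "\<alpha> ~= 0" by (auto simp: Nz_def)
  then have "br b (f i) = 0" using br_f_0[OF Bs_W[OF _ a(2)]] Nz_shift_rest[OF a(1)] by blast
  then show "\<rho> (du \<alpha> b) (\<rho> (br b (f i)) ?x) = 0" by (simp add: \<rho>s)
 qed
 have 2: "CS (Nz (?m + uvec i)) (%p q. \<rho> p (F i (\<rho> q ?x))) = CS (Nz ?m) (%p q. \<rho> p (F i (\<rho> q ?x)))"
 proof (rule CS_mono[OF finite_Nz])
  show "Nz ?m \<subseteq> Nz (?m + uvec i)" by (auto simp: Nz_def le_fun_def intro: trans_le_add1)
  fix \<alpha> b assume a: "\<alpha> : Nz (?m + uvec i) - Nz ?m" "b : Bs \<alpha>"
  then have "\<alpha> ~= 0" "\<not> \<alpha> <= ?m" by (auto simp: Nz_def)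
  then have "\<rho> b ?x = 0" using up_kills[OF Bs_W[OF _ a(2)]] by blast
  then show "\<rho> (du \<alpha> b) (F i (\<rho> b ?x)) = 0" by (simp add: \<rho>s)
 qed
 have 3: "CS (Nz ?m) (%p q. \<rho> p (F i (\<rho> q ?x))) =
  CS (Nz ?m) (%p q. \<rho> (br p (f i)) (\<rho> q ?x)) + CS (Nz ?m) (%p q. F i (\<rho> p (\<rho> q ?x)))"
  unfolding CS_add[symmetric] by (rule CS_cong) (simp add: \<rho>b)
 have 4: "CS (Nz ?m) (%p q. F i (\<rho> p (\<rho> q ?x))) = kap ?m *. F i ?x"
  unfolding CS_linear[OF lie_module_linear[OF mod], symmetric] Cons.IH by (simp add: \<rho>s)
 have "CS (Nz (?m + uvec i)) (%p q. \<rho> p (\<rho> q (F i ?x))) =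
  CS (Nz (?m + uvec i)) (%p q. \<rho> p (\<rho> (br q (f i)) ?x)) + CS (Nz (?m + uvec i)) (%p q. \<rho> p (F i (\<rho> q ?x)))"
  unfolding CS_add[symmetric] by (rule CS_cong) (simp add: \<rho>b \<rho>s)
 also have "... = dc i *. F i (\<rho> (ch (cr i)) ?x) + kap ?m *. F i ?x" unfolding 1 2 3 4 CS_shift[OF bil finite_Nz nz] by simp
 also have "... = kap (?m + uvec i) *. F i ?x" unfolding kap_step H_Fw by (simp add: \<rho>s scaleC_add_left scaleC_scaleC)
 finally show ?case unfolding cnt_Cons foldr_Cons comp_apply .
qed

lemma casimir:
 assumes x: "x : dep F y n"
 shows "CS (Nz n) (%p q. \<rho> p (\<rho> q x)) = kap n *. x"
proof -
 have lin: "clinear (%x. CS (Nz n) (%p q. \<rho> p (\<rho> q x)))"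
  by (rule clinearI) (simp_all add: CS_def \<rho>s sum.distrib cvec.scale_sum_right)
 have "dep F y n \<subseteq> {x. CS (Nz n) (%p q. \<rho> p (\<rho> q x)) - kap n *. x = 0}" proof (rule dep_minimal)
  show "cvec.subspace {x. CS (Nz n) (%p q. \<rho> p (\<rho> q x)) - kap n *. x = 0}" by (rule subspace_zeros, rule clinearI)
    (simp_all add: clinear_add[OF lin] clinear_scale[OF lin] scaleC_add_right cvec.scale_left_commute cvec.scale_right_diff_distrib)
  show "Fw F w y : {x. CS (Nz n) (%p q. \<rho> p (\<rho> q x)) - kap n *. x = 0}" if "cnt w = n" for w
   using casimir_Fw[of w] unfolding that by simp
 qed
 then show ?thesis using x by auto
qed

definition dom :: "('h => complex) => bool" where "dom \<mu> \<longleftrightarrow> (ALL i. \<exists>n::nat. \<mu> (cr i) = of_nat n)"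

text \<open>On a singular vector the Casimir sum is 0, so \<open>kap n\<close> annihilates
  \<open>x\<close>. With \<open>l\<close> and \<open>m\<close> the values of the top weight and of
  the weight of \<open>x\<close> on the coroots, \<open>2 * kap n\<close> is the sum of
  \<open>n i * d i * (l i + m i + 2)\<close>, which is positive.\<close>

lemma singular_dominant_0:
 assumes x: "x : dep F y n" "!!k. \<rho> (e k) x = 0" and n: "n ~= 0" and dom: "dom \<Lambda>" "dom (dwt n)"
 shows "x = 0"
proof -
 have "CS (Nz n) (%p q. \<rho> p (\<rho> q x)) = CS {} (%p q. \<rho> p (\<rho> q x))" proof (rule CS_mono[OF finite_Nz])
  fix \<alpha> b assume "\<alpha> : Nz n - {}" "b : Bs \<alpha>"
  then have "\<alpha> ~= 0" "b : W (up \<alpha>)" using Bs_W by (auto simp: Nz_def)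
  then show "\<rho> (du \<alpha> b) (\<rho> b x) = 0" using PS_kills[OF x(2)] by (simp add: \<rho>s)
 qed simp
 then have k: "kap n *. x = 0" using casimir[OF x(1)] by (simp add: CS_def)
 obtain l m :: "'i => nat" where l: "!!i. \<Lambda> (cr i) = of_nat (l i)" and m: "!!i. dwt n (cr i) = of_nat (m i)"
  using dom unfolding dom_def by metis
 have p: "real (m i) = real (l i) - pr (up n) i" for i proof -
  have "complex_of_real (real (m i)) = complex_of_real (real (l i) - pr (up n) i)" using m[of i] by (simp add: dwt_wt wt_cr l)
  then show ?thesis using of_real_eq_iff by blast
 qed
 obtain j where j: "0 < n j" using n by (auto simp: fun_eq_iff)
 have "0 < (SUM i:UNIV. real (n i) * d i * (real (l i) + real (m i) + 2))" proof (rule sum_pos2[of _ j])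
  show "0 < real (n j) * d j * (real (l j) + real (m j) + 2)" using j d_pos[of j] by simp
  show "0 <= real (n i) * d i * (real (l i) + real (m i) + 2)" for i using d_pos[of i] by simp
 qed simp_all
 also have "... = 2 * (SUM i:UNIV. real (n i) * d i * l i) + sq n"
  by (simp add: sq_def bf_def p algebra_simps sum_subtractf sum.distrib sum_distrib_left)
 finally have "2 * (SUM i:UNIV. real (n i) * d i * l i) + sq n ~= 0" by simp
 moreover have "2 * kap n = of_real (2 * (SUM i:UNIV. real (n i) * d i * l i) + sq n)" by (simp add: kap_def lam_def l)
 ultimately have "2 * kap n ~= 0" by (simp only: of_real_eq_0_iff not_False_eq_True)
 then show ?thesis using k by simp
qed

lemma dwt_inj: "inj dwt"
proof (rule injI)
 fix n n' assume "dwt n = dwt n'"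
 then have "wt (up n) = wt (up n')" by (simp add: dwt_wt fun_eq_iff)
 then have "up n = up n'" using wt_inj by (rule injD[rotated])
 then show "n = n'" by (simp add: fun_eq_iff)
qed

lemma submodule_component:
 assumes S: "cvec.subspace S" "!!h x. x : S ==> \<rho> (ch h) x : S"
  and K: "finite K" "!!n. n : K ==> g n : dep F y n" "(SUM n:K. g n) : S" "n : K"
 shows "g n : S"
proof (rule weight_components[where H = "%h. \<rho> (ch h)" and wt = dwt and K = K])
 show "inj_on dwt K" using dwt_inj by (rule inj_on_subset) simp
 show "\<rho> (ch h) (g n) = dwt n h *. g n" if "n : K" for n h using H_dep[OF K(2)[OF that]] .
qed (fact K(1) S(1) K(3) K(4) | rule lie_module_linear[OF mod] | erule S(2))+

lemma submodule_zero:
 assumes S: "cvec.subspace S" "!!i x. x : S ==> \<rho> (e i) x : S" "!!h x. x : S ==> \<rho> (ch h) x : S" "S \<subseteq> U"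
  and y: "!!c. c *. y : S ==> c *. y = 0" and \<Lambda>: "dom \<Lambda>"
  and sing: "!!x n. x : S ==> x : dep F y n ==> x ~= 0 ==> (!!k. \<rho> (e k) x = 0) ==> dom (dwt n)"
 shows "S = {0}"
proof -
 have z: "x : S ==> x : dep F y n ==> x = 0" for x n proof (induction "height n" arbitrary: n x rule: less_induct)
  case less
  have k: "\<rho> (e k) x = 0" for k proof (cases "n k = 0")
   case True then show ?thesis using E_dep_0 less.prems by blast
  next case False
   then have n: "n - uvec k + uvec k = n" by (intro diff_uvec) simp
   then have "height (n - uvec k) < height n"
    using height_add[of "n - uvec k" "uvec k"] by (simp only: n height_uvec)
   then show ?thesis using less.hyps[OF _ S(2)[OF less.prems(1)] E_dep[OF less.prems(2)]] False by simp
  qed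
  show ?case proof (rule ccontr)
   assume x0: "x ~= 0"
   then have "dom (dwt n)" using sing less.prems k by blast
   moreover have "n ~= 0" proof
    assume "n = 0"
    then have "x : cvec.span {y}" using less.prems(2) by (simp add: dep_0)
    then obtain c where "x = c *. y" by (auto simp: cvec.span_singleton)
    then show False using y less.prems(1) x0 by blast
   qed
   ultimately show False using singular_dominant_0[OF less.prems(2) k] \<Lambda> x0 by blast
  qed
 qed
 have "x = 0" if x: "x : S" for x proof -
  have "x : U" using x S(4) by blast
  then obtain K g where K: "finite K" "ALL n:K. g n : dep F y n" "x = (SUM n:K. g n)"
   using U_decomp[OF \<open>x \<in> U\<close>] by (elim exE conjE)
  have "g n = 0" if n: "n : K" for n proof (rule z)
   show "g n : S" by (rule submodule_component[OF S(1,3) K(1) _ _ n]) (use K x in auto)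
   show "g n : dep F y n" using K(2) n by blast
  qed
  then show ?thesis using K(3) by simp
 qed
 then show ?thesis using cvec.subspace_0[OF S(1)] by blast
qed

end

section \<open>Integrable operators generate a module\<close>

lemma lie_anti:
 assumes "lie_algebra \<beta>"
 shows "\<beta> x y = - \<beta> y x"
proof -
 have b: "cbilinear \<beta>" and s: "!!x. \<beta> x x = 0" using assms by (simp_all add: lie_algebra_def)
 have "\<beta> (x + y) (x + y) = \<beta> x x + \<beta> x y + (\<beta> y x + \<beta> y y)"
  by (simp only: cbilinear_simps[OF b] add_ac)
 then have "\<beta> x y + \<beta> y x = 0" by (simp only: s add_0_left add_0_right)
 then show ?thesis by (simp only: eq_neg_iff_add_eq_0)
qed

lemma lie_jacobi:
 assumes "lie_algebra \<beta>"
 shows "\<beta> x (\<beta> y z) = \<beta> (\<beta> x y) z + \<beta> y (\<beta> x z)"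
proof -
 have b: "cbilinear \<beta>" using assms by (simp add: lie_algebra_def)
 have "\<beta> x (\<beta> y z) + \<beta> y (\<beta> z x) + \<beta> z (\<beta> x y) = 0" using assms by (auto simp: lie_algebra_def)
 then show ?thesis using lie_anti[OF assms, of z x] lie_anti[OF assms, of z "\<beta> x y"]
  by (simp add: cbilinear_simps[OF b] algebra_simps eq_neg_iff_add_eq_0)
qed

locale lieg =
 fixes sr :: "'i::finite => 'h::complex_vector => complex" and cr :: "'i => 'h"
  and \<beta> :: "'y::complex_vector => 'y => 'y" and a b :: "'i => 'y" and c :: "'h => 'y"
 assumes lie: "lie_algebra \<beta>" and c_lin: "clinear c" and ab: "!!i j. \<beta> (a i) (b j) = (if i = j then c (cr i) else 0)"
  and ca: "!!h i. \<beta> (c h) (a i) = sr i h *. a i" and cb: "!!h i. \<beta> (c h) (b i) = - (sr i h *. b i)"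
  and cc: "!!h h'. \<beta> (c h) (c h') = 0"
begin

lemma bil: "cbilinear \<beta>" using lie by (simp add: lie_algebra_def)
lemmas bs = cbilinear_simps[OF bil]
lemmas anti = lie_anti[OF lie]
lemmas jac = lie_jacobi[OF lie]

sublocale adj sr cr "%i. \<beta> (a i)" "%i. \<beta> (b i)" "%h. \<beta> (c h)" a b c
proof (rule adj.intro)
 show "\<beta> (a i) (\<beta> (b j) y) = \<beta> (b j) (\<beta> (a i) y) + (if i = j then \<beta> (c (cr i)) y else 0)" for i j y
  using jac[of "a i" "b j" y] by (simp add: ab bs)
 show "\<beta> (c h) (\<beta> (a i) y) = \<beta> (a i) (\<beta> (c h) y) + sr i h *. \<beta> (a i) y" for h i y
  using jac[of "c h" "a i" y] by (simp add: ca bs)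
 show "\<beta> (c h) (\<beta> (b i) y) = \<beta> (b i) (\<beta> (c h) y) - sr i h *. \<beta> (b i) y" for h i y
  using jac[of "c h" "b i" y] by (simp add: cb bs)
 show "\<beta> (a i) (c h) = - (sr i h *. a i)" for i h using anti[of "a i" "c h"] by (simp add: ca)
 show "\<beta> (b i) (c h) = sr i h *. b i" for i h using anti[of "b i" "c h"] by (simp add: cb)
 show "\<beta> (b i) (a j) = - (if i = j then c (cr i) else 0)" for i j using anti[of "b i" "a j"] by (simp add: ab)
qed (simp_all add: cbilinear_right[OF bil] c_lin ab ca cb cc)

lemma wrd_br: "w ~= [] ==> y : QS m ==> m ~= 0 ==> \<beta> (wrd (%i. \<beta> (b i)) b w) y : QS (m + cnt w)"
proof (induction w arbitrary: m y)
 case (Cons i w)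
 have n: "m + cnt (i # w) = m + cnt w + uvec i" unfolding cnt_Cons by (simp only: add.assoc)
 show ?case proof (cases "w = []")
  case True
  have c: "cnt (i # w) = uvec i" unfolding True cnt_Cons cnt_Nil by simp
  show ?thesis unfolding c unfolding True wrd.simps using Q_QS[OF Cons.prems(2,3), of i] by (simp only: if_True simp_thms)
 next case False
  let ?u = "wrd (%i. \<beta> (b i)) b w"
  have nz: "m + cnt w ~= 0" "m + uvec i ~= 0" using Cons.prems(3) by (auto simp: fun_eq_iff)
  have 1: "\<beta> (b i) (\<beta> ?u y) : QS (m + cnt w + uvec i)" by (rule Q_QS[OF Cons.IH[OF False Cons.prems(2,3)] nz(1)])
  have "\<beta> ?u (\<beta> (b i) y) : QS (m + uvec i + cnt w)" by (rule Cons.IH[OF False Q_QS[OF Cons.prems(2,3)] nz(2)])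
  then have 2: "\<beta> ?u (\<beta> (b i) y) : QS (m + cnt w + uvec i)" by (simp only: add_ac)
  have "\<beta> (\<beta> (b i) ?u) y = \<beta> (b i) (\<beta> ?u y) - \<beta> ?u (\<beta> (b i) y)" using jac[of "b i" ?u y] by simp
  then show ?thesis using cvec.subspace_diff[OF subspace_QS 1 2] False unfolding n wrd.simps by (simp only: if_False)
 qed
qed simp

lemma QS_br:
 assumes x: "x : QS n" and y: "y : QS m" "m ~= 0"
 shows "\<beta> x y : QS (n + m)"
proof -
 have "QS n \<subseteq> {x. \<beta> x y : QS (n + m)}"
 proof (rule QS_minimal[OF subspace_preimage[OF cbilinear_left[OF bil] subspace_QS]])
  fix w :: "'i list" assume w: "w ~= []" "cnt w = n"
  show "wrd (%i. \<beta> (b i)) b w : {x. \<beta> x y : QS (n + m)}"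
   using wrd_br[OF w(1) y] w(2) by (simp only: mem_Collect_eq add.commute)
 qed
 then show ?thesis using x by blast
qed

text \<open>The Jacobi identity resolves the bracket with a nested word into brackets with its
  letters.\<close>

lemma wrd_D:
 assumes "!!i y. y : D ==> \<beta> (g i) y : D" "y : D"
 shows "\<beta> (wrd (%i. \<beta> (g i)) g w) y : D" using assms(2)
proof (induction w arbitrary: y)
 case Nil then show ?case by (simp add: bs cvec.subspace_0[OF subspace_D])
next case (Cons i w)
 let ?u = "wrd (%i. \<beta> (g i)) g w"
 have "\<beta> (\<beta> (g i) ?u) y = \<beta> (g i) (\<beta> ?u y) - \<beta> ?u (\<beta> (g i) y)" using jac[of "g i" ?u y] by simp
 then show ?case using Cons.IH[OF Cons.prems] Cons.IH[OF assms(1)[OF Cons.prems, of i]] assms(1) Cons.prems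
  by (auto intro: cvec.subspace_diff[OF subspace_D])
qed

lemma D_br:
 assumes x: "x : D" and y: "y : D"
 shows "\<beta> x y : D"
proof -
 have "D \<subseteq> {x. \<beta> x y : D}" unfolding D_def[of] 
  by (rule cvec.span_minimal[OF _ subspace_preimage[OF cbilinear_left[OF bil] subspace_D[unfolded D_def]]])
   (use D_R[OF y] wrd_D[OF D_P y] wrd_D[OF D_Q y] in \<open>auto simp: D_def[symmetric]\<close>)
 then show ?thesis using x by blast
qed

end

lift_definition cm :: "('m::complex_vector, 'm) clin => ('m, 'm) clin => ('m, 'm) clin" is "%f g x. f (g x) - g (f x)"
 by (rule clinearI) (simp_all add: clinear_add clinear_scale cvec.scale_right_diff_distrib)

lemma app_cm [simp]: "app (cm \<phi> \<psi>) x = app \<phi> (app \<psi> x) - app \<psi> (app \<phi> x)" by transfer simp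

lemma lie_cm: "lie_algebra cm" unfolding lie_algebra_def
proof (intro conjI allI)
 show "cbilinear cm" by (rule cbilinearI; rule clin_eqI) (simp_all add: app_simps cvec.scale_right_diff_distrib)
qed (rule clin_eqI, simp add: app_simps)+

definition pbr :: "('a => 'a => 'a) => ('b => 'b => 'b) => 'a \<times> 'b => 'a \<times> 'b => 'a \<times> 'b"
 where "pbr \<beta> \<gamma> p q = (\<beta> (fst p) (fst q), \<gamma> (snd p) (snd q))"

lemma lie_pbr:
 assumes "lie_algebra \<beta>" "lie_algebra \<gamma>"
 shows "lie_algebra (pbr \<beta> \<gamma>)"
proof -
 have b: "cbilinear \<beta>" "cbilinear \<gamma>" using assms by (simp_all add: lie_algebra_def)
 have "cbilinear (pbr \<beta> \<gamma>)"
  by (rule cbilinearI) (simp_all add: pbr_def cbilinear_simps[OF b(1)] cbilinear_simps[OF b(2)])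
 then show ?thesis using assms by (simp add: lie_algebra_def pbr_def zero_prod_def)
qed

section \<open>The Casimir sum without its top degree, on the adjoint module\<close>

context km
begin

text \<open>Degree \<open>n\<close> itself is left out so that, on a vector of degree
  \<open>dn n\<close>, all inner brackets stay in strictly negative degrees, where a partial lift is
  available.\<close>

definition Nl :: "('i => nat) => ('i => nat) set" where "Nl n = Nz n - {n}"

lemma finite_Nl: "finite (Nl n)" by (simp add: Nl_def finite_Nz)

lemma height_Nl: "m : Nl n ==> height m < height n"
proof -
 assume "m : Nl n"
 then have m: "m <= n" "m ~= n" by (auto simp: Nl_def Nz_def)
 then obtain i where "m i ~= n i" by (auto simp: fun_eq_iff)
 with m(1) have "m i < n i" by (simp add: le_fun_def le_neq_trans)
 then show ?thesis unfolding height_def using m(1) by (intro sum_strict_mono_ex1) (auto simp: le_fun_def)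
qed

lemma W_dn_diff: "x : W (up \<alpha>) ==> y : W (dn m) ==> \<alpha> <= m ==> br x y : W (dn (m - \<alpha>))"
proof -
 assume "x : W (up \<alpha>)" "y : W (dn m)" "\<alpha> <= m"
 moreover from this(3) have "up \<alpha> + dn m = dn (m - \<alpha>)" by (auto simp: fun_eq_iff le_fun_def of_nat_diff)
 ultimately show ?thesis using W_br by metis
qed

text \<open>\<open>L\<close> is the bracket for the adjoint module, and the commutator of a partial
  lift for the theorem of Gabber and Kac; the latter is a cocycle only on triples of negative
  degrees, as in \<open>coc\<close>. The boundary term of \<open>CS_shift\<close> and the terms of
  degree \<open>m\<close>, which pass through the Cartan subalgebra, contribute
  \<open>- d i * pr (up m) i\<close> each, and together with \<open>sq m\<close> they make up
  \<open>sq (m + uvec i)\<close>.\<close>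

lemma partial_casimir_step:
 fixes L :: "'g => 'g => 'x::complex_vector"
 assumes L: "cbilinear L" "!!x y. L x y = - L y x"
  and coc: "!!\<alpha> \<beta> \<gamma> x y z. x : W (dn \<alpha>) ==> y : W (dn \<beta>) ==> z : W (dn \<gamma>) ==> \<alpha> + \<beta> + \<gamma> = m + uvec i ==>
   \<alpha> ~= 0 ==> \<beta> ~= 0 ==> \<gamma> ~= 0 ==> L x (br y z) = L (br x y) z + L y (br x z)"
  and y: "y : W (dn m)" and m: "m ~= 0" and Q: "CS (Nl m) (%p q. br p (br q y)) = of_real (sq m) *. y"
 shows "CS (Nl (m + uvec i)) (%p q. L p (br q (br (f i) y))) = of_real (sq (m + uvec i)) *. L (f i) y"
proof -
 let ?n = "m + uvec i"
 let ?N = "insert (uvec i) ((%\<alpha>. \<alpha> + uvec i) ` Nl m)"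
 note Ls = cbilinear_simps[OF L(1)]
 have nz: "0 ~: Nl m" by (simp add: Nl_def Nz_def)
 have chy: "br (ch (cr i)) y = - of_int (pr (up m) i) *. y"
  using y wt_cr[of "dn m" i] pr_uminus[of "up m" i] by (simp add: W_def neg_up)
 have bil: "cbilinear (%p z. L p (br z y))" by (rule cbilinearI) (simp_all add: br_simps Ls)
 have N_eq: "?N \<subseteq> Nl ?n" proof -
  have "uvec i ~= ?n" using m by (auto simp: fun_eq_iff)
  then show ?thesis using Nz_shift[of i m] by (auto simp: Nl_def)
 qed
 have 1: "CS (Nl ?n) (%p q. L p (br (br q (f i)) y)) = CS ?N (%p q. L p (br (br q (f i)) y))"
 proof (rule CS_mono[OF finite_Nl N_eq])
  fix \<alpha> b assume a: "\<alpha> : Nl ?n - ?N" "b : Bs \<alpha>"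
  have "\<alpha> ~: (%\<alpha>. \<alpha> + uvec i) ` Nz m" proof
   assume "\<alpha> : (%\<alpha>. \<alpha> + uvec i) ` Nz m"
   then have "\<alpha> = ?n" using a(1) by (auto simp: Nl_def)
   then show False using a(1) by (simp add: Nl_def)
  qed
  then have r: "\<alpha> : Nz ?n - insert (uvec i) ((%\<alpha>. \<alpha> + uvec i) ` Nz m)" using a(1) by (auto simp: Nl_def)
  then have "\<alpha> ~= 0" by (auto simp: Nz_def)
  then have "br b (f i) = 0" using br_f_0[OF Bs_W[OF _ a(2)]] Nz_shift_rest[OF r] by blast
  then show "L (du \<alpha> b) (br (br b (f i)) y) = 0" by (simp add: br_simps Ls)
 qed
 have 2: "CS (Nl ?n) (%p q. L p (br (f i) (br q y))) = CS (Nz m) (%p q. L p (br (f i) (br q y)))" proof (rule CS_mono[OF finite_Nl])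
  show "Nz m \<subseteq> Nl ?n" proof
   fix \<alpha> assume a: "\<alpha> : Nz m"
   then have "\<alpha> i < ?n i" by (simp add: Nz_def le_fun_def less_Suc_eq_le)
   then have "\<alpha> ~= ?n" by blast
   moreover have "\<alpha> <= ?n" using a by (auto simp: Nz_def le_fun_def intro: trans_le_add1)
   ultimately show "\<alpha> : Nl ?n" using a by (simp add: Nl_def Nz_def)
  qed
  fix \<alpha> b assume a: "\<alpha> : Nl ?n - Nz m" "b : Bs \<alpha>"
  then have a0: "\<alpha> ~= 0" and le: "!!j. \<alpha> j <= m j + uvec i j" "\<alpha> ~= ?n" and nle: "\<not> \<alpha> <= m"
   by (auto simp: Nl_def Nz_def le_fun_def)
  obtain j where j: "m j < \<alpha> j" using nle by (auto simp: le_fun_def not_le)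
  then have ji: "j = i" using le(1)[of j] by (auto simp: uvec_def split: if_splits)
  obtain k where k: "\<alpha> k ~= ?n k" using le(2) by (auto simp: fun_eq_iff)
  have "k ~= i" using k j le(1)[of i] ji by auto
  then have "\<alpha> k < m k" using k le(1)[of k] by (auto simp: uvec_def)
  then have "W (up \<alpha> + dn m) = {0}" using j by (intro W_mixed[of _ j k]) auto
  then have "br b y = 0" using W_br[OF Bs_W[OF a0 a(2)] y] by blast
  then show "L (du \<alpha> b) (br (f i) (br b y)) = 0" by (simp add: br_simps Ls)
 qed
 have "m : Nz m" using m by (simp add: Nz_def)
 then have 3: "CS (Nz m) (%p q. L p (br (f i) (br q y))) =
  (SUM b:Bs m. L (du m b) (br (f i) (br b y))) + CS (Nl m) (%p q. L p (br (f i) (br q y)))"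
  unfolding CS_def Nl_def by (rule sum.remove[OF finite_Nz])
 have "(SUM b:Bs m. L (du m b) (br (f i) (br b y))) = (SUM b:Bs m. of_real (d i * pr (up m) i) *. form b y *. L (du m b) (f i))"
 proof (rule sum.cong[OF refl])
  fix b assume "b : Bs m"
  then obtain h where "br b y = ch h" "!!i. sr i h = of_real (d i * pr (up m) i) * form b y"
   using cartan_value[OF Bs_W[OF m] y] by metis
  then show "L (du m b) (br (f i) (br b y)) = of_real (d i * pr (up m) i) *. form b y *. L (du m b) (f i)"
   by (simp add: f_h Ls scaleC_scaleC)
 qed
 also have "... = of_real (d i * pr (up m) i) *. L (SUM b:Bs m. form b y *. du m b) (f i)" by (simp add: Ls cvec.scale_sum_right)
 finally have 4: "(SUM b:Bs m. L (du m b) (br (f i) (br b y))) = - (of_real (d i * pr (up m) i) *. L (f i) y)"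
  unfolding dn_expand[OF m y] using L(2)[of y "f i"] by simp
 have 5: "CS (Nl m) (%p q. L p (br (f i) (br q y))) =
  CS (Nl m) (%p q. L (br p (f i)) (br q y)) + CS (Nl m) (%p q. L (f i) (br p (br q y)))" unfolding CS_add[symmetric]
 proof (rule CS_cong)
  fix \<alpha> b assume a: "\<alpha> : Nl m" "b : Bs \<alpha>"
  then have \<alpha>: "\<alpha> ~= 0" "\<alpha> <= m" "\<alpha> ~= m" by (auto simp: Nl_def Nz_def)
  have md: "m - \<alpha> ~= 0" proof
   assume z: "m - \<alpha> = 0"
   have "m j <= \<alpha> j" for j using fun_cong[OF z, of j] by simp
   then have "m <= \<alpha>" by (simp add: le_fun_def)
   then show False using \<alpha>(2,3) by simp
  qed
  have sm: "\<alpha> + uvec i + (m - \<alpha>) = ?n" using \<alpha>(2) by (auto simp: fun_eq_iff le_fun_def)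
  show "L (du \<alpha> b) (br (f i) (br b y)) = L (br (du \<alpha> b) (f i)) (br b y) + L (f i) (br (du \<alpha> b) (br b y))"
   by (rule coc[OF du_W[OF \<alpha>(1) a(2)] f_W W_dn_diff[OF Bs_W[OF \<alpha>(1) a(2)] y \<alpha>(2)] sm \<alpha>(1) uvec_neq_0(1) md])
 qed
 have 6: "CS (Nl m) (%p q. L (f i) (br p (br q y))) = of_real (sq m) *. L (f i) y"
  unfolding CS_linear[OF cbilinear_right[OF L(1)], symmetric] Q by (simp add: Ls)
 have "CS (Nl ?n) (%p q. L p (br q (br (f i) y))) =
  CS (Nl ?n) (%p q. L p (br (br q (f i)) y)) + CS (Nl ?n) (%p q. L p (br (f i) (br q y)))"
  unfolding CS_add[symmetric] by (rule CS_cong) (subst jacobi, simp add: Ls)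
 also have "... = dc i *. L (f i) (br (ch (cr i)) y) - of_real (d i * pr (up m) i) *. L (f i) y + of_real (sq m) *. L (f i) y"
  unfolding 1 2 3 4 5 6 CS_shift[OF bil finite_Nl nz] by simp
 also have "... = of_real (sq ?n) *. L (f i) y" proof -
  define c where "c = complex_of_real (d i * pr (up m) i)"
  have 1: "dc i *. L (f i) (br (ch (cr i)) y) = - (c *. L (f i) y)" by (simp add: chy Ls scaleC_scaleC c_def)
  have 2: "complex_of_real (sq ?n) = of_real (sq m) - c - c" by (simp add: sq_step c_def)
  show ?thesis unfolding 1 2 c_def[symmetric] cvec.scale_left_diff_distrib by simp
 qed
 finally show ?thesis .
qed

text \<open>The step with \<open>L = br\<close>. The induction starts at a simple root, where the
  sum is empty and \<open>sq\<close> is 0.\<close>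

lemma partial_casimir_ad: "y : W (dn n) ==> n ~= 0 ==> CS (Nl n) (%p q. br p (br q y)) = of_real (sq n) *. y"
proof (induction "height n" arbitrary: n y rule: less_induct)
 case less
 have lin: "clinear (%y. CS (Nl n) (%p q. br p (br q y)) - of_real (sq n) *. y)"
  by (rule clinearI) (simp_all add: CS_def br_simps sum.distrib cvec.scale_sum_right scaleC_add_right
    cvec.scale_left_commute cvec.scale_right_diff_distrib)
 have "ad.QS n \<subseteq> {y. CS (Nl n) (%p q. br p (br q y)) - of_real (sq n) *. y = 0}"
 proof (rule ad.QS_minimal[OF subspace_zeros[OF lin]])
  fix w :: "'i list" assume w: "w ~= []" "cnt w = n"
  then obtain i v where iv: "w = i # v" by (cases w) auto
  have n: "n = cnt v + uvec i" using w(2) unfolding iv cnt_Cons by simp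
  show "wrd (%i. br (f i)) f w : {y. CS (Nl n) (%p q. br p (br q y)) - of_real (sq n) *. y = 0}" proof (cases "v = []")
   case True
   then have "n = uvec i" unfolding n by simp
   moreover have "Nl (uvec i) = {}" using height_Nl[of _ "uvec i"] by (fastforce simp: Nl_def Nz_def)
   ultimately show ?thesis by (simp add: CS_def sq_unit)
  next case False
   let ?u = "wrd (%i. br (f i)) f v"
   have v0: "cnt v ~= 0" using False by simp
   have u: "?u : W (dn (cnt v))" unfolding W_dn[OF v0] by (rule ad.wrd_Q_in[OF False])
   have h: "height (cnt v) < height n" unfolding n height_add height_uvec by simp
   have "CS (Nl n) (%p q. br p (br q (br (f i) ?u))) = of_real (sq n) *. br (f i) ?u"
    unfolding n by (rule partial_casimir_step[OF br_bilinear br_anti jacobi u v0 less.hyps[OF h u v0]])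
   then show ?thesis unfolding iv using False by simp
  qed
 qed
 then show ?case using less.prems by (auto simp: W_dn)
qed

end

text \<open>No Serre relation is among the axioms: local nilpotency and integral weights turn out to
  force them.\<close>

locale intm = chev sr cr E F H for sr :: "'i::finite => 'h::complex_vector => complex" and cr :: "'i => 'h"
  and E F :: "'i => 'y::complex_vector => 'y" and H :: "'h => 'y => 'y" +
 assumes nilE: "!!i v. EX n. (E i ^^ n) v = 0" and nilF: "!!i v. EX n. (F i ^^ n) v = 0"
  and diag: "!!x. x : cvec.span {v. \<exists>\<mu>. (ALL h. H h v = \<mu> h *. v) & (ALL i. \<exists>m::int. \<mu> (cr i) = of_int m)}"
begin

lemma intm_swap: "intm sr cr F E (%h y. - H h y)"
proof (rule intm.intro[OF chev_swap], rule intm_axioms.intro)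
 fix x :: 'y
 have "{v. \<exists>\<mu>. (ALL h. H h v = \<mu> h *. v) & (ALL i. \<exists>m::int. \<mu> (cr i) = of_int m)} \<subseteq>
  {v. \<exists>\<mu>. (ALL h. - H h v = \<mu> h *. v) & (ALL i. \<exists>m::int. \<mu> (cr i) = of_int m)}" proof safe
  fix v \<mu> assume a: "ALL h. H h v = \<mu> h *. v" "ALL i. \<exists>m::int. \<mu> (cr i) = of_int m"
  have "\<exists>m::int. - \<mu> (cr i) = of_int m" for i proof -
   obtain m :: int where "\<mu> (cr i) = of_int m" using a(2) by blast
   then show ?thesis by (intro exI[of _ "- m"]) simp
  qed
  then show "\<exists>\<mu>. (ALL h. - H h v = \<mu> h *. v) & (ALL i. \<exists>m::int. \<mu> (cr i) = of_int m)"
   using a(1) by (intro exI[of _ "%h. - \<mu> h"]) simp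
 qed
 from cvec.span_mono[OF this] diag[of x]
 show "x : cvec.span {v. \<exists>\<mu>. (ALL h. - H h v = \<mu> h *. v) & (ALL i. \<exists>m::int. \<mu> (cr i) = of_int m)}" by blast
qed (fact nilF nilE)+

end

lemma (in km) sl2_chev: "chev sr cr E F H ==> sl2 (E k) (F k) (H (cr k))" by (rule sl2.intro)
  (simp_all add: chev.E_lin chev.F_lin cbilinear_right[OF chev.H_bil] chev.EF chev.HE chev.HF sr_cr A_diag)

text \<open>The pairs \<open>(e i, E i)\<close>, \<open>(f i, F i)\<close> and
  \<open>(ch h, H h)\<close> generate a Lie algebra inside the product of the given one with the
  endomorphisms of the module. The operators extend to a representation once \<open>pa.D\<close>,
  its underlying space, is known to be a graph.\<close>

locale gk = km A sr cr br ch e f d + intm sr cr E F H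
 for A :: "'i::finite => 'i => int" and sr :: "'i => 'h::complex_vector => complex" and cr
  and br :: "'g::complex_vector => 'g => 'g" and ch e f d and E F :: "'i => 'y::complex_vector => 'y" and H :: "'h => 'y => 'y"
begin

lemma gk_swap: "gk A sr cr br (%h. - ch h) f e d F E (%h y. - H h y)" by (intro gk.intro swap intm_swap)

lemma clin_H: "clinear (H h)" by (rule cbilinear_right[OF H_bil])

sublocale pa: lieg sr cr "pbr br cm" "%i. (e i, Clin (E i))" "%i. (f i, Clin (F i))" "%h. (ch h, Clin (H h))"
proof (rule lieg.intro)
 show "lie_algebra (pbr br cm)" by (rule lie_pbr[OF lie lie_cm])
 show "clinear (%h. (ch h, Clin (H h)))" by (rule clinearI) (auto simp: clinear_simps[OF ch_lin] Hl clin_H intro!: clin_eqI)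
qed (auto simp: pbr_def e_f h_e h_f ch_ch E_lin F_lin clin_H EF HE HF HH app_simps zero_prod_def intro!: clin_eqI)

lemma fst_QS:
 assumes p: "p : pa.QS n" and n: "n ~= 0"
 shows "fst p : W (dn n)"
proof -
 have "br (ch h) (fst p) = - wt (up n) h *. fst p" for h
  using arg_cong[OF pa.R_QS[OF p, of h], of fst] by (simp add: pbr_def ad.wt_def pa.wt_def)
 then show ?thesis using ad.wt_uminus[of "up n"] by (simp add: W_def neg_up)
qed

lemma wrd_fst: "fst (wrd (%i. pbr br cm (f i, Clin (F i))) (%i. (f i, Clin (F i))) w) = wrd (%i. br (f i)) f w"
 by (induction w) (simp_all add: pbr_def)

lemma fst_QS_onto:
 assumes n: "n ~= 0" and x: "x : W (dn n)"
 shows "\<exists>\<phi>. (x, \<phi>) : pa.QS n"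
proof -
 have "ad.QS n \<subseteq> fst ` pa.QS n" proof (rule ad.QS_minimal)
  show "cvec.subspace (fst ` pa.QS n)" by (rule cpair.linear_subspace_image[OF _ pa.subspace_QS]) (rule clinearI, simp_all)
  show "wrd (%i. br (f i)) f w : fst ` pa.QS n" if "w ~= []" "cnt w = n" for w
   using pa.wrd_Q_in[OF that(1)] wrd_fst[of w] that(2) by force
 qed
 then show ?thesis using x n by (force simp: W_dn)
qed

text \<open>\<open>z\<close> commutes with \<open>E k\<close> and shifts the weights of the k-th sl2
  by \<open>- pr (up n) k\<close>; by \<open>sl2_negative_hom\<close> a negative shift is impossible
  for a nonzero \<open>z\<close>.\<close>

lemma antidominant_or_0:
 assumes c: "!!k. cm (Clin (E k)) z = 0" and h: "!!h. cm (Clin (H h)) z = - wt (up n) h *. z" and z: "z ~= 0"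
 shows "pr (up n) k <= 0"
proof (rule ccontr)
 assume "\<not> pr (up n) k <= 0"
 then have neg: "- pr (up n) k < 0" by simp
 have comm: "app z (E k v) = E k (app z v)" for v using arg_cong[OF c[of k], of "%\<phi>. app \<phi> v"] by (simp add: E_lin)
 have wt: "H (cr k) (app z v) = (m + of_int (- pr (up n) k)) *. app z v" if "H (cr k) v = m *. v" for v m proof -
  have "H (cr k) (app z v) - app z (H (cr k) v) = - of_int (pr (up n) k) *. app z v"
   using arg_cong[OF h[of "cr k"], of "%\<phi>. app \<phi> v"] by (simp add: clin_H wt_cr)
  then show ?thesis by (simp add: that app_simps algebra_simps scaleC_add_left)
 qed
 have s: "sl2 (E k) (F k) (H (cr k))" by (rule sl2_chev) unfold_locales
 have "{v. \<exists>\<mu>. (ALL h. H h v = \<mu> h *. v) & (ALL i. \<exists>m::int. \<mu> (cr i) = of_int m)} \<subseteq> {v. app z v = 0}"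
 proof safe
  fix v \<mu> assume v: "ALL h. H h v = \<mu> h *. v" "ALL i. \<exists>m::int. \<mu> (cr i) = of_int m"
  obtain m :: int where m: "\<mu> (cr k) = of_int m" using v(2) by blast
  obtain N where N: "(F k ^^ N) v = 0" using nilF by blast
  have "H (cr k) v = of_int m *. v" using v(1) m by simp
  from sl2_negative_hom[OF s s clinear_app comm wt neg nilE nilF this N] show "app z v = 0" .
 qed
 then have "cvec.span {v. \<exists>\<mu>. (ALL h. H h v = \<mu> h *. v) & (ALL i. \<exists>m::int. \<mu> (cr i) = of_int m)} \<subseteq> {v. app z v = 0}"
  by (rule cvec.span_minimal[OF _ subspace_zeros[OF clinear_app]])
 then have "app z v = 0" for v using diag[of v] by blast
 then have "z = 0" by (intro clin_eqI) simp
 then show False using z by simp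
qed

text \<open>Injectivity in each degree of \<open>Nl n\<close> gives it on their span, because the
  first components lie in independent root spaces.\<close>

lemma partial_lift:
 assumes "ALL m:Nl n. \<forall>\<phi>. (0, \<phi>) : pa.QS m --> \<phi> = 0"
 obtains \<tau> where "clinear \<tau>" "!!m p. m : Nl n ==> p : pa.QS m ==> snd p = \<tau> (fst p)"
  "!!m x. m : Nl n ==> x : W (dn m) ==> (x, \<tau> x) : pa.QS m"
proof -
 let ?\<Gamma> = "cvec.span (\<Union>m\<in>Nl n. pa.QS m)"
 have IH: "m : Nl n ==> (0, \<phi>) : pa.QS m ==> \<phi> = 0" for m \<phi> using assms by blast
 have inj: "\<phi> = 0" if \<phi>: "(0, \<phi>) : ?\<Gamma>" for \<phi> proof -
  obtain K g where K: "finite K" "K \<subseteq> Nl n" "ALL m:K. g m : pa.QS m" "(0, \<phi>) = (SUM m:K. g m)"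
   using span_UN_decomp[OF pa.subspace_QS \<phi>] by (elim exE conjE)
  have inj_dn: "inj_on dn K" by (auto simp: inj_on_def fun_eq_iff)
  have nz: "m ~= 0" if "m : K" for m using that K(2) by (auto simp: Nl_def Nz_def)
  have f0: "fst (g m) = 0" if m: "m : K" for m proof -
   have s0: "(SUM m:K. fst (g m)) = 0" unfolding fst_sum[symmetric] K(4)[symmetric] by simp
   define g' where "g' z = fst (g (the_inv_into K dn z))" for z
   have g': "g' (dn m) = fst (g m)" if "m : K" for m unfolding g'_def the_inv_into_f_f[OF inj_dn that] ..
   have "(SUM z:dn ` K. g' z) = 0" unfolding sum.reindex[OF inj_dn] comp_def using s0 g' by (simp cong: sum.cong)
   moreover have "g' z : W z" if "z : dn ` K" for z proof -
    obtain m where m: "m : K" "z = dn m" using \<open>z \<in> dn ` K\<close> by blast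
    show ?thesis unfolding m(2) g'[OF m(1)] using fst_QS nz K(3) m(1) by blast
   qed
   ultimately have "g' (dn m) = 0" using W_indep[of "dn ` K" g' "dn m"] K(1) m by blast
   then show ?thesis using g'[OF m] by simp
  qed
  have z: "snd (g m) = 0" if m: "m : K" for m proof (rule IH)
   show "m : Nl n" using K(2) m by blast
   have "(0, snd (g m)) = g m" using f0[OF m] by (simp add: prod_eq_iff)
   then show "(0, snd (g m)) : pa.QS m" using K(3) m by simp
  qed
  have "\<phi> = snd (0 :: 'g, \<phi>)" by simp
  also have "... = (SUM m:K. snd (g m))" unfolding K(4) snd_sum ..
  finally show ?thesis using z by simp
 qed
 obtain \<tau> where \<tau>: "clinear \<tau>" "!!x y. (x, y) : ?\<Gamma> ==> y = \<tau> x"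
  using graph_clinear[OF cvec.subspace_span inj] by blast
 have base: "p : ?\<Gamma>" if "m : Nl n" "p : pa.QS m" for m p by (rule cvec.span_base) (use that in blast)
 have 2: "snd p = \<tau> (fst p)" if "m : Nl n" "p : pa.QS m" for m p by (rule \<tau>(2)) (use base[OF that] in simp)
 show ?thesis proof (rule that[OF \<tau>(1) 2])
  fix m x assume m: "m : Nl n" and x: "x : W (dn m)"
  then have "m ~= 0" by (simp add: Nl_def Nz_def)
  then obtain \<phi> where "(x, \<phi>) : pa.QS m" using fst_QS_onto x by blast
  then show "(x, \<tau> x) : pa.QS m" using 2[OF m, of "(x, \<phi>)"] by simp
 qed
qed

text \<open>In a counterexample of least height, \<open>z\<close> commutes with every
  \<open>E k\<close>, so \<open>n\<close> is antidominant and \<open>sq n\<close> is positive. On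
  pairs of degree \<open>n\<close> the Casimir sum \<open>CS (Nl n)\<close> formed with the partial
  lift equals \<open>sq n\<close> times the second component, yet it depends on the first component
  only, which is 0 here.\<close>

lemma QS_injective: "(0, z) : pa.QS n ==> z = 0"
proof (induction "height n" arbitrary: n z rule: less_induct)
 case less
 consider "n = 0" | k where "n = uvec k" | "n ~= 0" "!!k. n ~= uvec k" by blast
 then show ?case proof cases
  case 1 then show ?thesis using less.prems pa.QS_0 by (auto simp: zero_prod_def)
 next case 2
  have "(0, z) : cvec.span {(f k, Clin (F k))}" using less.prems unfolding 2 pa.QS_unit .
  then obtain c where "(0, z) = c *. (f k, Clin (F k))" unfolding cvec.span_singleton by (rule rangeE)
  then show ?thesis using f_neq_0[of k] by auto
 next case 3
  have c: "cm (Clin (E k)) z = 0" for k proof (cases "n k = 0")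
   case True
   show ?thesis using pa.P_QS_0[OF less.prems True] by (simp add: pbr_def zero_prod_def)
  next case False
   then have nk: "n - uvec k + uvec k = n" by (intro diff_uvec) simp
   have h: "height (n - uvec k) < height n"
    using height_add[of "n - uvec k" "uvec k"] by (simp only: nk height_uvec)
   have "pbr br cm (e k, Clin (E k)) (0, z) : pa.QS (n - uvec k)" using pa.P_QS[OF less.prems _ 3(2)] False by simp
   then show ?thesis using less.hyps[OF h] by (simp add: pbr_def br_simps)
  qed
  have h: "cm (Clin (H h)) z = - wt (up n) h *. z" for h
   using arg_cong[OF pa.R_QS[OF less.prems, of h], of snd] by (simp add: pbr_def ad.wt_def pa.wt_def)
  show ?thesis proof (rule ccontr)
   assume z: "z ~= 0"
   have s: "0 < sq n" by (rule sq_antidominant[OF 3(1) antidominant_or_0[OF c h z]])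
   have IH: "ALL m:Nl n. \<forall>\<phi>. (0, \<phi>) : pa.QS m --> \<phi> = 0" using less.hyps height_Nl by blast
   obtain \<tau> where \<tau>: "clinear \<tau>" "!!m p. m : Nl n ==> p : pa.QS m ==> snd p = \<tau> (fst p)"
    "!!m x. m : Nl n ==> x : W (dn m) ==> (x, \<tau> x) : pa.QS m" using partial_lift[OF IH] by blast
   define L where "L x y = cm (\<tau> x) (\<tau> y)" for x y
   note cmb = cbilinear_simps[OF lie_cm[unfolded lie_algebra_def, THEN conjunct1]]
   have Lb: "cbilinear L" by (rule cbilinearI) (simp_all add: L_def clinear_simps[OF \<tau>(1)] cmb)
   have La: "L x y = - L y x" for x y unfolding L_def by (rule lie_anti[OF lie_cm])
   have Nl_sum: "\<alpha> + \<beta> : Nl n" "\<alpha> : Nl n" "\<beta> : Nl n"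
    if "\<alpha> + \<beta> + \<gamma> = n" "\<alpha> ~= 0" "\<beta> ~= 0" "\<gamma> ~= 0" for \<alpha> \<beta> \<gamma> proof -
    have "\<alpha> ~= \<alpha> + \<beta> + \<gamma>" "\<beta> ~= \<alpha> + \<beta> + \<gamma>" "\<alpha> + \<beta> ~= \<alpha> + \<beta> + \<gamma>" "\<alpha> + \<beta> ~= 0"
     using that(2-4) by (auto simp: fun_eq_iff)
    then show "\<alpha> + \<beta> : Nl n" "\<alpha> : Nl n" "\<beta> : Nl n"
     unfolding that(1)[symmetric] using that(2-4) by (auto simp: Nl_def Nz_def le_fun_def)
   qed
   have \<tau>br: "\<tau> (br x y) = cm (\<tau> x) (\<tau> y)"
    if "x : W (dn \<alpha>)" "y : W (dn \<beta>)" "\<alpha> + \<beta> + \<gamma> = n" "\<alpha> ~= 0" "\<beta> ~= 0" "\<gamma> ~= 0" for x y \<alpha> \<beta> \<gamma>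
   proof -
    note N = Nl_sum[OF that(3-6)]
    have "pbr br cm (x, \<tau> x) (y, \<tau> y) : pa.QS (\<alpha> + \<beta>)"
     by (rule pa.QS_br[OF \<tau>(3)[OF N(2) that(1)] \<tau>(3)[OF N(3) that(2)] that(5)])
    from \<tau>(2)[OF N(1) this] show ?thesis by (simp add: pbr_def)
   qed
   have coc: "L x (br y y') = L (br x y) y' + L y (br x y')"
    if "x : W (dn \<alpha>)" "y : W (dn \<beta>)" "y' : W (dn \<gamma>)" "\<alpha> + \<beta> + \<gamma> = n" "\<alpha> ~= 0" "\<beta> ~= 0" "\<gamma> ~= 0"
    for x y y' \<alpha> \<beta> \<gamma> proof -
    have "\<beta> + \<gamma> + \<alpha> = n" "\<alpha> + \<gamma> + \<beta> = n" using that(4) by (simp_all only: add_ac)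
    with \<tau>br[OF that(1,2,4)] \<tau>br[OF that(2,3), of \<alpha>] \<tau>br[OF that(1,3), of \<beta>] that(5-7)
    show ?thesis unfolding L_def using lie_jacobi[OF lie_cm] by simp
   qed
   have lin: "clinear (%p. CS (Nl n) (%p' q. L p' (br q (fst p))) - of_real (sq n) *. snd p)"
    by (rule clinearI) (simp_all add: CS_def br_simps cbilinear_simps[OF Lb] sum.distrib cvec.scale_sum_right
      scaleC_add_right cvec.scale_left_commute cvec.scale_right_diff_distrib)
   have "pa.QS n \<subseteq> {p. CS (Nl n) (%p' q. L p' (br q (fst p))) - of_real (sq n) *. snd p = 0}"
   proof (rule pa.QS_minimal[OF subspace_zeros[OF lin]])
    fix w :: "'i list" assume w: "w ~= []" "cnt w = n"
    then obtain i v where iv: "w = i # v" by (cases w) auto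
    have n: "cnt v + uvec i = n" using w(2) unfolding iv cnt_Cons by simp
    have v: "v ~= []" using 3(2)[of i] n by auto
    let ?p = "wrd (%i. pbr br cm (f i, Clin (F i))) (%i. (f i, Clin (F i))) v"
    have v0: "cnt v ~= 0" using v by simp
    have "height n = length v + 1" unfolding n[symmetric] height_add height_uvec height_cnt ..
    then have "cnt v ~= n" "uvec i ~= n" using v by (auto simp: height_cnt[symmetric])
    then have N: "cnt v : Nl n" "uvec i : Nl n" unfolding n[symmetric] using v0 by (auto simp: Nl_def Nz_def le_fun_def)
    have p: "?p : pa.QS (cnt v)" by (rule pa.wrd_Q_in[OF v])
    have "(f i, Clin (F i)) : pa.QS (uvec i)" by (simp add: pa.QS_unit cvec.span_base)
    from \<tau>(2)[OF N(2) this] have fi: "Clin (F i) = \<tau> (f i)" by simp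
    have fp: "fst ?p : W (dn (cnt v))" by (rule fst_QS[OF p v0])
    have "CS (Nl (cnt v + uvec i)) (%p q. L p (br q (br (f i) (fst ?p)))) = of_real (sq (cnt v + uvec i)) *. L (f i) (fst ?p)"
     by (rule partial_casimir_step[OF Lb La _ fp v0 partial_casimir_ad[OF fp v0]]) (rule coc, unfold n)
    then show "wrd (%i. pbr br cm (f i, Clin (F i))) (%i. (f i, Clin (F i))) w \<in>
     {p. CS (Nl n) (%p' q. L p' (br q (fst p))) - of_real (sq n) *. snd p = 0}"
     unfolding n iv using v \<tau>(2)[OF N(1) p] fi by (simp add: pbr_def L_def)
   qed
   then have "CS (Nl n) (%p' q. L p' (br q 0)) - of_real (sq n) *. z = 0" using less.prems by force
   then have "of_real (sq n) *. z = 0" by (simp add: CS_def br_simps cbilinear_simps[OF Lb])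
   then show False using s z by simp
  qed
 qed
qed

lemma D_injective:
 assumes "(0, z) : pa.D"
 shows "z = 0"
proof -
 interpret sw: gk A sr cr br "%h. - ch h" f e d F E "%h y. - H h y" by (rule gk_swap)
 have PS: "z = 0" if "(0, z) : pa.PS n" for n z using sw.QS_injective[of z n] that unfolding pa.PS_def sw.pa.QS_def by blast
 obtain Z g where Z: "finite Z" "ALL z:Z. g z : pa.gr z" "(0, z) = (SUM z:Z. g z)" using pa.D_decomp[OF assms] by (elim exE conjE)
 have R: "pbr br cm (ch h, Clin (H h)) (g y) = wt y h *. g y" if y: "y : Z" for y h
  using pa.R_gr[of "g y" y h] Z(2) y by (simp add: ad.wt_def pa.wt_def)
 have g1: "fst (g y) : W y" if "y : Z" for y using arg_cong[OF R[OF that], of fst] by (simp add: W_def pbr_def)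
 have z0: "(SUM y:Z. fst (g y)) = 0" unfolding fst_sum[symmetric] Z(3)[symmetric] by simp
 have s0: "snd (g y) = 0" if y: "y : Z" for y proof -
  have f0: "fst (g y) = 0" by (rule W_indep[OF Z(1) g1 z0 y])
  then have gy: "g y = (0, snd (g y))" by (metis prod.collapse)
  have gr: "g y : pa.gr y" using Z(2) y by blast
  consider "y = 0" | "y ~= 0" "ALL i. 0 <= y i" | "y ~= 0" "\<not> (ALL i. 0 <= y i)" "ALL i. y i <= 0"
   | "y ~= 0" "\<not> (ALL i. 0 <= y i)" "\<not> (ALL i. y i <= 0)" by blast
  then show ?thesis proof cases
   case 1
   then have "pa.gr y = range (%h. (ch h, Clin (H h)))" by (simp add: pa.gr_def)
   then obtain h where h: "g y = (ch h, Clin (H h))" using gr by blast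
   then have "ch h = ch 0" using f0 by (simp add: clinear_0[OF ch_lin])
   then have "h = 0" using ch_inj by (simp add: inj_eq)
   then show ?thesis using h clin_H[of 0] by (intro clin_eqI) (simp add: Hl)
  next case 2
   then show ?thesis using PS gr gy unfolding pa.gr_def by auto
  next case 3
   then have "g y : pa.QS (%i. nat (- y i))" using gr unfolding pa.gr_def by (simp only: 3 if_False if_True simp_thms)
   then have "(0, snd (g y)) : pa.QS (%i. nat (- y i))" using gy by simp
   then show ?thesis by (rule QS_injective)
  next case 4
   then have "g y : {0}" using gr unfolding pa.gr_def by (simp only: 4 if_False if_True simp_thms)
   then show ?thesis by simp
  qed
 qed
 have "z = snd (0 :: 'g, z)" by simp
 also have "... = (SUM y:Z. snd (g y))" unfolding Z(3) snd_sum ..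
 finally show ?thesis using s0 by simp
qed

text \<open>\<open>pa.D\<close> is now the graph of a linear map on the whole algebra, and its
  closure under brackets makes that map a homomorphism to endomorphisms.\<close>

theorem module_exists:
 "\<exists>\<rho>. lie_module br \<rho> & (ALL i. \<rho> (e i) = E i) & (ALL i. \<rho> (f i) = F i) & (ALL h. \<rho> (ch h) = H h)"
proof -
 obtain \<tau> where \<tau>: "clinear \<tau>" "!!x y. (x, y) : pa.D ==> y = \<tau> x"
  using graph_clinear[OF pa.subspace_D D_injective] by blast
 have D: "(x, \<tau> x) : pa.D" for x proof -
  have ex: "(x, \<phi>) : pa.D ==> (x, \<tau> x) : pa.D" for x \<phi> using \<tau>(2)[of x \<phi>] by (simp only:)
  show ?thesis proof (induction x rule: gen_induct)
   case (h h)
   show ?case by (rule ex[OF pa.D_base(1)])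
  next case (e i)
   show ?case by (rule ex[OF pa.a_in_D])
  next case (f i)
   show ?case by (rule ex[OF pa.b_in_D])
  next case (add x y)
   from cvec.subspace_add[OF pa.subspace_D this] show ?case by (simp add: clinear_add[OF \<tau>(1)])
  next case (scale c x)
   from cvec.subspace_scale[OF pa.subspace_D this, of c] show ?case by (simp add: clinear_scale[OF \<tau>(1)])
  next case (br x y)
   have "pbr br cm (x, \<tau> x) (y, \<tau> y) = (br x y, cm (\<tau> x) (\<tau> y))" by (simp only: pbr_def fst_conv snd_conv)
   with pa.D_br[OF br] show ?case by (intro ex[of "br x y" "cm (\<tau> x) (\<tau> y)"]) (simp only:)
  qed
 qed
 have br: "\<tau> (br x y) = cm (\<tau> x) (\<tau> y)" for x y proof -
  have "pbr br cm (x, \<tau> x) (y, \<tau> y) = (br x y, cm (\<tau> x) (\<tau> y))" by (simp only: pbr_def fst_conv snd_conv)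
  with pa.D_br[OF D[of x] D[of y]] have "(br x y, cm (\<tau> x) (\<tau> y)) : pa.D" by (simp only:)
  from \<tau>(2)[OF this] show ?thesis by (rule sym)
 qed
 have gen: "\<tau> (e i) = Clin (E i)" "\<tau> (f i) = Clin (F i)" "\<tau> (ch h) = Clin (H h)" for i h
  using \<tau>(2)[OF pa.a_in_D] \<tau>(2)[OF pa.b_in_D] \<tau>(2)[OF pa.D_base(1)] by (simp_all only:)
 show ?thesis proof (intro exI[of _ "%x. app (\<tau> x)"] conjI allI)
  show "lie_module br (%x. app (\<tau> x))" unfolding lie_module_def proof (intro conjI allI)
   show "cbilinear (%x. app (\<tau> x))"
    by (rule cbilinearI) (simp_all add: clinear_add[OF \<tau>(1)] clinear_scale[OF \<tau>(1)] app_simps)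
  qed (simp add: br)
 qed (simp_all add: gen E_lin F_lin clin_H)
qed

end

section \<open>Serre relations and nilpotency\<close>

lemma subspace_nil:
 fixes F :: "'y::complex_vector => 'y"
 assumes F: "clinear F" and K: "cvec.subspace K" "!!x. x : K ==> F x : K"
 shows "cvec.subspace {x. EX n. (F ^^ n) x : K}"
proof -
 note Fl = clinear_simps[OF clinear_funpow[OF F]]
 have up: "(F ^^ m) x : K" if "(F ^^ n) x : K" "n <= m" for n m x proof -
  have "(F ^^ k) y : K" if "y : K" for y k using that by (induction k) (auto intro: K(2))
  moreover have "(F ^^ m) x = (F ^^ (m - n)) ((F ^^ n) x)" using that(2) funpow_add[of "m - n" n F] by (simp add: fun_eq_iff)
  ultimately show ?thesis using that(1) by simp
 qed
 show ?thesis proof (rule cvec.subspaceI)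
  show "0 : {x. EX n. (F ^^ n) x : K}" using cvec.subspace_0[OF K(1)] by (auto intro: exI[of _ 0])
 next fix x y assume "x : {x. EX n. (F ^^ n) x : K}" "y : {x. EX n. (F ^^ n) x : K}"
  then obtain n m where "(F ^^ n) x : K" "(F ^^ m) y : K" by blast
  then have "(F ^^ max n m) x : K" "(F ^^ max n m) y : K" using up by (meson max.cobounded1 max.cobounded2)+
  then have "(F ^^ max n m) (x + y) : K" unfolding Fl by (rule cvec.subspace_add[OF K(1)])
  then show "x + y : {x. EX n. (F ^^ n) x : K}" by blast
 next fix c x assume "x : {x. EX n. (F ^^ n) x : K}"
  then obtain n where "(F ^^ n) x : K" by blast
  then have "(F ^^ n) (c *. x) : K" unfolding Fl by (rule cvec.subspace_scale[OF K(1)])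
  then show "c *. x : {x. EX n. (F ^^ n) x : K}" by blast
 qed
qed

text \<open>With \<open>D k = (ad F)\<^sup>k (D 0)\<close>: if \<open>ad F\<close> is nilpotent on \<open>D 0\<close>, then \<open>D 0\<close> preserves the vectors killed
 by a power of \<open>F\<close>.\<close>

lemma nil_derivation:
 fixes F :: "'y::complex_vector => 'y"
 assumes F: "clinear F" and K: "cvec.subspace K" "!!x. x : K ==> F x : K"
  and D: "!!k x. x : T ==> F (D k x) = D k (F x) + D (Suc k) x" and T: "!!x. x : T ==> F x : T"
  and DK: "!!k x. x : T ==> x : K ==> D k x : K" and DN: "!!x. x : T ==> D N x : K" and x: "x : T" "(F ^^ m) x : K"
 shows "(F ^^ (m + N)) (D 0 x) : K"
proof -
 have pow: "(F ^^ r) y : K" if "y : K" for r y using that by (induction r) (auto intro: K(2))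
 have "(F ^^ r) (D k x) : K" if "m + (N - k) <= r" "k <= N" "x : T" "(F ^^ m) x : K" for r m k x using that
 proof (induction r arbitrary: m k x)
  case 0
  then have "k = N" by simp
  then show ?case using DN[OF 0(3)] by simp
 next case (Suc r)
  show ?case proof (cases "k = N")
   case True then show ?thesis using pow[OF DN[OF Suc.prems(3)]] by blast
  next case False
   show ?thesis proof (cases m)
    case 0
    show ?thesis proof -
     have "x : K" using Suc.prems(4) 0 by simp
     from pow[OF DK[OF Suc.prems(3) this]] show ?thesis .
    qed
   next case (Suc m')
    have 1: "(F ^^ r) (D k (F x)) : K" proof (rule Suc.IH)
     show "m' + (N - k) <= r" using Suc.prems(1) Suc by simp
     show "(F ^^ m') (F x) : K" using Suc.prems(4) Suc by (simp add: funpow_swap1)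
    qed (use Suc.prems T in auto)
    have 2: "(F ^^ r) (D (Suc k) x) : K" by (rule Suc.IH[of m]) (use Suc.prems False in auto)
    have "(F ^^ Suc r) (D k x) = (F ^^ r) (D k (F x)) + (F ^^ r) (D (Suc k) x)"
     using D[OF Suc.prems(3)] clinear_add[OF clinear_funpow[OF F]] by (simp add: funpow_swap1)
    then show ?thesis using cvec.subspace_add[OF K(1) 1 2] by simp
   qed
  qed
 qed
 from this[of m 0 "m + N" x] show ?thesis using x by simp
qed

context lieg
begin

lemma sl2_ad: "sr i (cr i) = 2 ==> sl2 (\<beta> (a i)) (\<beta> (b i)) (\<beta> (c (cr i)))"
 by (rule sl2.intro) (simp_all add: cbilinear_right[OF bil] PQ RP RQ)

text \<open>For \<open>k = i\<close> this is the sl2 formula at the exponent where its coefficient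
  vanishes. For \<open>k = j\<close> the bracket turns \<open>b j\<close> into a coroot; its bracket
  with \<open>b i\<close> is a multiple of \<open>b i\<close>, which is 0 or is killed by the next
  bracket. Any other \<open>k\<close> commutes with both letters.\<close>

lemma serre_singular:
 assumes A: "!!i j. sr j (cr i) = of_int (A i j)" "!!i. A i i = 2" "!!i j. i ~= j ==> A i j <= 0"
  "!!i j. A i j = 0 ==> A j i = 0" and ij: "i ~= j"
 shows "\<beta> (a k) ((\<beta> (b i) ^^ nat (1 - A i j)) (b j)) = 0"
proof -
 have N: "nat (1 - A i j) = Suc (nat (- A i j))" using A(3)[OF ij] by simp
 consider "k = i" | "k = j" | "k ~= i" "k ~= j" by blast
 then show ?thesis proof cases
  case 1
  interpret s: sl2 "\<beta> (a i)" "\<beta> (b i)" "\<beta> (c (cr i))" by (rule sl2_ad) (simp add: A)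
  have h: "\<beta> (c (cr i)) (b j) = (- of_int (A i j)) *. b j" by (simp add: cb A)
  have "\<beta> (a i) (b j) = 0" using ij by (simp add: ab)
  note s.E_F_pow_highest[OF h this, of "nat (- A i j)"]
  moreover have "- of_int (A i j) - of_nat (nat (- A i j)) = (0 :: complex)" using A(3)[OF ij] by simp
  ultimately show ?thesis unfolding N 1 by (simp only: mult_zero_right cvec.scale_zero_left)
 next case 2
  have comm: "\<beta> (a j) (\<beta> (b i) y) = \<beta> (b i) (\<beta> (a j) y)" for y using PQ[of j i y] ij by simp
  have *: "\<beta> (a j) ((\<beta> (b i) ^^ n) y) = (\<beta> (b i) ^^ n) (\<beta> (a j) y)" for n y
   by (induction n) (simp_all add: comm)
  have 3: "\<beta> (b i) (\<beta> (a j) (b j)) = of_int (A j i) *. b i" by (simp add: ab Qc A)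
  show ?thesis proof (cases "A j i = 0")
   case True
   have "(\<beta> (b i) ^^ n) 0 = 0" for n by (induction n) (simp_all add: bs)
   then show ?thesis unfolding N 2 * using 3 True by (simp add: funpow_swap1)
  next case False
   then have "A i j ~= 0" using A(4)[of i j] by blast
   then obtain n where n: "nat (- A i j) = Suc n" using A(3)[OF ij] by (cases "nat (- A i j)") auto
   have "\<beta> (b i) (b i) = 0" using lie by (simp add: lie_algebra_def)
   then have "\<beta> (b i) (\<beta> (b i) (\<beta> (a j) (b j))) = 0" unfolding 3 by (simp add: bs)
   moreover have "(\<beta> (b i) ^^ n) 0 = 0" for n by (induction n) (simp_all add: bs)
   ultimately show ?thesis unfolding N n 2 * by (simp add: funpow_swap1)
  qed
 next case 3
  have comm: "\<beta> (a k) (\<beta> (b i) y) = \<beta> (b i) (\<beta> (a k) y)" for y using PQ[of k i y] 3 by simp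
  have *: "\<beta> (a k) ((\<beta> (b i) ^^ n) y) = (\<beta> (b i) ^^ n) (\<beta> (a k) y)" for n y
   by (induction n) (simp_all add: comm)
  have "(\<beta> (b i) ^^ n) 0 = 0" for n by (induction n) (simp_all add: bs)
  then show ?thesis unfolding * using 3 by (simp add: ab)
 qed
qed

end

context chev
begin

lemma chev_lieg: "lieg sr cr cm (%i. Clin (E i)) (%i. Clin (F i)) (%h. Clin (H h))"
proof (rule lieg.intro)
 have H: "clinear (H h)" for h by (rule cbilinear_right[OF H_bil])
 show "clinear (%h. Clin (H h))" by (rule clinearI) (auto simp: Hl H intro!: clin_eqI)
 show "cm (Clin (E i)) (Clin (F j)) = (if i = j then Clin (H (cr i)) else 0)" for i j
  by (rule clin_eqI) (simp add: E_lin F_lin H EF)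
 show "cm (Clin (H h)) (Clin (E i)) = sr i h *. Clin (E i)" for h i by (rule clin_eqI) (simp add: E_lin H HE)
 show "cm (Clin (H h)) (Clin (F i)) = - (sr i h *. Clin (F i))" for h i by (rule clin_eqI) (simp add: F_lin H HF)
 show "cm (Clin (H h)) (Clin (H h')) = 0" for h h' by (rule clin_eqI) (simp add: H HH[of h h'])
qed (rule lie_cm)

text \<open>The operator that should represent the k-fold bracket of \<open>f i\<close> with
  \<open>f j\<close>, formed from commutators because no representation of the algebra is available
  at this stage.\<close>

definition adF :: "'i => 'i => nat => 'y => 'y" where "adF i j k = app ((cm (Clin (F i)) ^^ k) (Clin (F j)))"

lemma adF_lin: "clinear (adF i j k)" unfolding adF_def by (rule clinear_app)
lemma adF_0 [simp]: "adF i j 0 x = F j x" by (simp add: adF_def F_lin)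
lemma adF_Suc: "F i (adF i j k x) = adF i j k (F i x) + adF i j (Suc k) x" by (simp add: adF_def F_lin)

lemma adF_stable: "cvec.subspace S ==> (!!i x. x : S ==> F i x : S) ==> x : S ==> adF i j k x : S"
proof (induction k arbitrary: x)
 case (Suc k)
 have "adF i j (Suc k) x = F i (adF i j k x) - adF i j k (F i x)" using adF_Suc[of i j k x] by simp
 then show ?case using Suc by (simp add: cvec.subspace_diff)
qed simp

end

sublocale km0 \<subseteq> lg: lieg sr cr br e f ch by (rule lieg.intro) (simp_all add: lie ch_lin e_f h_e h_f ch_ch)

context km
begin

lemma A_zero: "A i j = 0 ==> A j i = 0" using d_sym[of i j] d_pos[of j] by simp


abbreviation "sN i j \<equiv> nat (1 - A i j)"

lemma serre:
 assumes ij: "i ~= j"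
 shows "(br (f i) ^^ sN i j) (f j) = 0"
proof -
 have W: "(br (f i) ^^ k) (f j) : W (dn (%l. k * uvec i l + uvec j l))" for k proof (induction k)
  case 0 then show ?case using f_W by simp
 next case (Suc k)
  have "dn (uvec i) + dn (%l. k * uvec i l + uvec j l) = dn (%l. Suc k * uvec i l + uvec j l)"
   by (auto simp: fun_eq_iff)
  then show ?case using W_br[OF f_W Suc.IH, of i] by simp
 qed
 show ?thesis proof (rule singular_zero[OF W])
  show "(%l. sN i j * uvec i l + uvec j l) ~= 0" by (auto simp: fun_eq_iff intro!: exI[of _ j])
  show "br (e k) ((br (f i) ^^ sN i j) (f j)) = 0" for k by (rule lg.serre_singular[OF sr_cr A_diag A_off A_zero ij])
 qed
qed

lemma E_serre_commute:
 assumes "chev sr cr E F H" "i ~= j"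
 shows "E k (chev.adF F i j (sN i j) x) = chev.adF F i j (sN i j) (E k x)"
proof -
 interpret chev sr cr E F H by fact
 interpret l: lieg sr cr cm "%i. Clin (E i)" "%i. Clin (F i)" "%h. Clin (H h)" by (rule chev_lieg)
 have "cm (Clin (E k)) ((cm (Clin (F i)) ^^ sN i j) (Clin (F j))) = 0"
  by (rule l.serre_singular[OF sr_cr A_diag A_off A_zero assms(2)])
 from arg_cong[OF this, of "%\<phi>. app \<phi> x"] show ?thesis by (simp add: adF_def E_lin)
qed

lemma module_serre:
 assumes m: "lie_module br \<rho>" and ij: "i ~= j"
 shows "chev.adF (%i. \<rho> (f i)) i j (sN i j) x = 0"
proof -
 interpret chev sr cr "%i. \<rho> (e i)" "%i. \<rho> (f i)" "%h. \<rho> (ch h)" by (rule chev_module[OF m])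
 have "cm (Clin (\<rho> x)) (Clin (\<rho> y)) = Clin (\<rho> (br x y))" for x y
  by (rule clin_eqI) (simp only: app_cm app_Clin[OF lie_module_linear[OF m]] lie_module_bracket[OF m])
 then have "(cm (Clin (\<rho> (f i))) ^^ k) (Clin (\<rho> (f j))) = Clin (\<rho> ((br (f i) ^^ k) (f j)))" for k
  by (induction k) simp_all
 then show ?thesis
  unfolding adF_def using serre[OF ij] by (simp add: lie_module_linear[OF m] cbilinear_01[OF lie_module_bilinear[OF m]])
qed

text \<open>The quotient lives on the complement cut out by \<pi>. The compressed operators satisfy
  the Chevalley relations, are locally nilpotent because the original ones are so modulo
  \<open>K\<close>, and vanish on the kernel of \<pi>, which counts as weight 0. Then
  \<open>gk\<close> extends them to the algebra.\<close>

lemma quotient_module: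
 fixes E F :: "'i => 'y::complex_vector => 'y"
 assumes c: "chev sr cr E F H" and K: "cvec.subspace K" and T: "cvec.subspace T" "K \<subseteq> T"
  and sK: "!!i x. x : K ==> E i x : K" "!!i x. x : K ==> F i x : K" "!!h x. x : K ==> H h x : K"
  and sT: "!!i x. x : T ==> E i x : T" "!!i x. x : T ==> F i x : T" "!!h x. x : T ==> H h x : T"
  and nil: "!!i x. x : T ==> EX n. (E i ^^ n) x : K" "!!i x. x : T ==> EX n. (F i ^^ n) x : K"
  and dg: "T \<subseteq> cvec.span {v\<in>T. \<exists>\<mu>. (ALL h. H h v = \<mu> h *. v) & (ALL i. \<exists>m::int. \<mu> (cr i) = of_int m)}"
 obtains \<rho> :: "'g => 'y => 'y" and \<pi> :: "'y => 'y"
  where "lie_module br \<rho>" "clinear \<pi>" "!!x. x : T ==> \<pi> x = 0 \<longleftrightarrow> x : K"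
  "!!x i. x : T ==> \<rho> (e i) (\<pi> x) = \<pi> (E i x)" "!!x i. x : T ==> \<rho> (f i) (\<pi> x) = \<pi> (F i x)"
  "!!x h. x : T ==> \<rho> (ch h) (\<pi> x) = \<pi> (H h x)"
  "!!i x. EX n. (\<rho> (e i) ^^ n) x = 0" "!!i x. EX n. (\<rho> (f i) ^^ n) x = 0"
proof -
 interpret chev sr cr E F H by (rule c)
 obtain \<pi> where \<pi>: "clinear \<pi>" "!!x. \<pi> x : T" "!!x. \<pi> (\<pi> x) = \<pi> x"
  "!!x. x : T ==> x - \<pi> x : K" "!!x. x : K ==> \<pi> x = 0" using projection_exists[OF K T] by blast
 note ps = clinear_simps[OF \<pi>(1)]
 have H_lin: "clinear (H h)" for h by (rule cbilinear_right[OF H_bil])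
 have op: "\<pi> (G (\<pi> x)) = \<pi> (G x)" if "clinear G" "!!x. x : K ==> G x : K" "x : T" for G x proof -
  have "G (x - \<pi> x) : K" using that(2) \<pi>(4)[OF that(3)] by blast
  then have "\<pi> (G (x - \<pi> x)) = 0" by (rule \<pi>(5))
  then show ?thesis by (simp add: clinear_diff[OF that(1)] ps)
 qed
 have oE: "\<pi> (E i (\<pi> x)) = \<pi> (E i x)" and oF: "\<pi> (F i (\<pi> x)) = \<pi> (F i x)"
  and oH: "\<pi> (H h (\<pi> x)) = \<pi> (H h x)" if "x : T" for x i h
  using op[OF E_lin _ that, of i] op[OF F_lin _ that, of i] op[OF H_lin _ that, of h] sK by blast+
 let ?E = "%i x. \<pi> (E i (\<pi> x))" and ?F = "%i x. \<pi> (F i (\<pi> x))" and ?H = "%h x. \<pi> (H h (\<pi> x))"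
 have c': "chev sr cr ?E ?F ?H" proof (rule chev.intro)
  show "clinear (?E i)" "clinear (?F i)" for i by (rule clinearI, simp_all add: ps El Fl)+
  show "cbilinear ?H" by (rule cbilinearI) (simp_all add: ps Hl)
  fix i j h h' and y
  have t: "\<pi> y : T" by (rule \<pi>(2))
  show "?E i (?F j y) = ?F j (?E i y) + (if i = j then ?H (cr i) y else 0)"
   unfolding \<pi>(3) oE[OF sT(2)[OF t]] oF[OF sT(1)[OF t]] by (simp add: EF ps)
  show "?H h (?E i y) = ?E i (?H h y) + sr i h *. ?E i y"
   unfolding \<pi>(3) oE[OF sT(3)[OF t]] oH[OF sT(1)[OF t]] by (simp add: HE ps)
  show "?H h (?F i y) = ?F i (?H h y) - sr i h *. ?F i y"
   unfolding \<pi>(3) oF[OF sT(3)[OF t]] oH[OF sT(2)[OF t]] by (simp add: HF ps)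
  show "?H h (?H h' y) = ?H h' (?H h y)" unfolding \<pi>(3) oH[OF sT(3)[OF t]] by (simp add: HH[of h h'])
 qed
 have pow: "((%x. \<pi> (G (\<pi> x))) ^^ n) (\<pi> x) = \<pi> ((G ^^ n) x) & (G ^^ n) x : T"
  if "clinear G" "!!x. x : K ==> G x : K" "!!x. x : T ==> G x : T" "x : T" for G n x
  by (induction n) (use that op[OF that(1,2)] \<pi>(3) in auto)
 have nil': "EX n. ((%x. \<pi> (G (\<pi> x))) ^^ n) y = 0"
  if g: "clinear G" "!!x. x : K ==> G x : K" "!!x. x : T ==> G x : T" "!!x. x : T ==> EX n. (G ^^ n) x : K" for G y proof -
  obtain n where n: "(G ^^ n) (\<pi> y) : K" using g(4) \<pi>(2) by blast
  have t: "((%x. \<pi> (G (\<pi> x))) ^^ Suc n) y = \<pi> ((G ^^ Suc n) (\<pi> y))" proof -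
   have "((%x. \<pi> (G (\<pi> x))) ^^ Suc n) (\<pi> y) = ((%x. \<pi> (G (\<pi> x))) ^^ Suc n) y"
    by (simp only: funpow_Suc_right comp_apply \<pi>(3))
   then show ?thesis using pow[OF g(1-3) \<pi>(2), of "Suc n" y] by (simp only: \<pi>(3))
  qed
  have "(G ^^ Suc n) (\<pi> y) : K" using g(2)[OF n] by simp
  then show ?thesis using t \<pi>(5) by (intro exI[of _ "Suc n"]) (simp only:)
 qed
 have "intm sr cr ?E ?F ?H" proof (rule intm.intro[OF c'], rule intm_axioms.intro)
  show "EX n. (?E i ^^ n) v = 0" for i v by (rule nil'[OF E_lin sK(1) sT(1) nil(1)])
  show "EX n. (?F i ^^ n) v = 0" for i v by (rule nil'[OF F_lin sK(2) sT(2) nil(2)])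
  let ?S = "{v. \<exists>\<mu>. (ALL h. ?H h v = \<mu> h *. v) & (ALL i. \<exists>m::int. \<mu> (cr i) = of_int m)}"
  show "x : cvec.span ?S" for x proof -
   have "\<pi> y : cvec.span ?S" if "y : T" for y proof -
    have "{v\<in>T. \<exists>\<mu>. (ALL h. H h v = \<mu> h *. v) & (ALL i. \<exists>m::int. \<mu> (cr i) = of_int m)} \<subseteq> {y. \<pi> y : cvec.span ?S}"
    proof safe
     fix v \<mu> assume v: "v : T" "ALL h. H h v = \<mu> h *. v" "ALL i. \<exists>m::int. \<mu> (cr i) = of_int m"
     have "?H h (\<pi> v) = \<mu> h *. \<pi> v" for h using oH[OF v(1)] v(2) by (simp add: \<pi>(3) ps)
     then have "\<pi> v : ?S" using v(3) by blast
     then show "\<pi> v : cvec.span ?S" by (rule cvec.span_base)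
    qed
    from cvec.span_minimal[OF this subspace_preimage[OF \<pi>(1) cvec.subspace_span]] dg that show ?thesis by blast
   qed
   from this[OF \<pi>(2)[of x]] have 1: "\<pi> x : cvec.span ?S" unfolding \<pi>(3) .
   have "?H h (x - \<pi> x) = 0" for h by (simp add: ps \<pi>(3) Hl)
   then have "x - \<pi> x : ?S" by (auto intro!: exI[of _ "%_. 0"] exI[of _ "0::int"])
   then have "x - \<pi> x : cvec.span ?S" by (rule cvec.span_base)
   from cvec.span_add[OF this 1] show ?thesis by simp
  qed
 qed
 then interpret q: gk A sr cr br ch e f d ?E ?F ?H by (intro gk.intro km_axioms)
 obtain \<rho> where \<rho>: "lie_module br \<rho>" "!!i. \<rho> (e i) = ?E i" "!!i. \<rho> (f i) = ?F i" "!!h. \<rho> (ch h) = ?H h"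
  using q.module_exists by blast
 show ?thesis proof (rule that[OF \<rho>(1) \<pi>(1)])
  show "\<pi> x = 0 \<longleftrightarrow> x : K" if "x : T" for x using \<pi>(4)[OF that] \<pi>(5) by auto
  show "EX n. (\<rho> (e i) ^^ n) x = 0" "EX n. (\<rho> (f i) ^^ n) x = 0" for i x unfolding \<rho> by (rule q.nilE, rule q.nilF)
 qed (simp_all add: \<rho> \<pi>(3) oE oF oH)
qed

end

section \<open>The maximal integrable highest weight module\<close>

lemma (in hw) E_nil: "x : dep F y n ==> (E k ^^ Suc (n k)) x = 0"
proof (induction "n k" arbitrary: n x)
 case 0 then show ?case using E_dep_0[OF 0(2), of k] by (simp flip: 0(1))
next case (Suc m)
 have m: "m = (n - uvec k) k" using Suc(2) by simp
 have "E k x : dep F y (n - uvec k)" using E_dep[OF Suc(3), of k] Suc(2) by simp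
 from Suc(1)[OF m this] have "(E k ^^ Suc m) (E k x) = 0" unfolding m .
 then show ?case unfolding Suc(2)[symmetric] by (simp only: funpow_Suc_right[of "Suc m"] comp_apply)
qed

lemma (in hw) Fw_dep: "x : dep F y n ==> Fw F w x : dep F y (n + cnt w)"
proof (induction w)
 case (Cons i w)
 have "F i (Fw F w x) : dep F y (n + cnt w + uvec i)" by (rule F_dep[where F = F, OF F_lin Cons.IH[OF Cons.prems]])
 then show ?case unfolding cnt_Cons by (simp only: add.assoc foldr_Cons comp_apply)
qed simp

lemma (in hw) adF_dep: "x : dep F y n ==> EX m. m ~= 0 & (ALL x:dep F y n. adF i j k x : dep F y m)"
proof -
 have "ALL x:dep F y n. adF i j k x : dep F y (n + uvec j + (%l. k * uvec i l))" for n proof (induction k arbitrary: n)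
  case 0
  have "(n + uvec j + (%l. 0 * uvec i l)) = n + uvec j" by (simp add: fun_eq_iff)
  then show ?case using F_dep[where F = F, OF F_lin] by (simp only: adF_0) blast
 next case (Suc k)
  have n: "n + uvec j + (%l. Suc k * uvec i l) = n + uvec j + (%l. k * uvec i l) + uvec i"
   "n + uvec j + (%l. Suc k * uvec i l) = n + uvec i + uvec j + (%l. k * uvec i l)"
   by (simp_all add: fun_eq_iff)
  show ?case proof
   fix x assume x: "x : dep F y n"
   have 1: "F i (adF i j k x) : dep F y (n + uvec j + (%l. Suc k * uvec i l))"
    unfolding n(1) by (rule F_dep[where F = F, OF F_lin]) (use Suc x in blast)
   have 2: "adF i j k (F i x) : dep F y (n + uvec j + (%l. Suc k * uvec i l))"
    unfolding n(2) using Suc[of "n + uvec i"] F_dep[where F = F, OF F_lin x] by blast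
   have "adF i j (Suc k) x = F i (adF i j k x) - adF i j k (F i x)" using adF_Suc[of i j k x] by simp
   then show "adF i j (Suc k) x : dep F y (n + uvec j + (%l. Suc k * uvec i l))"
    using cvec.subspace_diff[OF subspace_dep 1 2] by (simp only:)
  qed
 qed
 moreover have "n + uvec j + (%l. k * uvec i l) ~= 0" by (auto simp: fun_eq_iff intro!: exI[of _ j])
 ultimately show ?thesis by blast
qed

section \<open>The free highest weight module on words in the lowering operators\<close>

definition ew :: "'i list => 'i list => complex" where "ew w u = (if u = w then 1 else 0)"

definition vF :: "'i => ('i list => complex) => 'i list => complex"
 where "vF i c w = (case w of [] => 0 | j # u => if j = i then c u else 0)"

lemma vF_simps: "vF i c [] = 0" "vF i c (j # u) = (if j = i then c u else 0)" by (simp_all add: vF_def)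

lemma vF_ew: "vF i (ew w) = ew (i # w)"
proof
 fix u show "vF i (ew w) u = ew (i # w) u" by (cases u) (auto simp: vF_simps ew_def)
qed

lemma Fw_ew: "Fw vF w (ew []) = ew w" by (induction w) (simp_all add: vF_ew)

lemma ew_map:
 fixes g :: "'i list => 'x::complex_vector"
 obtains \<Phi> where "clinear \<Phi>" "!!w. \<Phi> (ew w) = g w"
proof -
 have inj: "inj (ew :: 'i list => _)" proof (rule injI)
  fix u w :: "'i list" assume "ew u = ew w"
  then have "ew u u = ew w u" by simp
  then show "u = w" by (simp add: ew_def split: if_splits)
 qed
 have ind: "cvec.independent (range (ew :: 'i list => _))" unfolding cvec.dependent_explicit proof
  assume "EX t u. finite t & t \<subseteq> range (ew :: 'i list => _) & (SUM v:t. u v *. v) = 0 & (EX v:t. u v ~= 0)"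
  then obtain t u v where t': "finite t" "t \<subseteq> range (ew :: 'i list => _)" "v : t" "u v ~= 0" "(SUM v:t. u v *. v) = 0"
   by blast
  then obtain w where "v = ew w" by blast
  note t = t'[unfolded this]
  have "(SUM v:t. u v *. v) w = (SUM v:t. if v = ew w then u v else 0)" unfolding sum_fun_apply proof (rule sum.cong[OF refl])
   fix v assume "v : t"
   then obtain w' where "v = ew w'" using t(2) by blast
   then show "(u v *. v) w = (if v = ew w then u v else 0)" using inj by (auto simp: ew_def inj_eq)
  qed
  also have "... = u (ew w)" using t(1,3) by simp
  finally show False using t(4,5) by simp
 qed
 let ?\<Phi> = "cpair.construct (range (ew :: 'i list => _)) (%v. g (inv ew v))"
 have 1: "clinear ?\<Phi>" by (rule cpair.linear_construct[OF ind])
 have 2: "?\<Phi> (ew w) = g w" for w by (subst cpair.construct_basis[OF ind]) (simp_all add: inj)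
 show ?thesis by (rule that[OF 1 2])
qed

locale verma = km A sr cr br ch e f d for A :: "'i::finite => 'i => int" and sr :: "'i => 'h::complex_vector => complex" and cr
  and br :: "'g::complex_vector => 'g => 'g" and ch e f d +
 fixes \<Lambda> :: "'h => complex" and n :: "'i => nat"
 assumes \<Lambda>_lin: "clinear \<Lambda>" and \<Lambda>_cr: "!!i. \<Lambda> (cr i) = of_nat (n i)"
begin

definition vco :: "'i list => 'h => complex" where "vco w h = \<Lambda> h - wt (up (cnt w)) h"

lemma vco_clinear: "clinear (vco w)"
 by (rule clinearI) (simp_all add: vco_def clinear_add[OF \<Lambda>_lin] clinear_add[OF clinear_wt]
   clinear_scale[OF \<Lambda>_lin] clinear_scale[OF clinear_wt] algebra_simps)

lemma vco_Cons: "vco (i # w) h = vco w h - sr i h" unfolding vco_def cnt_Cons up_shift(4) ad.wt_add ad.wt_unit by simp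

lemma vco_insert: "vco (take k w @ i # drop k w) h = vco w h - sr i h"
proof -
 have "cnt (take k w @ i # drop k w) = cnt (take k w @ drop k w) + uvec i"
  unfolding cnt_append cnt_Cons by (simp only: add.assoc)
 then have "cnt (take k w @ i # drop k w) = cnt (i # w)" unfolding cnt_Cons by (simp only: append_take_drop_id)
 then have "vco (take k w @ i # drop k w) h = vco (i # w) h" unfolding vco_def by (simp only:)
 then show ?thesis by (simp only: vco_Cons)
qed

text \<open>On basis words, the operator deletes a letter \<open>i\<close> and multiplies by the
  value at the coroot of the weight of the part behind it. In coordinates, the value at
  \<open>w\<close> therefore collects all insertions of \<open>i\<close> into \<open>w\<close>, a
  finite sum for functions of any support.\<close>

definition vE :: "'i => ('i list => complex) => 'i list => complex"
 where "vE i c w = (SUM k<=length w. vco (drop k w) (cr i) * c (take k w @ i # drop k w))"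
definition vH :: "'h => ('i list => complex) => 'i list => complex" where "vH h c w = vco w h * c w"

lemma verma_chev: "chev sr cr vE vF vH"
proof (rule chev.intro)
 show "clinear (vE i)" for i by (rule clinearI) (auto simp: vE_def fun_eq_iff algebra_simps sum.distrib sum_distrib_left)
 show "clinear (vF i)" for i :: 'i by (rule clinearI) (auto simp: vF_def fun_eq_iff split: list.split)
 show "cbilinear vH"
  by (rule cbilinearI) (auto simp: vH_def fun_eq_iff clinear_add[OF vco_clinear] clinear_scale[OF vco_clinear] algebra_simps)
 show "vE i (vF j c) = vF j (vE i c) + (if i = j then vH (cr i) c else 0)" for i j c proof
  fix w show "vE i (vF j c) w = (vF j (vE i c) + (if i = j then vH (cr i) c else 0)) w" proof (cases w)
   case (Cons j' u)
   have "vE i (vF j c) (j' # u) = vco (j' # u) (cr i) * vF j c (i # j' # u)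
    + (SUM k<=length u. vco (drop k u) (cr i) * vF j c (j' # take k u @ i # drop k u))"
    by (simp only: vE_def list.size(4) add_Suc_right add_0_right sum.atMost_Suc_shift) simp
   then show ?thesis unfolding Cons by (simp add: vF_simps vE_def vH_def)
  qed (simp add: vE_def vF_simps vH_def)
 qed
 show "vH h (vE i c) = vE i (vH h c) + sr i h *. vE i c" for h i c
  by (simp add: fun_eq_iff vH_def vE_def vco_insert sum_distrib_left sum.distrib[symmetric] algebra_simps)
 show "vH h (vF i c) = vF i (vH h c) - sr i h *. vF i c" for h i c
  by (auto simp: fun_eq_iff vH_def vF_def vco_Cons algebra_simps split: list.split)
 show "vH h (vH h' c) = vH h' (vH h c)" for h h' c by (simp add: vH_def fun_eq_iff)
qed

sublocale v: hw sr cr vE vF vH "ew []" \<Lambda>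
proof (rule hw.intro[OF verma_chev], rule hw_axioms.intro)
 show "vE i (ew []) = 0" for i by (simp add: vE_def ew_def fun_eq_iff)
 show "vH h (ew []) = \<Lambda> h *. ew []" for h by (auto simp: vH_def ew_def vco_def fun_eq_iff ad.wt_def)
qed

lemma ew_U: "ew w : v.U"
proof -
 have "ew w = Fw vF w (ew [])" by (simp only: Fw_ew)
 then have "ew w : {Fw vF w (ew []) |w. True}" by blast
 then show ?thesis unfolding v.U_def by (rule cvec.span_base)
qed

lemma U_minimal: "cvec.subspace S ==> (!!w. ew w : S) ==> v.U \<subseteq> S"
 unfolding v.U_def by (rule cvec.span_minimal) (auto simp: Fw_ew)

lemma dep_Nil: "x : dep vF (ew []) m ==> m ~= 0 ==> x [] = 0" for m :: "'i => nat"
proof -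
 assume x: "x : dep vF (ew []) m" and m: "m ~= 0"
 have "clinear (%c :: 'i list => complex. c [])" by (rule clinearI) simp_all
 from subspace_zeros[OF this] have "dep vF (ew []) m \<subseteq> {c. c [] = 0}" proof (rule dep_minimal)
  fix w assume "cnt w = m"
  then have "w ~= []" using m by auto
  then show "Fw vF w (ew []) : {c. c [] = 0}" by (simp add: Fw_ew ew_def)
 qed
 then show ?thesis using x by blast
qed

text \<open>The integrability and Serre relations. The latter are imposed on every basis word,
  because \<open>VK\<close> is closed off from the left only, by the operators
  \<open>vF\<close>.\<close>

definition vgen :: "('i list => complex) set" where
 "vgen = {(vF i ^^ Suc (n i)) (ew []) |i. True} \<union> {v.adF i j (sN i j) (ew w) |i j w. i ~= j}"
definition VK :: "('i list => complex) set" where "VK = cvec.span {Fw vF u s |u s. s : vgen}"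

lemma subspace_VK: "cvec.subspace VK" by (simp add: VK_def)

lemma VK_base: "s : vgen ==> Fw vF u s : VK" unfolding VK_def by (rule cvec.span_base) blast

lemma VK_minimal: "cvec.subspace S ==> (!!u s. s : vgen ==> Fw vF u s : S) ==> VK \<subseteq> S"
 unfolding VK_def by (rule cvec.span_minimal) auto

lemma vgen_dep: "s : vgen ==> EX m. m ~= 0 & s : dep vF (ew []) m"
proof -
 assume "s : vgen"
 then consider i where "s = (vF i ^^ Suc (n i)) (ew [])" | i j w where "i ~= j" "s = v.adF i j (sN i j) (ew w)"
  by (auto simp: vgen_def)
 then show ?thesis proof cases
  case 1
  have "(vF i ^^ k) (ew []) = ew (replicate k i)" for k by (induction k) (simp_all add: vF_ew)
  then have "s = Fw vF (replicate (Suc (n i)) i) (ew [])" using 1 by (simp only: Fw_ew)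
  then show ?thesis using Fw_in_dep[OF refl, of vF "replicate (Suc (n i)) i" "ew []"]
   by (intro exI[of _ "cnt (replicate (Suc (n i)) i)"]) (simp only: cnt_eq_0, simp)
 next case 2
  have "ew w : dep vF (ew []) (cnt w)" using Fw_in_dep[OF refl, of vF w "ew []"] by (simp only: Fw_ew)
  then show ?thesis using v.adF_dep[of "ew w" "cnt w" i j "sN i j"] 2(2) by blast
 qed
qed

lemma VK_gen_dep: "s : vgen ==> EX m. m ~= 0 & Fw vF u s : dep vF (ew []) m"
proof -
 assume "s : vgen"
 then obtain m where "m ~= 0" "s : dep vF (ew []) m" using vgen_dep by blast
 moreover from this(1) have "m + cnt u ~= 0" by (auto simp: fun_eq_iff)
 ultimately show ?thesis using v.Fw_dep by blast
qed

lemma VK_sub_U: "VK \<subseteq> v.U" by (rule VK_minimal[OF v.subspace_U]) (use VK_gen_dep v.dep_U in blast)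

lemma VK_Nil: "x : VK ==> x [] = 0"
proof -
 have "clinear (%c :: 'i list => complex. c [])" by (rule clinearI) simp_all
 from VK_minimal[OF subspace_zeros[OF this]] have "VK \<subseteq> {c. c [] = 0}" using VK_gen_dep dep_Nil by blast
 then show "x : VK ==> x [] = 0" by blast
qed

lemma VK_F: "x : VK ==> vF i x : VK"
proof -
 have "VK \<subseteq> {x. vF i x : VK}" proof (rule VK_minimal[OF subspace_preimage[OF v.F_lin subspace_VK]])
  fix u s assume "s : vgen"
  from VK_base[OF this, of "i # u"] show "Fw vF u s : {x. vF i x : VK}" by simp
 qed
 then show "x : VK ==> vF i x : VK" by blast
qed

lemma VK_H: "x : VK ==> vH h x : VK"
proof -
 have "VK \<subseteq> {x. vH h x : VK}" proof (rule VK_minimal[OF subspace_preimage[OF cbilinear_right[OF v.H_bil] subspace_VK]])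
  fix u s assume s: "s : vgen"
  then obtain m where "Fw vF u s : dep vF (ew []) m" using VK_gen_dep by blast
  from v.H_dep[OF this] show "Fw vF u s : {x. vH h x : VK}" using cvec.subspace_scale[OF subspace_VK VK_base[OF s]] by simp
 qed
 then show "x : VK ==> vH h x : VK" by blast
qed

lemma serre_VK:
 assumes ij: "i ~= j" and x: "x : v.U"
 shows "v.adF i j (sN i j) x : VK"
proof -
 have "v.U \<subseteq> {x. v.adF i j (sN i j) x : VK}" proof (rule U_minimal[OF subspace_preimage[OF v.adF_lin subspace_VK]])
  fix w :: "'i list"
  have "v.adF i j (sN i j) (ew w) : vgen" using ij by (auto simp: vgen_def)
  from VK_base[OF this, of "[]"] show "ew w : {x. v.adF i j (sN i j) x : VK}" by simp
 qed
 then show ?thesis using x by blast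
qed

text \<open>The Serre operators commute with \<open>vE k\<close>, and at the exponent
  \<open>Suc (n i)\<close> the sl2 coefficient vanishes.\<close>

lemma vgen_E: "s : vgen ==> vE k s : VK"
proof -
 assume "s : vgen"
 then consider i where "s = (vF i ^^ Suc (n i)) (ew [])" | i j w where "i ~= j" "s = v.adF i j (sN i j) (ew w)"
  by (auto simp: vgen_def)
 then show ?thesis proof cases
  case 1
  have "vE k ((vF i ^^ Suc (n i)) (ew [])) = 0" proof (cases "k = i")
   case True
   interpret s: sl2 "vE i" "vF i" "vH (cr i)" by (rule sl2_chev[OF verma_chev])
   have "vH (cr i) (ew []) = of_nat (n i) *. ew []" by (simp add: v.Hy \<Lambda>_cr)
   from s.E_F_pow_highest[OF this v.Ey, of "n i"] show ?thesis unfolding True by simp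
  next case False
   have comm: "vE k (vF i z) = vF i (vE k z)" for z using v.EF[of k i z] False by (simp only: if_False add_0_right)
   have "vE k ((vF i ^^ m) (ew [])) = 0" for m by (induction m) (simp_all only: funpow.simps comp_apply id_apply comm v.Ey v.Fl)
   then show ?thesis .
  qed
  then show ?thesis unfolding 1 using cvec.subspace_0[OF subspace_VK] by simp
 next case 2
  have "vE k s = v.adF i j (sN i j) (vE k (ew w))" unfolding 2(2) by (rule E_serre_commute[OF verma_chev 2(1)])
  then show ?thesis using serre_VK[OF 2(1) v.U_E[OF ew_U]] by simp
 qed
qed

lemma VK_E: "x : VK ==> vE k x : VK"
proof -
 have "VK \<subseteq> {x. vE k x : VK}" proof (rule VK_minimal[OF subspace_preimage[OF v.E_lin subspace_VK]])
  fix u s assume s: "s : vgen"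
  have "vE k (Fw vF u s) : VK" proof (induction u)
   case Nil then show ?case using vgen_E[OF s] by simp
  next case (Cons i u)
   have "vE k (Fw vF (i # u) s) = vF i (vE k (Fw vF u s)) + (if k = i then vH (cr k) (Fw vF u s) else 0)"
    using v.EF[of k i "Fw vF u s"] by (cases "k = i") (simp_all only: foldr_Cons comp_apply if_True if_False simp_thms)
   moreover have "(if k = i then vH (cr k) (Fw vF u s) else 0) : VK"
    using VK_H[OF VK_base[OF s]] cvec.subspace_0[OF subspace_VK] by (cases "k = i") (simp_all only: if_True if_False simp_thms)
   ultimately show ?case using cvec.subspace_add[OF subspace_VK VK_F[OF Cons.IH]] by (simp only:)
  qed
  then show "Fw vF u s : {x. vE k x : VK}" by simp
 qed
 then show "x : VK ==> vE k x : VK" by blast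
qed

text \<open>Induction on the word: a new letter different from \<open>i\<close> is passed with
  \<open>nil_derivation\<close>, since modulo \<open>VK\<close> the Serre relations make the
  commutator with \<open>vF i\<close> nilpotent on it.\<close>

lemma VK_nil_F:
 assumes x: "x : v.U"
 shows "EX N. (vF i ^^ N) x : VK"
proof -
 have "v.U \<subseteq> {x. EX N. (vF i ^^ N) x : VK}" proof (rule U_minimal)
  show "cvec.subspace {x. EX N. (vF i ^^ N) x : VK}" by (rule subspace_nil[OF v.F_lin subspace_VK]) (rule VK_F)
  fix w :: "'i list"
  have "EX N. (vF i ^^ N) (ew w) : VK" proof (induction w)
   case Nil
   have "(vF i ^^ Suc (n i)) (ew []) : vgen" by (auto simp: vgen_def)
   from VK_base[OF this, of "[]"] show ?case by (intro exI[of _ "Suc (n i)"]) simp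
  next case (Cons j w)
   then obtain N where N: "(vF i ^^ N) (ew w) : VK" by blast
   show ?case proof (cases "i = j")
    case True then show ?thesis using VK_F[OF N, of i] by (intro exI[of _ N]) (simp add: vF_ew[symmetric] funpow_swap1)
   next case False
    have "(vF i ^^ (N + sN i j)) (v.adF i j 0 (ew w)) : VK"
    proof (rule nil_derivation[where K = VK and T = v.U and D = "v.adF i j"])
     show "v.adF i j k x : VK" if "x : VK" for k x by (rule v.adF_stable[OF subspace_VK VK_F that])
    qed (fact v.F_lin subspace_VK ew_U N | rule VK_F v.adF_Suc v.U_F serre_VK[OF False]; assumption)+
    then show ?thesis by (intro exI[of _ "N + sN i j"]) (simp add: vF_ew)
   qed
  qed
  then show "ew w : {x. EX N. (vF i ^^ N) x : VK}" by simp
 qed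
 then show ?thesis using x by blast
qed

lemma VK_nil_E:
 assumes x: "x : v.U"
 shows "EX N. (vE i ^^ N) x : VK"
proof -
 have "v.U \<subseteq> {x. EX N. (vE i ^^ N) x : VK}" proof (rule U_minimal)
  show "cvec.subspace {x. EX N. (vE i ^^ N) x : VK}" by (rule subspace_nil[OF v.E_lin subspace_VK]) (rule VK_E)
  fix w :: "'i list"
  have "ew w : dep vF (ew []) (cnt w)" using Fw_in_dep[OF refl, of vF w "ew []"] by (simp only: Fw_ew)
  from v.E_nil[OF this, of i] cvec.subspace_0[OF subspace_VK]
  show "ew w : {x. EX N. (vE i ^^ N) x : VK}" by (auto intro!: exI[of _ "Suc (cnt w i)"])
 qed
 then show ?thesis using x by blast
qed

lemma U_diag: "v.U \<subseteq> cvec.span {x\<in>v.U. \<exists>\<mu>. (ALL h. vH h x = \<mu> h *. x) & (ALL i. \<exists>m::int. \<mu> (cr i) = of_int m)}"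
proof (rule U_minimal[OF cvec.subspace_span], rule cvec.span_base, safe)
 fix w show "ew w : v.U" by (rule ew_U)
 have "vH h (ew w) = vco w h *. ew w" for h by (auto simp: vH_def ew_def fun_eq_iff)
 moreover have "\<exists>m::int. vco w (cr i) = of_int m" for i
  by (rule exI[of _ "int (n i) - pr (up (cnt w)) i"]) (simp add: vco_def wt_cr \<Lambda>_cr)
 ultimately show "\<exists>\<mu>. (ALL h. vH h (ew w) = \<mu> h *. ew w) & (ALL i. \<exists>m::int. \<mu> (cr i) = of_int m)" by blast
qed

lemma max_module:
 obtains \<rho> :: "'g => ('i list => complex) => 'i list => complex" and \<pi>
  where "lie_module br \<rho>" "clinear \<pi>" "!!x. x : v.U ==> \<pi> x = 0 \<longleftrightarrow> x : VK"
  "!!x i. x : v.U ==> \<rho> (e i) (\<pi> x) = \<pi> (vE i x)" "!!x i. x : v.U ==> \<rho> (f i) (\<pi> x) = \<pi> (vF i x)"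
  "!!x h. x : v.U ==> \<rho> (ch h) (\<pi> x) = \<pi> (vH h x)"
  "!!i x. EX n. (\<rho> (e i) ^^ n) x = 0" "!!i x. EX n. (\<rho> (f i) ^^ n) x = 0"
proof -
 show thesis by (rule quotient_module[OF verma_chev subspace_VK v.subspace_U VK_sub_U VK_E VK_F VK_H
    v.U_E v.U_F v.U_H VK_nil_E VK_nil_F U_diag], assumption+, rule that)
qed

text \<open>A highest weight vector of dominant weight satisfies no relations over the lower triangular part
 other than those forced by integrability: compare with the maximal integrable module \<open>N\<close> inside
 \<open>V \<oplus> N\<close>.\<close>

lemma relations_forced:
 assumes m: "lie_module br \<rho>" and v: "v ~= 0" "!!i. \<rho> (e i) v = 0" "!!h. \<rho> (ch h) v = \<Lambda> h *. v"
  and \<Phi>: "clinear \<Phi>" "!!w. \<Phi> (ew w) = Fw (%i. \<rho> (f i)) w v" and t: "t : v.U" "\<Phi> t = 0"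
 shows "t : VK"
proof -
 obtain \<sigma> :: "'g => ('i list => complex) => 'i list => complex" and \<pi> where N: "lie_module br \<sigma>" "clinear \<pi>" "!!x. x : v.U ==> \<pi> x = 0 \<longleftrightarrow> x : VK"
  "!!x i. x : v.U ==> \<sigma> (e i) (\<pi> x) = \<pi> (vE i x)" "!!x i. x : v.U ==> \<sigma> (f i) (\<pi> x) = \<pi> (vF i x)"
  "!!x h. x : v.U ==> \<sigma> (ch h) (\<pi> x) = \<pi> (vH h x)"
  "!!i x. EX n. (\<sigma> (e i) ^^ n) x = 0" "!!i x. EX n. (\<sigma> (f i) ^^ n) x = 0" by (rule max_module, rule that)
 let ?P = "pair_act \<rho> \<sigma>" and ?p = "(v, \<pi> (ew []))"
 have P: "lie_module br ?P" by (rule lie_module_pair_act[OF m N(1)])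
 interpret p: hwm A sr cr br ch e f d ?P ?p \<Lambda> proof (intro hwm.intro hw.intro hw_axioms.intro hwm_axioms.intro)
  show "chev sr cr (%i. ?P (e i)) (%i. ?P (f i)) (%h. ?P (ch h))" by (rule chev_module[OF P])
  show "?P (e i) ?p = 0" for i by (simp add: pair_act_def v N(4)[OF ew_U] v.Ey clinear_0[OF N(2)] zero_prod_def)
  show "?P (ch h) ?p = \<Lambda> h *. ?p" for h by (simp add: pair_act_def v N(6)[OF ew_U] v.Hy clinear_scale[OF N(2)])
 qed (fact km_axioms P)+
 have Fw_pair: "Fw (%i. ?P (f i)) w ?p = (\<Phi> (ew w), \<pi> (ew w))" for w
  by (induction w) (simp_all add: pair_act_def \<Phi>(2) N(5)[OF ew_U] vF_ew)
 let ?S = "{x\<in>p.U. fst x = 0}"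
 have fst_lin: "clinear fst" by (rule clinearI) simp_all
 have S: "?S = {0}" proof (rule p.submodule_zero)
  show "cvec.subspace ?S" using cvec.subspace_inter[OF p.subspace_U subspace_zeros[OF fst_lin]] by (simp add: Int_def)
  show "?P (e i) x : ?S" if "x : ?S" for i x proof -
   have "?P (e i) x : p.U" using that p.U_E by blast
   moreover have "fst (?P (e i) x) = 0" using that by (simp add: pair_act_def clinear_0[OF lie_module_linear[OF m]])
   ultimately show ?thesis by blast
  qed
  show "?P (ch h) x : ?S" if "x : ?S" for h x proof -
   have "?P (ch h) x : p.U" using that p.U_H by blast
   moreover have "fst (?P (ch h) x) = 0" using that by (simp add: pair_act_def clinear_0[OF lie_module_linear[OF m]])
   ultimately show ?thesis by blast
  qed
  show "c *. ?p = 0" if "c *. ?p : ?S" for c using that v(1) by (auto simp: zero_prod_def)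
  show "p.dom \<Lambda>" using \<Lambda>_cr by (auto simp: p.dom_def)
  show "p.dom (p.dwt n)" if x: "x : ?S" "x : dep (%i. ?P (f i)) ?p n" "x ~= 0" "!!k. ?P (e k) x = 0" for x n unfolding p.dom_def
  proof
   fix i
   interpret s: sl2 "\<sigma> (e i)" "\<sigma> (f i)" "\<sigma> (ch (cr i))" by (rule sl2_chev[OF chev_module[OF N(1)]])
   obtain z where z: "x = (0, z)" using x(1) by (cases x) auto
   have 1: "\<sigma> (ch (cr i)) z = p.dwt n (cr i) *. z" using p.H_dep[OF x(2), of "cr i"] by (simp add: z pair_act_def)
   have 2: "\<sigma> (e i) z = 0" using x(4)[of i] by (simp add: z pair_act_def zero_prod_def)
   have 3: "z ~= 0" using x(3) by (simp add: z zero_prod_def)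
   obtain k where "(\<sigma> (f i) ^^ k) z = 0" using N(8) by blast
   from s.highest_weight[OF 1 2 this 3] show "EX k. p.dwt n (cr i) = of_nat k" by blast
  qed
 qed blast
 have "v.U \<subseteq> {t. (\<Phi> t, \<pi> t) : p.U}" proof (rule U_minimal)
  have "clinear (%t. (\<Phi> t, \<pi> t))" by (rule clinearI) (simp_all add: clinear_simps[OF \<Phi>(1)] clinear_simps[OF N(2)])
  from subspace_preimage[OF this p.subspace_U] show "cvec.subspace {t. (\<Phi> t, \<pi> t) : p.U}" .
  fix w show "ew w : {t. (\<Phi> t, \<pi> t) : p.U}" proof -
   have "Fw (%i. ?P (f i)) w ?p : {Fw (%i. ?P (f i)) w ?p |w. True}" by blast
   from cvec.span_base[OF this] show ?thesis unfolding Fw_pair p.U_def by (simp only: mem_Collect_eq)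
  qed
 qed
 then have "(\<Phi> t, \<pi> t) : p.U" using t(1) by blast
 then have "(0, \<pi> t) : ?S" unfolding t(2) by simp
 then have "\<pi> t = 0" unfolding S by (simp add: zero_prod_def)
 then show ?thesis using N(3)[OF t(1)] by simp
qed

text \<open>The Serre relations hold in every module and the powers vanish on \<open>y\<close> by
  hypothesis; the map commutes with the lowering operators, so it kills everything generated from
  these.\<close>

lemma VK_vanish:
 assumes m: "lie_module br \<sigma>" and y: "!!i. (\<sigma> (f i) ^^ Suc (n i)) y = 0"
  and \<Phi>: "clinear \<Phi>" "!!w. \<Phi> (ew w) = Fw (%i. \<sigma> (f i)) w y" and t: "t : VK"
 shows "\<Phi> t = 0"
proof -
 interpret s: chev sr cr "%i. \<sigma> (e i)" "%i. \<sigma> (f i)" "%h. \<sigma> (ch h)" by (rule chev_module[OF m])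
 note \<sigma>l = lie_module_linear[OF m]
 have F: "\<Phi> (vF i x) = \<sigma> (f i) (\<Phi> x)" if "x : v.U" for i x proof -
  have lin: "clinear (%x. \<Phi> (vF i x) - \<sigma> (f i) (\<Phi> x))"
   by (rule clinearI) (simp_all add: clinear_simps[OF \<Phi>(1)] clinear_simps[OF \<sigma>l] v.Fl cvec.scale_right_diff_distrib)
  have "v.U \<subseteq> {x. \<Phi> (vF i x) - \<sigma> (f i) (\<Phi> x) = 0}"
   by (rule U_minimal[OF subspace_zeros[OF lin]]) (simp add: vF_ew \<Phi>(2))
  then show ?thesis using that by auto
 qed
 have ad: "\<Phi> (v.adF i j k x) = s.adF i j k (\<Phi> x)" if "x : v.U" for i j k x using that proof (induction k arbitrary: x)
  case 0 then show ?case by (simp add: F)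
 next case (Suc k)
  have 1: "v.adF i j (Suc k) x = vF i (v.adF i j k x) - v.adF i j k (vF i x)" using v.adF_Suc[of i j k x] by simp
  have 2: "s.adF i j (Suc k) (\<Phi> x) = \<sigma> (f i) (s.adF i j k (\<Phi> x)) - s.adF i j k (\<sigma> (f i) (\<Phi> x))"
   using s.adF_Suc[of i j k "\<Phi> x"] by simp
  have "v.adF i j k x : v.U" by (rule v.adF_stable[OF v.subspace_U v.U_F Suc.prems])
  then show ?case unfolding 1 2 clinear_diff[OF \<Phi>(1)] using Suc F v.U_F by simp
 qed
 have gen: "\<Phi> s = 0 & s : v.U" if "s : vgen" for s proof -
  have U: "s : v.U" using vgen_dep[OF that] v.dep_U by blast
  have pow: "\<Phi> ((vF i ^^ k) (ew [])) = (\<sigma> (f i) ^^ k) y & (vF i ^^ k) (ew []) : v.U" for i k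
   by (induction k) (simp_all add: \<Phi>(2) ew_U F v.U_F)
  from that consider i where "s = (vF i ^^ Suc (n i)) (ew [])" | i j w where "i ~= j" "s = v.adF i j (sN i j) (ew w)"
   by (auto simp: vgen_def)
  then have "\<Phi> s = 0" proof cases
   case 1 then show ?thesis using pow[of "Suc (n i)" i] y[of i] by (simp only:)
  next case 2
   then show ?thesis using ad[OF ew_U] module_serre[OF m 2(1)] by (simp only:)
  qed
  then show ?thesis using U by blast
 qed
 have "VK \<subseteq> {t. \<Phi> t = 0}" proof (rule VK_minimal[OF subspace_zeros[OF \<Phi>(1)]])
  fix u s assume s: "s : vgen"
  have "\<Phi> (Fw vF u s) = 0 & Fw vF u s : v.U"
   by (induction u) (use gen[OF s] in \<open>simp_all add: F v.U_F clinear_0[OF \<sigma>l]\<close>)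
  then show "Fw vF u s : {t. \<Phi> t = 0}" by simp
 qed
 then show ?thesis using t by blast
qed

text \<open>All relations among the words applied to \<open>v\<close> lie in \<open>VK\<close>, and
  these hold for \<open>y\<close>. That \<open>y\<close> is an arbitrary vector killed by the powers
  is what makes the construction of pairings possible.\<close>

lemma highest_weight_lift:
 assumes m: "lie_module br \<rho>" and v: "v ~= 0" "!!i. \<rho> (e i) v = 0" "!!h. \<rho> (ch h) v = \<Lambda> h *. v"
  and m': "lie_module br \<sigma>" and y: "!!i. (\<sigma> (f i) ^^ Suc (n i)) y = 0"
 obtains f0 where "clinear f0" "!!w. f0 (Fw (%i. \<rho> (f i)) w v) = Fw (%i. \<sigma> (f i)) w y"
proof -
 obtain \<Phi> where \<Phi>: "clinear \<Phi>" "!!w. \<Phi> (ew w) = Fw (%i. \<rho> (f i)) w v"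
  using ew_map[of "%w. Fw (%i. \<rho> (f i)) w v"] by blast
 obtain \<Psi> where \<Psi>: "clinear \<Psi>" "!!w. \<Psi> (ew w) = Fw (%i. \<sigma> (f i)) w y"
  using ew_map[of "%w. Fw (%i. \<sigma> (f i)) w y"] by blast
 have lin: "clinear (%t. (\<Phi> t, \<Psi> t))"
  by (rule clinearI) (simp_all add: clinear_simps[OF \<Phi>(1)] clinear_simps[OF \<Psi>(1)])
 have inj: "z = 0" if z: "(0, z) : (%t. (\<Phi> t, \<Psi> t)) ` v.U" for z proof -
  obtain t where t: "t : v.U" "\<Phi> t = 0" "z = \<Psi> t" using z by auto
  show ?thesis unfolding t(3) by (rule VK_vanish[OF m' y \<Psi> relations_forced[OF m v \<Phi> t(1,2)]])
 qed
 obtain f0 where f0: "clinear f0" "!!x y. (x, y) : (%t. (\<Phi> t, \<Psi> t)) ` v.U ==> y = f0 x"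
  using graph_clinear[OF cpair.linear_subspace_image[OF lin v.subspace_U] inj] by blast
 have "f0 (\<Phi> (ew w)) = \<Psi> (ew w)" for w by (rule f0(2)[OF image_eqI[OF refl ew_U], symmetric])
 then show ?thesis using that f0(1) \<Phi>(2) \<Psi>(2) by simp
qed

end

section \<open>Extending maps to the restricted dual\<close>

lemma eigen_component:
 assumes H: "!!h. clinear (H h)" and inj: "inj wt" and N: "finite N" "!!k h. k : N ==> H h (g k) = wt k h *. g k"
  and x: "x = (SUM k:N. g k)" "!!h. H h x = wt k0 h *. x"
 shows "x = (if k0 : N then g k0 else 0)"
proof -
 define g' where "g' k = (if k : N then g k else 0) - (if k = k0 then x else 0)" for k
 have "(SUM k:insert k0 N. g' k) = (SUM k:insert k0 N. if k : N then g k else 0) - x" using N(1) by (simp add: g'_def sum_subtractf)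
 also have "(SUM k:insert k0 N. if k : N then g k else 0) = (SUM k:N. g k)" using N(1) by (intro sum.mono_neutral_cong_right) auto
 finally have s: "(SUM k:insert k0 N. g' k) : {0}" using x(1) by simp
 have "g' k0 : {0}" proof (rule weight_components[where H = H and wt = wt and v = g', OF _ _ cvec.subspace_single_0 H _ _ s])
  show "inj_on wt (insert k0 N)" using inj by (rule inj_on_subset) simp
  show "H h (g' k) = wt k h *. g' k" if "k : insert k0 N" for k h
   using that N(2) x(2)[of h] by (auto simp: g'_def clinear_simps[OF H] cvec.scale_right_diff_distrib)
 qed (use N(1) in \<open>auto simp: clinear_0[OF H]\<close>)
 then show ?thesis by (simp add: g'_def)
qed

text \<open>Project along the span of all other weight spaces, which misses \<open>v\<close> because
  weights are independent.\<close>

lemma weight_functional: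
 fixes S :: "'k => 'v::complex_vector set" and H :: "'h => 'v => 'v" and wt :: "'k => 'h => complex"
 assumes S: "!!k. cvec.subspace (S k)" and wt: "inj wt" and H: "!!h. clinear (H h)"
  and eig: "!!k h x. x : S k ==> H h x = wt k h *. x" and v: "v : S k0" "v ~= 0"
 obtains l :: "'v => complex" where "clinear l" "l v = 1" "!!k x. k ~= k0 ==> x : S k ==> l x = 0"
proof -
 define K where "K = cvec.span (\<Union>k\<in>{k. k ~= k0}. S k)"
 have subK: "cvec.subspace K" by (simp add: K_def)
 have SK: "x : S k ==> k ~= k0 ==> x : K" for x k unfolding K_def by (rule cvec.span_base) blast
 have vK: "v ~: K" proof
  assume "v : K"
  from span_UN_decomp[of S v, OF S this[unfolded K_def]]
  obtain N g where N: "finite N" "N \<subseteq> {k. k ~= k0}" "ALL k:N. g k : S k" "v = (SUM k:N. g k)" by (elim exE conjE)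
  have "v = (if k0 : N then g k0 else 0)" by (rule eigen_component[OF H wt N(1) _ N(4) eig[OF v(1)]]) (use N(3) eig in blast)
  moreover have "k0 ~: N" using N(2) by blast
  ultimately show False using v(2) by simp
 qed
 obtain \<pi> where \<pi>': "clinear \<pi>" "!!x. \<pi> x : UNIV" "!!x. \<pi> (\<pi> x) = \<pi> x"
   "!!x. x : UNIV ==> x - \<pi> x : K" "!!x. x : K ==> \<pi> x = 0"
  by (rule projection_exists[OF subK cvec.subspace_UNIV subset_UNIV], rule that)
 note \<pi> = \<pi>'(1,4,5)
 have "\<pi> v ~= 0" using \<pi>(2)[of v] vK by auto
 then obtain l :: "'v => complex" where l: "clinear l" "l (\<pi> v) = 1" using functional_exists by blast
 have 1: "clinear (%x. l (\<pi> x))" by (rule clinear_compose[OF l(1) \<pi>(1)])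
 have 2: "l (\<pi> x) = 0" if "k ~= k0" "x : S k" for k x using \<pi>(3)[OF SK[OF that(2,1)]] by (simp add: clinear_0[OF l(1)])
 show ?thesis by (rule that[OF 1 l(2) 2])
qed

lemma (in chev) H_Fw_weight:
 assumes "!!h. H h y = \<mu> h *. y"
 shows "H h (Fw F w y) = (\<mu> h - (SUM i:UNIV. of_nat (cnt w i) * sr i h)) *. Fw F w y"
proof (induction w)
 case (Cons i w)
 have "(SUM j:UNIV. of_nat (cnt (i # w) j) * sr j h) = (SUM j:UNIV. of_nat (cnt w j) * sr j h) + sr i h" proof -
  have "(SUM j:UNIV. of_nat (uvec i j) * sr j h) = (SUM j:UNIV. if j = i then sr j h else 0)"
   by (rule sum.cong) (auto simp: uvec_def)
  then show ?thesis unfolding cnt_Cons by (simp add: algebra_simps sum.distrib)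
 qed
 then show ?case by (simp add: HF Cons.IH Fl cvec.scale_left_diff_distrib scaleC_add_left)
qed (simp add: assms)

context km
begin

lemma hw_module:
 assumes "lie_module br \<rho>" "!!i. \<rho> (e i) v = 0" "!!h. \<rho> (ch h) v = \<Lambda> h *. v"
 shows "hwm A sr cr br ch e f d \<rho> v \<Lambda>"
 by (intro hwm.intro hw.intro hw_axioms.intro hwm_axioms.intro chev_module km_axioms assms)

text \<open>A map that commutes with the \<open>f i\<close> on words commutes with the Cartan
  subalgebra because the weights agree, then with \<open>e i\<close> by moving it through the word,
  and finally with all brackets.\<close>

lemma hw_map_equivariant:
 assumes m: "lie_module br \<rho>" and v: "!!i. \<rho> (e i) v = 0" "!!h. \<rho> (ch h) v = \<Lambda> h *. v"
  and m': "lie_module br \<sigma>" and y: "!!i. \<sigma> (e i) y = 0" "!!h. \<sigma> (ch h) y = \<Lambda> h *. y"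
  and f0: "clinear f0" "!!w. f0 (Fw (%i. \<rho> (f i)) w v) = Fw (%i. \<sigma> (f i)) w y"
  and u: "u : cvec.span {Fw (%i. \<rho> (f i)) w v |w. True}"
 shows "\<rho> x u : cvec.span {Fw (%i. \<rho> (f i)) w v |w. True} & f0 (\<rho> x u) = \<sigma> x (f0 u)"
proof -
 interpret p: hwm A sr cr br ch e f d \<rho> v \<Lambda> by (rule hw_module[OF m v])
 interpret q: hwm A sr cr br ch e f d \<sigma> y \<Lambda> by (rule hw_module[OF m' y])
 have lin: "f0 (T u) = T' (f0 u)"
  if T: "clinear T" "clinear T'" "!!w. f0 (T (Fw (%i. \<rho> (f i)) w v)) = T' (Fw (%i. \<sigma> (f i)) w y)" and u: "u : p.U" for T T' u
 proof -
  have "clinear (%u. f0 (T u) - T' (f0 u))"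
   by (rule clinearI) (simp_all add: clinear_simps[OF T(1)] clinear_simps[OF T(2)] clinear_simps[OF f0(1)] cvec.scale_right_diff_distrib)
  from subspace_zeros[OF this] have "p.U \<subseteq> {u. f0 (T u) - T' (f0 u) = 0}"
   unfolding p.U_def by (rule cvec.span_minimal[rotated]) (auto simp: T(3) f0(2))
  then show ?thesis using u by auto
 qed
 have F: "f0 (\<rho> (f i) u) = \<sigma> (f i) (f0 u)" if "u : p.U" for i u proof (rule lin[OF _ _ _ that])
  show "f0 (\<rho> (f i) (Fw (%i. \<rho> (f i)) w v)) = \<sigma> (f i) (Fw (%i. \<sigma> (f i)) w y)" for w
   using f0(2)[of "i # w"] by simp
 qed (rule lie_module_linear[OF m] lie_module_linear[OF m'])+
 have H: "f0 (\<rho> (ch h) u) = \<sigma> (ch h) (f0 u)" if "u : p.U" for h u proof (rule lin[OF _ _ _ that])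
  show "f0 (\<rho> (ch h) (Fw (%i. \<rho> (f i)) w v)) = \<sigma> (ch h) (Fw (%i. \<sigma> (f i)) w y)" for w
   by (simp add: p.H_Fw q.H_Fw clinear_scale[OF f0(1)] f0(2) p.dwt_def q.dwt_def)
 qed (rule lie_module_linear[OF m] lie_module_linear[OF m'])+
 have wU: "Fw (%i. \<rho> (f i)) w v : p.U" for w unfolding p.U_def by (rule cvec.span_base) blast
 have E: "f0 (\<rho> (e i) u) = \<sigma> (e i) (f0 u)" if "u : p.U" for i u proof (rule lin[OF _ _ _ that])
  show "f0 (\<rho> (e i) (Fw (%i. \<rho> (f i)) w v)) = \<sigma> (e i) (Fw (%i. \<sigma> (f i)) w y)" for w proof (induction w)
   case Nil then show ?case by (simp add: v y clinear_0[OF f0(1)])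
  next case (Cons j w)
   have "f0 (\<rho> (f j) (\<rho> (e i) (Fw (%i. \<rho> (f i)) w v))) = \<sigma> (f j) (\<sigma> (e i) (Fw (%i. \<sigma> (f i)) w y))"
    using F[OF p.U_E[OF wU]] Cons.IH by simp
   moreover have "f0 (\<rho> (ch h) (Fw (%i. \<rho> (f i)) w v)) = \<sigma> (ch h) (Fw (%i. \<sigma> (f i)) w y)" for h
    using H[OF wU] by (simp add: f0(2))
   ultimately show ?case by (simp add: p.EF q.EF clinear_add[OF f0(1)] clinear_0[OF f0(1)])
  qed
 qed (rule lie_module_linear[OF m] lie_module_linear[OF m'])+
 have "ALL u:p.U. \<rho> x u : p.U & f0 (\<rho> x u) = \<sigma> x (f0 u)" proof (induction x rule: gen_induct)
  case (h h) then show ?case using H p.U_H by blast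
 next case (e i)
  then show ?case using E p.U_E by blast
 next case (f i)
  then show ?case using F p.U_F by blast
 next case (add x y)
  then show ?case by (simp add: p.\<rho>s q.\<rho>s clinear_add[OF f0(1)] cvec.subspace_add[OF p.subspace_U])
 next case (scale c x)
  then show ?case by (simp add: p.\<rho>s q.\<rho>s clinear_scale[OF f0(1)] cvec.subspace_scale[OF p.subspace_U])
 next case (br x y)
  then show ?case by (simp add: p.\<rho>b q.\<rho>b clinear_diff[OF f0(1)] cvec.subspace_diff[OF p.subspace_U])
 qed
 then show ?thesis using u unfolding p.U_def by blast
qed

abbreviation "dual \<rho> \<equiv> hom_act \<rho> (%_ _. 0 :: complex)"

lemma dual_module: "lie_module br \<rho> ==> lie_module br (dual \<rho>)" by (rule lie_module_hom_act[OF _ trivial_module])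

lemma app_dual: "lie_module br \<rho> ==> app (dual \<rho> x a) v = - app a (\<rho> x v)"
 using app_hom_act[OF _ trivial_module] by simp

text \<open>Stands in for the restricted dual: the part of the full dual that the raising operators
  generate from a lowest weight functional. With the triangular halves exchanged it is a highest
  weight module, so \<open>highest_weight_lift\<close> applies to it.\<close>

definition rdual :: "('g => 'v::complex_vector => 'v) => ('v, complex) clin => ('v, complex) clin set"
 where "rdual \<rho> a0 = cvec.span {Fw (%i. dual \<rho> (e i)) w a0 |w. True}"

lemma top_functional:
 fixes \<rho> :: "'g => 'v::complex_vector => 'v"
 assumes m: "lie_module br \<rho>" and v: "v ~= 0" "!!i. \<rho> (e i) v = 0" "!!h. \<rho> (ch h) v = \<Lambda> h *. v"
  and gen: "cvec.span {Fw (%i. \<rho> (f i)) w v |w. True} = UNIV"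
 obtains a0 where "app a0 v = 1" "!!i. dual \<rho> (f i) a0 = 0" "!!h. dual \<rho> (ch h) a0 = - \<Lambda> h *. a0"
proof -
 interpret p: hwm A sr cr br ch e f d \<rho> v \<Lambda> by (rule hw_module[OF m v(2,3)])
 let ?dep = "dep (%i. \<rho> (f i)) v"
 have "v : ?dep 0" by (simp add: dep_0 cvec.span_base)
 from weight_functional[of ?dep p.dwt "%h. \<rho> (ch h)", OF subspace_dep p.dwt_inj lie_module_linear[OF m] p.H_dep this v(1)]
 obtain l :: "'v => complex" where l: "clinear l" "l v = 1" "!!n x. n ~= 0 ==> x : ?dep n ==> l x = 0" by blast
 define a0 where "a0 = Clin l"
 have a0: "app a0 = l" by (simp add: a0_def l(1))
 have U: "p.U = UNIV" using gen by (simp add: p.U_def)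
 have eqU: "\<phi> = \<psi>" if "!!n x. x : ?dep n ==> app \<phi> x = app \<psi> x" for \<phi> \<psi> :: "('v, complex) clin"
 proof (rule clin_eqI)
  fix x
  have "cvec.span (\<Union>n\<in>UNIV. ?dep n) \<subseteq> {x. app \<phi> x - app \<psi> x = 0}"
   by (rule cvec.span_minimal[OF _ subspace_zeros]) (use that in \<open>auto intro!: clinearI simp: app_simps algebra_simps\<close>)
  then show "app \<phi> x = app \<psi> x" using U p.U_eq by auto
 qed
 show ?thesis proof (rule that)
  show "app a0 v = 1" by (simp add: a0 l)
  show "dual \<rho> (f i) a0 = 0" for i proof (rule eqU)
   fix n x assume x: "x : ?dep n"
   have "n + uvec i ~= 0" by (auto simp: fun_eq_iff intro!: exI[of _ i])
   from l(3)[OF this F_dep[where F = "%i. \<rho> (f i)", OF lie_module_linear[OF m] x, of i]]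
   show "app (dual \<rho> (f i) a0) x = app 0 x" by (simp add: app_dual[OF m] a0)
  qed
  show "dual \<rho> (ch h) a0 = - \<Lambda> h *. a0" for h proof (rule eqU)
   fix n x assume x: "x : ?dep n"
   show "app (dual \<rho> (ch h) a0) x = app (- \<Lambda> h *. a0) x" proof (cases "n = 0")
    case True
    then obtain c where "x = c *. v" using x by (auto simp: dep_0 cvec.span_singleton)
    then show ?thesis by (simp add: app_dual[OF m] p.\<rho>s v app_simps)
   next case False
    then show ?thesis using l(3)[OF False x] p.H_dep[OF x] by (simp add: app_dual[OF m] a0 clinear_scale[OF l(1)])
   qed
  qed
 qed
qed

lemma rdual_hw:
 assumes "lie_module br \<rho>" "!!i. dual \<rho> (f i) a0 = 0" "!!h. dual \<rho> (ch h) a0 = - \<Lambda> h *. a0"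
 shows "hwm A sr cr br (%h. - ch h) f e d (dual \<rho>) a0 \<Lambda>"
proof -
 interpret sw: km A sr cr br "%h. - ch h" f e d by (rule swap)
 show ?thesis proof (rule sw.hw_module[OF dual_module[OF assms(1)] assms(2)])
  show "dual \<rho> (- ch h) a0 = \<Lambda> h *. a0" for h
   using assms(3)[of h] by (simp add: cbilinear_neg1[OF lie_module_bilinear[OF dual_module[OF assms(1)]]])
 qed
qed

lemma rdual_stable:
 assumes "lie_module br \<rho>" "!!i. dual \<rho> (f i) a0 = 0" "!!h. dual \<rho> (ch h) a0 = - \<Lambda> h *. a0" "a : rdual \<rho> a0"
 shows "dual \<rho> x a : rdual \<rho> a0"
proof -
 interpret p: hwm A sr cr br "%h. - ch h" f e d "dual \<rho>" a0 \<Lambda> by (rule rdual_hw[OF assms(1-3)])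
 have U: "rdual \<rho> a0 = p.U" by (simp add: rdual_def p.U_def)
 show ?thesis using p.submodule_gen[OF dual_module[OF assms(1)] p.subspace_U p.U_E p.U_F p.U_H] assms(4) unfolding U by blast
qed

text \<open>The common zeros of the restricted dual form a submodule that misses \<open>v\<close>,
  so irreducibility makes them 0.\<close>

lemma rdual_separates:
 assumes m: "lie_module br \<rho>" and irr: "irreducible_module \<rho>"
  and a0: "app a0 v = 1" "!!i. dual \<rho> (f i) a0 = 0" "!!h. dual \<rho> (ch h) a0 = - \<Lambda> h *. a0"
  and x: "!!a. a : rdual \<rho> a0 ==> app a x = 0"
 shows "x = 0"
proof -
 let ?S = "{x. ALL a:rdual \<rho> a0. app a x = 0}"
 have "submodule \<rho> ?S" unfolding submodule_def proof safe
  show "cvec.subspace ?S" by (rule cvec.subspaceI) (auto simp: app_simps)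
  fix y x a assume x: "ALL a:rdual \<rho> a0. app a x = 0" and a: "a : rdual \<rho> a0"
  have "dual \<rho> y a : rdual \<rho> a0" by (rule rdual_stable[OF m a0(2,3) a])
  with x have "app (dual \<rho> y a) x = 0" by blast
  then show "app a (\<rho> y x) = 0" by (simp add: app_dual[OF m])
 qed
 moreover have "?S ~= UNIV" proof
  assume S: "?S = UNIV"
  have "Fw (%i. dual \<rho> (e i)) [] a0 : {Fw (%i. dual \<rho> (e i)) w a0 |w. True}" by blast
  then have "a0 : rdual \<rho> a0" unfolding rdual_def by (intro cvec.span_base) simp
  moreover have "v : ?S" unfolding S by (rule UNIV_I)
  ultimately show False using a0(1) by simp
 qed
 ultimately have "?S = {0}" using irr unfolding irreducible_module_def by blast
 then show ?thesis using x by blast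
qed

text \<open>For \<open>y \<in> X\<close> of weight \<open>\<Lambda>\<^sub>1 - \<Lambda>\<^sub>2\<close> the map \<open>v\<^sub>1 \<mapsto> y\<close> of modules over the lower triangular part is a
 lowest weight vector of weight \<open>-\<Lambda>\<^sub>2\<close> in \<open>Hom(V\<^sub>1, X)\<close>.\<close>

lemma dual_hom_lift:
 fixes \<rho>1 :: "'g => 'v1::complex_vector => 'v1" and \<rho>2 :: "'g => 'v2::complex_vector => 'v2"
  and \<sigma> :: "'g => 'x::complex_vector => 'x" and n1 n2 :: "'i => nat"
 assumes m1: "lie_module br \<rho>1" and v1: "v1 ~= 0" "!!i. \<rho>1 (e i) v1 = 0" "!!h. \<rho>1 (ch h) v1 = \<Lambda>1 h *. v1"
  and gen1: "cvec.span {Fw (%i. \<rho>1 (f i)) w v1 |w. True} = UNIV"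
  and \<Lambda>1: "clinear \<Lambda>1" "!!i. \<Lambda>1 (cr i) = of_nat (n1 i)"
  and m2: "lie_module br \<rho>2" and a0: "a0 ~= 0" "!!i. dual \<rho>2 (f i) a0 = 0" "!!h. dual \<rho>2 (ch h) a0 = - \<Lambda>2 h *. a0"
  and \<Lambda>2: "clinear \<Lambda>2" "!!i. \<Lambda>2 (cr i) = of_nat (n2 i)"
  and m: "lie_module br \<sigma>" and y: "!!h. \<sigma> (ch h) y = (\<Lambda>1 h - \<Lambda>2 h) *. y"
   "!!i. (\<sigma> (f i) ^^ Suc (n1 i)) y = 0" "!!i. (\<sigma> (e i) ^^ Suc (n2 i)) y = 0"
 obtains B where "clinear B" "!!x a. a : rdual \<rho>2 a0 ==> B (dual \<rho>2 x a) = hom_act \<rho>1 \<sigma> x (B a)"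
  "!!w. app (B (Fw (%i. dual \<rho>2 (e i)) w a0)) v1 = Fw (%i. \<sigma> (e i)) w y"
proof -
 interpret v: verma A sr cr br ch e f d \<Lambda>1 n1 by (intro verma.intro km_axioms verma_axioms.intro) (fact \<Lambda>1)+
 interpret sw: verma A sr cr br "%h. - ch h" f e d \<Lambda>2 n2 by (intro verma.intro swap verma_axioms.intro) (fact \<Lambda>2)+
 let ?H = "hom_act \<rho>1 \<sigma>"
 have mH: "lie_module br ?H" by (rule lie_module_hom_act[OF m1 m])
 note app_H = app_hom_act[OF m1 m]
 note \<rho>1s = cbilinear_simps[OF lie_module_bilinear[OF m1]] and \<sigma>s = cbilinear_simps[OF lie_module_bilinear[OF m]]
 interpret \<sigma>: chev sr cr "%i. \<sigma> (e i)" "%i. \<sigma> (f i)" "%h. \<sigma> (ch h)" by (rule chev_module[OF m])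
 interpret \<rho>1: chev sr cr "%i. \<rho>1 (e i)" "%i. \<rho>1 (f i)" "%h. \<rho>1 (ch h)" by (rule chev_module[OF m1])
 obtain g where g: "clinear g" "!!w. g (Fw (%i. \<rho>1 (f i)) w v1) = Fw (%i. \<sigma> (f i)) w y"
  using v.highest_weight_lift[OF m1 v1 m y(2)] by blast
 define f0 where "f0 = Clin g"
 have f0: "app f0 = g" by (simp add: f0_def g(1))
 have eq: "\<phi> = \<psi>" if "!!w. app \<phi> (Fw (%i. \<rho>1 (f i)) w v1) = app \<psi> (Fw (%i. \<rho>1 (f i)) w v1)" for \<phi> \<psi> :: "('v1, 'x) clin"
 proof (rule clin_eqI)
  fix x
  have "clinear (%x. app \<phi> x - app \<psi> x)" by (rule clinearI) (simp_all add: app_simps cvec.scale_right_diff_distrib)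
  from subspace_zeros[OF this]
  have "cvec.span {Fw (%i. \<rho>1 (f i)) w v1 |w. True} \<subseteq> {x. app \<phi> x - app \<psi> x = 0}"
   by (rule cvec.span_minimal[rotated]) (use that in auto)
  then show "app \<phi> x = app \<psi> x" using gen1 by auto
 qed
 have Ff0: "?H (f i) f0 = 0" for i by (rule eq) (use g(2)[of "i # _"] in \<open>simp add: app_H f0 g(2)\<close>)
 have Hf0: "?H (- ch h) f0 = \<Lambda>2 h *. f0" for h proof (rule eq)
  fix w
  have "\<sigma> (ch h) (Fw (%i. \<sigma> (f i)) w y) = ((\<Lambda>1 h - \<Lambda>2 h) - (SUM i:UNIV. of_nat (cnt w i) * sr i h)) *. Fw (%i. \<sigma> (f i)) w y"
   by (rule \<sigma>.H_Fw_weight[OF y(1)])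
  moreover have "\<rho>1 (ch h) (Fw (%i. \<rho>1 (f i)) w v1) = (\<Lambda>1 h - (SUM i:UNIV. of_nat (cnt w i) * sr i h)) *. Fw (%i. \<rho>1 (f i)) w v1"
   by (rule \<rho>1.H_Fw_weight[OF v1(3)])
  ultimately show "app (?H (- ch h) f0) (Fw (%i. \<rho>1 (f i)) w v1) = app (\<Lambda>2 h *. f0) (Fw (%i. \<rho>1 (f i)) w v1)"
   by (simp add: app_H f0 g(2) \<rho>1s \<sigma>s clinear_simps[OF g(1)] cvec.scale_left_diff_distrib)
 qed
 have top: "app ((?H (e i) ^^ k) f0) v1 = (\<sigma> (e i) ^^ k) y" for i k
  by (induction k) (use g(2)[of "[]"] in \<open>simp_all add: app_H v1 app_simps f0\<close>)
 \<comment> \<open>A map that commutes with the \<open>f i\<close> is determined by its value at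
   \<open>v1\<close>.\<close>
 have vanish: "\<phi> = 0" if F: "!!i. ?H (f i) \<phi> = 0" and "app \<phi> v1 = 0" for \<phi> proof (rule eq)
  have "app \<phi> (\<rho>1 (f i) x) = \<sigma> (f i) (app \<phi> x)" for i x
   using arg_cong[OF F[of i], of "%\<phi>. app \<phi> x"] by (simp add: app_H)
  then show "app \<phi> (Fw (%i. \<rho>1 (f i)) w v1) = app 0 (Fw (%i. \<rho>1 (f i)) w v1)" for w
   by (induction w) (use that(2) in \<open>simp_all add: \<sigma>s\<close>)
 qed
 interpret Hc: chev sr cr "%i. ?H (e i)" "%i. ?H (f i)" "%h. ?H (ch h)" by (rule chev_module[OF mH])
 \<comment> \<open>The value at \<open>v1\<close> is 0 by the hypothesis on \<open>y\<close>, and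
   the map is still killed by every \<open>f j\<close>: for \<open>j = i\<close> because the sl2
   coefficient vanishes at this exponent. Thus \<open>f0\<close> meets the relations needed for a
   lift out of the restricted dual.\<close>
 have Ef0: "(?H (e i) ^^ Suc (n2 i)) f0 = 0" for i proof (rule vanish)
  show "app ((?H (e i) ^^ Suc (n2 i)) f0) v1 = 0" unfolding top by (rule y(3))
  fix j
  show "?H (f j) ((?H (e i) ^^ Suc (n2 i)) f0) = 0" proof (cases "j = i")
   case True
   interpret s: sl2 "?H (f i)" "?H (e i)" "?H (- ch (cr i))" by (rule sw.sl2_chev[OF sw.chev_module[OF mH]])
   have "?H (- ch (cr i)) f0 = of_nat (n2 i) *. f0" by (simp add: Hf0 \<Lambda>2(2))
   from s.E_F_pow_highest[OF this Ff0, of "n2 i"] show ?thesis unfolding True by simp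
  next case False
   have comm: "?H (f j) (?H (e i) z) = ?H (e i) (?H (f j) z)" for z using Hc.EF[of i j z] False by simp
   have "?H (f j) ((?H (e i) ^^ m) f0) = 0" for m by (induction m) (simp_all only: funpow.simps comp_apply id_apply comm Ff0 Hc.El)
   then show ?thesis .
  qed
 qed
 have a0': "dual \<rho>2 (- ch h) a0 = \<Lambda>2 h *. a0" for h
  using a0(3)[of h] by (simp add: cbilinear_neg1[OF lie_module_bilinear[OF dual_module[OF m2]]])
 obtain B where B: "clinear B" "!!w. B (Fw (%i. dual \<rho>2 (e i)) w a0) = Fw (%i. ?H (e i)) w f0"
  using sw.highest_weight_lift[OF dual_module[OF m2] a0(1,2) a0' mH Ef0] by blast
 show ?thesis proof (rule that[OF B(1)])
  fix x a assume "a : rdual \<rho>2 a0"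
  then show "B (dual \<rho>2 x a) = ?H x (B a)" unfolding rdual_def
   using sw.hw_map_equivariant[OF dual_module[OF m2] a0(2) a0' mH Ff0 Hf0 B] by blast
 next fix w
  have "app (Fw (%i. ?H (e i)) w f0) v1 = Fw (%i. \<sigma> (e i)) w y"
   by (induction w) (use g(2)[of "[]"] in \<open>simp_all add: app_H v1 app_simps f0\<close>)
  then show "app (B (Fw (%i. dual \<rho>2 (e i)) w a0)) v1 = Fw (%i. \<sigma> (e i)) w y" unfolding B(2) .
 qed
qed

end

section \<open>Invariant pairings along a reduced word\<close>

text \<open>Moving \<open>Fc\<close> off the middle argument gives a binomial sum over the ways to
  share the \<open>p\<close> factors between the other two. Hypothesis \<open>z\<close> leaves only
  the term in which the third argument has \<open>a\<close> factors in total, \<open>s\<close> of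
  which it carries already.\<close>

lemma invariant_pairing_pow:
 fixes P :: "'a => 'c => 'm => complex"
 assumes D: "!!b. b : D ==> Fa b : D" and inv: "!!b c x. b : D ==> P b (Fc c) x = - P (Fa b) c x - P b c (Fm x)"
  and z: "!!b s. b : D ==> s ~= a ==> P b c ((Fm ^^ s) x) = 0"
 shows "b : D ==> P b ((Fc ^^ p) c) ((Fm ^^ s) x) =
  (if s <= a then (- 1) ^ p * of_nat (p choose (a - s)) * P ((Fa ^^ (p + s - a)) b) c ((Fm ^^ a) x) else 0)"
proof (induction p arbitrary: b s)
 case 0 then show ?case using z[OF 0, of s] by (cases "s = a") (auto simp: binomial_eq_0)
next case (Suc p)
 have r: "P b ((Fc ^^ Suc p) c) ((Fm ^^ s) x) = - P (Fa b) ((Fc ^^ p) c) ((Fm ^^ s) x) - P b ((Fc ^^ p) c) ((Fm ^^ Suc s) x)"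
  using inv[OF Suc.prems] by simp
 note 1 = Suc.IH[OF D[OF Suc.prems], of s] and 2 = Suc.IH[OF Suc.prems, of "Suc s"]
 consider "a < s" | "s = a" | "s < a" by linarith
 then show ?case proof cases
  case 1 then show ?thesis unfolding r \<open>P (Fa b) _ _ = _\<close> 2 by simp
 next case 2
  then show ?thesis unfolding r 1 \<open>P b _ ((Fm ^^ Suc s) x) = _\<close> by (simp add: funpow_swap1)
 next case 3
  then obtain k where k: "a - s = Suc k" by (cases "a - s") auto
  have k': "a - Suc s = k" "p + Suc s - a = Suc p + s - a" using k by simp_all
  let ?X = "P ((Fa ^^ (Suc p + s - a)) b) c ((Fm ^^ a) x)"
  have "of_nat (p choose Suc k) * P ((Fa ^^ (p + s - a)) (Fa b)) c ((Fm ^^ a) x) = of_nat (p choose Suc k) * ?X"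
  proof (cases "Suc k <= p")
   case True
   then have "Suc p + s - a = Suc (p + s - a)" using k by simp
   then show ?thesis by (simp add: funpow_swap1)
  qed (simp add: binomial_eq_0)
  then show ?thesis unfolding r 1 2 using 3 k k' by (auto simp: algebra_simps)
 qed
qed

lemma invariant_pairing_zero:
 fixes P :: "'a => 'c => 'm => complex"
 assumes D: "!!b. b : D ==> Fa b : D" and inv: "!!b c x. b : D ==> P b (Fc c) x = - P (Fa b) c x - P b c (Fm x)"
  and S: "!!x. x : S ==> Fm x : S" and z: "!!b x. b : D ==> x : S ==> P b c x = 0"
 shows "b : D ==> x : S ==> P b ((Fc ^^ p) c) x = 0"
proof (induction p arbitrary: b x)
 case (Suc p) then show ?case using D S by (simp add: inv)
qed (simp add: z)

section \<open>One reflection: transport of a pairing along an sl2-string\<close>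

context km
begin

definition wspan :: "('g => 'm::complex_vector => 'm) => 'm => ('i list => bool) => 'm set"
 where "wspan \<tau> m Q = cvec.span {Fw (%i. \<tau> (e i)) w m |w. Q w}"

lemma wspan_base: "Q w ==> Fw (%i. \<tau> (e i)) w m : wspan \<tau> m Q" unfolding wspan_def by (rule cvec.span_base) blast

lemma wspan_sub: "cvec.subspace (wspan \<tau> m Q)" by (simp add: wspan_def)

lemma wspan_minimal: "cvec.subspace S ==> (!!w. Q w ==> Fw (%i. \<tau> (e i)) w m : S) ==> wspan \<tau> m Q \<subseteq> S"
 unfolding wspan_def by (rule cvec.span_minimal) auto

lemma wspan_e:
 assumes "lie_module br \<tau>" "x : wspan \<tau> m Q" "!!w. Q w ==> R (k # w)"
 shows "\<tau> (e k) x : wspan \<tau> m R"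
proof -
 have "wspan \<tau> m Q \<subseteq> {x. \<tau> (e k) x : wspan \<tau> m R}"
 proof (rule wspan_minimal[OF subspace_preimage[OF lie_module_linear[OF assms(1)] wspan_sub]])
  fix w assume "Q w"
  from wspan_base[of R "k # w" \<tau> m, OF assms(3)[OF this]]
  show "Fw (%i. \<tau> (e i)) w m : {x. \<tau> (e k) x : wspan \<tau> m R}" by simp
 qed
 then show ?thesis using assms(2) by blast
qed

text \<open>\<open>f i\<close> commutes with every letter other than \<open>i\<close> and trades a
  letter \<open>i\<close> for a scalar, so a letter other than \<open>i\<close> survives.\<close>

lemma f_wspan:
 assumes m: "lie_module br \<tau>" and fm: "\<tau> (f i) m = 0" and hm: "!!h. \<tau> (ch h) m = \<theta> h *. m"
 shows "x : wspan \<tau> m (%w. set w - {i} ~= {}) ==> \<tau> (f i) x : wspan \<tau> m (%w. set w - {i} ~= {})"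
proof -
 note r = module_gen[OF m] and ts = cbilinear_simps[OF lie_module_bilinear[OF m]]
 interpret t: chev sr cr "%i. \<tau> (f i)" "%i. \<tau> (e i)" "%h y. - \<tau> (ch h) y"
  by (rule chev.chev_swap[OF chev_module[OF m]])
 have wt: "EX c. \<tau> (ch h) (Fw (%i. \<tau> (e i)) w m) = c *. Fw (%i. \<tau> (e i)) w m" for h w proof -
  have "- \<tau> (ch h) m = (- \<theta> h) *. m" for h by (simp add: hm)
  from arg_cong[OF t.H_Fw_weight[OF this, of h w], of uminus] show ?thesis
   unfolding minus_minus cvec.scale_minus_left[symmetric] by (rule exI)
 qed
 have fe: "\<tau> (f i) (\<tau> (e k) x) = \<tau> (e k) (\<tau> (f i) x) - (if k = i then \<tau> (ch (cr i)) x else 0)" for k x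
  using r(1)[of k i x] by auto
 have A: "\<tau> (f i) (Fw (%i. \<tau> (e i)) w m) : wspan \<tau> m (%_. True)" for w proof (induction w)
  case Nil then show ?case using cvec.subspace_0[OF wspan_sub] by (simp add: fm)
 next case (Cons k w)
  have 1: "\<tau> (e k) (\<tau> (f i) (Fw (%i. \<tau> (e i)) w m)) : wspan \<tau> m (%_. True)" by (rule wspan_e[OF m Cons.IH]) simp
  obtain c where "\<tau> (ch (cr i)) (Fw (%i. \<tau> (e i)) w m) = c *. Fw (%i. \<tau> (e i)) w m" using wt by blast
  then have 2: "(if k = i then \<tau> (ch (cr i)) (Fw (%i. \<tau> (e i)) w m) else 0) : wspan \<tau> m (%_. True)"
   using wspan_base[of "%_. True" w \<tau> m] cvec.subspace_scale[OF wspan_sub] cvec.subspace_0[OF wspan_sub] by auto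
  show ?case using cvec.subspace_diff[OF wspan_sub 1 2] by (simp add: fe)
 qed
 have B: "\<tau> (f i) (Fw (%i. \<tau> (e i)) w m) : wspan \<tau> m (%w. set w - {i} ~= {})" if "set w - {i} ~= {}" for w using that
 proof (induction w)
  case (Cons k w)
  show ?case proof (cases "k = i")
   case False
   have "\<tau> (e k) (\<tau> (f i) (Fw (%i. \<tau> (e i)) w m)) : wspan \<tau> m (%w. set w - {i} ~= {})"
    by (rule wspan_e[OF m A]) (use False in auto)
   then show ?thesis using False by (simp add: fe)
  next case True
   then have w: "set w - {i} ~= {}" using Cons.prems by auto
   have 1: "\<tau> (e k) (\<tau> (f i) (Fw (%i. \<tau> (e i)) w m)) : wspan \<tau> m (%w. set w - {i} ~= {})"
    by (rule wspan_e[OF m Cons.IH[OF w]]) auto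
   obtain c where c: "\<tau> (ch (cr i)) (Fw (%i. \<tau> (e i)) w m) = c *. Fw (%i. \<tau> (e i)) w m" using wt by blast
   have 2: "\<tau> (ch (cr i)) (Fw (%i. \<tau> (e i)) w m) : wspan \<tau> m (%w. set w - {i} ~= {})"
    unfolding c by (rule cvec.subspace_scale[OF wspan_sub], rule wspan_base) (rule w)
   show ?thesis using cvec.subspace_diff[OF wspan_sub 1 2] True by (simp add: fe)
  qed
 qed simp
 have "wspan \<tau> m (%w. set w - {i} ~= {}) \<subseteq> {x. \<tau> (f i) x : wspan \<tau> m (%w. set w - {i} ~= {})}"
  by (rule wspan_minimal[OF subspace_preimage[OF lie_module_linear[OF m] wspan_sub]]) (use B in blast)
 then show "x : wspan \<tau> m (%w. set w - {i} ~= {}) ==> ?thesis" by blast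
qed

text \<open>The pairing of \<open>c\<close> with words on \<open>n\<close> is concentrated at
  \<open>n\<close> itself, and \<open>f i ^^ a\<close> returns a nonzero multiple of
  \<open>n\<close> from the top of its string. Of the \<open>p\<close> factors moved off
  \<open>(\<sigma>1 (f i) ^^ p) c\<close>, exactly \<open>a\<close> go there and \<open>q\<close> go
  to \<open>b\<close>. The constant picks up a sign, \<open>p choose a\<close> and the sl2
  coefficient, all nonzero.\<close>

lemma chain_step:
 fixes \<tau> :: "'g => 'm::complex_vector => 'm" and P :: "'a => 'c => 'm => complex" and K :: complex
 assumes m: "lie_module br \<tau>" and D: "!!b x. b : D ==> da x b : D"
  and inv: "!!b g c x. b : D ==> P b (\<sigma>1 g c) x = - P (da g b) c x - P b c (\<tau> g x)"
  and lin: "!!b c. clinear (P b c)" and ev: "!!b g u. b : D ==> ev (da g b) u = - ev b (\<sigma>2 g u)"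
  and fm: "\<tau> (f i) n = 0" and hm: "!!h. \<tau> (ch h) n = \<theta> h *. n" and a: "\<theta> (cr i) = - of_nat a"
  and top: "(\<tau> (e i) ^^ Suc a) n = 0" and c1: "!!b. b : D ==> P b c n = K * ev b u" and K: "K ~= 0"
  and c2: "!!b w. b : D ==> w ~= [] ==> P b c (Fw (%i. \<tau> (e i)) w n) = 0" and pq: "p = q + a"
 shows "EX K'. K' ~= 0 & (ALL b:D. P b ((\<sigma>1 (f i) ^^ p) c) ((\<tau> (e i) ^^ a) n) = K' * ev b ((\<sigma>2 (f i) ^^ q) u)) \<and>
  (ALL b:D. ALL w. w ~= [] --> P b ((\<sigma>1 (f i) ^^ p) c) (Fw (%i. \<tau> (e i)) w ((\<tau> (e i) ^^ a) n)) = 0)"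
proof -
 note ts = cbilinear_simps[OF lie_module_bilinear[OF m]] and Ps = clinear_simps[OF lin]
 interpret s: sl2 "\<tau> (f i)" "\<tau> (e i)" "%y. - \<tau> (ch (cr i)) y"
  by (rule sl2_chev[OF chev.chev_swap[OF chev_module[OF m]]])
 let ?m = "(\<tau> (e i) ^^ a) n"
 have Hn: "- \<tau> (ch (cr i)) n = of_nat a *. n" by (simp add: hm a)
 have epow: "(\<tau> (e i) ^^ k) n = Fw (%i. \<tau> (e i)) (replicate k i) n" for k by (induction k) auto
 define \<kappa> where "\<kappa> = (\<Prod>j<a. of_nat (Suc j) * (of_nat a - of_nat j :: complex))"
 have \<kappa>0: "\<kappa> ~= 0" unfolding \<kappa>_def by (rule s.E_pow_F_pow_coeff) simp
 have fa: "(\<tau> (f i) ^^ a) ?m = \<kappa> *. n" unfolding \<kappa>_def by (rule s.E_pow_F_pow_highest[OF Hn fm])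
 have lo: "EX k. (\<tau> (f i) ^^ s) ?m = k *. (\<tau> (e i) ^^ (a - s)) n" if "s <= a" for s using that proof (induction s)
  case 0 then show ?case by (intro exI[of _ 1]) (simp add: scaleC_one)
 next case (Suc s)
  then obtain k where k: "(\<tau> (f i) ^^ s) ?m = k *. (\<tau> (e i) ^^ (a - s)) n" by auto
  have "a - s = Suc (a - Suc s)" using Suc.prems by simp
  then have "\<tau> (f i) ((\<tau> (e i) ^^ (a - s)) n) = (of_nat (Suc (a - Suc s)) * (of_nat a - of_nat (a - Suc s))) *. (\<tau> (e i) ^^ (a - Suc s)) n"
   using s.E_F_pow_highest[OF Hn fm, of "a - Suc s"] by simp
  then show ?case using k by (auto simp: ts scaleC_scaleC)
 qed
 have zero: "P b c ((\<tau> (f i) ^^ s) ?m) = 0" if b: "b : D" and s: "s ~= a" for b s proof (cases "s < a")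
  case True
  then obtain k where k: "(\<tau> (f i) ^^ s) ?m = k *. (\<tau> (e i) ^^ (a - s)) n" using lo[of s] by auto
  have "replicate (a - s) i ~= []" using True by simp
  from c2[OF b this] show ?thesis unfolding k unfolding Ps epow by simp
 next case False
  then have "s = Suc (s - a - 1) + a" using s by simp
  then obtain r where "s = Suc r + a" by blast
  then have "(\<tau> (f i) ^^ s) ?m = (\<tau> (f i) ^^ r) (\<tau> (f i) ((\<tau> (f i) ^^ a) ?m))"
   by (simp only: funpow_add comp_apply funpow_Suc_right)
  moreover have "(\<tau> (f i) ^^ r) 0 = 0" by (induction r) (simp_all add: ts)
  ultimately show ?thesis unfolding fa by (simp add: ts fm Ps)
 qed
 have dap: "(da (f i) ^^ r) b : D" if "b : D" for b r using that by (induction r) (simp_all add: D)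
 have evp: "ev ((da (f i) ^^ r) b) u = (- 1) ^ r * ev b ((\<sigma>2 (f i) ^^ r) u)" if "b : D" for b u r
  by (induction r arbitrary: u) (simp_all add: ev dap[OF that] funpow_swap1[of "\<sigma>2 (f i)"])
 define K' where "K' = (- 1) ^ (p + q) * of_nat (p choose a) * \<kappa> * K"
 have "p choose a ~= 0" using pq by simp
 then have K'0: "K' ~= 0" unfolding K'_def using \<kappa>0 K by (simp only: mult_eq_0_iff of_nat_eq_0_iff power_eq_0_iff) simp
 have 1: "P b ((\<sigma>1 (f i) ^^ p) c) ?m = K' * ev b ((\<sigma>2 (f i) ^^ q) u)" if b: "b : D" for b proof -
  have "P b ((\<sigma>1 (f i) ^^ p) c) ((\<tau> (f i) ^^ 0) ?m) =
   (if 0 <= a then (- 1) ^ p * of_nat (p choose (a - 0)) * P ((da (f i) ^^ (p + 0 - a)) b) c ((\<tau> (f i) ^^ a) ?m) else 0)"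
   by (rule invariant_pairing_pow[where D = D and Fa = "da (f i)" and Fm = "\<tau> (f i)" and P = P and Fc = "\<sigma>1 (f i)"
     and a = a and c = c and x = ?m, OF D inv zero b])
  then show ?thesis unfolding fa using pq by (simp add: Ps c1[OF dap[OF b]] evp[OF b] K'_def power_add)
 qed
 let ?S = "wspan \<tau> n (%w. set w - {i} ~= {})"
 have S0: "P b c x = 0" if "b : D" "x : ?S" for b x proof -
  have "?S \<subseteq> {x. P b c x = 0}" proof (rule wspan_minimal[OF subspace_zeros[OF lin]])
   fix w assume "set w - {i} ~= {}"
   then have "w ~= []" by auto
   with c2[OF that(1)] show "Fw (%i. \<tau> (e i)) w n : {x. P b c x = 0}" by simp
  qed
  then show ?thesis using that(2) by blast
 qed
 \<comment> \<open>A nonempty word in \<open>i\<close> alone leaves the string and gives 0 by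
   \<open>top\<close>. Any other word lies in \<open>?S\<close>, which \<open>f i\<close> preserves
   and on which the pairing with \<open>c\<close> vanishes.\<close>
 have 2: "P b ((\<sigma>1 (f i) ^^ p) c) (Fw (%i. \<tau> (e i)) w ?m) = 0" if b: "b : D" and w: "w ~= []" for b w
 proof (cases "set w - {i} = {}")
  case True
  then have "ALL x:set w. x = i" by auto
  from replicate_length_same[OF this, symmetric] have rep: "w = replicate (length w) i" .
  have "Fw (%i. \<tau> (e i)) w ?m = (\<tau> (e i) ^^ length w) ?m" by (subst rep) (simp only: foldr_replicate)
  also have "... = 0" proof -
   obtain r where r: "length w = Suc r" using w by (cases w) auto
   have "(\<tau> (e i) ^^ Suc r) ?m = (\<tau> (e i) ^^ r) ((\<tau> (e i) ^^ Suc a) n)" by (simp add: funpow_swap1)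
   moreover have "(\<tau> (e i) ^^ r) 0 = 0" by (induction r) (simp_all add: ts)
   ultimately show ?thesis unfolding r top by (simp only:)
  qed
  finally show ?thesis by (simp add: Ps)
 next case False
  have "Fw (%i. \<tau> (e i)) w ?m = Fw (%i. \<tau> (e i)) (w @ replicate a i) n" by (simp only: epow foldr_append)
  also have "... : ?S" by (rule wspan_base) (use False in auto)
  finally have "Fw (%i. \<tau> (e i)) w ?m : ?S" .
  from invariant_pairing_zero[where D = D and Fa = "da (f i)" and Fm = "\<tau> (f i)" and S = ?S and P = P and Fc = "\<sigma>1 (f i)" and c = c,
    OF D inv f_wspan[OF m fm hm] S0 b this]
  show ?thesis .
 qed
 have A: "ALL b:D. P b ((\<sigma>1 (f i) ^^ p) c) ?m = K' * ev b ((\<sigma>2 (f i) ^^ q) u)" by (rule ballI) (rule 1)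
 have B: "ALL b:D. ALL w. w ~= [] --> P b ((\<sigma>1 (f i) ^^ p) c) (Fw (%i. \<tau> (e i)) w ?m) = 0"
  by (rule ballI, rule allI, rule impI) (rule 2)
 show ?thesis by (rule exI) (rule conjI[OF K'0 conjI[OF A B]])
qed

definition srf :: "'i => ('h => complex) => 'h => complex" where "srf i \<mu> h = \<mu> h - \<mu> (cr i) * sr i h"

abbreviation "swd v \<mu> \<equiv> foldr srf v \<mu>"

lemma pow_weight:
 assumes "lie_module br \<sigma>" "!!h. \<sigma> (ch h) x = \<mu> h *. x"
 shows "\<sigma> (ch h) ((\<sigma> (f i) ^^ n) x) = (\<mu> h - of_nat n * sr i h) *. (\<sigma> (f i) ^^ n) x"
  "\<sigma> (ch h) ((\<sigma> (e i) ^^ n) x) = (\<mu> h + of_nat n * sr i h) *. (\<sigma> (e i) ^^ n) x"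
proof -
 show "\<sigma> (ch h) ((\<sigma> (f i) ^^ n) x) = (\<mu> h - of_nat n * sr i h) *. (\<sigma> (f i) ^^ n) x"
  using chev.H_pow[OF chev_module[OF assms(1)], where h = h and y = x and c = "\<mu> h" and i = i and n = n, OF assms(2)] .
 have "- \<sigma> (ch h) x = (- \<mu> h) *. x" by (simp add: assms(2))
 from chev.H_pow[OF chev.chev_swap[OF chev_module[OF assms(1)]], where h = h and y = x and c = "- \<mu> h" and i = i and n = n, OF this]
 have "- \<sigma> (ch h) ((\<sigma> (e i) ^^ n) x) = (- (\<mu> h + of_nat n * sr i h)) *. (\<sigma> (e i) ^^ n) x" by (simp add: algebra_simps)
 then show "\<sigma> (ch h) ((\<sigma> (e i) ^^ n) x) = (\<mu> h + of_nat n * sr i h) *. (\<sigma> (e i) ^^ n) x"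
  by (simp only: cvec.scale_minus_left neg_equal_iff_equal)
qed

lemma f_pow_neq_0:
 assumes "lie_module br \<sigma>" "!!h. \<sigma> (ch h) x = \<mu> h *. x" "\<mu> (cr i) = of_nat n" "EX N. (\<sigma> (e i) ^^ N) x = 0" "x ~= 0"
 shows "(\<sigma> (f i) ^^ n) x ~= 0"
proof
 assume z: "(\<sigma> (f i) ^^ n) x = 0"
 interpret s: sl2 "\<sigma> (e i)" "\<sigma> (f i)" "\<sigma> (ch (cr i))" by (rule sl2_chev[OF chev_module[OF assms(1)]])
 obtain N where "(\<sigma> (e i) ^^ N) x = 0" using assms(4) by blast
 from s.pow_inj[OF _ this z, of "int n"] show False using assms(2,3,5) by simp
qed

lemma e_pow_neq_0:
 assumes "lie_module br \<sigma>" "!!h. \<sigma> (ch h) x = \<mu> h *. x" "\<mu> (cr i) = - of_nat n" "EX N. (\<sigma> (f i) ^^ N) x = 0" "x ~= 0"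
 shows "(\<sigma> (e i) ^^ n) x ~= 0"
proof
 assume z: "(\<sigma> (e i) ^^ n) x = 0"
 interpret s: sl2 "\<sigma> (f i)" "\<sigma> (e i)" "%y. - \<sigma> (ch (cr i)) y"
  by (rule sl2_chev[OF chev.chev_swap[OF chev_module[OF assms(1)]]])
 obtain N where "(\<sigma> (f i) ^^ N) x = 0" using assms(4) by blast
 from s.pow_inj[OF _ this z, of "int n"] show False using assms(2,3,5) by simp
qed

end

text \<open>Weight modules whose weights \<open>\<omega> + z\<close> have norm at most that of \<open>\<omega>\<close>; \<open>qf z\<close> is the difference of
 the squared norms. The module is the image of the projection
 \<open>pj\<close>, and \<open>\<gg>\<close> acts by zero on the kernel of \<open>pj\<close>, which only fills up the type.\<close>

context km
begin

definition qfn :: "('i => int) => ('i => int) => real" where "qfn a z = 2 * (SUM i:UNIV. real_of_int (z i) * d i * a i) + bf z z"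
definition sh :: "int => 'i => 'i => int" where "sh k i j = (if j = i then k else 0)"

lemma sh_alt: "sh k i = (%j. k * up (uvec i) j)" by (auto simp: sh_def uvec_def)

lemma pr_sh: "pr (sh k i) j = k * A j i"
proof -
 have "pr (sh k i) j = k * pr (up (uvec i)) j" unfolding pr_def sh_alt by (simp add: sum_distrib_left mult.assoc)
 then show ?thesis by (simp add: pr_unit)
qed

lemma bf_sh: "bf (sh k i) z = k * d i * pr z i"
proof -
 have "bf (sh k i) z = k * bf (up (uvec i)) z" unfolding bf_def sh_alt by (simp add: sum_distrib_left mult.assoc)
 then show ?thesis by (simp add: bf_unit1)
qed

lemma wt_sh: "wt (sh k i) h = of_int k * sr i h"
proof -
 have "wt (sh k i) h = of_int k * wt (up (uvec i)) h" unfolding ad.wt_def sh_alt by (simp add: sum_distrib_left mult.assoc)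
 then show ?thesis by (simp only: ad.wt_unit)
qed

lemma qf_shift: "qfn a (z + sh k i) = qfn a z + 2 * d i * k * (k + a i + pr z i)"
proof -
 have "(SUM j:UNIV. real_of_int (sh k i j) * d j * a j) = (SUM j:UNIV. if j = i then k * d j * a j else 0)"
  by (rule sum.cong) (auto simp: sh_def)
 then have "(SUM j:UNIV. real_of_int ((z + sh k i) j) * d j * a j) = (SUM j:UNIV. real_of_int (z j) * d j * a j) + k * d i * a i"
  by (simp add: algebra_simps sum.distrib)
 moreover have "bf (z + sh k i) (z + sh k i) = bf z z + 2 * (k * d i * pr z i) + k * d i * (k * 2)"
  unfolding bf_add1 bf_add2 bf_sym[of z "sh k i"] bf_sh pr_sh A_diag by simp
 ultimately show ?thesis by (simp add: qfn_def algebra_simps)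
qed

lemma qf_0: "qfn a 0 = 0" by (simp add: qfn_def bf_def)

end

locale wtmod = km A sr cr br ch e f d for A :: "'i::finite => 'i => int" and sr :: "'i => 'h::complex_vector => complex" and cr
  and br :: "'g::complex_vector => 'g => 'g" and ch e f d +
 fixes \<tau> :: "'g => 'm::complex_vector => 'm" and pj :: "'m => 'm" and \<omega> :: "'h => complex" and \<omega>i :: "'i => int" and nv :: 'm
 assumes mod\<tau>: "lie_module br \<tau>" and \<omega>i: "!!i. \<omega> (cr i) = of_int (\<omega>i i)"
  and pj: "clinear pj" "!!x. pj (pj x) = pj x" "!!g x. \<tau> g (pj x) = \<tau> g x" "!!g x. pj (\<tau> g x) = \<tau> g x"
  and spanning: "!!x. pj x : cvec.span (\<Union>z. {x. pj x = x & (ALL h. \<tau> (ch h) x = (\<omega> h + wt z h) *. x)})"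
  and bound: "!!z x. 0 < qfn \<omega>i z ==> pj x = x ==> (!!h. \<tau> (ch h) x = (\<omega> h + wt z h) *. x) ==> x = 0"
  and nv: "pj nv = nv" "!!h. \<tau> (ch h) nv = \<omega> h *. nv" "nv ~= 0"
begin

definition Mz :: "('i => int) => 'm set" where "Mz z = {x. pj x = x & (ALL h. \<tau> (ch h) x = (\<omega> h + wt z h) *. x)}"
abbreviation "qf \<equiv> qfn \<omega>i"

lemmas ts = cbilinear_simps[OF lie_module_bilinear[OF mod\<tau>]]

lemma Mz_bound: "x : Mz z ==> 0 < qf z ==> x = 0" using bound[of z x] by (simp add: Mz_def)

lemma sub_Mz: "cvec.subspace (Mz z)"
 unfolding Mz_def by (rule cvec.subspaceI) (simp_all add: ts clinear_simps[OF pj(1)] scaleC_add_right cvec.scale_left_commute)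

lemma pj_pow: "pj ((\<tau> g ^^ k) (pj x)) = pj ((\<tau> g ^^ k) x)"
 by (cases k) (simp_all add: pj funpow_swap1[of "\<tau> g"] del: funpow.simps(2) add: funpow_Suc_right)

lemma pow_pj: "pj x = x ==> pj ((\<tau> g ^^ k) x) = (\<tau> g ^^ k) x" by (cases k) (simp_all add: pj)

lemma e_pow_Mz: "x : Mz z ==> (\<tau> (e i) ^^ k) x : Mz (z + sh (int k) i)"
 using pow_weight(2)[OF mod\<tau>, where x = x and \<mu> = "%h. \<omega> h + wt z h" and i = i and n = k] by (simp add: Mz_def pow_pj ad.wt_add wt_sh algebra_simps)
lemma f_pow_Mz: "x : Mz z ==> (\<tau> (f i) ^^ k) x : Mz (z + sh (- int k) i)"
 using pow_weight(1)[OF mod\<tau>, where x = x and \<mu> = "%h. \<omega> h + wt z h" and i = i and n = k] by (simp add: Mz_def pow_pj ad.wt_add wt_sh algebra_simps)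

text \<open>Where the norm bound is attained, a string cannot pass the reflected weight: by
  \<open>qf_shift\<close> the weight beyond it would be longer.\<close>

lemma e_pow_0: "x : Mz z ==> qf z = 0 ==> 0 < k ==> - (\<omega>i i + pr z i) < int k ==> (\<tau> (e i) ^^ k) x = 0"
proof (rule Mz_bound[OF e_pow_Mz])
 assume "qf z = 0" "0 < k" "- (\<omega>i i + pr z i) < int k"
 then have "0 < int k + \<omega>i i + pr z i" by linarith
 then have "0 < real_of_int (int k + \<omega>i i + pr z i)" by linarith
 then show "0 < qf (z + sh (int k) i)" unfolding qf_shift \<open>qf z = 0\<close> using d_pos[of i] \<open>0 < k\<close> by simp
qed

lemma f_pow_0: "x : Mz z ==> qf z = 0 ==> 0 < k ==> \<omega>i i + pr z i < int k ==> (\<tau> (f i) ^^ k) x = 0"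
proof (rule Mz_bound[OF f_pow_Mz])
 assume "qf z = 0" "0 < k" "\<omega>i i + pr z i < int k"
 then have "0 < int k - \<omega>i i - pr z i" by linarith
 then have "0 < real_of_int (int k - \<omega>i i - pr z i)" by linarith
 then have "0 < 2 * d i * real k * real_of_int (int k - \<omega>i i - pr z i)" using d_pos[of i] \<open>0 < k\<close> by simp
 then show "0 < qf (z + sh (- int k) i)" unfolding qf_shift \<open>qf z = 0\<close> by (simp add: algebra_simps)
qed

lemma nv_Mz: "nv : Mz 0" using nv by (simp add: Mz_def)

lemma eq_on_Mz:
 assumes "clinear \<phi>" "clinear \<psi>" "!!x. \<phi> (pj x) = \<phi> x" "!!x. \<psi> (pj x) = \<psi> x" "!!z x. x : Mz z ==> \<phi> x = \<psi> x"
 shows "\<phi> x = \<psi> x"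
proof -
 have "clinear (%x. \<phi> x - \<psi> x)"
  by (rule clinearI) (simp_all add: clinear_simps[OF assms(1)] clinear_simps[OF assms(2)] cvec.scale_right_diff_distrib)
 from subspace_zeros[OF this] have "cvec.span (\<Union>z. Mz z) \<subseteq> {x. \<phi> x - \<psi> x = 0}"
  by (rule cvec.span_minimal[rotated]) (use assms(5) in auto)
 then have "\<phi> (pj x) = \<psi> (pj x)" using spanning[of x] unfolding Mz_def by auto
 then show ?thesis by (simp add: assms)
qed

lemma dual_pow: "app ((dual \<tau> g ^^ k) \<psi>) x = (- 1) ^ k * app \<psi> ((\<tau> g ^^ k) x)"
 by (induction k arbitrary: x) (simp_all add: app_dual[OF mod\<tau>] funpow_swap1[of "\<tau> g"])

text \<open>Evaluate the component of weight \<omega>. A power of \<open>e i\<close> or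
  \<open>f i\<close> on this functional reads off the weight space shifted the opposite way, which
  the norm bound makes 0 beyond the length of the string.\<close>

lemma coefficient_functional:
 obtains \<psi> where "app \<psi> nv = 1" "!!z x. z ~= 0 ==> x : Mz z ==> app \<psi> x = 0"
  "!!h. dual \<tau> (ch h) \<psi> = - \<omega> h *. \<psi>"
  "!!i k. 0 < k ==> - \<omega>i i < int k ==> (dual \<tau> (f i) ^^ k) \<psi> = 0"
  "!!i k. 0 < k ==> \<omega>i i < int k ==> (dual \<tau> (e i) ^^ k) \<psi> = 0"
proof -
 have inj: "inj (%z h. \<omega> h + wt z h)" proof (rule injI)
  fix z z' assume "(%h. \<omega> h + wt z h) = (%h. \<omega> h + wt z' h)"
  then have "wt z = wt z'" by (simp add: fun_eq_iff)
  then show "z = z'" using wt_inj by (rule injD[rotated])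
 qed
 have eig: "\<tau> (ch h) x = (\<omega> h + wt z h) *. x" if "x : Mz z" for z h x using that by (simp add: Mz_def)
 obtain l :: "'m => complex" where l: "clinear l" "l nv = 1" "!!z x. z ~= 0 ==> x : Mz z ==> l x = 0"
  using weight_functional[of Mz "%z h. \<omega> h + wt z h" "%h. \<tau> (ch h)", OF sub_Mz inj lie_module_linear[OF mod\<tau>] eig nv_Mz nv(3)]
  by blast
 define \<psi> where "\<psi> = Clin (%x. l (pj x))"
 have "clinear (%x. l (pj x))" by (rule clinearI) (simp_all add: clinear_simps[OF pj(1)] clinear_simps[OF l(1)])
 then have \<psi>pj: "app \<psi> x = l (pj x)" for x by (simp add: \<psi>_def)
 have \<psi>: "app \<psi> x = l x" if "x : Mz z" for x z using that by (simp add: \<psi>pj Mz_def)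
 have eqM: "\<phi> = \<theta>" if "!!x. app \<phi> (pj x) = app \<phi> x" "!!x. app \<theta> (pj x) = app \<theta> x"
  "!!z x. x : Mz z ==> app \<phi> x = app \<theta> x" for \<phi> \<theta> :: "('m, complex) clin"
  by (rule clin_eqI) (rule eq_on_Mz[OF clinear_app clinear_app that])
 have pow0: "(dual \<tau> g ^^ k) \<psi> = 0"
  if g: "!!x z. x : Mz z ==> (\<tau> g ^^ k) x : Mz (z + s)" and s: "0 < qf (- s)" for g k s proof (rule eqM)
  fix z x assume x: "x : Mz z"
  have "app \<psi> ((\<tau> g ^^ k) x) = 0" proof (cases "z + s = 0")
   case True
   then have "z = - s" by (simp add: eq_neg_iff_add_eq_0)
   then have "x = 0" using Mz_bound x s by blast
   then show ?thesis by (simp add: clinear_0[OF clinear_funpow[OF lie_module_linear[OF mod\<tau>]]] app_simps)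
  next case False
   then show ?thesis using l(3)[OF False g[OF x]] by (simp add: \<psi>[OF g[OF x]])
  qed
  then show "app ((dual \<tau> g ^^ k) \<psi>) x = app 0 x" by (simp add: dual_pow)
 qed (simp_all add: dual_pow \<psi>pj pj_pow app_simps)
 have neg: "- sh k i = 0 + sh (- k) i" for k i by (auto simp: sh_def fun_eq_iff)
 show ?thesis proof (rule that)
  show "app \<psi> nv = 1" "!!z x. z ~= 0 ==> x : Mz z ==> app \<psi> x = 0" using l \<psi>[OF nv_Mz] \<psi> by simp_all
  show "dual \<tau> (ch h) \<psi> = - \<omega> h *. \<psi>" for h proof (rule eqM)
   fix z x assume x: "x : Mz z"
   show "app (dual \<tau> (ch h) \<psi>) x = app (- \<omega> h *. \<psi>) x" proof (cases "z = 0")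
    case True then show ?thesis using eig[OF x, of h] by (simp add: app_dual[OF mod\<tau>] app_simps)
   next case False
    then show ?thesis using l(3)[OF False x] eig[OF x, of h] by (simp add: app_dual[OF mod\<tau>] app_simps \<psi>[OF x])
   qed
  qed (simp_all add: app_dual[OF mod\<tau>] \<psi>pj pj app_simps)
  show "(dual \<tau> (f i) ^^ k) \<psi> = 0" if "0 < k" "- \<omega>i i < int k" for i k proof (rule pow0[OF f_pow_Mz])
   have "0 < real_of_int (int k + \<omega>i i)" using that(2) by linarith
   then show "0 < qf (- sh (- int k) i)" unfolding neg qf_shift qf_0 using d_pos[of i] that(1) by (simp add: pr_def)
  qed
  show "(dual \<tau> (e i) ^^ k) \<psi> = 0" if "0 < k" "\<omega>i i < int k" for i k proof (rule pow0[OF e_pow_Mz])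
   have "0 < real_of_int (int k - \<omega>i i)" using that(2) by linarith
   then have "0 < 2 * d i * real k * real_of_int (int k - \<omega>i i)" using d_pos[of i] that(1) by simp
   then show "0 < qf (- sh (int k) i)" unfolding neg qf_shift qf_0 by (simp add: pr_def algebra_simps)
  qed
 qed
qed

text \<open>After each suffix of the word, \<open>c\<close> and \<open>u\<close> are extremal
  vectors, and \<open>n\<close> has the difference of their weights and still attains the norm
  bound. The condition \<open>q <= p\<close> places \<open>n\<close> at the lower end of its string
  for the next letter, of length \<open>a = p - q\<close>, as \<open>chain_step\<close>
  requires.\<close>

lemma chain:
 fixes P :: "'a => 'c::complex_vector => 'm => complex" and \<sigma>2 :: "'g => 'u::complex_vector => 'u"
 assumes D: "!!b x. b : D ==> da x b : D"
  and inv: "!!b g c x. b : D ==> P b (\<sigma>1 g c) x = - P (da g b) c x - P b c (\<tau> g x)"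
  and lin: "!!b c. clinear (P b c)" and ev: "!!b g u. b : D ==> ev (da g b) u = - ev b (\<sigma>2 g u)"
  and m1: "lie_module br \<sigma>1" "!!i x. EX n. (\<sigma>1 (e i) ^^ n) x = 0"
  and m2: "lie_module br \<sigma>2" "!!i x. EX n. (\<sigma>2 (e i) ^^ n) x = 0"
  and c0: "!!h. \<sigma>1 (ch h) c0 = \<mu>1 h *. c0" "c0 ~= 0" and u0: "!!h. \<sigma>2 (ch h) u0 = \<mu>2 h *. u0" "u0 ~= 0"
  and \<omega>: "!!h. \<omega> h = \<mu>2 h - \<mu>1 h" and base: "!!b. b : D ==> P b c0 nv = ev b u0"
   "!!b w. b : D ==> w ~= [] ==> P b c0 (Fw (%i. \<tau> (e i)) w nv) = 0" and v: "ALL pre i suf. v = pre @ i # suf -->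
   (EX p q. swd suf \<mu>1 (cr i) = of_nat p & swd suf \<mu>2 (cr i) = of_nat q & q <= p)"
 shows "EX c u n z K. c ~= 0 & u ~= 0 & K ~= 0 & (ALL h. \<sigma>1 (ch h) c = swd v \<mu>1 h *. c) \<and>
  (ALL h. \<sigma>2 (ch h) u = swd v \<mu>2 h *. u) & n : Mz z & (ALL h. \<omega> h + wt z h = swd v \<mu>2 h - swd v \<mu>1 h) & qf z = 0 \<and>
  (ALL b:D. P b c n = K * ev b u) & (ALL b:D. ALL w. w ~= [] --> P b c (Fw (%i. \<tau> (e i)) w n) = 0)" using v
proof (induction v)
 case Nil
 show ?case proof (intro exI conjI)
  show "ALL h. \<omega> h + wt 0 h = swd [] \<mu>2 h - swd [] \<mu>1 h" using \<omega> by simp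
  show "ALL b:D. P b c0 nv = 1 * ev b u0" using base(1) by simp
  show "ALL b:D. ALL w. w ~= [] --> P b c0 (Fw (%i. \<tau> (e i)) w nv) = 0" using base(2) by blast
 qed (fact nv_Mz qf_0 c0(2) u0(2) | simp add: c0 u0)+
next case (Cons i v)
 have "ALL pre j suf. v = pre @ j # suf --> (EX p q. swd suf \<mu>1 (cr j) = of_nat p & swd suf \<mu>2 (cr j) = of_nat q & q <= p)"
  using Cons.prems by (metis append_Cons)
 from Cons.IH[OF this]
 obtain c u n z K where IH': "c ~= 0" "u ~= 0" "K ~= 0" "ALL h. \<sigma>1 (ch h) c = swd v \<mu>1 h *. c"
  "ALL h. \<sigma>2 (ch h) u = swd v \<mu>2 h *. u" "n : Mz z" "ALL h. \<omega> h + wt z h = swd v \<mu>2 h - swd v \<mu>1 h" "qf z = 0"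
  "ALL b:D. P b c n = K * ev b u" "ALL b:D. ALL w. w ~= [] --> P b c (Fw (%i. \<tau> (e i)) w n) = 0" by (elim exE conjE)
 note IH = IH'(1-3) IH'(4,5)[rule_format] IH'(6) IH'(7)[rule_format] IH'(8) IH'(9,10)[rule_format]
 obtain p q where pq: "swd v \<mu>1 (cr i) = of_nat p" "swd v \<mu>2 (cr i) = of_nat q" "q <= p"
  using Cons.prems by (metis append_Nil)
 define a where "a = p - q"
 have pa: "p = q + a" using pq(3) by (simp add: a_def)
 have z: "\<omega> (cr i) + wt z (cr i) = - of_nat a" using IH(7)[of "cr i"] pq pa by simp
 then have "complex_of_int (\<omega>i i + pr z i) = of_int (- int a)" by (simp add: \<omega>i wt_cr)
 then have zi: "\<omega>i i + pr z i = - int a" by (simp only: of_int_eq_iff)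
 have fm: "\<tau> (f i) n = 0" using f_pow_0[OF IH(6,8), of 1 i] zi by simp
 have top: "(\<tau> (e i) ^^ Suc a) n = 0" by (rule e_pow_0[OF IH(6,8)]) (use zi in simp_all)
 have hm: "\<tau> (ch h) n = (\<omega> h + wt z h) *. n" for h using IH(6) by (simp add: Mz_def)
 have "EX K'. K' ~= 0 & (ALL b:D. P b ((\<sigma>1 (f i) ^^ p) c) ((\<tau> (e i) ^^ a) n) = K' * ev b ((\<sigma>2 (f i) ^^ q) u)) \<and>
  (ALL b:D. ALL w. w ~= [] --> P b ((\<sigma>1 (f i) ^^ p) c) (Fw (%i. \<tau> (e i)) w ((\<tau> (e i) ^^ a) n)) = 0)"
  by (rule chain_step[where D = D and da = da and P = P and ?\<sigma>1.0 = \<sigma>1 and ev = ev and ?\<sigma>2.0 = \<sigma>2,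
    OF mod\<tau> D inv lin ev fm hm z top IH(9,3,10) pa], assumption+)
 then obtain K' where K': "K' ~= 0" "ALL b:D. P b ((\<sigma>1 (f i) ^^ p) c) ((\<tau> (e i) ^^ a) n) = K' * ev b ((\<sigma>2 (f i) ^^ q) u)"
  "ALL b:D. ALL w. w ~= [] --> P b ((\<sigma>1 (f i) ^^ p) c) (Fw (%i. \<tau> (e i)) w ((\<tau> (e i) ^^ a) n)) = 0"
  by (elim exE conjE)
 show ?case proof (intro exI conjI)
  show "(\<sigma>1 (f i) ^^ p) c ~= 0" by (rule f_pow_neq_0[OF m1(1) IH(4) pq(1) m1(2) IH(1)])
  show "(\<sigma>2 (f i) ^^ q) u ~= 0" by (rule f_pow_neq_0[OF m2(1) IH(5) pq(2) m2(2) IH(2)])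
  show "ALL h. \<sigma>1 (ch h) ((\<sigma>1 (f i) ^^ p) c) = swd (i # v) \<mu>1 h *. (\<sigma>1 (f i) ^^ p) c"
   using pow_weight(1)[OF m1(1) IH(4)] by (simp add: srf_def pq)
  show "ALL h. \<sigma>2 (ch h) ((\<sigma>2 (f i) ^^ q) u) = swd (i # v) \<mu>2 h *. (\<sigma>2 (f i) ^^ q) u"
   using pow_weight(1)[OF m2(1) IH(5)] by (simp add: srf_def pq)
  show "(\<tau> (e i) ^^ a) n : Mz (z + sh (int a) i)" by (rule e_pow_Mz[OF IH(6)])
  show "ALL h. \<omega> h + wt (z + sh (int a) i) h = swd (i # v) \<mu>2 h - swd (i # v) \<mu>1 h" proof
   fix h
   show "\<omega> h + wt (z + sh (int a) i) h = swd (i # v) \<mu>2 h - swd (i # v) \<mu>1 h"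
    using IH(7)[of h] unfolding ad.wt_add wt_sh by (simp add: srf_def pq pa algebra_simps)
  qed
  show "qf (z + sh (int a) i) = 0" unfolding qf_shift IH(8) using zi by (simp flip: of_int_add)
 qed (fact K')+
qed

end

section \<open>From pairings to canonical morphisms\<close>

lemma tensor_zero_right: "v \<otimes> 0 = 0" using tensor_scale_right[of v 0 0] by simp

lemma tensor_sum_left: "sum f B \<otimes> w = (SUM b:B. f b \<otimes> w)"
proof (induction B rule: infinite_finite_induct)
 case (insert x F) then show ?case by (simp add: tensor_add_left)
qed (use tensor_scale_left[of 0 0 w] in simp_all)

lemma tensor_basis_expansion:
 fixes t :: "'v::complex_vector \<otimes>\<^sub>C 'u::complex_vector"
 obtains B g where "finite B" "cvec.independent B" "t = (SUM b:B. b \<otimes> g b)"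
proof -
 obtain B0 :: "'v set" where B0: "cvec.independent B0" "UNIV \<subseteq> cvec.span B0" using basis_ex[of "UNIV :: 'v set"] by blast
 have ext: "(SUM b:C. b \<otimes> (if b : B then g b else 0)) = (SUM b:B. b \<otimes> g b)"
  if "finite C" "B \<subseteq> C" for B C :: "'v set" and g :: "'v => 'u"
  by (rule sum.mono_neutral_cong_right) (use that in \<open>auto simp: tensor_zero_right\<close>)
 have "EX B g. finite B & B \<subseteq> B0 & t = (SUM b:B. b \<otimes> g b)" proof (induction t rule: tensor_induct)
  case (add s t)
  then obtain B g C k where 1: "finite B" "B \<subseteq> B0" "s = (SUM b:B. b \<otimes> g b)"
   and 2: "finite C" "C \<subseteq> B0" "t = (SUM b:C. b \<otimes> k b)" by blast
  have "s + t = (SUM b:B \<union> C. b \<otimes> ((if b : B then g b else 0) + (if b : C then k b else 0)))"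
   unfolding tensor_add_right sum.distrib using 1 2 by (simp add: ext)
  then show ?case using 1 2
   by (intro exI[of _ "B \<union> C"] exI[of _ "%b. (if b : B then g b else 0) + (if b : C then k b else 0)"]) simp
 next case (scale c t)
  then obtain B g where 1: "finite B" "B \<subseteq> B0" "t = (SUM b:B. b \<otimes> g b)" by blast
  then show ?case by (intro exI[of _ B] exI[of _ "%b. c *. g b"]) (simp add: tensor_scale_right cvec.scale_sum_right)
 next case (pure v w)
  have "v : cvec.span B0" using B0(2) by blast
  then obtain B r where "finite B" "B \<subseteq> B0" "v = (SUM b:B. r b *. b)" unfolding cvec.span_explicit by blast
  then show ?case by (intro exI[of _ B] exI[of _ "%b. r b *. w"]) (simp add: tensor_sum_left tensor_scale_left tensor_scale_right)
 qed
 then obtain B g where "finite B" "B \<subseteq> B0" "t = (SUM b:B. b \<otimes> g b)" by blast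
 then show ?thesis using that cvec.independent_mono[OF B0(1)] by blast
qed

lemma pairing_bilinear: "cbilinear (%x y. app a x * app b y :: complex)"
 by (rule cbilinearI) (simp_all add: app_simps algebra_simps)

text \<open>Expand \<open>t\<close> in independent vectors of the first factor. Functionals in
  \<open>Da\<close> dual to the finitely many vectors that occur isolate each coefficient, and
  \<open>Db\<close> detects it.\<close>

lemma tensor_separates:
 fixes t :: "'v::complex_vector \<otimes>\<^sub>C 'u::complex_vector"
 assumes Da: "cvec.subspace Da" "!!x. (!!a. a : Da ==> app a x = (0::complex)) ==> x = 0"
  and Db: "!!y. (!!b. b : Db ==> app b y = (0::complex)) ==> y = 0"
  and t: "!!a b. a : Da ==> b : Db ==> tensor_lift (%x y. app a x * app b y) t = 0"
 shows "t = 0"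
proof -
 obtain B g where B: "finite B" "cvec.independent B" "t = (SUM b:B. b \<otimes> g b)" using tensor_basis_expansion[of t] .
 have "ALL x:B. c x = 0" if c: "!!a. a : Da ==> (SUM x:B. c x * app a x) = 0" for c proof -
  have "(SUM x:B. c x *. x) = 0" by (rule Da(2)) (simp add: app_simps c)
  then show ?thesis using independent_sum_0[OF B(2,1)] by blast
 qed
 from dual_family[of B Da "%x a. app a x", OF B(1) Da(1) clinear_app_left this]
 obtain u where u: "!!x. x : B ==> u x : Da" "!!x x'. x : B ==> x' : B ==> app (u x) x' = (if x' = x then 1 else 0)" by blast
 have "g x = 0" if x: "x : B" for x proof (rule Db)
  fix b assume b: "b : Db"
  have "tensor_lift (%z y. app (u x) z * app b y) t = (SUM z:B. app (u x) z * app b (g z))"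
   unfolding B(3) clinear_sum[OF clinear_tensor_lift[OF pairing_bilinear]] tensor_lift_pure[OF pairing_bilinear] ..
  also have "... = (SUM z:B. if z = x then app b (g z) else 0)" by (rule sum.cong) (auto simp: u(2)[OF x])
  also have "... = app b (g x)" using B(1) x by simp
  finally show "app b (g x) = 0" using t[OF u(1)[OF x] b] by simp
 qed
 then show ?thesis unfolding B(3) by (simp add: tensor_zero_right)
qed

text \<open>The submodule generated by \<open>(s, t)\<close> is the graph of the morphism as soon as
  it meets the second summand trivially; this is the precise form of the demand that every relation
  of \<open>s\<close> hold for \<open>t\<close>.\<close>

lemma graph_morphism:
 fixes \<rho> :: "'g::complex_vector => 's::complex_vector => 's" and \<sigma> :: "'g => 't::complex_vector => 't"
 assumes m: "lie_module br \<rho>" "lie_module br \<sigma>"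
  and inj: "!!z. (0, z) : U_span (pair_act \<rho> \<sigma>) (s, t) ==> z = 0"
 obtains \<phi> where "U_linear \<rho> (U_span \<rho> s) \<sigma> (U_span \<sigma> t) \<phi>" "\<phi> s = t" "\<phi> ` U_span \<rho> s = U_span \<sigma> t"
proof -
 let ?P = "pair_act \<rho> \<sigma>"
 let ?\<Gamma> = "U_span ?P (s, t)"
 have sub: "submodule ?P ?\<Gamma>" by (rule submodule_U_span[OF lie_module_linear[OF lie_module_pair_act[OF m]]])
 have sub1: "submodule \<rho> (U_span \<rho> s)" and sub2: "submodule \<sigma> (U_span \<sigma> t)"
  by (rule submodule_U_span[OF lie_module_linear[OF m(1)]], rule submodule_U_span[OF lie_module_linear[OF m(2)]])
 have \<Gamma>: "cvec.subspace ?\<Gamma>" and S1: "cvec.subspace (U_span \<rho> s)" and S2: "cvec.subspace (U_span \<sigma> t)"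
  using sub sub1 sub2 by (simp_all add: submodule_def)
 obtain \<phi> where \<phi>: "clinear \<phi>" "!!x y. (x, y) : ?\<Gamma> ==> y = \<phi> x" using graph_clinear[OF \<Gamma> inj] by blast
 note \<phi>s = clinear_simps[OF \<phi>(1)]
 have fold: "foldr ?P xs (s, t) = (foldr \<rho> xs s, foldr \<sigma> xs t)" for xs by (induction xs) (simp_all add: pair_act_def)
 have base: "(foldr \<rho> xs s, foldr \<sigma> xs t) : ?\<Gamma>" for xs
  unfolding U_span_def fold[symmetric] by (rule cvec.span_base) blast
 have st: "foldr \<sigma> xs t = \<phi> (foldr \<rho> xs s)" for xs by (rule \<phi>(2)[OF base])
 have graph: "(x, \<phi> x) : ?\<Gamma>" if "x : U_span \<rho> s" for x proof -
  have lin: "clinear (%x. (x, \<phi> x))" by (rule clinearI) (simp_all add: \<phi>s)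
  have "U_span \<rho> s \<subseteq> {x. (x, \<phi> x) : ?\<Gamma>}" unfolding U_span_def[of \<rho>]
   by (rule cvec.span_minimal[OF _ subspace_preimage[OF lin \<Gamma>]]) (use base st in auto)
  then show ?thesis using that by blast
 qed
 have image: "\<phi> x : U_span \<sigma> t" if "x : U_span \<rho> s" for x proof -
  have "U_span \<rho> s \<subseteq> {x. \<phi> x : U_span \<sigma> t}" unfolding U_span_def[of \<rho>]
  proof (rule cvec.span_minimal[OF _ subspace_preimage[OF \<phi>(1) S2]], safe)
   fix xs
   have "foldr \<sigma> xs t : {foldr \<sigma> xs t |xs. True}" by blast
   then show "\<phi> (foldr \<rho> xs s) : U_span \<sigma> t" unfolding st[symmetric] U_span_def by (rule cvec.span_base)
  qed
  then show ?thesis using that by blast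
 qed
 have eqv: "\<phi> (\<rho> g x) = \<sigma> g (\<phi> x)" if "x : U_span \<rho> s" for g x proof -
  have "?P g (x, \<phi> x) : ?\<Gamma>" using sub graph[OF that] unfolding submodule_def by blast
  then have "(\<rho> g x, \<sigma> g (\<phi> x)) : ?\<Gamma>" by (simp only: pair_act_def fst_conv snd_conv)
  from \<phi>(2)[OF this] show ?thesis by (rule sym)
 qed
 have onto: "U_span \<sigma> t \<subseteq> \<phi> ` U_span \<rho> s" unfolding U_span_def[of \<sigma>]
 proof (rule cvec.span_minimal, safe)
  fix xs
  have "foldr \<rho> xs s : {foldr \<rho> xs s |xs. True}" by blast
  then have "foldr \<rho> xs s : U_span \<rho> s" unfolding U_span_def by (rule cvec.span_base)
  then show "foldr \<sigma> xs t : \<phi> ` U_span \<rho> s" unfolding st by (rule imageI)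
 qed (rule cpair.linear_subspace_image[OF \<phi>(1) S1])
 show ?thesis proof (rule that)
  show "U_linear \<rho> (U_span \<rho> s) \<sigma> (U_span \<sigma> t) \<phi>"
   unfolding U_linear_def using image eqv by (auto simp: \<phi>s)
  show "\<phi> s = t" using st[of "[]"] by simp
  show "\<phi> ` U_span \<rho> s = U_span \<sigma> t" using image onto by blast
 qed
qed

section \<open>Uniqueness of extremal weight vectors\<close>

context km
begin

lemma top_weight_space:
 assumes m: "lie_module br \<rho>" and v: "!!i. \<rho> (e i) v = 0" "!!h. \<rho> (ch h) v = \<Lambda> h *. v"
  and gen: "cvec.span {Fw (%i. \<rho> (f i)) w v |w. True} = UNIV" and x: "!!h. \<rho> (ch h) x = \<Lambda> h *. x"
 shows "EX k. x = k *. v"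
proof -
 interpret p: hwm A sr cr br ch e f d \<rho> v \<Lambda> by (rule hw_module[OF m v])
 have "x : p.U" using gen by (simp add: p.U_def)
 from p.U_decomp[OF this] obtain N g where N: "finite N" "ALL n:N. g n : dep (%i. \<rho> (f i)) v n" "x = (SUM n:N. g n)"
  by (elim exE conjE)
 have "p.dwt 0 h = \<Lambda> h" for h by (simp add: p.dwt_def)
 then have "x = (if 0 : N then g 0 else 0)"
  by (intro eigen_component[where H = "%h. \<rho> (ch h)" and wt = p.dwt, OF lie_module_linear[OF m] p.dwt_inj N(1) _ N(3)])
   (use N(2) x p.H_dep in auto)
 moreover have "EX k. g 0 = k *. v" if "0 : N" proof -
  have "g 0 : dep (%i. \<rho> (f i)) v 0" using N(2) that by blast
  then show ?thesis unfolding dep_0 cvec.span_singleton by blast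
 qed
 ultimately show ?thesis by (metis cvec.scale_zero_left)
qed

text \<open>Powers of the \<open>e i\<close> along the word carry the weight space injectively into
  the line of the top weight. This matches given extremal vectors with those produced by
  \<open>chain\<close>.\<close>

lemma extremal_weight_space:
 assumes m: "lie_module br \<rho>" and v: "!!i. \<rho> (e i) v = 0" "!!h. \<rho> (ch h) v = \<Lambda> h *. v" "v ~= 0"
  and gen: "cvec.span {Fw (%i. \<rho> (f i)) w v |w. True} = UNIV" and nil: "!!i x. EX n. (\<rho> (f i) ^^ n) x = 0"
  and u: "ALL pre i suf. u = pre @ i # suf --> (EX p. swd suf \<Lambda> (cr i) = of_nat p)"
  and x: "!!h. \<rho> (ch h) x = swd u \<Lambda> h *. x" and y: "!!h. \<rho> (ch h) y = swd u \<Lambda> h *. y" "y ~= 0"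
 shows "EX k. x = k *. y" using u x y
proof (induction u arbitrary: x y)
 case Nil
 obtain k l where "x = k *. v" "y = l *. v" using top_weight_space[OF m v(1,2) gen] Nil by fastforce
 then show ?case using Nil(4) by (intro exI[of _ "k / l"]) (auto simp: scaleC_scaleC)
next case (Cons i u)
 obtain p where p: "swd u \<Lambda> (cr i) = of_nat p" using Cons.prems(1) by (metis append_Nil)
 have neg: "swd (i # u) \<Lambda> (cr i) = - of_nat p" by (simp add: srf_def p sr_cr A_diag)
 have e0: "(\<rho> (e i) ^^ p) z ~= 0" if "!!h. \<rho> (ch h) z = swd (i # u) \<Lambda> h *. z" "z ~= 0" for z
  by (rule e_pow_neq_0[OF m that(1) neg nil that(2)])
 have wt: "\<rho> (ch h) ((\<rho> (e i) ^^ p) z) = swd u \<Lambda> h *. (\<rho> (e i) ^^ p) z"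
  if "!!h. \<rho> (ch h) z = swd (i # u) \<Lambda> h *. z" for z h
  using pow_weight(2)[OF m, where x = z and \<mu> = "swd (i # u) \<Lambda>" and i = i and n = p, OF that] by (simp add: srf_def p)
 have u': "ALL pre j suf. u = pre @ j # suf --> (EX p. swd suf \<Lambda> (cr j) = of_nat p)"
  using Cons.prems(1) by (metis append_Cons)
 have ps: "clinear (\<rho> (e i) ^^ p)" by (rule clinear_funpow[OF lie_module_linear[OF m]])
 obtain k where k: "(\<rho> (e i) ^^ p) x = k *. (\<rho> (e i) ^^ p) y"
  using Cons.IH[OF u' wt[OF Cons.prems(2)] wt[OF Cons.prems(3)] e0[OF Cons.prems(3,4)]] by blast
 have "x - k *. y = 0" proof (rule ccontr)
  assume n: "x - k *. y ~= 0"
  have "\<rho> (ch h) (x - k *. y) = swd (i # u) \<Lambda> h *. (x - k *. y)" for h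
   using Cons.prems(2,3) by (simp add: clinear_simps[OF lie_module_linear[OF m]] cvec.scale_right_diff_distrib cvec.scale_left_commute)
  from e0[OF this n] show False by (simp add: clinear_simps[OF ps] k)
 qed
 then show ?case by (intro exI[of _ k]) simp
qed

end

locale hw_gen = km A sr cr br ch e f d for A :: "'i::finite => 'i => int" and sr :: "'i => 'h::complex_vector => complex" and cr
  and br :: "'g::complex_vector => 'g => 'g" and ch e f d +
 fixes \<rho> :: "'g => 'v::complex_vector => 'v" and v :: 'v and \<Lambda> :: "'h => complex" and n :: "'i => nat"
 assumes m: "lie_module br \<rho>" and v: "v ~= 0" "!!i. \<rho> (e i) v = 0" "!!h. \<rho> (ch h) v = \<Lambda> h *. v"
  and gen: "cvec.span {Fw (%i. \<rho> (f i)) w v |w. True} = UNIV"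
  and irr: "irreducible_module \<rho>" and nil: "!!i x. EX n. (\<rho> (e i) ^^ n) x = 0" "!!i x. EX n. (\<rho> (f i) ^^ n) x = 0"
  and \<Lambda>: "clinear \<Lambda>" "!!i. \<Lambda> (cr i) = of_nat (n i)"
begin

lemma app_dual_word: "app a0 v = 1 ==> app (Fw (%i. dual \<rho> (e i)) w a0) v = (if w = [] then 1 else 0)"
 by (cases w) (simp_all add: app_dual[OF m] v app_simps)

end

lemma (in wtmod) canonical_morphism_exists:
 fixes \<rho>1 :: "'g => 'v1::complex_vector => 'v1" and \<sigma>1 :: "'g => 'u1::complex_vector => 'u1"
  and \<rho>2 :: "'g => 'v2::complex_vector => 'v2" and \<sigma>2 :: "'g => 'u2::complex_vector => 'u2"
 assumes "hw_gen A sr cr br ch e f d \<rho>1 v1 \<Lambda>1 l1" "hw_gen A sr cr br ch e f d \<rho>2 v2 \<Lambda>2 l2"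
  and "hw_gen A sr cr br ch e f d \<sigma>1 x1 \<mu>1 k1" "hw_gen A sr cr br ch e f d \<sigma>2 x2 \<mu>2 k2"
  and \<omega>: "!!h. \<omega> h = \<mu>2 h - \<mu>1 h" and \<nu>: "!!h. \<Lambda>1 h - \<Lambda>2 h = swd v \<mu>2 h - swd v \<mu>1 h"
  and v: "ALL pre i suf. v = pre @ i # suf -->
   (EX p q. swd suf \<mu>1 (cr i) = of_nat p & swd suf \<mu>2 (cr i) = of_nat q & q <= p)"
  and u1: "!!h. \<sigma>1 (ch h) u1 = swd v \<mu>1 h *. u1" "u1 ~= 0"
  and u2: "!!h. \<sigma>2 (ch h) u2 = swd v \<mu>2 h *. u2" "u2 ~= 0"
 obtains \<phi> where "canonical_morphism \<rho>1 \<sigma>1 v1 u1 \<rho>2 \<sigma>2 v2 u2 \<phi>"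
  "\<phi> ` kostant_kumar \<rho>1 \<sigma>1 v1 u1 = kostant_kumar \<rho>2 \<sigma>2 v2 u2"
proof -
 interpret r1: hw_gen A sr cr br ch e f d \<rho>1 v1 \<Lambda>1 l1 by fact
 interpret r2: hw_gen A sr cr br ch e f d \<rho>2 v2 \<Lambda>2 l2 by fact
 interpret s1: hw_gen A sr cr br ch e f d \<sigma>1 x1 \<mu>1 k1 by fact
 interpret s2: hw_gen A sr cr br ch e f d \<sigma>2 x2 \<mu>2 k2 by fact
 obtain a0 where a0: "app a0 v2 = 1" "!!i. dual \<rho>2 (f i) a0 = 0" "!!h. dual \<rho>2 (ch h) a0 = - \<Lambda>2 h *. a0"
  using top_functional[OF r2.m r2.v r2.gen] by blast
 obtain b0 where b0: "app b0 x2 = 1" "!!i. dual \<sigma>2 (f i) b0 = 0" "!!h. dual \<sigma>2 (ch h) b0 = - \<mu>2 h *. b0"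
  using top_functional[OF s2.m s2.v s2.gen] by blast
 let ?Da = "rdual \<rho>2 a0" and ?Db = "rdual \<sigma>2 b0"
 obtain \<psi> where \<psi>: "app \<psi> nv = 1" "!!z x. z ~= 0 ==> x : Mz z ==> app \<psi> x = 0"
  "!!h. dual \<tau> (ch h) \<psi> = - \<omega> h *. \<psi>"
  "!!i k. 0 < k ==> - \<omega>i i < int k ==> (dual \<tau> (f i) ^^ k) \<psi> = 0"
  "!!i k. 0 < k ==> \<omega>i i < int k ==> (dual \<tau> (e i) ^^ k) \<psi> = 0" by (rule coefficient_functional, rule that)
 have \<omega>k: "\<omega>i i = int (k2 i) - int (k1 i)" for i proof -
  have "complex_of_int (\<omega>i i) = of_int (int (k2 i) - int (k1 i))"
   using \<omega>[of "cr i"] by (simp add: \<omega>i s1.\<Lambda> s2.\<Lambda>)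
  then show ?thesis by (simp only: of_int_eq_iff)
 qed
 have b00: "b0 ~= 0" and a00: "a0 ~= 0" using b0(1) a0(1) by auto
 \<comment> \<open>\<open>C\<close> turns a functional on the second target factor into a map from
   the second source factor to the dual of M; \<open>P\<close> is the resulting trilinear pairing,
   whose value at \<open>x1\<close> and \<open>nv\<close> is \<open>app b x2\<close>.\<close>
 obtain C where C: "clinear C" "!!x b. b : ?Db ==> C (dual \<sigma>2 x b) = hom_act \<sigma>1 (dual \<tau>) x (C b)"
  "!!w. app (C (Fw (%i. dual \<sigma>2 (e i)) w b0)) x1 = Fw (%i. dual \<tau> (e i)) w \<psi>"
 proof (rule dual_hom_lift[OF s1.m s1.v s1.gen s1.\<Lambda> s2.m b00 b0(2,3) s2.\<Lambda> dual_module[OF mod\<tau>], of \<psi>])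
  show "dual \<tau> (ch h) \<psi> = (\<mu>1 h - \<mu>2 h) *. \<psi>" for h using \<psi>(3)[of h] by (simp add: \<omega>)
  show "(dual \<tau> (f i) ^^ Suc (k1 i)) \<psi> = 0" for i by (rule \<psi>(4)) (simp_all add: \<omega>k)
  show "(dual \<tau> (e i) ^^ Suc (k2 i)) \<psi> = 0" for i by (rule \<psi>(5)) (simp_all add: \<omega>k)
 qed (rule that)
 define P where "P b c x = app (app (C b) c) x" for b c x
 have Dst: "dual \<sigma>2 x b : ?Db" if "b : ?Db" for x b by (rule rdual_stable[OF s2.m b0(2,3) that])
 have Dast: "dual \<rho>2 x a : ?Da" if "a : ?Da" for x a by (rule rdual_stable[OF r2.m a0(2,3) that])
 note app_C = app_hom_act[OF s1.m dual_module[OF mod\<tau>]]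
 have Pinv: "P b (\<sigma>1 g c) x = - P (dual \<sigma>2 g b) c x - P b c (\<tau> g x)" if "b : ?Db" for b g c x
  by (simp add: P_def C(2)[OF that] app_C app_dual[OF mod\<tau>])
 have Plin: "clinear (P b c)" for b c unfolding P_def by (rule clinear_app)
 have Plin1: "clinear (%b. P b c x)" for c x by (rule clinearI) (simp_all add: P_def clinear_simps[OF C(1)])
 have Plin2: "clinear (%c. P b c x)" for b x by (rule clinearI) (simp_all add: P_def app_simps)
 \<comment> \<open>All letters can be moved onto \<open>nv\<close>, which they raise to weights
   other than \<omega>, where \<psi> vanishes.\<close>
 have kill: "app (Fw (%i. dual \<tau> (e i)) w \<psi>) (Fw (%i. \<tau> (e i)) w' nv) = (if w = [] & w' = [] then 1 else 0)" for w w'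
 proof (induction w arbitrary: w')
  case Nil
  interpret t: chev sr cr "%i. \<tau> (f i)" "%i. \<tau> (e i)" "%h y. - \<tau> (ch h) y"
   by (rule chev.chev_swap[OF chev_module[OF mod\<tau>]])
  have "- \<tau> (ch h) nv = (- \<omega> h) *. nv" for h by (simp add: nv)
  from arg_cong[OF t.H_Fw_weight[OF this, of _ w'], of uminus]
  have "Fw (%i. \<tau> (e i)) w' nv : Mz (up (cnt w'))"
   by (cases w') (simp_all add: Mz_def nv pj ad.wt_def cvec.scale_minus_left[symmetric] del: cvec.scale_minus_left)
  then show ?case using \<psi>(1,2) up_neq_0(1)[of "cnt w'"] by (cases "w' = []") auto
 next case (Cons i w)
  show ?case using Cons.IH[of "i # w'"] by (simp add: app_dual[OF mod\<tau>])
 qed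
 have base_gen: "P b x1 (Fw (%i. \<tau> (e i)) w' nv) = (if w' = [] then 1 else 0) * app b x2" if b: "b : ?Db" for b w' proof -
  have lin: "clinear (%b. P b x1 (Fw (%i. \<tau> (e i)) w' nv) - (if w' = [] then 1 else 0) * app b x2)"
   by (rule clinearI) (simp_all add: clinear_simps[OF Plin1] algebra_simps)
  have "?Db \<subseteq> {b. P b x1 (Fw (%i. \<tau> (e i)) w' nv) - (if w' = [] then 1 else 0) * app b x2 = 0}" unfolding rdual_def
   by (rule cvec.span_minimal[OF _ subspace_zeros[OF lin]]) (auto simp: P_def C(3) kill kill[of _ "[]", simplified] s2.app_dual_word[OF b0(1)])
  then show ?thesis using b by auto
 qed
 have base: "P b x1 nv = app b x2" "w ~= [] ==> P b x1 (Fw (%i. \<tau> (e i)) w nv) = 0" if "b : ?Db" for b w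
  using base_gen[OF that, of "[]"] base_gen[OF that, of w] by simp_all
 have ch_ex: "EX c u n z K. c ~= 0 & u ~= 0 & K ~= 0 & (ALL h. \<sigma>1 (ch h) c = swd v \<mu>1 h *. c) \<and>
  (ALL h. \<sigma>2 (ch h) u = swd v \<mu>2 h *. u) & n : Mz z & (ALL h. \<omega> h + wt z h = swd v \<mu>2 h - swd v \<mu>1 h) & qf z = 0 \<and>
  (ALL b:?Db. P b c n = K * app b u) & (ALL b:?Db. ALL w. w ~= [] --> P b c (Fw (%i. \<tau> (e i)) w n) = 0)"
  by (rule chain[where D = ?Db and da = "dual \<sigma>2" and P = P and ?\<sigma>1.0 = \<sigma>1 and ev = app and ?\<sigma>2.0 = \<sigma>2 and ?c0.0 = x1 and ?u0.0 = x2,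
    OF Dst Pinv Plin app_dual[OF s2.m] s1.m s1.nil(1) s2.m s2.nil(1) s1.v(3,1) s2.v(3,1) \<omega> base v], assumption+)
 obtain c u n z K where ch': "c ~= 0" "u ~= 0" "K ~= 0" "ALL h. \<sigma>1 (ch h) c = swd v \<mu>1 h *. c"
  "ALL h. \<sigma>2 (ch h) u = swd v \<mu>2 h *. u" "n : Mz z" "ALL h. \<omega> h + wt z h = swd v \<mu>2 h - swd v \<mu>1 h" "qf z = 0"
  "ALL b:?Db. P b c n = K * app b u" "ALL b:?Db. ALL w. w ~= [] --> P b c (Fw (%i. \<tau> (e i)) w n) = 0"
  using ch_ex by (elim exE conjE)
 have v1': "ALL pre i suf. v = pre @ i # suf --> (EX p. swd suf \<mu>1 (cr i) = of_nat p)"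
  "ALL pre i suf. v = pre @ i # suf --> (EX p. swd suf \<mu>2 (cr i) = of_nat p)" using v by blast+
 obtain q1 where q1: "u1 = q1 *. c"
  using extremal_weight_space[OF s1.m s1.v(2,3,1) s1.gen s1.nil(2) v1'(1) u1(1) ch'(4)[rule_format] ch'(1)] by blast
 obtain q2 where q2: "u2 = q2 *. u"
  using extremal_weight_space[OF s2.m s2.v(2,3,1) s2.gen s2.nil(2) v1'(2) u2(1) ch'(5)[rule_format] ch'(2)] by blast
 have q0: "q1 ~= 0" "q2 ~= 0" using q1 q2 u1(2) u2(2) by auto
 \<comment> \<open>\<open>q1\<close> and \<open>q2\<close> compare the given extremal vectors with
   those of \<open>chain\<close>.\<close>
 define K' where "K' = q1 * K / q2"
 have K'0: "K' ~= 0" using q0 ch'(3) by (simp add: K'_def)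
 have claim: "P b u1 n = K' * app b u2" "w ~= [] ==> P b u1 (Fw (%i. \<tau> (e i)) w n) = 0" if "b : ?Db" for b w
  using ch'(9,10) that q0 by (simp_all add: q1 q2 K'_def clinear_simps[OF Plin2] app_simps)
 have wn: "\<tau> (ch h) n = (\<Lambda>1 h - \<Lambda>2 h) *. n" for h using ch'(6,7) by (simp add: Mz_def \<nu>)
 have zi: "\<omega>i i + pr z i = int (l1 i) - int (l2 i)" for i proof -
  have "complex_of_int (\<omega>i i + pr z i) = of_int (int (l1 i) - int (l2 i))"
   using ch'(7) \<nu>[of "cr i"] by (simp add: \<omega>i wt_cr[symmetric] r1.\<Lambda> r2.\<Lambda>) (simp add: \<omega>i[symmetric])
  then show ?thesis by (simp only: of_int_eq_iff)
 qed
 obtain B where B: "clinear B" "!!x a. a : ?Da ==> B (dual \<rho>2 x a) = hom_act \<rho>1 \<tau> x (B a)"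
  "!!w. app (B (Fw (%i. dual \<rho>2 (e i)) w a0)) v1 = Fw (%i. \<tau> (e i)) w n"
 proof (rule dual_hom_lift[OF r1.m r1.v r1.gen r1.\<Lambda> r2.m a00 a0(2,3) r2.\<Lambda> mod\<tau> wn])
  show "(\<tau> (f i) ^^ Suc (l1 i)) n = 0" for i by (rule f_pow_0[OF ch'(6,8)]) (simp_all add: zi)
  show "(\<tau> (e i) ^^ Suc (l2 i)) n = 0" for i by (rule e_pow_0[OF ch'(6,8)]) (simp_all add: zi)
 qed (rule that)
 \<comment> \<open>It suffices to test words on \<open>a0\<close>. There \<open>B a\<close> sends
   \<open>v1\<close> to the same word on \<open>n\<close>, and both sides vanish unless the word is
   empty.\<close>
 have gen: "P b u1 (app (B a) v1) = K' * (app a v2 * app b u2)" if b: "b : ?Db" and a: "a : ?Da" for a b proof -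
  have lin: "clinear (%a. P b u1 (app (B a) v1) - K' * (app a v2 * app b u2))"
   by (rule clinearI) (simp_all add: clinear_simps[OF B(1)] clinear_simps[OF Plin] algebra_simps)
  have "?Da \<subseteq> {a. P b u1 (app (B a) v1) - K' * (app a v2 * app b u2) = 0}" unfolding rdual_def
  proof (rule cvec.span_minimal[OF _ subspace_zeros[OF lin]], safe)
   fix w show "P b u1 (app (B (Fw (%i. dual \<rho>2 (e i)) w a0)) v1) - K' * (app (Fw (%i. dual \<rho>2 (e i)) w a0) v2 * app b u2) = 0"
    unfolding B(3) r2.app_dual_word[OF a0(1)] using claim[OF b] by (cases "w = []") simp_all
  qed
  then show ?thesis using a by auto
 qed
 let ?\<beta> = "%a b v c. P b c (app (B a) v)" and ?\<gamma> = "%a b x y. app a x * app b y :: complex"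
 have \<beta>: "cbilinear (?\<beta> a b)" for a b
  by (rule cbilinearI) (simp_all add: app_simps clinear_simps[OF Plin] clinear_simps[OF Plin2])
 let ?T1 = "tensor_act \<rho>1 \<sigma>1" and ?T2 = "tensor_act \<rho>2 \<sigma>2"
 have mT1: "lie_module br ?T1" and mT2: "lie_module br ?T2"
  by (rule lie_module_tensor_act[OF r1.m s1.m], rule lie_module_tensor_act[OF r2.m s2.m])
 note T1s = clinear_simps[OF lie_module_linear[OF mT1]] and T2s = clinear_simps[OF lie_module_linear[OF mT2]]
 define G where "G a b = tensor_lift (?\<gamma> a b)" for a :: "('v2, complex) clin" and b :: "('u2, complex) clin"
 have G_lin: "clinear (G a b)" and G_pure: "G a b (x \<otimes> y) = app a x * app b y" for a b x y
  unfolding G_def by (rule clinear_tensor_lift[OF pairing_bilinear], rule tensor_lift_pure[OF pairing_bilinear])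
 note \<beta>s = clinear_simps[OF clinear_tensor_lift[OF \<beta>]] and \<gamma>s = clinear_simps[OF G_lin]
 note app_B = app_hom_act[OF r1.m mod\<tau>]
 have T1: "tensor_lift (?\<beta> a b) (?T1 g s) = - tensor_lift (?\<beta> (dual \<rho>2 g a) b) s - tensor_lift (?\<beta> a (dual \<sigma>2 g b)) s"
  if "a : ?Da" "b : ?Db" for a b g s proof (induction s rule: tensor_induct)
  case (pure x y)
  show ?case unfolding tensor_act_pure[OF r1.m s1.m] \<beta>s tensor_lift_pure[OF \<beta>]
   by (simp add: B(2)[OF that(1)] app_B Pinv[OF that(2)] clinear_simps[OF Plin])
 next case (scale c t)
  then show ?case unfolding T1s \<beta>s scaleC_complex by (simp only: right_diff_distrib mult_minus_right)
 next case (add s t)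
  then show ?case unfolding T1s \<beta>s by simp
 qed
 have T2: "G a b (?T2 g s) = - G (dual \<rho>2 g a) b s - G a (dual \<sigma>2 g b) s" for a b g s
 proof (induction s rule: tensor_induct)
  case (pure x y)
  show ?case unfolding tensor_act_pure[OF r2.m s2.m] \<gamma>s G_pure by (simp add: app_dual[OF r2.m] app_dual[OF s2.m])
 next case (scale c t)
  then show ?case unfolding T2s \<gamma>s scaleC_complex by (simp only: right_diff_distrib mult_minus_right)
 next case (add s t)
  then show ?case unfolding T2s \<gamma>s by simp
 qed
 \<comment> \<open>The pairs on which the two families of forms agree up to \<open>K'\<close>.
   Invariance of both families makes this a submodule, so it contains everything generated by the
   pair of generators.\<close>
 define R where "R = {p. ALL a:?Da. ALL b:?Db. tensor_lift (?\<beta> a b) (fst p) = K' * G a b (snd p)}"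
 have R: "submodule (pair_act ?T1 ?T2) R" unfolding submodule_def proof (intro conjI allI ballI)
  show "cvec.subspace R" unfolding R_def by (rule cvec.subspaceI) (auto simp: \<beta>s \<gamma>s algebra_simps)
  fix g p assume p: "p : R"
  show "pair_act ?T1 ?T2 g p : R" unfolding R_def proof (intro CollectI ballI)
   fix a b assume a: "a : ?Da" and b: "b : ?Db"
   have 1: "tensor_lift (?\<beta> (dual \<rho>2 g a) b) (fst p) = K' * G (dual \<rho>2 g a) b (snd p)"
    using p Dast[OF a, of g] b unfolding R_def by blast
   have 2: "tensor_lift (?\<beta> a (dual \<sigma>2 g b)) (fst p) = K' * G a (dual \<sigma>2 g b) (snd p)"
    using p a Dst[OF b, of g] unfolding R_def by blast
   show "tensor_lift (?\<beta> a b) (fst (pair_act ?T1 ?T2 g p)) = K' * G a b (snd (pair_act ?T1 ?T2 g p))"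
    unfolding pair_act_def fst_conv snd_conv T1[OF a b] T2 1 2 by (simp add: algebra_simps)
  qed
 qed
 have "(v1 \<otimes> u1, v2 \<otimes> u2) : R" unfolding R_def using gen by (auto simp: tensor_lift_pure[OF \<beta>] G_pure)
 from U_span_minimal[OF R this] have sub: "U_span (pair_act ?T1 ?T2) (v1 \<otimes> u1, v2 \<otimes> u2) \<subseteq> R" .
 have inj: "z = 0" if "(0, z) : U_span (pair_act ?T1 ?T2) (v1 \<otimes> u1, v2 \<otimes> u2)" for z proof (rule tensor_separates)
  show "cvec.subspace ?Da" by (simp add: rdual_def)
  show "x = 0" if "!!a. a : ?Da ==> app a x = 0" for x by (rule rdual_separates[OF r2.m r2.irr a0 that])
  show "x = 0" if "!!b. b : ?Db ==> app b x = 0" for x by (rule rdual_separates[OF s2.m s2.irr b0 that])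
  fix a b assume "a : ?Da" "b : ?Db"
  then have "tensor_lift (?\<beta> a b) 0 = K' * G a b z" using that sub unfolding R_def by force
  then show "tensor_lift (?\<gamma> a b) z = 0" using K'0 by (simp add: \<beta>s flip: G_def)
 qed
 obtain \<phi> where \<phi>: "U_linear ?T1 (U_span ?T1 (v1 \<otimes> u1)) ?T2 (U_span ?T2 (v2 \<otimes> u2)) \<phi>" "\<phi> (v1 \<otimes> u1) = v2 \<otimes> u2"
  "\<phi> ` U_span ?T1 (v1 \<otimes> u1) = U_span ?T2 (v2 \<otimes> u2)" using graph_morphism[OF mT1 mT2 inj] by blast
 show ?thesis by (rule that[of \<phi>]) (use \<phi> in \<open>simp_all add: canonical_morphism_def kostant_kumar_def\<close>)
qed

section \<open>Real roots and the Weyl group\<close>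

context km0
begin

definition rf :: "'i => ('i => int) => 'i => int" where "rf i z j = z j - (if j = i then pr z i else 0)"

abbreviation "ze i \<equiv> up (uvec i)"
abbreviation "rfw u z \<equiv> foldr rf u z"

lemma pr_rf: "pr (rf i z) j = pr z j - pr z i * A j i"
proof -
 have "pr (rf i z) j = pr z j - (SUM k:UNIV. if k = i then pr z i * A j k else 0)"
  unfolding pr_def sum_subtractf[symmetric] by (rule sum.cong) (auto simp: rf_def pr_def algebra_simps)
 then show ?thesis by simp
qed

lemma rf_rf [simp]: "rf i (rf i z) = z" by (auto simp: rf_def fun_eq_iff pr_rf A_diag)

lemma rf_ze: "rf i (ze i) = - ze i" 
proof
 fix j show "rf i (ze i) j = (- ze i) j" unfolding rf_def pr_unit A_diag by (simp add: uvec_def)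
qed

lemma rf_uminus: "rf i (- z) = - rf i z" by (auto simp: rf_def fun_eq_iff pr_uminus)

lemma rfw_uminus: "rfw u (- z) = - rfw u z" by (induction u) (simp_all only: foldr.simps comp_apply id_apply rf_uminus)

lemma rfw_rev [simp]: "rfw (rev u) (rfw u z) = z" by (induction u) simp_all

definition root :: "('i => int) => bool" where "root z \<longleftrightarrow> z ~= 0 & W z ~= {0}"

abbreviation "pos z \<equiv> ALL i. 0 <= (z i :: int)"

lemma root_ze: "root (ze i)"
proof -
 have "e i : W (ze i)" "e i ~= 0" by (rule e_W, rule e_neq_0)
 moreover have "ze i ~= 0" by (auto simp: fun_eq_iff intro!: exI[of _ i])
 ultimately show ?thesis unfolding root_def by blast
qed

lemma root_sign: "root z ==> pos z | pos (- z)" using W_mixed[of z] unfolding root_def by (force simp: not_le)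

text \<open>A nested bracket of length at least 2 in a single letter is 0, because its innermost
  bracket is \<open>br (e i) (e i)\<close>.\<close>

lemma root_multiple:
 assumes r: "root z" and p: "pos z" and z: "!!j. j ~= i ==> z j = 0"
 shows "z = ze i"
proof -
 define n where "n = (%j. nat (z j))"
 have zn: "z = up n" using p by (auto simp: n_def)
 then have n0: "n ~= 0" using r by (auto simp: root_def fun_eq_iff)
 have rep: "w = replicate (length w) i" if "cnt w = n" for w proof -
  have "j ~: set w" if "j ~= i" for j proof -
   have "cnt w j = 0" unfolding \<open>cnt w = n\<close> n_def using z[OF that] by simp
   then show ?thesis by (simp add: cnt_def count_list_0_iff)
  qed
  then have "ALL j:set w. j = i" by blast
  from replicate_length_same[OF this, symmetric] show ?thesis .
 qed
 have two: "wrd (%i. br (e i)) e (replicate (Suc (Suc k)) i) = 0" for k by (induction k) (simp_all add: br_self br_simps)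
 have "height n = 1" proof (rule ccontr)
  assume h: "height n ~= 1"
  have "W z \<subseteq> {0}" unfolding zn W_up[OF n0] proof (rule ad.PS_minimal[OF cvec.subspace_single_0])
   fix w assume w: "w ~= []" "cnt w = n"
   then have "length w ~= 1" using h height_cnt[of w] by simp
   then obtain k where "length w = Suc (Suc k)" using w(1) by (metis One_nat_def Suc_pred length_greater_0_conv neq0_conv)
   then show "wrd (%i. br (e i)) e w : {0}" using two[of k] rep[OF w(2)] by (metis singletonI)
  qed
  then show False using r cvec.subspace_0[OF subspace_W] unfolding root_def by blast
 qed
 moreover have "height n = n i" unfolding height_def using sum.mono_neutral_right[of UNIV "{i}" n] z by (simp add: n_def)
 ultimately have "n i = 1" by simp
 then show ?thesis using z p by (auto simp: fun_eq_iff uvec_def n_def)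
qed

text \<open>A positive root other than the i-th simple root has a positive coefficient at some other
  index. The reflection leaves that coefficient unchanged, and a root has only one sign.\<close>

lemma rf_pos:
 assumes r: "root z" "root (rf i z)" and p: "pos z" and z: "z ~= ze i"
 shows "pos (rf i z)"
proof -
 obtain j where j: "j ~= i" "z j ~= 0" using root_multiple[OF r(1) p] z by blast
 then have "0 < rf i z j" using p by (simp add: rf_def order.not_eq_order_implies_strict)
 then have "\<not> pos (- rf i z)" by (auto simp: not_le)
 then show ?thesis using root_sign[OF r(2)] by blast
qed

end

locale kmn = km0 A sr cr br ch e f for A :: "'i::finite => 'i => int" and sr :: "'i => 'h::complex_vector => complex" and cr
  and br :: "'g::complex_vector => 'g => 'g" and ch e f +
 assumes ad_nil: "!!i x. EX n. (br (e i) ^^ n) x = 0" "!!i x. EX n. (br (f i) ^^ n) x = 0"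
begin

text \<open>The power of \<open>f i\<close> or \<open>e i\<close> that reaches the reflected degree
  is injective on the root space by \<open>pow_inj\<close>.\<close>

lemma root_rf:
 assumes r: "root z"
 shows "root (rf i z)"
proof -
 have z0: "z ~= 0" and "W z ~= {0}" using r by (auto simp: root_def)
 then obtain x where x: "x : W z" "x ~= 0" using cvec.subspace_0[OF subspace_W] by blast
 interpret s: sl2 "br (e i)" "br (f i)" "br (ch (cr i))" by (rule lg.sl2_ad) (simp add: sr_cr A_diag)
 interpret t: sl2 "br (f i)" "br (e i)" "%y. - br (ch (cr i)) y" by (rule s.swap)
 have H: "br (ch (cr i)) x = of_int (pr z i) *. x" using x(1) by (simp add: W_def wt_cr)
 have fpow: "(br (f i) ^^ k) x : W (%j. z j - int k * ze i j)" for k proof (induction k)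
  case (Suc k)
  have "dn (uvec i) + (%j. z j - int k * ze i j) = (%j. z j - int (Suc k) * ze i j)" by (auto simp: fun_eq_iff algebra_simps)
  then show ?case using W_br[OF f_W Suc, of i] by simp
 qed (simp add: x)
 have epow: "(br (e i) ^^ k) x : W (%j. z j + int k * ze i j)" for k proof (induction k)
  case (Suc k)
  have "ze i + (%j. z j + int k * ze i j) = (%j. z j + int (Suc k) * ze i j)" by (auto simp: fun_eq_iff algebra_simps)
  then show ?case using W_br[OF e_W Suc, of i] by simp
 qed (simp add: x)
 have "rf i 0 = 0" by (auto simp: rf_def pr_def fun_eq_iff)
 then have "rf i z ~= 0" using rf_rf[of i z] z0 by metis
 moreover have "EX y. y : W (rf i z) & y ~= 0" proof (cases "0 <= pr z i")
  case True
  obtain N where N: "(br (e i) ^^ N) x = 0" using ad_nil(1) by blast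
  have "(br (f i) ^^ nat (pr z i)) x ~= 0" using s.pow_inj[OF H N, of "nat (pr z i)"] True x(2) by auto
  moreover have "(%j. z j - int (nat (pr z i)) * ze i j) = rf i z" using True by (auto simp: rf_def uvec_def fun_eq_iff)
  ultimately show ?thesis using fpow[of "nat (pr z i)"] by auto
 next case False
  obtain N where N: "(br (f i) ^^ N) x = 0" using ad_nil(2) by blast
  have H': "- br (ch (cr i)) x = of_int (- pr z i) *. x" by (simp add: H)
  have "(br (e i) ^^ nat (- pr z i)) x ~= 0" using t.pow_inj[OF H' N, of "nat (- pr z i)"] False x(2) by auto
  moreover have "(%j. z j + int (nat (- pr z i)) * ze i j) = rf i z" using False by (auto simp: rf_def uvec_def fun_eq_iff)
  ultimately show ?thesis using epow[of "nat (- pr z i)"] by auto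
 qed
 ultimately show ?thesis unfolding root_def by blast
qed

lemma root_rfw: "root z ==> root (rfw u z)" by (induction u) (simp_all add: root_rf)

end

text \<open>On the generators this is the Serre relations; a bracket inherits nilpotency because
  \<open>br (f i)\<close> is a derivation.\<close>

lemma (in km) ad_nilpotent_f: "EX n. (br (f i) ^^ n) x = 0"
proof -
 note subz = subspace_nil[OF cbilinear_right[OF br_bilinear] cvec.subspace_single_0, of "f i"]
 have z: "(br (f i) ^^ n) 0 = 0" for n by (induction n) (simp_all add: br_simps)
 show ?thesis proof (induction x rule: gen_induct)
  case (h h)
  show ?case by (rule exI[of _ 2]) (simp add: numeral_2_eq_2 f_h br_simps br_self)
 next case (e j)
  show ?case by (rule exI[of _ 3]) (simp add: numeral_3_eq_3 f_e f_h br_simps br_self)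
 next case (f j)
  show ?case proof (cases "i = j")
   case True then show ?thesis by (intro exI[of _ 1]) (simp add: br_self)
  next case False
   from serre[OF False] show ?thesis by blast
  qed
 next case (add x y)
  then show ?case using cvec.subspace_add[OF subz, of x y] by (simp add: br_simps)
 next case (scale c x)
  then show ?case using cvec.subspace_scale[OF subz, of x c] by (simp add: br_simps)
 next case (br x y)
  then obtain m N where m: "(br (f i) ^^ m) y = 0" and N: "(br (f i) ^^ N) x = 0" by blast
  have "(br (f i) ^^ (m + N)) (br ((br (f i) ^^ 0) x) y) : {0}"
   by (rule nil_derivation[where K = "{0}" and T = UNIV and D = "%k. br ((br (f i) ^^ k) x)"])
    (auto simp: cbilinear_right[OF br_bilinear] cvec.subspace_single_0 br_simps m N jacobi[of "f i"])
  then show ?case by auto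
 qed
qed

sublocale km \<subseteq> kmn
proof
 show "EX n. (br (f i) ^^ n) x = 0" for i x by (rule ad_nilpotent_f)
 show "EX n. (br (e i) ^^ n) x = 0" for i x by (rule km.ad_nilpotent_f[OF swap])
qed

section \<open>The form on the root lattice and reduced words\<close>

context km
begin

lemma bf_rf1: "bf (rf i z) z' = bf z z' - pr z i * d i * pr z' i"
proof -
 have "bf (rf i z) z' = bf z z' - (SUM k:UNIV. if k = i then pr z i * d k * pr z' k else 0)"
  unfolding bf_def sum_subtractf[symmetric] by (rule sum.cong) (auto simp: rf_def algebra_simps)
 then show ?thesis by simp
qed

lemma bf_rf: "bf (rf i z) (rf i z') = bf z z'"
 unfolding bf_rf1 bf_sym[of z "rf i z'"] pr_rf A_diag bf_sym[of z' z] by (simp add: algebra_simps)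

lemma bf_rfw: "bf (rfw u z) (rfw u z') = bf z z'" by (induction u) (simp_all add: bf_rf)

lemma same_length: "rfw u (ze i) = ze j ==> d i = d j" using bf_rfw[of u "ze i" "ze i"] by (simp add: bf_unit1 pr_unit A_diag)

text \<open>The pairing of a weight with a lattice vector, by
  \<open>(\<mu>, \<alpha>_i) = d i * \<mu> (cr i)\<close>. It turns values at coroots of arbitrary
  real roots into invariant expressions on the root lattice.\<close>

definition shp :: "('h => complex) => ('i => int) => complex" where "shp \<mu> z = (SUM i:UNIV. of_int (z i) * dc i * \<mu> (cr i))"

lemma shp_ze: "shp \<mu> (ze i) = dc i * \<mu> (cr i)"
proof -
 have "shp \<mu> (ze i) = (SUM k:UNIV. if k = i then dc k * \<mu> (cr k) else 0)"
  unfolding shp_def by (rule sum.cong) (auto simp: uvec_def)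
 then show ?thesis by simp
qed

lemma dc_sym: "dc i * of_int (A i j) = dc j * of_int (A j i)" using arg_cong[OF d_sym[of i j], of complex_of_real] by simp

lemma shp_rf: "shp (srf i \<mu>) (rf i z) = shp \<mu> z"
proof -
 have 1: "shp \<nu> (rf i z) = shp \<nu> z - of_int (pr z i) * dc i * \<nu> (cr i)" for \<nu> proof -
  have "shp \<nu> (rf i z) = shp \<nu> z - (SUM k:UNIV. if k = i then of_int (pr z i) * dc k * \<nu> (cr k) else 0)"
   unfolding shp_def sum_subtractf[symmetric] by (rule sum.cong) (auto simp: rf_def algebra_simps)
  then show ?thesis by simp
 qed
 have "shp (srf i \<mu>) z = shp \<mu> z - \<mu> (cr i) * (SUM k:UNIV. of_int (z k) * (dc k * of_int (A k i)))"
  unfolding shp_def sum_distrib_left sum_subtractf[symmetric] by (rule sum.cong) (auto simp: srf_def sr_cr algebra_simps)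
 also have "(SUM k:UNIV. of_int (z k) * (dc k * of_int (A k i))) = dc i * of_int (pr z i)"
  unfolding dc_sym[of _ i] pr_def of_int_sum sum_distrib_left by (rule sum.cong) auto
 finally have 2: "shp (srf i \<mu>) z = shp \<mu> z - \<mu> (cr i) * (dc i * of_int (pr z i))" .
 have 3: "srf i \<mu> (cr i) = - \<mu> (cr i)" by (simp add: srf_def sr_cr A_diag)
 show ?thesis unfolding 1 2 3 by (simp add: algebra_simps)
qed

lemma shp_rfw: "shp (swd u \<mu>) (rfw u z) = shp \<mu> z" by (induction u) (simp_all add: shp_rf)

lemma srf_srf [simp]: "srf i (srf i \<mu>) = \<mu>" by (simp add: srf_def fun_eq_iff sr_cr A_diag)

lemma swd_rev [simp]: "swd (rev u) (swd u \<mu>) = \<mu>" by (induction u) simp_all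

lemma swd_rev' [simp]: "swd u (swd (rev u) \<mu>) = \<mu>" using swd_rev[of "rev u"] by simp

lemma rfw_rev' [simp]: "rfw u (rfw (rev u) z) = z" using rfw_rev[of "rev u"] by simp

lemma swd_cr: "dc i * swd u \<mu> (cr i) = shp \<mu> (rfw (rev u) (ze i))"
 using shp_rfw[of u \<mu> "rfw (rev u) (ze i)"] by (simp add: shp_ze)

lemma wt_ze: "wt (ze i) = sr i" by (simp add: fun_eq_iff ad.wt_unit)

lemma srf_wt: "srf i (wt z) = wt (rf i z)"
proof
 fix h
 have "wt (rf i z) h = wt z h - (SUM k:UNIV. if k = i then of_int (pr z i) * sr k h else 0)"
  unfolding ad.wt_def sum_subtractf[symmetric] by (rule sum.cong) (auto simp: rf_def algebra_simps)
 then show "srf i (wt z) h = wt (rf i z) h" by (simp add: srf_def wt_cr)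
qed

lemma swd_wt: "swd u (wt z) = wt (rfw u z)" by (induction u) (simp_all add: srf_wt)

lemma swd_add: "swd u (%h. \<mu> h + c * \<nu> h) = (%h. swd u \<mu> h + c * swd u \<nu> h)"
 by (induction u) (simp_all add: srf_def fun_eq_iff algebra_simps)

text \<open>At the letter \<open>t\<close> where the simple root first turns negative, the running
  root is the simple root \<open>t\<close>. Hence reflecting in \<open>t\<close> before or in
  \<open>i\<close> behind the remaining word gives the same map, and the two letters cancel.\<close>

lemma deletion:
 assumes "\<not> pos (rfw v (ze i))"
 shows "EX v'. length v' < length v & swd (v @ [i]) = swd v'" using assms
proof (induction v)
 case (Cons t v)
 show ?case proof (cases "pos (rfw v (ze i))")
  case True
  have "rfw v (ze i) = ze t" proof (rule ccontr)
   assume "rfw v (ze i) ~= ze t"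
   from rf_pos[OF root_rfw[OF root_ze] _ True this] root_rf[OF root_rfw[OF root_ze]] Cons.prems
   show False by simp
  qed
  note t = this same_length[OF this]
  have d0: "dc t ~= 0" using d_pos[of t] by simp
  have "swd (t # v @ [i]) \<mu> = swd v \<mu>" for \<mu> proof -
   have m: "srf i \<mu> = (%h. \<mu> h + (- \<mu> (cr i)) * wt (ze i) h)" by (simp add: srf_def fun_eq_iff wt_ze)
   have "dc t * swd v \<mu> (cr t) = shp (swd v \<mu>) (rfw v (ze i))" by (simp add: t shp_ze)
   also have "... = dc t * \<mu> (cr i)" by (simp add: shp_rfw shp_ze t(2))
   finally have c: "swd v \<mu> (cr t) = \<mu> (cr i)" using d0 by simp
   have "swd v (srf i \<mu>) = srf t (swd v \<mu>)" unfolding m swd_add swd_wt t(1) by (simp add: srf_def fun_eq_iff c wt_ze)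
   then show ?thesis by simp
  qed
  then show ?thesis by (intro exI[of _ v]) (simp add: fun_eq_iff)
 next case False
  then obtain v' where v': "length v' < length v" "swd (v @ [i]) = swd v'" using Cons.IH by blast
  have "swd ((t # v) @ [i]) \<mu> = swd (t # v') \<mu>" for \<mu> using fun_cong[OF v'(2), of \<mu>] by simp
  then show ?thesis using v'(1) by (intro exI[of _ "t # v'"]) auto
 qed
qed (simp add: uvec_def)

text \<open>A word of least length qualifies: a root without the required sign would shorten it by
  \<open>deletion\<close>, applied to the reversed suffix in the second case.\<close>

lemma reduced_word:
 obtains u where "swd u = swd u0" "ALL pre i suf. u = pre @ i # suf --> pos (rfw pre (ze i)) & pos (rfw (rev suf) (ze i))"
proof -
 define u where "u = arg_min length (%u. swd u = swd u0)"
 have u: "swd u = swd u0" and min: "!!v. swd v = swd u0 ==> length u <= length v"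
  using arg_min_natI[of "%u. swd u = swd u0" u0 length] arg_min_nat_le[of "%u. swd u = swd u0" _ length] unfolding u_def by auto
 have "pos (rfw pre (ze i)) & pos (rfw (rev suf) (ze i))" if s: "u = pre @ i # suf" for pre i suf proof (rule ccontr)
  assume "\<not> (pos (rfw pre (ze i)) & pos (rfw (rev suf) (ze i)))"
  then consider "\<not> pos (rfw pre (ze i))" | "\<not> pos (rfw (rev suf) (ze i))" by blast
  then show False proof cases
   case 1
   from deletion[OF this] obtain v where v: "length v < length pre" "swd (pre @ [i]) = swd v" by blast
   have "swd (v @ suf) \<mu> = swd u \<mu>" for \<mu> using fun_cong[OF v(2), of "swd suf \<mu>"] by (simp add: s)
   then have "swd (v @ suf) = swd u0" using u by (simp add: fun_eq_iff)
   from min[OF this] v(1) show False by (simp add: s)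
  next case 2
   from deletion[OF this] obtain v where v: "length v < length (rev suf)" "swd (rev suf @ [i]) = swd v" by blast
   have "swd (i # suf) \<mu> = swd (rev v) \<mu>" for \<mu> proof -
    have "swd v (swd (i # suf) \<mu>) = \<mu>" using fun_cong[OF v(2), of "swd (i # suf) \<mu>"] by simp
    then show ?thesis using swd_rev[of v "swd (i # suf) \<mu>"] by simp
   qed
   then have "swd (pre @ rev v) \<mu> = swd u \<mu>" for \<mu> by (simp add: s)
   then have "swd (pre @ rev v) = swd u0" using u by (simp add: fun_eq_iff)
   from min[OF this] v(1) show False by (simp add: s)
  qed
 qed
 with u show ?thesis using that by blast
qed

lemma swd_clinear: "clinear \<mu> ==> clinear (swd u \<mu>)"
proof (induction u)
 case (Cons i u)
 then have l: "clinear (swd u \<mu>)" by blast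
 have "clinear (srf i (swd u \<mu>))"
  by (rule clinearI) (simp_all add: srf_def clinear_simps[OF l] clinear_simps[OF sr_lin] algebra_simps)
 then show ?case by (simp only: foldr.simps comp_apply)
qed simp

text \<open>Gives the description in \<open>weyl_on_cartan\<close> its meaning; uniqueness holds
  because linear functionals separate points.\<close>

lemma coroot_transport: "\<exists>!h'. \<forall>\<mu>. clinear \<mu> --> swd u \<mu> h' = \<mu> h"
proof (rule ex_ex1I)
 show "EX h'. \<forall>\<mu>. clinear \<mu> --> swd u \<mu> h' = \<mu> h" proof (induction u)
  case (Cons i u)
  then obtain h' where h': "!!\<mu>. clinear \<mu> ==> swd u \<mu> h' = \<mu> h" by blast
  have "swd (i # u) \<mu> (h' - sr i h' *. cr i) = \<mu> h" if "clinear \<mu>" for \<mu>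
   using h'[OF that] swd_clinear[OF that, of u]
   by (simp add: srf_def clinear_diff[of "swd u \<mu>"] clinear_scale[of "swd u \<mu>"] clinear_simps[OF sr_lin] sr_cr A_diag algebra_simps)
  then show ?case by blast
 qed auto
 fix h1 h2 assume h: "\<forall>\<mu>. clinear \<mu> --> swd u \<mu> h1 = \<mu> h" "\<forall>\<mu>. clinear \<mu> --> swd u \<mu> h2 = \<mu> h"
 show "h1 = h2" proof (rule ccontr)
  assume "h1 ~= h2"
  then obtain l :: "'h => complex" where l: "clinear l" "l (h1 - h2) = 1" using functional_exists[of "h1 - h2" 1] by auto
  have "clinear (swd (rev u) l)" by (rule swd_clinear[OF l(1)])
  then have "l h1 = l h2" using h by (metis swd_rev')
  then show False using l by (simp add: clinear_diff[OF l(1)])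
 qed
qed

text \<open>Both sides are the pairing of \<nu> with the same root, divided by half its squared
  length. Hence the choice made inside \<open>coroot\<close> does not matter.\<close>

lemma transported_coroot_value:
 assumes "\<nu> h' = swd (rev u') \<nu> (cr j)" "rfw u' (ze j) = rfw pre (ze i)"
 shows "\<nu> h' = swd (rev pre) \<nu> (cr i)"
proof -
 have "rfw (rev pre) (rfw u' (ze j)) = ze i" using assms(2) by simp
 then have dd: "d j = d i" using same_length[of "rev pre @ u'" j i] by simp
 have "dc j * swd (rev u') \<nu> (cr j) = dc i * swd (rev pre) \<nu> (cr i)" unfolding swd_cr by (simp add: assms(2))
 then show ?thesis using assms(1) dd d_pos[of i] by simp
qed

lemma swd_integral:
 assumes "!!i. \<mu> (cr i) : \<int>"
 shows "swd u \<mu> (cr i) : \<int>" by (induction u arbitrary: i) (simp_all add: assms srf_def sr_cr)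

text \<open>Up to the factor \<open>d i\<close>, the value is the pairing of a dominant weight with
  a positive root; it is also an integer.\<close>

lemma swd_nonneg:
 assumes "!!i. \<mu> (cr i) = of_nat (k i)" "pos (rfw (rev u) (ze i))"
 shows "EX p. swd u \<mu> (cr i) = of_nat p"
proof -
 have "dc i * swd u \<mu> (cr i) = of_real (SUM j:UNIV. rfw (rev u) (ze i) j * d j * k j)"
  unfolding swd_cr shp_def by (simp add: assms(1))
 moreover obtain m :: int where m: "swd u \<mu> (cr i) = of_int m"
  using swd_integral[of \<mu> u i] assms(1) by (metis Ints_cases Ints_of_nat)
 ultimately have "complex_of_real (d i * m) = of_real (SUM j:UNIV. rfw (rev u) (ze i) j * d j * k j)" by simp
 then have "d i * m = (SUM j:UNIV. rfw (rev u) (ze i) j * d j * k j)" by (simp only: of_real_eq_iff)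
 also have "... \<ge> 0" using assms(2) d_pos by (intro sum_nonneg) (simp add: less_imp_le)
 finally have "0 <= d i * m" .
 then have "0 <= m" using d_pos[of i] by (simp add: zero_le_mult_iff)
 then show ?thesis using m by (intro exI[of _ "nat m"]) simp
qed

end

section \<open>Modules of finite type\<close>

locale fkm = km0 A sr cr br ch e f for A :: "'i::finite => 'i => int" and sr :: "'i => 'h::complex_vector => complex" and cr
  and br :: "'g::complex_vector => 'g => 'g" and ch e f +
 assumes fin: "finite_dim (UNIV :: 'g set)"
begin

text \<open>Nonzero vectors from distinct root spaces are independent, so a finite spanning set
  bounds their number.\<close>

lemma finite_W: "finite {z. W z ~= {0}}"
proof (rule ccontr)
 let ?R = "{z. W z ~= {0}}"
 assume inf: "infinite ?R"
 obtain B :: "'g set" where B: "finite B" "UNIV \<subseteq> cvec.span B" using fin by (auto simp: finite_dim_def)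
 have "ALL z:?R. EX x. x : W z & x ~= 0" using cvec.subspace_0[OF subspace_W] by blast
 then obtain x where x: "!!z. z : ?R ==> x z : W z" "!!z. z : ?R ==> x z ~= 0" by (metis (no_types))
 have inj: "inj_on x ?R" proof (rule inj_onI, rule ccontr)
  fix z z' assume z: "z : ?R" "z' : ?R" "x z = x z'" "z ~= z'"
  define g where "g u = (if u = z then x z else - x z)" for u
  have "g z = 0"
   by (rule W_indep[of "{z, z'}"]) (use x(1)[OF z(1)] x(1)[OF z(2)] z(3,4) cvec.subspace_neg[OF subspace_W] in \<open>auto simp: g_def\<close>)
  then show False using x(2)[OF z(1)] by (simp add: g_def)
 qed
 have "cvec.independent (x ` ?R)" unfolding cvec.dependent_explicit proof
  assume "EX t u. finite t & t \<subseteq> x ` ?R & (SUM v:t. u v *. v) = 0 & (EX v:t. u v ~= 0)"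
  then obtain t u v where t: "finite t" "t \<subseteq> x ` ?R" "(SUM v:t. u v *. v) = 0" "v : t" "u v ~= 0" by blast
  obtain Z where Z: "Z \<subseteq> ?R" "finite Z" "t = x ` Z" using finite_subset_image[OF t(1,2)] by blast
  obtain z where z: "z : Z" "v = x z" using t(4) Z(3) by blast
  have "(SUM z:Z. u (x z) *. x z) = 0" using t(3) unfolding Z(3) sum.reindex[OF inj_on_subset[OF inj Z(1)]] by simp
  then have "u (x z) *. x z = 0" using W_indep[of Z "%z. u (x z) *. x z" z] Z z(1) x(1) cvec.subspace_scale[OF subspace_W] by blast
  moreover have "x z ~= 0" by (rule x(2)[OF subsetD[OF Z(1) z(1)]])
  ultimately show False using t(5) z(2) by simp
 qed
 from cvec.independent_span_bound[OF B(1) this] B(2) have "finite (x ` ?R)" by blast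
 then show False using inf finite_imageD[OF _ inj] by blast
qed

lemma ad_nil_aux: assumes "!!z x. x : W z ==> br y x : W (z + s)" "s ~= 0"
 shows "EX n. (br y ^^ n) x = 0"
proof -
 have pow: "(br y ^^ k) x : W (%j. z j + int k * s j)" if "x : W z" for k x z proof (induction k)
  case (Suc k)
  have "(%j. z j + int k * s j) + s = (%j. z j + int (Suc k) * s j)" by (auto simp: fun_eq_iff algebra_simps)
  then show ?case using assms(1)[OF Suc] by simp
 qed (simp add: that)
 have nil: "EX n. (br y ^^ n) x = 0" if x: "x : W z" for x z proof (rule ccontr)
  assume n: "\<nexists>n. (br y ^^ n) x = 0"
  obtain i where i: "s i ~= 0" using assms(2) by (auto simp: fun_eq_iff)
  have "inj (%k j. z j + int k * s j)" by (rule injI) (use i in \<open>auto dest!: fun_cong[where x = i]\<close>)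
  moreover have "range (%k j. z j + int k * s j) \<subseteq> {z. W z ~= {0}}" using pow[OF x] n by blast
  ultimately show False using finite_W finite_subset range_inj_infinite by blast
 qed
 have sub: "cvec.subspace {x. EX n. (br y ^^ n) x : {0}}"
  by (rule subspace_nil[OF cbilinear_right[OF br_bilinear] cvec.subspace_single_0]) (auto simp: br_simps)
 obtain Z g where "finite Z" "ALL z:Z. g z : W z" "x = (SUM z:Z. g z)" using W_decomp[of x] by blast
 then have "x : {x. EX n. (br y ^^ n) x : {0}}" using nil by (auto intro!: cvec.subspace_sum[OF sub, simplified])
 then show ?thesis by simp
qed

sublocale kmn
proof
 show "EX n. (br (e i) ^^ n) x = 0" for i x
  by (rule ad_nil_aux[where s = "up (uvec i)"]) (use W_br[OF e_W] in \<open>auto simp: add.commute fun_eq_iff intro!: exI[of _ i]\<close>)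
 show "EX n. (br (f i) ^^ n) x = 0" for i x
  by (rule ad_nil_aux[where s = "dn (uvec i)"]) (use W_br[OF f_W] in \<open>auto simp: add.commute fun_eq_iff intro!: exI[of _ i]\<close>)
qed

lemma finite_roots: "finite {z. root z}" by (rule finite_subset[OF _ finite_W]) (auto simp: root_def)

text \<open>By linearity a product of reflections is determined by the images of the simple roots.
  These are roots, finitely many here, and so the Weyl group is finite.\<close>

lemma rfw_expand: "rfw u z = (%k. SUM j:UNIV. z j * rfw u (ze j) k)"
proof (induction u)
 case Nil
 have "(SUM j:UNIV. z j * ze j k) = (SUM j:UNIV. if j = k then z j else 0)" for k by (rule sum.cong) (auto simp: uvec_def)
 then show ?case by simp
next case (Cons i u)
 have p: "pr (%k. SUM j:UNIV. z j * rfw u (ze j) k) i = (SUM j:UNIV. z j * pr (rfw u (ze j)) i)"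
  unfolding pr_def sum_distrib_left sum_distrib_right by (subst sum.swap) (simp add: mult.assoc)
 show ?case unfolding foldr.simps comp_apply Cons.IH
  by (rule ext) (simp only: rf_def p right_diff_distrib sum_subtractf if_distrib[of "%x. _ * x"] mult_zero_right, simp)
qed

text \<open>The Euclidean form averaged over the finite Weyl group provides the symmetrization.\<close>

lemma symmetrizable: "EX d. km A sr cr br ch e f d"
proof -
 define G where "G = range (%u. foldr rf u)"
 have inj: "inj_on (%g j. g (ze j)) G" proof (rule inj_onI)
  fix g g' assume "g : G" "g' : G" and eq: "(%j. g (ze j)) = (%j. g' (ze j))"
  then obtain u u' where u: "g = foldr rf u" "g' = foldr rf u'" by (auto simp: G_def)
  have "rfw u (ze j) = rfw u' (ze j)" for j using fun_cong[OF eq, of j] by (simp only: u)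
  then have "rfw u z = rfw u' z" for z by (subst (1 2) rfw_expand) (simp only:)
  then show "g = g'" by (simp add: u fun_eq_iff)
 qed
 have "(%g j. g (ze j)) ` G \<subseteq> PiE UNIV (%_. {z. root z})" using root_rfw[OF root_ze] by (auto simp: G_def)
 then have finG: "finite G" by (rule finite_imageD[OF finite_subset inj]) (rule finite_PiE, simp_all add: finite_roots)
 define B where "B z z' = (SUM g:G. SUM k:UNIV. g z k * g z' k)" for z z' :: "'i => int"
 have add: "rfw u (%j. z j - c * z' j) k = rfw u z k - c * rfw u z' k" for u z z' c k
  by (subst (1 2 3) rfw_expand) (simp add: left_diff_distrib sum_subtractf sum_distrib_left mult.assoc)
 have inv: "B (rf i z) (rf i z') = B z z'" for i z z' unfolding B_def
 proof (rule sum.reindex_bij_witness[where i = "%g. g \<circ> rf i" and j = "%g. g \<circ> rf i"])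
  have "foldr rf u \<circ> rf i = foldr rf (u @ [i])" for u by (simp add: fun_eq_iff)
  then show "g \<circ> rf i : G" if "g : G" for g using that unfolding G_def by auto
  then show "g \<circ> rf i : G" if "g : G" for g using that .
 qed (simp_all add: fun_eq_iff)
 have B1: "B (- z) z' = - B z z'" for z z'
  unfolding B_def sum_negf[symmetric] by (intro sum.cong refl) (auto simp: G_def rfw_uminus)
 have B2: "B z (%j. z1 j - c * z2 j) = B z z1 - c * B z z2" for z z1 z2 c
  unfolding B_def sum_distrib_left sum_subtractf[symmetric] by (intro sum.cong refl) (auto simp: G_def add algebra_simps)
 have Bsym: "B z z' = B z' z" for z z' by (simp add: B_def mult.commute)
 \<comment> \<open>Invariance of \<open>B\<close> under the reflection expresses
   \<open>B (ze i) z\<close> through the coroot; taking \<open>z\<close> simple, the squared lengths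
   symmetrize the matrix.\<close>
 have two: "2 * B (ze i) z = pr z i * B (ze i) (ze i)" for i z proof -
  have z: "rf i z = (%j. z j - pr z i * ze i j)" by (auto simp: rf_def uvec_def)
  have "B (ze i) z = B (rf i (ze i)) (rf i z)" by (simp only: inv)
  also have "... = - (B (ze i) z - pr z i * B (ze i) (ze i))" unfolding rf_ze B1 unfolding z B2 ..
  finally show ?thesis by linarith
 qed
 have pos: "0 < B (ze i) (ze i)" for i proof -
  have id: "id : G" unfolding G_def by (rule image_eqI[of _ _ "[]"]) (simp_all add: fun_eq_iff)
  have "0 < (SUM k:UNIV. id (ze i) k * id (ze i) k)" by (rule sum_pos2[where i = i]) simp_all
  then show ?thesis unfolding B_def by (rule sum_pos2[OF finG id]) (simp add: sum_nonneg)
 qed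
 have "B (ze i) (ze i) * A i j = B (ze j) (ze j) * A j i" for i j
  using two[of i "ze j"] two[of j "ze i"] Bsym[of "ze i" "ze j"] by (simp add: pr_unit mult.commute)
 then have "real_of_int (B (ze i) (ze i)) * A i j = B (ze j) (ze j) * A j i" for i j by (metis of_int_mult)
 then have "km A sr cr br ch e f (%i. real_of_int (B (ze i) (ze i)))"
  using pos by (intro km.intro km_axioms.intro km0_axioms) simp_all
 then show ?thesis by blast
qed

end

context km
begin

lemma stable_projection:
 assumes m: "lie_module br \<tau>" and T: "submodule \<tau> T"
 obtains pj where "clinear pj" "!!x. pj x = x \<longleftrightarrow> x : T" "!!x. pj x : T" "lie_module br (%g x. \<tau> g (pj x))"
proof -
 have sT: "cvec.subspace T" and st: "!!g x. x : T ==> \<tau> g x : T" using T by (auto simp: submodule_def)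
 have T0: "{0} \<subseteq> T" using cvec.subspace_0[OF sT] by simp
 obtain pj where p: "clinear pj" "!!x. pj x : T" "!!x. pj (pj x) = pj x" "!!x. x : T ==> x - pj x : {0}" "!!x. x : {0} ==> pj x = 0"
  by (rule projection_exists[OF cvec.subspace_single_0 sT T0], rule that)
 have id: "pj x = x" if "x : T" for x using p(4)[OF that] by simp
 show ?thesis proof (rule that[OF p(1) _ p(2)])
  show "pj x = x \<longleftrightarrow> x : T" for x using id p(2)[of x] by metis
  show "lie_module br (%g x. \<tau> g (pj x))" unfolding lie_module_def proof (intro conjI allI)
   show "cbilinear (%g x. \<tau> g (pj x))"
    by (rule cbilinearI) (simp_all add: cbilinear_simps[OF lie_module_bilinear[OF m]] clinear_simps[OF p(1)])
   show "\<tau> (br x y) (pj v) = \<tau> x (pj (\<tau> y (pj v))) - \<tau> y (pj (\<tau> x (pj v)))" for x y v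
    by (simp add: id[OF st[OF p(2)]] lie_module_bracket[OF m])
  qed
 qed
qed

end

context verma
begin

lemma wtmod_dominant:
 obtains \<tau> :: "'g => ('i list => complex) => 'i list => complex" and pj nv
 where "wtmod A sr cr br ch e f d \<tau> pj \<Lambda> (%i. int (n i)) nv" "!!i x. EX n. (\<tau> (e i) ^^ n) x = 0" "!!i x. EX n. (\<tau> (f i) ^^ n) x = 0"
proof -
 obtain \<rho> :: "'g => ('i list => complex) => 'i list => complex" and \<pi>
  where N: "lie_module br \<rho>" "clinear \<pi>" "!!x. x : v.U ==> \<pi> x = 0 \<longleftrightarrow> x : VK"
   "!!x i. x : v.U ==> \<rho> (e i) (\<pi> x) = \<pi> (vE i x)" "!!x i. x : v.U ==> \<rho> (f i) (\<pi> x) = \<pi> (vF i x)"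
   "!!x h. x : v.U ==> \<rho> (ch h) (\<pi> x) = \<pi> (vH h x)"
   "!!i x. EX n. (\<rho> (e i) ^^ n) x = 0" "!!i x. EX n. (\<rho> (f i) ^^ n) x = 0" by (rule max_module, rule that)
 define y where "y = \<pi> (ew [])"
 interpret p: hwm A sr cr br ch e f d \<rho> y \<Lambda> proof (intro hwm.intro hw.intro hw_axioms.intro hwm_axioms.intro)
  show "chev sr cr (%i. \<rho> (e i)) (%i. \<rho> (f i)) (%h. \<rho> (ch h))" by (rule chev_module[OF N(1)])
  show "\<rho> (e i) y = 0" for i by (simp add: y_def N(4)[OF ew_U] v.Ey clinear_0[OF N(2)])
  show "\<rho> (ch h) y = \<Lambda> h *. y" for h by (simp add: y_def N(6)[OF ew_U] v.Hy clinear_scale[OF N(2)])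
 qed (fact km_axioms N(1))+
 have y0: "y ~= 0" using VK_Nil[of "ew []"] N(3)[OF ew_U] by (auto simp: y_def ew_def)
 have subU: "submodule \<rho> p.U"
  unfolding submodule_def by (intro conjI allI ballI p.subspace_U submodule_gen[OF N(1) p.subspace_U p.U_E p.U_F p.U_H])
 obtain pj where pj: "clinear pj" "!!x. pj x = x \<longleftrightarrow> x : p.U" "!!x. pj x : p.U" "lie_module br (%g x. \<rho> g (pj x))"
  by (rule stable_projection[OF N(1) subU], rule that)
 let ?t = "%g x. \<rho> g (pj x)"
 have pjU: "pj x = x" if "x : p.U" for x using that pj(2) by blast
 have st: "\<rho> g x : p.U" if "x : p.U" for g x using subU that by (auto simp: submodule_def)
 have nil: "EX n. (?t g ^^ n) x = 0" if nl: "!!x. EX n. (\<rho> g ^^ n) x = 0" for g x proof -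
  have pow: "(?t g ^^ k) x = (\<rho> g ^^ k) x" if "x : p.U" for k x proof -
   have "(?t g ^^ k) x = (\<rho> g ^^ k) x & (\<rho> g ^^ k) x : p.U"
    by (induction k) (use that in \<open>simp_all add: st pjU\<close>)
   then show ?thesis by blast
  qed
  obtain k where "(\<rho> g ^^ k) (?t g x) = 0" using nl by blast
  then have "(?t g ^^ k) (?t g x) = 0" using pow[OF st[OF pj(3)]] by simp
  then show ?thesis by (intro exI[of _ "Suc k"]) (simp add: funpow_Suc_right del: funpow.simps)
 qed
 have wti: "inj (%z h. \<Lambda> h + wt z h)" using wt_inj unfolding inj_def by (simp add: fun_eq_iff)
 have wsub: "cvec.subspace {x. ALL h. \<rho> (ch h) x = (\<Lambda> h + wt z h) *. x}" for z
  by (rule cvec.subspaceI) (simp_all add: p.\<rho>s scaleC_add_right cvec.scale_left_commute)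
 have wdn: "p.dwt k h = \<Lambda> h + wt (dn k) h" for k h by (simp add: p.dwt_wt ad.wt_def sum_negf)
 have low: "EX k. z = dn k" if x: "x : p.U" "x ~= 0" "!!h. \<rho> (ch h) x = (\<Lambda> h + wt z h) *. x" for x z
 proof (rule ccontr)
  assume z: "\<nexists>k. z = dn k"
  obtain l :: "_ => complex" where l: "clinear l" "l x = 1" "!!z' x. z' ~= z ==> x : {x. ALL h. \<rho> (ch h) x = (\<Lambda> h + wt z' h) *. x} ==> l x = 0"
   by (rule weight_functional[where H = "%h. \<rho> (ch h)" and ?k0.0 = z and v = x, OF wsub wti lie_module_linear[OF N(1)]]) (use x in auto)
  obtain K g where K: "finite K" "ALL k:K. g k : dep p.F y k" "x = (SUM k:K. g k)" using p.U_decomp[OF x(1)] by blast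
  have "l (g k) = 0" if "k : K" for k
   by (rule l(3)[of "dn k"]) (use z p.H_dep[OF K(2)[rule_format, OF that]] in \<open>auto simp: wdn\<close>)
  then have "l x = 0" by (simp add: K(3) clinear_sum[OF l(1)])
  then show False using l(2) by simp
 qed
 \<comment> \<open>If the weight is dominant, the norm difference is minus a sum of nonnegative
   terms. Otherwise a reflection at a negative value keeps the norm, and a power of
   \<open>e i\<close> reaches the reflected weight space at a smaller depth.\<close>
 have bound: "qfn (%i. int (n i)) z <= 0"
  if x: "x : p.U" "x ~= 0" "!!h. \<rho> (ch h) x = (\<Lambda> h + wt z h) *. x" "z = dn k" for x z k using x
 proof (induction "height k" arbitrary: x z k rule: less_induct)
  case less
  show ?case proof (cases "ALL i. 0 <= int (n i) + pr z i")
   case True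
   have "qfn (%i. int (n i)) z = (SUM i:UNIV. - (real (k i) * (d i * (real (n i) + real_of_int (int (n i) + pr z i)))))"
    unfolding qfn_def bf_def sum_distrib_left sum.distrib[symmetric] by (rule sum.cong) (simp_all add: less.prems(4) algebra_simps)
   also have "... <= 0" proof (rule sum_nonpos)
    fix i
    have "0 <= real_of_int (int (n i) + pr z i)" using True by (simp only: of_int_0_le_iff)
    then have "0 <= real (k i) * (d i * (real (n i) + real_of_int (int (n i) + pr z i)))"
     using d_pos[of i] by (intro mult_nonneg_nonneg) simp_all
    then show "- (real (k i) * (d i * (real (n i) + real_of_int (int (n i) + pr z i)))) <= 0" by linarith
   qed
   finally show ?thesis .
  next case False
   then obtain i where i: "int (n i) + pr z i < 0" by (auto simp: not_le)
   define m where "m = nat (- (int (n i) + pr z i))"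
   have mi: "int m = - (int (n i) + pr z i)" "0 < m" using i by (simp_all add: m_def)
   let ?x = "(\<rho> (e i) ^^ m) x"
   have "\<Lambda> (cr i) + wt z (cr i) = complex_of_int (int (n i) + pr z i)" by (simp add: \<Lambda>_cr wt_cr)
   also have "... = - of_nat m" using mi(1) by (metis minus_equation_iff of_int_minus of_int_of_nat_eq)
   finally have x0: "?x ~= 0" using e_pow_neq_0[OF N(1) less.prems(3) _ N(8) less.prems(2)] by blast
   have xU: "?x : p.U" using less.prems(1) st by (induction m) auto
   have w: "\<rho> (ch h) ?x = (\<Lambda> h + wt (z + sh (int m) i) h) *. ?x" for h
    using pow_weight(2)[OF N(1) less.prems(3)] by (simp add: ad.wt_add wt_sh algebra_simps)
   obtain k' where k': "z + sh (int m) i = dn k'" using low[OF xU x0 w] by blast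
   have kk: "int (k' j) = int (k j) - sh (int m) i j" for j using fun_cong[OF k', of j] by (simp add: less.prems(4))
   have "int (height k') = int (height k) - (SUM j:UNIV. sh (int m) i j)" unfolding height_def of_nat_sum kk sum_subtractf by simp
   also have "(SUM j:UNIV. sh (int m) i j) = int m" by (simp add: sh_def)
   finally have "height k' < height k" using mi(2) by linarith
   from less.hyps[OF this xU x0 w k'] show ?thesis unfolding qf_shift using mi(1) by (simp add: algebra_simps flip: of_int_add)
  qed
 qed
 have "wtmod A sr cr br ch e f d ?t pj \<Lambda> (%i. int (n i)) y" proof (intro wtmod.intro wtmod_axioms.intro)
  show "pj (pj x) = pj x" for x using pj(2,3) by blast
  then show "?t g (pj x) = ?t g x" for g x by simp
  show "pj (?t g x) = ?t g x" for g x using pj(2) st[OF pj(3)] by blast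
  show "pj x : cvec.span (\<Union>z. {x. pj x = x & (ALL h. ?t (ch h) x = (\<Lambda> h + wt z h) *. x)})" for x proof -
   obtain K g where K: "finite K" "ALL k:K. g k : dep p.F y k" "pj x = (SUM k:K. g k)" using p.U_decomp[OF pj(3)] by blast
   have "g k : cvec.span (\<Union>z. {x. pj x = x & (ALL h. ?t (ch h) x = (\<Lambda> h + wt z h) *. x)})" if "k : K" for k
   proof (rule cvec.span_base, rule UN_I[of "dn k"])
    have "pj (g k) = g k" using K(2) that p.dep_U pj(2) by blast
    then show "g k : {x. pj x = x & (ALL h. ?t (ch h) x = (\<Lambda> h + wt (dn k) h) *. x)}"
     using p.H_dep[OF K(2)[rule_format, OF that]] by (simp add: wdn)
   qed simp
   then show ?thesis unfolding K(3) by (rule cvec.span_sum)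
  qed
  show "x = 0" if q: "0 < qfn (%i. int (n i)) z" and x: "pj x = x" "!!h. ?t (ch h) x = (\<Lambda> h + wt z h) *. x" for z x
  proof (rule ccontr)
   assume x0: "x ~= 0"
   have xU: "x : p.U" using x(1) pj(2) by blast
   have w: "\<rho> (ch h) x = (\<Lambda> h + wt z h) *. x" for h using x(2)[of h] by (simp add: x(1))
   obtain k where "z = dn k" using low[OF xU x0 w] by blast
   from bound[OF xU x0 w this] q show False by simp
  qed
  have "pj y = y" using p.y_U pj(2) by blast
  then show "pj y = y" "?t (ch h) y = \<Lambda> h *. y" for h by (simp_all add: p.Hy)
 qed (simp_all add: km_axioms pj(1,4) \<Lambda>_cr y0)
 then show ?thesis by (rule that[OF _ nil[OF N(7)] nil[OF N(8)]])
qed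

end

text \<open>The module stays the same and only its base point moves along a string. The norm is
  invariant under the reflection, so the labels \<open>z\<close> shift by a constant and the bound
  persists.\<close>

lemma (in wtmod) wtmod_reflect:
 assumes nil: "!!x. EX n. (\<tau> (e i) ^^ n) x = 0" "!!x. EX n. (\<tau> (f i) ^^ n) x = 0"
 shows "EX nv'. wtmod A sr cr br ch e f d \<tau> pj (srf i \<omega>) (%j. \<omega>i j - \<omega>i i * A j i) nv'"
proof -
 obtain nv' where nv': "nv' : Mz (sh (- \<omega>i i) i)" "nv' ~= 0" proof (cases "0 <= \<omega>i i")
  case True
  then have "\<omega> (cr i) = of_nat (nat (\<omega>i i))" by (simp add: \<omega>i)
  from f_pow_neq_0[OF mod\<tau> nv(2) this nil(1) nv(3)] f_pow_Mz[OF nv_Mz, where i = i and k = "nat (\<omega>i i)"] that True show thesis by simp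
 next case False
  then have "\<omega> (cr i) = - of_nat (nat (- \<omega>i i))" by (simp add: \<omega>i)
  from e_pow_neq_0[OF mod\<tau> nv(2) this nil(2) nv(3)] e_pow_Mz[OF nv_Mz, where i = i and k = "nat (- \<omega>i i)"] that False show thesis by simp
 qed
 have eq: "srf i \<omega> h + wt z h = \<omega> h + wt (z + sh (- \<omega>i i) i) h" for z h
  by (simp add: srf_def ad.wt_add wt_sh \<omega>i)
 have sp: "(\<Union>z. {x. pj x = x & (ALL h. \<tau> (ch h) x = (srf i \<omega> h + wt z h) *. x)}) = (\<Union>z. Mz z)" proof -
  have "surj (%z. z + sh (- \<omega>i i) i)" by (rule surjI[of _ "%z. z - sh (- \<omega>i i) i"]) simp
  then have "range (%z. Mz (z + sh (- \<omega>i i) i)) = range Mz" using image_image[of Mz "%z. z + sh (- \<omega>i i) i" UNIV] by simp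
  then show ?thesis unfolding eq Mz_def by simp
 qed
 have q: "qfn (%j. \<omega>i j - \<omega>i i * A j i) z = qf (z + sh (- \<omega>i i) i)" for z proof -
  have dA: "real_of_int (z j) * d j * real_of_int (\<omega>i j - \<omega>i i * A j i)
   = real_of_int (z j) * d j * \<omega>i j - \<omega>i i * (d i * (z j * A i j))" for j
   using d_sym[of i j] by (simp add: algebra_simps)
  have "(SUM j:UNIV. real_of_int (z j) * d j * real_of_int (\<omega>i j - \<omega>i i * A j i))
   = (SUM j:UNIV. real_of_int (z j) * d j * \<omega>i j) - \<omega>i i * (d i * pr z i)"
   unfolding dA sum_subtractf by (simp add: sum_distrib_left pr_def)
  then show ?thesis unfolding qf_shift by (simp add: qfn_def algebra_simps)
 qed
 have "wtmod A sr cr br ch e f d \<tau> pj (srf i \<omega>) (%j. \<omega>i j - \<omega>i i * A j i) nv'"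
 proof (intro wtmod.intro wtmod_axioms.intro)
  show "srf i \<omega> (cr j) = of_int (\<omega>i j - \<omega>i i * A j i)" for j by (simp add: srf_def \<omega>i sr_cr)
  show "pj x : cvec.span (\<Union>z. {x. pj x = x & (ALL h. \<tau> (ch h) x = (srf i \<omega> h + wt z h) *. x)})" for x
   unfolding sp using spanning[of x] unfolding Mz_def .
  show "x = 0" if "0 < qfn (%j. \<omega>i j - \<omega>i i * A j i) z" "pj x = x" "!!h. \<tau> (ch h) x = (srf i \<omega> h + wt z h) *. x" for z x
   using that unfolding q eq by (rule bound)
  show "pj nv' = nv'" using nv'(1) by (simp add: Mz_def)
  show "\<tau> (ch h) nv' = srf i \<omega> h *. nv'" for h using nv'(1) by (simp add: Mz_def srf_def wt_sh \<omega>i)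
 qed (simp_all add: km_axioms mod\<tau> pj nv')
 then show ?thesis by (rule exI)
qed

text \<open>Induct on the number of positive roots that pair negatively with \<omega>. Reflecting at
  a simple root of this kind permutes the other positive roots, so the number drops;
  \<open>wtmod_reflect\<close> moves the base point back.\<close>

lemma (in km) wtmod_finite_type:
 assumes fin: "finite {z. root z}" and \<omega>: "clinear \<omega>" "!!i. \<omega> (cr i) = of_int (a i)"
 shows "\<exists>(\<tau> :: 'g => ('i list => complex) => 'i list => complex) pj nv. wtmod A sr cr br ch e f d \<tau> pj \<omega> a nv \<and>
  (ALL i x. (EX n. (\<tau> (e i) ^^ n) x = 0) & (EX n. (\<tau> (f i) ^^ n) x = 0))" using \<omega>
proof (induction "card {z. root z & pos z & Re (shp \<omega> z) < 0}" arbitrary: \<omega> a rule: less_induct)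
 case less
 show ?case proof (cases "ALL i. 0 <= a i")
  case True
  interpret verma A sr cr br ch e f d \<omega> "%i. nat (a i)" proof (intro verma.intro verma_axioms.intro km_axioms less.prems(1))
   show "\<omega> (cr i) = of_nat (nat (a i))" for i unfolding less.prems(2) using True by simp
  qed
  have a: "(%i. int (nat (a i))) = a" using True by auto
  obtain \<tau> :: "'g => ('i list => complex) => 'i list => complex" and pj nv where
   w: "wtmod A sr cr br ch e f d \<tau> pj \<omega> a nv" and
   nil: "!!i x. EX n. (\<tau> (e i) ^^ n) x = 0" "!!i x. EX n. (\<tau> (f i) ^^ n) x = 0"
   by (rule wtmod_dominant[unfolded a], rule that)
  have "ALL i x. (EX n. (\<tau> (e i) ^^ n) x = 0) & (EX n. (\<tau> (f i) ^^ n) x = 0)" by (intro allI conjI nil)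
  then show ?thesis by - (rule exI, rule exI, rule exI, rule conjI[OF w])
 next case False
  then obtain i where i: "a i < 0" by (auto simp: not_le)
  let ?N = "%\<omega>. {z. root z & pos z & Re (shp \<omega> z) < 0}"
  let ?b = "%j. a j - a i * A j i"
  have finN: "finite (?N \<omega>)" for \<omega> by (rule finite_subset[OF _ fin]) blast
  have neg: "Re (shp \<omega> (ze i)) < 0" using i d_pos[of i] by (simp only: shp_ze less.prems(2), simp add: mult_pos_neg)
  have flip: "shp (srf i \<omega>) z = shp \<omega> (rf i z)" for z using shp_rf[of i \<omega> "rf i z"] by simp
  have shpm: "shp \<omega> (- z) = - shp \<omega> z" for z by (simp add: shp_def sum_negf)
  have "rf i ` ?N (srf i \<omega>) \<subseteq> ?N \<omega> - {ze i}" proof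
   fix y assume "y : rf i ` ?N (srf i \<omega>)"
   then obtain z where z: "y = rf i z" "root z" "pos z" "Re (shp \<omega> (rf i z)) < 0" by (auto simp only: flip)
   have zi: "z ~= ze i" proof
    assume zi: "z = ze i"
    from z(4) have "Re (- shp \<omega> (ze i)) < 0" unfolding zi rf_ze shpm .
    then show False using neg by simp
   qed
   have "rf i z ~= ze i" proof
    assume "rf i z = ze i"
    then have "z = - ze i" using rf_rf[of i z] rf_ze[of i] by simp
    then show False using z(3)[rule_format, of i] by (simp add: uvec_def)
   qed
   then show "y : ?N \<omega> - {ze i}" using z root_rf[OF z(2)] rf_pos[OF z(2) root_rf[OF z(2)] z(3) zi] by simp
  qed
  then have c1: "card (rf i ` ?N (srf i \<omega>)) <= card (?N \<omega> - {ze i})" by (rule card_mono[rotated]) (use finN in blast)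
  have c2: "inj_on (rf i) (?N (srf i \<omega>))" by (rule inj_on_inverseI[of _ "rf i"]) simp
  have c3: "ze i : ?N \<omega>" using neg root_ze by simp
  have lt: "card (?N (srf i \<omega>)) < card (?N \<omega>)"
   using card_image[OF c2] card_Diff1_less[OF finN[of \<omega>] c3] c1 by linarith
  have lin: "clinear (srf i \<omega>)" using swd_clinear[OF less.prems(1), of "[i]"] by simp
  have val: "srf i \<omega> (cr j) = of_int (?b j)" for j by (simp add: srf_def less.prems(2) sr_cr)
  from less.hyps[OF lt lin val]
  obtain \<tau> :: "'g => ('i list => complex) => 'i list => complex" and pj nv where
   w: "wtmod A sr cr br ch e f d \<tau> pj (srf i \<omega>) ?b nv" and
   nil: "ALL i x. (EX n. (\<tau> (e i) ^^ n) x = 0) & (EX n. (\<tau> (f i) ^^ n) x = 0)" by (elim exE conjE)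
  from nil have nil': "EX n. (\<tau> (e i) ^^ n) x = 0" "EX n. (\<tau> (f i) ^^ n) x = 0" for x by blast+
  have bb: "(%j. ?b j - ?b i * A j i) = a" by (auto simp: A_diag algebra_simps)
  from wtmod.wtmod_reflect[OF w nil'] obtain nv' where w': "wtmod A sr cr br ch e f d \<tau> pj \<omega> a nv'"
   unfolding srf_srf bb by (elim exE)
  show ?thesis by (rule exI, rule exI, rule exI, rule conjI[OF w' nil])
 qed
qed

section \<open>Heisenberg operators\<close>

text \<open>A slice \<open>g\<close> is a vector of the full dual of a Fock space: \<open>g w\<close> is the vacuum component of the
 product of annihilation operators \<open>\<alpha>\<^sub>i(n + 1)\<close> over the letters \<open>(i, n)\<close> of \<open>w\<close> applied to it.\<close>

type_synonym 'i slice = "('i \<times> nat) list => complex"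

definition del :: "'i => nat => 'i slice => 'i slice" where "del i n g w = g ((i, n) # w)"

text \<open>\<open>phi s i k\<close> is the coefficient of \<open>x\<^sup>k\<close> in \<open>exp (- s \<Sum>\<^sub>n \<alpha>\<^sub>i(n) x\<^sup>n / n)\<close>.\<close>

fun phi :: "int => 'i => nat => 'i slice => 'i slice" where "phi s i 0 g = g"
| "phi s i (Suc k) g = (- of_int s / of_nat (Suc k)) *. (SUM n<=k. del i n (phi s i (k - n) g))"

declare phi.simps(2) [simp del] plus_fun_apply [simp del] scaleC_fun_apply [simp del] uminus_apply [simp del]

definition ph :: "int => 'i => int => 'i slice => 'i slice" where "ph s i k g = (if k < 0 then 0 else phi s i (nat k) g)"

text \<open>Encodes that the annihilation operators commute.\<close>

definition symm :: "'i slice => bool" where "symm g \<longleftrightarrow> (ALL u x y v. g (u @ x # y # v) = g (u @ y # x # v))"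

lemma del_lin: "clinear (del i n)" by (rule clinearI) (simp_all add: del_def fun_eq_iff plus_fun_apply scaleC_fun_apply)

lemmas dels = clinear_simps[OF del_lin]

lemma phi_Suc: "of_nat (Suc k) *. phi s i (Suc k) g = of_int (- s) *. (SUM n<=k. del i n (phi s i (k - n) g))"
 by (simp add: phi.simps(2) scaleC_scaleC del: of_nat_Suc)

lemma phi_lin: "clinear (phi s i k)"
proof (induction k rule: less_induct)
 case (less k)
 show ?case proof (cases k)
  case 0 then show ?thesis by (intro clinearI) simp_all
 next case (Suc m)
  have l: "clinear (%g. del i n (phi s i (m - n) g))" for n by (rule clinear_compose[OF del_lin]) (rule less, simp add: Suc)
  show ?thesis unfolding Suc
   by (rule clinearI) (simp_all only: phi.simps(2) clinear_add[OF l] clinear_scale[OF l] sum.distrib scaleC_add_right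
     cvec.scale_sum_right[symmetric] cvec.scale_left_commute)
 qed
qed

lemmas phis = clinear_simps[OF phi_lin]

lemma ph_lin: "clinear (ph s i k)" unfolding ph_def using phi_lin by (auto intro!: clinearI simp: phis)

lemma subspace_symm: "cvec.subspace {g. symm g}" by (rule cvec.subspaceI) (simp_all add: symm_def plus_fun_apply scaleC_fun_apply)

lemma symm_del: "symm g ==> symm (del i n g)" unfolding symm_def del_def by (metis append_Cons)

lemma del_del: "symm g ==> del i n (del j m g) = del j m (del i n g)" unfolding symm_def del_def fun_eq_iff by (metis append_Nil)

lemma symm_phi: "symm g ==> symm (phi s i k g)"
proof (induction k rule: less_induct)
 case (less k)
 show ?case proof (cases k)
  case (Suc m)
  have "(SUM n<=m. del i n (phi s i (m - n) g)) : {g. symm g}"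
   by (rule cvec.subspace_sum[OF subspace_symm]) (use less Suc in \<open>auto intro!: symm_del\<close>)
  from cvec.subspace_scale[OF subspace_symm this] show ?thesis unfolding Suc phi.simps(2) by (rule CollectD)
 qed (use less in simp)
qed

lemma del_phi: "symm g ==> del j l (phi s i k g) = phi s i k (del j l g)"
proof (induction k rule: less_induct)
 case (less k)
 show ?case proof (cases k)
  case (Suc m)
  have "del j l (del i n (phi s i (m - n) g)) = del i n (phi s i (m - n) (del j l g))" if "n <= m" for n
   using less.IH[of "m - n"] less.prems by (simp add: Suc del_del[OF symm_phi[OF less.prems], of j])
  then show ?thesis by (simp add: Suc phi.simps(2) dels)
 qed simp
qed

lemma phi_phi: "symm g ==> phi s i k (phi t j l g) = phi t j l (phi s i k g)"
proof (induction k rule: less_induct)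
 case (less k)
 show ?case proof (cases k)
  case (Suc m)
  have "del i n (phi s i (m - n) (phi t j l g)) = phi t j l (del i n (phi s i (m - n) g))" if "n <= m" for n
   using less.IH[of "m - n"] less.prems by (simp add: Suc del_phi[OF symm_phi])
  then show ?thesis by (simp add: Suc phi.simps(2) phis)
 qed simp
qed

lemma ph_ph: "symm g ==> ph s i k (ph t j l g) = ph t j l (ph s i k g)" by (simp add: ph_def phi_phi clinear_0[OF phi_lin])

lemma sum_triangle:
 fixes f :: "nat => nat => 'a::comm_monoid_add"
 shows "(SUM n<=k. SUM a<=k - n. f n a) = (SUM m<=k. SUM n<=m. f n (m - n))"
  and "(SUM n<=k. SUM a<=k - n. f n a) = (SUM a<=k. SUM n<=k - a. f n a)" by (simp_all add: sum.Sigma,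
   rule sum.reindex_bij_witness[where i = "%(m, n). (n, m - n)" and j = "%(n, a). (n + a, n)"], auto,
   rule sum.reindex_bij_witness[where i = "%(a, n). (n, a)" and j = "%(n, a). (a, n)"], auto)

text \<open>Write \<open>E(s)\<close> for the generating series of \<open>phi s i\<close>. The
  recursion \<open>phi_Suc\<close> says that \<open>x d/dx\<close> multiplies \<open>E(s)\<close> by
  minus \<open>s\<close> times the sum of the annihilation operators
  \<open>\<alpha>_i(n) x^n\<close>. The claims are the coefficients of
  \<open>E(1) E(- 1) = 1\<close> and of the logarithmic derivative of \<open>E(1)\<close>.\<close>

lemma phi_inverse:
 assumes g: "symm g"
 shows "(SUM b<=K. phi 1 i b (phi (- 1) i (K - b) g)) = (if K = 0 then g else 0)"
  and "(SUM b<=K. of_nat b *. phi 1 i b (phi (- 1) i (K - b) g)) = (if K = 0 then 0 else - del i (K - 1) g)"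
proof -
 let ?S = "%K. SUM b<=K. phi 1 i b (phi (- 1) i (K - b) g)"
 let ?D = "%k. SUM n<=k. del i n (?S (k - n))"
 have T: "(SUM b<=Suc k. of_nat b *. phi 1 i b (phi (- 1) i (Suc k - b) g)) = - ?D k" for k proof -
  have "(SUM b<=Suc k. of_nat b *. phi 1 i b (phi (- 1) i (Suc k - b) g))
   = (SUM b<=k. of_nat (Suc b) *. phi 1 i (Suc b) (phi (- 1) i (k - b) g))" unfolding sum.atMost_Suc_shift by (simp del: of_nat_Suc)
  also have "... = - (SUM b<=k. SUM n<=b. del i n (phi 1 i (b - n) (phi (- 1) i (k - b) g)))"
   unfolding phi_Suc by (simp add: sum_negf)
  also have "(SUM b<=k. SUM n<=b. del i n (phi 1 i (b - n) (phi (- 1) i (k - b) g)))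
   = (SUM n<=k. SUM a<=k - n. del i n (phi 1 i a (phi (- 1) i (k - n - a) g)))"
   unfolding sum_triangle(1) by (intro sum.cong refl) simp
  finally show ?thesis by (simp add: dels)
 qed
 have T': "(SUM b<=Suc k. of_nat (Suc k - b) *. phi 1 i b (phi (- 1) i (Suc k - b) g)) = ?D k" for k proof -
  have "(SUM b<=Suc k. of_nat (Suc k - b) *. phi 1 i b (phi (- 1) i (Suc k - b) g))
   = (SUM b<=k. phi 1 i b (of_nat (Suc (k - b)) *. phi (- 1) i (Suc (k - b)) g))"
   by (simp add: phis Suc_diff_le del: of_nat_Suc of_nat_diff)
  also have "... = (SUM b<=k. SUM n<=k - b. del i n (phi 1 i b (phi (- 1) i (k - n - b) g)))"
   unfolding phi_Suc by (intro sum.cong refl) (simp add: phis del_phi[OF symm_phi[OF g]] add.commute)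
  also have "... = ?D k" by (subst sum_triangle(2)) (simp add: dels)
  finally show ?thesis .
 qed
 show S: "?S K = (if K = 0 then g else 0)" for K proof (cases K)
  case (Suc k)
  have "of_nat (Suc k) *. ?S (Suc k) = (SUM b<=Suc k. of_nat b *. phi 1 i b (phi (- 1) i (Suc k - b) g))
   + (SUM b<=Suc k. of_nat (Suc k - b) *. phi 1 i b (phi (- 1) i (Suc k - b) g))"
   unfolding sum.distrib[symmetric] cvec.scale_sum_right scaleC_add_left[symmetric] of_nat_add[symmetric]
   by (intro sum.cong refl) simp
  then have "of_nat (Suc k) *. ?S (Suc k) = 0" unfolding T T' by simp
  then show ?thesis using Suc by (simp del: of_nat_Suc)
 qed simp
 show "(SUM b<=K. of_nat b *. phi 1 i b (phi (- 1) i (K - b) g)) = (if K = 0 then 0 else - del i (K - 1) g)" proof (cases K)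
  case (Suc k)
  have "?D k = (SUM n<=k. if n = k then del i k g else 0)" unfolding S by (intro sum.cong refl) (auto simp: dels)
  then show ?thesis unfolding Suc T by simp
 qed simp
qed

text \<open>The coefficient of \<open>x^a\<close> in \<open>(1 - x)^p\<close>, the factor that
  arises when two vertex operators are reordered.\<close>

definition cf :: "int => nat => complex" where "cf p a = (- 1) ^ a * (of_int p gchoose a)"

lemma cf_Suc: "of_nat (Suc a) * cf p (Suc a) = - of_int p * (SUM m<=a. cf p m)"
proof -
 have "(SUM m<=a. cf p m) = (- 1) ^ a * (of_int p - 1 gchoose a)"
  using gbinomial_sum_lower_neg[of "of_int p :: complex" a] by (simp add: cf_def mult.commute)
 then show ?thesis using gbinomial_absorption[of a "of_int p :: complex"] by (simp add: cf_def del: of_nat_Suc)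
qed

definition cfi :: "int => int => complex" where "cfi p x = (if x < 0 then 0 else cf p (nat x))"

text \<open>For nonnegative \<open>p\<close> the power \<open>(1 - x)^p\<close> is a polynomial that
  equals its reversal up to sign.\<close>

lemma cfi_flip: "0 <= p ==> cfi p (p - x) = (- 1) ^ nat p * cfi p x"
proof -
 assume "0 <= p"
 then obtain q where p: "p = int q" by (metis nonneg_int_cases)
 have b: "cf (int q) a = (- 1) ^ a * of_nat (q choose a)" for a by (simp add: cf_def binomial_gbinomial)
 show ?thesis proof (cases "0 <= x & x <= p")
  case True
  then obtain a where a: "x = int a" by (metis nonneg_int_cases)
  have aq: "a <= q" using True by (simp add: a p)
  have "nat (p - x) = q - a" by (simp add: a p)
  moreover have "(- 1 :: complex) ^ (q - a) = (- 1) ^ q * (- 1) ^ a" using aq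
   by (metis (no_types, lifting) power_add le_add_diff_inverse2 mult.assoc mult.right_neutral power_mult_distrib mult_minus1_right minus_minus power_one)
  ultimately show ?thesis using True by (simp add: cfi_def b a p binomial_symmetric[OF aq, symmetric])
 qed (auto simp: cfi_def b p)
qed

text \<open>The expansions of \<open>(1 - x)^(- 2)\<close> at 0 and at infinity differ by the
  derivative of the formal delta function, whose coefficients stand on the right.\<close>

lemma cfi_minus_2: "cfi (- 2) x - cfi (- 2) (- 2 - x) = of_int (x + 1)"
proof -
 have cf2: "cf (- 2) a = of_nat a + 1" for a proof -
  have "cf (- 2) a = (of_nat (a + 1) gchoose a)" using gbinomial_minus[of "2 :: complex" a]
   by (simp add: cf_def algebra_simps mult.assoc[symmetric] power_mult_distrib[symmetric])
  also have "... = of_nat ((a + 1) choose a)" by (simp only: binomial_gbinomial)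
  finally show ?thesis by simp
 qed
 consider "0 <= x" | "x = - 1" | "x <= - 2" by linarith
 then show ?thesis by cases (simp_all add: cfi_def cf2)
qed

section \<open>The lattice vertex representation\<close>

locale fock = km A sr cr br ch e f d for A :: "'i::finite => 'i => int" and sr :: "'i => 'h::complex_vector => complex" and cr
  and br :: "'g::complex_vector => 'g => 'g" and ch e f d +
 fixes \<omega> :: "'h => complex" and a :: "'i => int"
 assumes d1: "!!i. d i = 1" and \<omega>_lin: "clinear \<omega>" and \<omega>_cr: "!!i. \<omega> (cr i) = of_int (a i)"
begin

lemma A_sym: "A i j = A j i" using d_sym[of i j] by (simp add: d1)

text \<open>\<open>X s i k\<close> is the zero mode of the vertex operator of \<open>s \<alpha>\<^sub>i\<close> on a slice of the lattice on which
 its vacuum component is \<open>ph s i k\<close>; the recursion expresses the commutator with \<open>\<alpha>\<^sub>j(n + 1)\<close>.\<close>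

fun X :: "int => 'i => int => 'i slice => 'i slice" where "X s i k g [] = ph s i k g []"
| "X s i k g (x # w) = X s i k (del (fst x) (snd x) g) w + of_int (s * A i (fst x)) * X s i (k + int (snd x) + 1) g w"

lemma X_lin: "clinear (X s i k)"
proof (rule clinearI)
 show "X s i k (g + g') = X s i k g + X s i k g'" for g g' proof
  fix w show "X s i k (g + g') w = (X s i k g + X s i k g') w"
   by (induction w arbitrary: k g g') (simp_all add: clinear_add[OF ph_lin] dels plus_fun_apply algebra_simps)
 qed
 show "X s i k (c *. g) = c *. X s i k g" for c g proof
  fix w show "X s i k (c *. g) w = (c *. X s i k g) w"
   by (induction w arbitrary: k g) (simp_all add: clinear_scale[OF ph_lin] dels scaleC_fun_apply algebra_simps)
 qed
qed

lemmas Xs = clinear_simps[OF X_lin]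

lemma del_X: "del j n (X s i k g) = X s i k (del j n g) + of_int (s * A i j) *. X s i (k + int n + 1) g"
 by (simp add: del_def fun_eq_iff plus_fun_apply scaleC_fun_apply)

lemma symm_X: "symm g ==> symm (X s i k g)" unfolding symm_def[of "X s i k g"]
proof (intro allI)
 fix u x y v assume "symm g"
 then show "X s i k g (u @ x # y # v) = X s i k g (u @ y # x # v)" proof (induction u arbitrary: k g)
  case Nil
  have c: "k + int (snd x) + 1 + int (snd y) + 1 = k + int (snd y) + 1 + int (snd x) + 1" by simp
  show ?case unfolding append_Nil X.simps(2) del_del[OF Nil, of "fst x" "snd x"] c by (simp add: algebra_simps)
 qed (simp add: symm_del)
qed

text \<open>The exponential of annihilation operators passes a vertex operator at the cost of the
  factor \<open>(1 - x)^(s t A i j)\<close>, where \<open>x\<close> also raises the index of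
  \<open>X\<close>. The recursion for \<open>phi\<close> splits into \<open>1\<close> and
  \<open>2\<close>, the two terms of a product rule, with weights \<open>Suc m - b\<close> and
  \<open>b\<close>.\<close>

lemma phi_X:
 assumes g: "symm g"
 shows "phi s i k (X t j l g) = (SUM b<=k. cf (s * t * A i j) b *. X t j (l + int b) (phi s i (k - b) g))"
proof (induction k rule: less_induct)
 case (less k)
 let ?p = "s * t * A i j"
 let ?c = "cf ?p"
 show ?case proof (cases k)
  case (Suc m)
  have IH: "del i n (phi s i (m - n) (X t j l g)) = (SUM b<=m - n. ?c b *. X t j (l + int b) (del i n (phi s i (m - n - b) g)))
   + (SUM b<=m - n. (of_int (t * A i j) * ?c b) *. X t j (l + int b + int n + 1) (phi s i (m - n - b) g))" for n
   using less[of "m - n"] Suc by (simp add: dels del_X scaleC_add_right sum.distrib scaleC_scaleC A_sym[of j i] mult.commute)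
  have 1: "of_int (- s) *. (SUM n<=m. SUM b<=m - n. ?c b *. X t j (l + int b) (del i n (phi s i (m - n - b) g)))
   = (SUM b<=Suc m. (of_nat (Suc m - b) * ?c b) *. X t j (l + int b) (phi s i (Suc m - b) g))" proof -
   have "(SUM n<=m - b. ?c b *. X t j (l + int b) (del i n (phi s i (m - n - b) g)))
    = ?c b *. X t j (l + int b) (SUM n<=m - b. del i n (phi s i (m - b - n) g))" for b
    by (simp add: Xs cvec.scale_sum_right add.commute)
   note inner = this
   have "of_int (- s) *. (SUM n<=m. SUM b<=m - n. ?c b *. X t j (l + int b) (del i n (phi s i (m - n - b) g)))
    = of_int (- s) *. (SUM b<=m. ?c b *. X t j (l + int b) (SUM n<=m - b. del i n (phi s i (m - b - n) g)))"
    by (subst sum_triangle(2)) (simp only: inner)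
   also have "... = (SUM b<=m. ?c b *. X t j (l + int b) (of_int (- s) *. (SUM n<=m - b. del i n (phi s i (m - b - n) g))))"
    unfolding cvec.scale_sum_right[of _ _ "{..m}"]
    by (intro sum.cong refl) (simp only: clinear_scale[OF X_lin] cvec.scale_left_commute)
   also have "... = (SUM b<=m. (of_nat (Suc m - b) * ?c b) *. X t j (l + int b) (phi s i (Suc m - b) g))"
    unfolding phi_Suc[symmetric] by (intro sum.cong refl) (simp add: Xs scaleC_scaleC Suc_diff_le mult.commute del: of_nat_Suc)
   finally show ?thesis by simp
  qed
  have 2: "of_int (- s) *. (SUM n<=m. SUM b<=m - n. (of_int (t * A i j) * ?c b) *. X t j (l + int b + int n + 1) (phi s i (m - n - b) g))
   = (SUM b<=Suc m. (of_nat b * ?c b) *. X t j (l + int b) (phi s i (Suc m - b) g))" proof -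
   have "of_int (- s) *. (SUM n<=q. (of_int (t * A i j) * ?c (q - n)) *. X t j (l + int (q - n) + int n + 1) (phi s i (m - n - (q - n)) g))
    = (of_nat (Suc q) * ?c (Suc q)) *. X t j (l + int (Suc q)) (phi s i (Suc m - Suc q) g)" if "q <= m" for q proof -
    have "(SUM n<=q. (of_int (t * A i j) * ?c (q - n)) *. X t j (l + int (q - n) + int n + 1) (phi s i (m - n - (q - n)) g))
     = (of_int (t * A i j) * (SUM n<=q. ?c (q - n))) *. X t j (l + int (Suc q)) (phi s i (m - q) g)"
     unfolding sum_distrib_left cvec.scale_sum_left by (intro sum.cong refl) (simp add: algebra_simps)
    also have "(SUM n<=q. ?c (q - n)) = (SUM n<=q. ?c n)"
     by (rule sum.reindex_bij_witness[where i = "%n. q - n" and j = "%n. q - n"]) auto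
    finally show ?thesis unfolding cf_Suc by (simp add: scaleC_scaleC mult_ac)
   qed
   then show ?thesis unfolding sum_triangle(1) cvec.scale_sum_right[of _ _ "{..m}"] sum.atMost_Suc_shift by simp
  qed
  have "of_nat (Suc m) *. phi s i (Suc m) (X t j l g)
   = (SUM b<=Suc m. (of_nat (Suc m - b) * ?c b) *. X t j (l + int b) (phi s i (Suc m - b) g))
   + (SUM b<=Suc m. (of_nat b * ?c b) *. X t j (l + int b) (phi s i (Suc m - b) g))"
   unfolding phi_Suc IH sum.distrib scaleC_add_right 1 2 ..
  also have "... = of_nat (Suc m) *. (SUM b<=Suc m. ?c b *. X t j (l + int b) (phi s i (Suc m - b) g))"
   unfolding sum.distrib[symmetric] cvec.scale_sum_right scaleC_add_left[symmetric] distrib_right[symmetric] of_nat_add[symmetric]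
   by (intro sum.cong refl) (simp add: scaleC_scaleC del: of_nat_Suc)
  finally show ?thesis unfolding Suc by (simp only: cvec.scale_cancel_left of_nat_eq_0_iff, simp)
 qed (simp add: cf_def)
qed

text \<open>Brings the vacuum component into a form in which the two orders of the operators involve
  the same products of \<open>ph\<close> and differ in the coefficients only.\<close>

lemma XX_Nil:
 assumes g: "symm g"
 shows "X s i k (X t j l g) [] = (SUM b:{0..k + l}. cfi (s * t * A i j) (k - b) * ph s i b (ph t j (k + l - b) g) [])"
proof (cases "k < 0")
 case True
 have "(SUM b:{0..k + l}. cfi (s * t * A i j) (k - b) * ph s i b (ph t j (k + l - b) g) []) = 0"
  by (rule sum.neutral) (use True in \<open>auto simp: cfi_def\<close>)
 then show ?thesis using True by (simp add: ph_def)
next case False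
 let ?G = "%b. cfi (s * t * A i j) (k - b) * ph s i b (ph t j (k + l - b) g) []"
 have "X s i k (X t j l g) [] = (SUM b<=nat k. ?G (k - int b))"
  using False by (auto simp: ph_def[of s i k] phi_X[OF g] sum_fun_apply scaleC_fun_apply cfi_def ph_ph[OF g, of s i] ph_def[of s i "k - int _"] nat_diff_distrib
    intro!: sum.cong)
 also have "... = (SUM b:{0..k}. ?G b)"
  by (rule sum.reindex_bij_witness[where i = "%b. nat (k - b)" and j = "%b. k - int b"]) (use False in auto)
 also have "... = (SUM b:{0..k} \<inter> {0..k + l}. ?G b)"
  by (rule sum.mono_neutral_right) (auto simp: ph_def[of t] clinear_0[OF ph_lin])
 also have "... = (SUM b:{0..k + l}. ?G b)" by (rule sum.mono_neutral_left) (auto simp: cfi_def)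
 finally show ?thesis .
qed

lemma XX_swapped:
 assumes g: "symm g"
 shows "X t j l (X s i k g) [] = (SUM b:{0..k + l}. cfi (s * t * A i j) (b - k) * ph s i b (ph t j (k + l - b) g) [])"
 unfolding XX_Nil[OF g] by (rule sum.reindex_bij_witness[where i = "%b. k + l - b" and j = "%b. k + l - b"])
  (auto simp: ph_ph[OF g, of t] A_sym[of j i] algebra_simps)

text \<open>The reordering power is \<open>- A i j\<close>, which is nonnegative, so
  \<open>cfi_flip\<close> settles the vacuum component. The other components follow because
  annihilation operators act alike on both sides.\<close>

lemma XX_neq:
 assumes ij: "i ~= j"
 shows "symm g ==> X 1 i k (X (- 1) j l g) w = (- 1) ^ nat (- A i j) * X (- 1) j (l - A i j) (X 1 i (k + A i j) g) w"
proof (induction w arbitrary: k l g)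
 case Nil
 have "cfi (- A i j) (b - (k + A i j)) = (- 1) ^ nat (- A i j) * cfi (- A i j) (k - b)" for b
  using cfi_flip[of "- A i j" "k - b"] A_off[OF ij] by (simp add: algebra_simps)
 then have "cfi (- A i j) (k - b) = (- 1) ^ nat (- A i j) * cfi (- A i j) (b - (k + A i j))" for b
  by (simp add: mult.assoc[symmetric] power_mult_distrib[symmetric])
 then show ?case 
  unfolding XX_Nil[OF Nil, of 1 i k "- 1" j l] XX_swapped[OF Nil, of "- 1" j "l - A i j" 1 i "k + A i j"] sum_distrib_left
  by (simp add: mult.assoc)
next case (Cons x w)
 have c: "k + int (snd x) + 1 + A i j = k + A i j + int (snd x) + 1" "l + int (snd x) + 1 - A i j = l - A i j + int (snd x) + 1" by simp_all
 show ?case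
  unfolding X.simps(2) del_X Xs plus_fun_apply scaleC_fun_apply Cons.IH[OF symm_del[OF Cons.prems]] Cons.IH[OF Cons.prems] c
  by (simp add: algebra_simps)
qed

text \<open>The reordering power is \<open>- 2\<close>, so the orders differ by the coefficients of
  \<open>cfi_minus_2\<close>, and \<open>phi_inverse\<close> evaluates the sum. Only total index 0,
  with its scalar, enters the representation; positive totals arise in the induction.\<close>

lemma XX_eq: "symm g ==> 0 <= k + l ==> X 1 i k (X (- 1) i l g) w - X (- 1) i (l - 2) (X 1 i (k + 2) g) w
  = (if k + l = 0 then of_int (k + 1) * g w else del i (nat (k + l - 1)) g w)"
proof (induction w arbitrary: k l g)
 case Nil
 note g = Nil(1)
 let ?G = "%b. ph 1 i b (ph (- 1) i (k + l - b) g) []"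
 obtain K where K: "k + l = int K" using Nil(2) by (metis nonneg_int_cases)
 have "X 1 i k (X (- 1) i l g) [] - X (- 1) i (l - 2) (X 1 i (k + 2) g) []
  = (SUM b:{0..k + l}. (cfi (- 2) (k - b) - cfi (- 2) (- 2 - (k - b))) * ?G b)" 
  unfolding XX_Nil[OF g, of 1 i k "- 1" i l] XX_swapped[OF g, of "- 1" i "l - 2" 1 i "k + 2"]
  by (simp add: A_diag sum_subtractf[symmetric] algebra_simps)
 also have "... = (SUM b:{0..k + l}. of_int (k - b + 1) * ?G b)" unfolding cfi_minus_2 ..
 also have "... = (SUM b<=K. of_int (k - int b + 1) * phi 1 i b (phi (- 1) i (K - b) g) [])"
  by (rule sum.reindex_bij_witness[where i = int and j = nat]) (auto simp: K ph_def nat_diff_distrib)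
 also have "... = of_int (k + 1) * (SUM b<=K. phi 1 i b (phi (- 1) i (K - b) g)) []
  - (SUM b<=K. of_nat b *. phi 1 i b (phi (- 1) i (K - b) g)) []"
  by (simp add: sum_fun_apply scaleC_fun_apply sum_distrib_left sum_subtractf[symmetric] algebra_simps)
 finally show ?case unfolding phi_inverse[OF g] by (auto simp: K nat_diff_distrib uminus_apply)
next case (Cons x w)
 let ?n = "int (snd x)"
 have c: "k + ?n + 1 + 2 = k + 2 + ?n + 1" "l + ?n + 1 - 2 = l - 2 + ?n + 1" by simp_all
 note 1 = Cons.IH[OF symm_del[OF Cons.prems(1)] Cons.prems(2), of "fst x" "snd x"]
 have 2: "X 1 i (k + ?n + 1) (X (- 1) i l g) w - X (- 1) i (l - 2) (X 1 i (k + 2 + ?n + 1) g) w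
  = del i (nat (k + l + ?n)) g w" using Cons.IH[OF Cons.prems(1), of "k + ?n + 1" l] Cons.prems(2) unfolding c by (simp add: algebra_simps)
 have 3: "X 1 i k (X (- 1) i (l + ?n + 1) g) w - X (- 1) i (l - 2 + ?n + 1) (X 1 i (k + 2) g) w
  = del i (nat (k + l + ?n)) g w" using Cons.IH[OF Cons.prems(1), of k "l + ?n + 1"] Cons.prems(2) unfolding c by (simp add: algebra_simps)
 have "X 1 i k (X (- 1) i l g) (x # w) - X (- 1) i (l - 2) (X 1 i (k + 2) g) (x # w)
  = (X 1 i k (X (- 1) i l (del (fst x) (snd x) g)) w - X (- 1) i (l - 2) (X 1 i (k + 2) (del (fst x) (snd x) g)) w)
  + of_int (A i (fst x)) * (X 1 i (k + ?n + 1) (X (- 1) i l g) w - X (- 1) i (l - 2) (X 1 i (k + 2 + ?n + 1) g) w)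
  - of_int (A i (fst x)) * (X 1 i k (X (- 1) i (l + ?n + 1) g) w - X (- 1) i (l - 2 + ?n + 1) (X 1 i (k + 2) g) w)"
  unfolding X.simps(2) del_X Xs plus_fun_apply scaleC_fun_apply by (simp add: algebra_simps)
 also have "... = (if k + l = 0 then of_int (k + 1) * g (x # w) else del i (nat (k + l - 1)) g (x # w))" proof -
  have "del i n (del (fst x) (snd x) g) w = del i n g (x # w)" for n
   unfolding del_del[OF Cons.prems(1), of i n "fst x" "snd x"] by (simp add: del_def[of "fst x"])
  then show ?thesis unfolding 1 2 3 by (simp add: del_def[of "fst x"])
 qed
 finally show ?case .
qed

end

context fock
begin

lemma ph_degree:
 assumes g: "!!w. g w ~= 0 ==> (\<Sum>x\<leftarrow>w. int (snd x) + 1) = c"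
 shows "ph s i k g w ~= 0 ==> (\<Sum>x\<leftarrow>w. int (snd x) + 1) = c - k"
proof -
 have "phi s i m g w ~= 0 ==> (\<Sum>x\<leftarrow>w. int (snd x) + 1) = c - int m" for m
 proof (induction m arbitrary: w rule: less_induct)
  case (less m)
  show ?case proof (cases m)
   case (Suc q)
   have "(SUM n<=q. del i n (phi s i (q - n) g) w) ~= 0"
    using less.prems by (auto simp: Suc phi.simps(2) scaleC_fun_apply uminus_apply sum_fun_apply)
   then obtain n where n: "n <= q" "phi s i (q - n) g ((i, n) # w) ~= 0"
    by (rule sum.not_neutral_contains_not_neutral) (simp add: del_def)
   have "q - n < m" using Suc by simp
   from less.IH[OF this n(2)] n(1) show ?thesis by (simp add: Suc)
  qed (use g less.prems in simp)
 qed
 then show "ph s i k g w ~= 0 ==> (\<Sum>x\<leftarrow>w. int (snd x) + 1) = c - k" by (force simp: ph_def split: if_splits)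
qed

lemma X_degree:
 assumes "!!w. g w ~= 0 ==> (\<Sum>x\<leftarrow>w. int (snd x) + 1) = c"
 shows "X s i k g w ~= 0 ==> (\<Sum>x\<leftarrow>w. int (snd x) + 1) = c - k" using assms
proof (induction w arbitrary: k g c)
 case Nil
 from ph_degree[where w = "[]" and g = g and c = c and s = s and i = i and k = k, OF Nil(2)] Nil(1) show ?case by simp
next case (Cons x w)
 from Cons.prems(1) have "X s i (k + int (snd x) + 1) g w = 0 ==> X s i k (del (fst x) (snd x) g) w ~= 0" by auto
 then consider "X s i k (del (fst x) (snd x) g) w ~= 0" | "X s i (k + int (snd x) + 1) g w ~= 0" by blast
 then show ?case proof cases
  case 1
  have "(\<Sum>x\<leftarrow>w'. int (snd x) + 1) = c - (int (snd x) + 1)" if "del (fst x) (snd x) g w' ~= 0" for w'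
   using Cons.prems(2)[of "x # w'"] that by (simp add: del_def)
  from Cons.IH[OF 1 this] show ?thesis by simp
 next case 2
  from Cons.IH[OF this Cons.prems(2)] show ?thesis by simp
 qed
qed

definition rk :: "'i => nat" where "rk = (SOME r. inj r)"

lemma rk_inj: "inj rk"
proof -
 obtain r :: "'i => nat" where "inj r" using finite_imp_inj_to_nat_seg[OF finite_class.finite_UNIV] by blast
 then show ?thesis unfolding rk_def by (rule someI[of inj])
qed

text \<open>The cocycle: ordering the indices by \<open>rk\<close> produces a sign for odd
  \<open>A i j\<close> in exactly one of the two orders, and this cancels the sign in
  \<open>XX_neq\<close>.\<close>

definition sg :: "'i => ('i => int) => complex"
 where "sg i z = (\<Prod>j\<in>UNIV. if odd (z j) & odd (A i j) & rk i < rk j then - 1 else 1)"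

lemma sg_square: "sg i z * sg i z = 1" unfolding sg_def prod.distrib[symmetric] by (rule prod.neutral) auto

lemma sg_shift:
 assumes s: "odd s"
 shows "sg i (z + sh s j) = sg i z * (if odd (A i j) & rk i < rk j then - 1 else 1)"
proof -
 have "sg i (z + sh s j) = (\<Prod>k\<in>UNIV. (if odd (z k) & odd (A i k) & rk i < rk k then - 1 else 1) *
   (if k = j then if odd (A i j) & rk i < rk j then - 1 else 1 else 1))"
  unfolding sg_def by (rule prod.cong) (use s in \<open>auto simp: sh_def plus_fun_apply\<close>)
 then show ?thesis by (simp add: prod.distrib sg_def)
qed

text \<open>The value at \<open>z\<close> comes from the lattice point \<open>z\<close> minus
  \<open>s\<close> times the simple root \<open>i\<close>, and the index is the one that conserves
  the sum of half of \<open>qfn\<close> and the degree.\<close>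

definition V :: "int => 'i => (('i => int) => 'i slice) => ('i => int) => 'i slice"
 where "V s i \<xi> z = sg i z *. X s i (s * (a i + pr z i) - 1) (\<xi> (z + sh (- s) i))"

definition H :: "'h => (('i => int) => 'i slice) => ('i => int) => 'i slice" where "H h \<xi> z = (\<omega> h + wt z h) *. \<xi> z"

text \<open>The states of energy \<open>|\<omega>|^2 / 2\<close>, supported on finitely many lattice
  points. As the degree of a word is nonnegative, a nonzero slice at \<open>z\<close> requires
  \<open>qfn a z <= 0\<close>, which is the norm bound.\<close>

definition T :: "(('i => int) => 'i slice) set" where "T = {\<xi>. (ALL z. symm (\<xi> z)) & finite {z. \<xi> z ~= 0} \<and>
  (ALL z w. \<xi> z w ~= 0 --> 2 * real_of_int (\<Sum>x\<leftarrow>w. int (snd x) + 1) = - qfn a z)}"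

lemma V_lin: "clinear (V s i)"
 by (rule clinearI) (auto simp: V_def fun_eq_iff Xs scaleC_add_right plus_fun_apply scaleC_fun_apply cvec.scale_left_commute)

lemma H_bilinear: "cbilinear H"
 by (rule cbilinearI) (auto simp: H_def fun_eq_iff plus_fun_apply scaleC_fun_apply clinear_simps[OF \<omega>_lin] clinear_simps[OF clinear_wt] algebra_simps)

lemma subspace_T: "cvec.subspace T"
proof (rule cvec.subspaceI)
 show "0 : T" by (simp add: T_def symm_def)
 show "\<xi> + \<xi>2 : T" if "\<xi> : T" "\<xi>2 : T" for \<xi> \<xi>2 proof -
  have "finite {z. (\<xi> + \<xi>2) z ~= 0}"
   by (rule finite_subset[of _ "{z. \<xi> z ~= 0} \<union> {z. \<xi>2 z ~= 0}"]) (use that in \<open>auto simp: T_def plus_fun_apply\<close>)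
  moreover have "symm ((\<xi> + \<xi>2) z)" for z
   using cvec.subspace_add[OF subspace_symm, of "\<xi> z" "\<xi>2 z"] that by (simp add: T_def plus_fun_apply)
  moreover have "\<xi> z w ~= 0 | \<xi>2 z w ~= 0" if "(\<xi> + \<xi>2) z w ~= 0" for z w using that by (auto simp: plus_fun_apply)
  ultimately show ?thesis using that unfolding T_def by blast
 qed
 show "c *. \<xi> : T" if "\<xi> : T" for c \<xi> proof -
  have "finite {z. (c *. \<xi>) z ~= 0}"
   by (rule finite_subset[of _ "{z. \<xi> z ~= 0}"]) (use that in \<open>auto simp: T_def scaleC_fun_apply\<close>)
  moreover have "symm ((c *. \<xi>) z)" for z
   using cvec.subspace_scale[OF subspace_symm, of "\<xi> z" c] that by (simp add: T_def scaleC_fun_apply)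
  moreover have "\<xi> z w ~= 0" if "(c *. \<xi>) z w ~= 0" for z w using that by (auto simp: scaleC_fun_apply)
  ultimately show ?thesis using that unfolding T_def by blast
 qed
qed

lemma T_V:
 assumes \<xi>: "\<xi> : T" and s: "s = 1 | s = - 1"
 shows "V s i \<xi> : T"
proof -
 have sub: "{z. V s i \<xi> z ~= 0} \<subseteq> (%z. z + sh s i) ` {z. \<xi> z ~= 0}" proof
  fix z assume z: "z : {z. V s i \<xi> z ~= 0}"
  have "\<xi> (z + sh (- s) i) ~= 0" using z by (auto simp: V_def clinear_0[OF X_lin])
  moreover have "z = z + sh (- s) i + sh s i" by (auto simp: sh_def plus_fun_apply fun_eq_iff)
  ultimately show "z : (%z. z + sh s i) ` {z. \<xi> z ~= 0}" by blast
 qed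
 have "finite {z. V s i \<xi> z ~= 0}" by (rule finite_subset[OF sub]) (use \<xi> in \<open>simp add: T_def\<close>)
 moreover have "symm (V s i \<xi> z)" for z
  using cvec.subspace_scale[OF subspace_symm, of "X s i _ (\<xi> (z + sh (- s) i))" "sg i z"] symm_X \<xi> by (simp add: V_def T_def)
 moreover have "2 * real_of_int (\<Sum>x\<leftarrow>w. int (snd x) + 1) = - qfn a z" if w: "V s i \<xi> z w ~= 0" for z w proof -
  have X0: "X s i (s * (a i + pr z i) - 1) (\<xi> (z + sh (- s) i)) w ~= 0" using w by (auto simp: V_def scaleC_fun_apply)
  then have "\<xi> (z + sh (- s) i) ~= 0" by (auto simp: clinear_0[OF X_lin])
  then obtain u where u: "\<xi> (z + sh (- s) i) u ~= 0" by (auto simp: fun_eq_iff)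
  let ?c = "\<Sum>x\<leftarrow>u. int (snd x) + 1"
  have deg: "2 * real_of_int (\<Sum>x\<leftarrow>w. int (snd x) + 1) = - qfn a (z + sh (- s) i)" if "\<xi> (z + sh (- s) i) w ~= 0" for w
   using \<xi> that unfolding T_def by blast
  have "(\<Sum>x\<leftarrow>w. int (snd x) + 1) = ?c" if "\<xi> (z + sh (- s) i) w ~= 0" for w
   using deg[OF that] deg[OF u] by linarith
  from X_degree[OF this X0] have D: "(\<Sum>x\<leftarrow>w. int (snd x) + 1) = ?c - (s * (a i + pr z i) - 1)" .
  have q: "qfn a (z + sh (- s) i) = qfn a z - 2 * real_of_int (s * (a i + pr z i) - 1)"
   using s unfolding qf_shift by (auto simp: d1 algebra_simps)
  show ?thesis unfolding D of_int_diff[of ?c] right_diff_distrib deg[OF u] q by simp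
 qed
 ultimately show ?thesis unfolding T_def by blast
qed

lemma T_H: "\<xi> : T ==> H h \<xi> : T"
proof -
 assume \<xi>: "\<xi> : T"
 have "finite {z. H h \<xi> z ~= 0}" by (rule finite_subset[of _ "{z. \<xi> z ~= 0}"]) (use \<xi> in \<open>auto simp: T_def H_def\<close>)
 moreover have "symm (H h \<xi> z)" for z using cvec.subspace_scale[OF subspace_symm, of "\<xi> z"] \<xi> by (simp add: H_def T_def)
 moreover have "\<xi> z w ~= 0" if "H h \<xi> z w ~= 0" for z w using that by (auto simp: H_def scaleC_fun_apply)
 ultimately show ?thesis using \<xi> unfolding T_def by blast
qed

lemma V_H: "H h (V s i \<xi>) = V s i (H h \<xi>) + (of_int s * sr i h) *. V s i \<xi>"
 by (auto simp: fun_eq_iff H_def V_def Xs ad.wt_add wt_sh plus_fun_apply scaleC_fun_apply algebra_simps)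

text \<open>For \<open>i = j\<close> the scalar \<open>a i + pr z i\<close> of \<open>XX_eq\<close>
  is the action of the coroot; for distinct indices the sign of \<open>XX_neq\<close> cancels
  against the cocycle.\<close>

lemma V_V:
 assumes \<xi>: "\<xi> : T"
 shows "V 1 i (V (- 1) j \<xi>) = V (- 1) j (V 1 i \<xi>) + (if i = j then H (cr i) \<xi> else 0)"
proof (rule ext)
 fix z
 have sy: "symm (\<xi> z')" for z' using \<xi> by (simp add: T_def)
 have pm: "pr (z + sh (- 1) i) j = pr z j - A i j" "pr (z + sh 1 j) i = pr z i + A i j" by (simp_all add: pr_add pr_sh A_sym[of j i])
 have zz: "z + sh (- 1) i + sh 1 j = z + sh 1 j + sh (- 1) i" by (simp add: add_ac)
 let ?g = "\<xi> (z + sh 1 j + sh (- 1) i)" and ?k = "a i + pr z i - 1" and ?l = "- (a j + pr z j) - 1"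
 have L: "V 1 i (V (- 1) j \<xi>) z = (sg i z * sg j (z + sh (- 1) i)) *. X 1 i ?k (X (- 1) j (?l + A i j) ?g)"
  by (simp add: V_def Xs pm zz scaleC_scaleC algebra_simps)
 have R: "V (- 1) j (V 1 i \<xi>) z = (sg j z * sg i (z + sh 1 j)) *. X (- 1) j ?l (X 1 i (?k + A i j) ?g)"
  by (simp add: V_def Xs pm scaleC_scaleC algebra_simps)
 show "V 1 i (V (- 1) j \<xi>) z = (V (- 1) j (V 1 i \<xi>) + (if i = j then H (cr i) \<xi> else 0)) z" proof (cases "i = j")
  case True
  have s: "sg i z * sg i (z + sh s i) = 1" if "odd s" for s unfolding sg_shift[OF that] by (simp add: sg_square)
  have z: "z + sh 1 i + sh (- 1) i = z" by (auto simp: sh_def plus_fun_apply fun_eq_iff)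
  let ?k = "a i + pr z i - 1" and ?l = "- (a i + pr z i) - 1"
  have e: "X 1 i ?k (X (- 1) i (?l + 2) (\<xi> z)) - X (- 1) i ?l (X 1 i (?k + 2) (\<xi> z)) = of_int (a i + pr z i) *. \<xi> z"
   by (rule ext) (use XX_eq[OF sy[of z], of ?k "?l + 2" i] in \<open>simp add: scaleC_fun_apply\<close>)
  have so: "sg i z * sg i (z + sh (- 1) i) = 1" "sg i z * sg i (z + sh 1 i) = 1" by (simp_all add: s)
  have "V 1 i (V (- 1) i \<xi>) z = V (- 1) i (V 1 i \<xi>) z + of_int (a i + pr z i) *. \<xi> z"
   unfolding L[folded True] R[folded True] A_diag z so scaleC_one e[symmetric] by simp
  then show ?thesis unfolding True[symmetric] by (simp add: plus_fun_apply H_def \<omega>_cr wt_cr)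
 next case False
  have e: "X 1 i ?k (X (- 1) j (?l + A i j) ?g) = (- 1) ^ nat (- A i j) *. X (- 1) j ?l (X 1 i (?k + A i j) ?g)"
   by (rule ext) (use XX_neq[OF False sy, of ?k "?l + A i j"] in \<open>simp add: scaleC_fun_apply\<close>)
  have "sg j (z + sh (- 1) i) * (- 1) ^ nat (- A i j) * sg i z = sg i (z + sh 1 j) * sg j z" proof -
   have "rk i ~= rk j" using False rk_inj by (simp add: inj_eq)
   moreover have "(- 1 :: complex) ^ nat (- A i j) = (if odd (A i j) then - 1 else 1)"
    using A_off[OF False] by (simp add: even_nat_iff minus_one_power_iff)
   ultimately show ?thesis by (auto simp: sg_shift A_sym[of j i])
  qed
  then have "V 1 i (V (- 1) j \<xi>) z = V (- 1) j (V 1 i \<xi>) z" unfolding L R e by (simp add: scaleC_scaleC mult_ac)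
  then show ?thesis using False by (simp add: plus_fun_apply)
 qed
qed

text \<open>Moving the finite support far along a simple root makes the norm too large for the
  energy. At each support point, with coroot value \<open>t\<close> and norm difference
  \<open>y\<close>, the choice of \<open>N\<close> ensures \<open>N >= |t| + |y| + 1\<close>, so
  that \<open>y + 2 N (N + s t)\<close> is positive.\<close>

lemma V_nil: "\<xi> : T ==> s = 1 | s = - 1 ==> EX n. (V s i ^^ n) \<xi> = 0"
proof -
 assume \<xi>: "\<xi> : T" and s: "s = 1 | s = - 1"
 have pow: "(V s i ^^ n) \<xi> : T & (ALL z. (V s i ^^ n) \<xi> z ~= 0 --> \<xi> (z + sh (- s * int n) i) ~= 0)" for n
 proof (induction n)
  case 0
  have z: "z + sh (- s * int 0) i = z" for z by (auto simp: sh_def plus_fun_apply fun_eq_iff)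
  show ?case unfolding z funpow_0 using \<xi> by blast
 next case (Suc n)
  have "\<xi> (z + sh (- s * int (Suc n)) i) ~= 0" if "V s i ((V s i ^^ n) \<xi>) z ~= 0" for z proof -
   have "(V s i ^^ n) \<xi> (z + sh (- s) i) ~= 0" using that by (auto simp: V_def clinear_0[OF X_lin])
   then have ne: "\<xi> (z + sh (- s) i + sh (- s * int n) i) ~= 0" using Suc by blast
   have zz: "z + sh (- s) i + sh (- s * int n) i = z + sh (- s * int (Suc n)) i" by (auto simp: sh_def plus_fun_apply fun_eq_iff algebra_simps)
   from ne show ?thesis unfolding zz .
  qed
  moreover have "V s i ((V s i ^^ n) \<xi>) : T" using Suc T_V[OF _ s] by blast
  ultimately show ?case unfolding funpow.simps(2) comp_apply by blast
 qed
 have fin: "finite {z. \<xi> z ~= 0}" using \<xi> by (simp add: T_def)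
 define B where "B z = \<bar>a i + pr z i\<bar> + \<lceil>\<bar>qfn a z\<bar>\<rceil> + 1" for z
 have B0: "0 <= B z" for z by (simp add: B_def)
 define N where "N = nat (SUM z:{z. \<xi> z ~= 0}. B z)"
 have "(V s i ^^ N) \<xi> z = 0" for z proof (rule ccontr)
  assume z: "(V s i ^^ N) \<xi> z ~= 0"
  let ?z = "z + sh (- s * int N) i"
  define t y where "t = a i + pr ?z i" and "y = qfn a ?z"
  have zf: "?z : {z. \<xi> z ~= 0}" using pow z by simp
  have "B ?z <= (SUM z:{z. \<xi> z ~= 0}. B z)" by (rule member_le_sum[OF zf _ fin]) (rule B0)
  also have "... <= int N" by (simp add: N_def)
  finally have "\<bar>t\<bar> + \<lceil>\<bar>y\<bar>\<rceil> + 1 <= int N" unfolding B_def t_def y_def .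
  then have N: "real_of_int \<bar>t\<bar> + \<bar>y\<bar> + 1 <= N" by linarith
  obtain w where w: "(V s i ^^ N) \<xi> z w ~= 0" using z by (auto simp: fun_eq_iff)
  have "(V s i ^^ N) \<xi> : T" using pow by blast
  then have "2 * real_of_int (\<Sum>x\<leftarrow>w. int (snd x) + 1) = - qfn a z" using w unfolding T_def by blast
  moreover have "0 <= (\<Sum>x\<leftarrow>w. int (snd x) + 1)" by (rule sum_list_nonneg) auto
  ultimately have q0: "qfn a z <= 0" by linarith
  have zz: "?z + sh (s * int N) i = z" by (auto simp: sh_def plus_fun_apply fun_eq_iff)
  have "qfn a z = y + 2 * real_of_int (s * int N) * real_of_int (s * int N + t)"
   using qf_shift[of a ?z "s * int N" i, unfolded zz] d1[of i] by (simp add: t_def y_def add.assoc)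
  also have "... = y + 2 * (real N * (real N + s * t))" using s by (auto simp: algebra_simps)
  finally have q: "qfn a z = y + 2 * (real N * (real N + s * t))" .
  have "1 + \<bar>y\<bar> <= real N + s * t" using N s by auto
  moreover have "1 <= real N" using N by linarith
  ultimately have "1 * (1 + \<bar>y\<bar>) <= real N * (real N + s * t)" by (intro mult_mono) simp_all
  then obtain p where "1 + \<bar>y\<bar> <= p" "qfn a z = y + 2 * p" using q by simp
  then show False using q0 abs_ge_minus_self[of y] by simp
 qed
 then show ?thesis by (intro exI[of _ N]) (simp add: fun_eq_iff)
qed

lemma slice_decomp: "\<xi> : T ==> \<xi> = (SUM z:{z. \<xi> z ~= 0}. (%z'. if z' = z then \<xi> z else 0))"
 and slice_T: "\<xi> : T ==> (%z'. if z' = z then \<xi> z else 0) : T"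
proof -
 assume \<xi>: "\<xi> : T"
 then have fin: "finite {z. \<xi> z ~= 0}" by (simp add: T_def)
 show "\<xi> = (SUM z:{z. \<xi> z ~= 0}. (%z'. if z' = z then \<xi> z else 0))"
  by (rule ext) (simp add: sum_fun_apply sum.delta'[OF fin])
 have "finite {z'. (if z' = z then \<xi> z else 0) ~= 0}" by (rule finite_subset[of _ "{z}"]) (auto split: if_splits)
 then show "(%z'. if z' = z then \<xi> z else 0) : T" using \<xi> by (auto simp: T_def symm_def split: if_splits)
qed

lemma wtmod_symmetric:
 "\<exists>(\<tau> :: 'g => (('i => int) => 'i slice) => ('i => int) => 'i slice) pj nv. wtmod A sr cr br ch e f d \<tau> pj \<omega> a nv"
proof -
 have T0: "{0} \<subseteq> T" using cvec.subspace_0[OF subspace_T] by simp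
 obtain P where P: "clinear P" "!!x. P x : T" "!!x. P (P x) = P x" "!!x. x : T ==> x - P x : {0}" "!!x. x : {0} ==> P x = 0"
  by (rule projection_exists[OF cvec.subspace_single_0 subspace_T T0], rule that)
 have PT: "P x = x" if "x : T" for x using P(4)[OF that] by simp
 have PV: "P (V 1 i (P x)) = V 1 i (P x)" "P (V (- 1) i (P x)) = V (- 1) i (P x)" "P (H h (P x)) = H h (P x)" for i h x
  by (simp_all add: PT T_V T_H P(2))
 note Vl = clinear_simps[OF V_lin] and Hl = cbilinear_simps[OF H_bilinear] and Pl = clinear_simps[OF P(1)]
 have nil: "EX n. ((%x. V s i (P x)) ^^ n) x = 0" if s: "s = 1 | s = - 1" for s i x proof -
  have pow: "((%x. V s i (P x)) ^^ n) y = (V s i ^^ n) y & (V s i ^^ n) y : T" if "y : T" for n y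
   by (induction n) (simp_all add: that PT T_V[OF _ s])
  obtain n where "(V s i ^^ n) (V s i (P x)) = 0" using V_nil[OF T_V[OF P(2) s] s] by blast
  then have "((%x. V s i (P x)) ^^ n) (V s i (P x)) = 0" using pow[OF T_V[OF P(2) s]] by metis
  then show ?thesis by (intro exI[of _ "Suc n"]) (simp add: funpow_Suc_right del: funpow.simps)
 qed
 have eig: "H h (%z'. if z' = z then g else 0) = (\<omega> h + wt z h) *. (%z'. if z' = z then g else 0)" for h z g
  by (rule ext) (simp add: H_def scaleC_fun_apply)
 interpret q: gk A sr cr br ch e f d "%i x. V 1 i (P x)" "%i x. V (- 1) i (P x)" "%h x. H h (P x)"
 proof (intro gk.intro km_axioms intm.intro intm_axioms.intro chev.intro)
  show "clinear (%x. V 1 i (P x))" "clinear (%x. V (- 1) i (P x))" for i by (rule clinear_compose[OF V_lin P(1)])+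
  show "cbilinear (%h x. H h (P x))" by (rule cbilinearI) (simp_all add: Hl Pl)
  show "V 1 i (P (V (- 1) j (P y))) = V (- 1) j (P (V 1 i (P y))) + (if i = j then H (cr i) (P y) else 0)" for i j y
   unfolding PV by (rule V_V[OF P(2)])
  show "H h (P (V 1 i (P y))) = V 1 i (P (H h (P y))) + sr i h *. V 1 i (P y)"
   "H h (P (V (- 1) i (P y))) = V (- 1) i (P (H h (P y))) - sr i h *. V (- 1) i (P y)" for h i y unfolding PV V_H by simp_all
  show "H h (P (H h' (P y))) = H h' (P (H h (P y)))" for h h' y
   unfolding PV by (simp add: H_def fun_eq_iff scaleC_scaleC mult.commute)
  show "EX n. ((%x. V 1 i (P x)) ^^ n) v = 0" "EX n. ((%x. V (- 1) i (P x)) ^^ n) v = 0" for i v by (rule nil, simp)+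
  fix x
  let ?S = "{v. \<exists>\<mu>. (ALL h. H h (P v) = \<mu> h *. v) & (ALL i. \<exists>m::int. \<mu> (cr i) = of_int m)}"
  have "x - P x : cvec.span ?S" by (rule cvec.span_base) (auto simp: Pl P(3) Hl intro!: exI[of _ "%_. 0"] exI[of _ "0::int"])
  moreover have "(%z'. if z' = z then P x z else 0) : ?S" for z using slice_T[OF P(2), of z x] eig[of _ z "P x z"]
   by (auto simp: PT \<omega>_cr wt_cr intro!: exI[of _ "%h. \<omega> h + wt z h"] exI[of _ "a _ + pr z _"])
  then have "P x : cvec.span ?S" by (subst slice_decomp[OF P(2)]) (intro cvec.span_sum cvec.span_base)
  ultimately show "x : cvec.span ?S" using cvec.span_add[of "x - P x" ?S "P x"] by simp
 qed
 obtain \<rho> :: "'g => (('i => int) => 'i slice) => ('i => int) => 'i slice" where \<rho>: "lie_module br \<rho>"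
  "ALL i. \<rho> (e i) = (%x. V 1 i (P x))" "ALL i. \<rho> (f i) = (%x. V (- 1) i (P x))" "ALL h. \<rho> (ch h) = (%x. H h (P x))"
  using q.module_exists by (elim exE conjE)
 note \<rho>s = cbilinear_simps[OF lie_module_bilinear[OF \<rho>(1)]]
 have st: "ALL x. \<rho> g (P x) = \<rho> g x & P (\<rho> g x) = \<rho> g x" for g
  by (induction g rule: gen_induct) (simp_all add: \<rho> PV P(3) \<rho>s Pl lie_module_bracket[OF \<rho>(1)] del: minus_apply)
 define nv :: "('i => int) => 'i slice" where "nv z = (if z = 0 then (%w. if w = [] then 1 else 0) else 0)" for z
 have nvT: "nv : T" proof -
  have "finite {z. nv z ~= 0}" by (rule finite_subset[of _ "{0}"]) (auto simp: nv_def split: if_splits)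
  then show ?thesis by (auto simp: T_def nv_def symm_def qf_0 split: if_splits)
 qed
 have "wtmod A sr cr br ch e f d \<rho> P \<omega> a nv" proof (intro wtmod.intro wtmod_axioms.intro)
  show "P x : cvec.span (\<Union>z. {x. P x = x & (ALL h. \<rho> (ch h) x = (\<omega> h + wt z h) *. x)})" for x
  proof (subst slice_decomp[OF P(2)], intro cvec.span_sum cvec.span_base)
   fix z
   show "(%z'. if z' = z then P x z else 0) : (\<Union>z. {x. P x = x & (ALL h. \<rho> (ch h) x = (\<omega> h + wt z h) *. x)})"
    by (rule UN_I[of z]) (simp_all add: PT[OF slice_T[OF P(2)]] \<rho>(4) eig)
  qed
  show "x = 0" if q: "0 < qfn a z" and x: "P x = x" "!!h. \<rho> (ch h) x = (\<omega> h + wt z h) *. x" for z x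
  proof (rule ext, rule ext)
   fix z' w
   have xT: "x : T" using x(1) P(2) by metis
   show "x z' w = 0 z' w" proof (cases "z' = z")
    case True
    have "0 <= (\<Sum>x\<leftarrow>w. int (snd x) + 1)" by (rule sum_list_nonneg) auto
    moreover have "2 * real_of_int (\<Sum>x\<leftarrow>w. int (snd x) + 1) = - qfn a z" if "x z w ~= 0" using xT that unfolding T_def by blast
    ultimately have "x z w = 0" using q by (cases "x z w = 0") auto
    then show ?thesis using True by simp
   next case False
    then obtain h where h: "wt z' h ~= wt z h" using wt_inj unfolding inj_def by (metis ext)
    have "(\<omega> h + wt z' h) *. x z' w = (\<omega> h + wt z h) *. x z' w"
     using fun_cong[OF fun_cong[OF x(2)[of h], of z'], of w] by (simp add: \<rho>(4) x(1) H_def scaleC_fun_apply)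
    then show ?thesis using h by simp
   qed
  qed
  show "P nv = nv" by (rule PT[OF nvT])
  then show "\<rho> (ch h) nv = \<omega> h *. nv" for h by (auto simp: \<rho>(4) H_def nv_def fun_eq_iff scaleC_fun_apply ad.wt_def)
  show "nv ~= 0" by (auto simp: nv_def fun_eq_iff intro!: exI[of _ 0] exI[of _ "[]"])
 qed (use st in \<open>simp_all add: km_axioms \<rho>(1) \<omega>_cr P(1,3)\<close>)
 then show ?thesis by (intro exI)
qed

end

declare plus_fun_apply [simp] scaleC_fun_apply [simp] uminus_apply [simp]

section \<open>Submodules of tensor products and the theorem\<close>

lemma (in hwm) submodule_U: "submodule \<rho> U"
 unfolding submodule_def by (intro conjI allI ballI subspace_U submodule_gen[OF mod subspace_U U_E U_F U_H])

text \<open>By the Leibniz rule every application of the operator lowers one of the two remaining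
  exponents.\<close>

lemma tensor_pow_zero:
 assumes m: "lie_module br \<rho>" "lie_module br \<sigma>"
 shows "p + q <= N ==> (\<rho> g ^^ p) v = 0 ==> (\<sigma> g ^^ q) u = 0 ==> (tensor_act \<rho> \<sigma> g ^^ N) (v \<otimes> u) = 0"
proof (induction N arbitrary: p q v u)
 case 0 then show ?case using tensor_scale_left[of 0 0 u] by simp
next case (Suc N)
 have z: "(tensor_act \<rho> \<sigma> g ^^ n) 0 = 0" for n by (rule clinear_0[OF clinear_funpow[OF clinear_tensor_act[OF m]]])
 show ?case proof (cases "p = 0 | q = 0")
  case True
  then have "v \<otimes> u = 0" using Suc.prems tensor_scale_left[of 0 0 u] tensor_zero_right[of v] by auto
  then show ?thesis by (simp only: z)
 next case False
  then obtain p' q' where pq: "p = Suc p'" "q = Suc q'" by (metis not0_implies_Suc)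
  have 1: "(\<rho> g ^^ p') (\<rho> g v) = 0" "(\<sigma> g ^^ q') (\<sigma> g u) = 0"
   using Suc.prems(2,3) unfolding pq by (simp_all add: funpow_Suc_right del: funpow.simps)
  have "(tensor_act \<rho> \<sigma> g ^^ N) (\<rho> g v \<otimes> u) = 0" "(tensor_act \<rho> \<sigma> g ^^ N) (v \<otimes> \<sigma> g u) = 0"
   by (rule Suc.IH[OF _ 1(1) Suc.prems(3)], use Suc.prems(1) pq in simp)
    (rule Suc.IH[OF _ Suc.prems(2) 1(2)], use Suc.prems(1) pq in simp)
  then show ?thesis
   by (simp add: funpow_Suc_right tensor_act_pure[OF m] clinear_add[OF clinear_funpow[OF clinear_tensor_act[OF m]]] del: funpow.simps)
 qed
qed

lemma tensor_nilpotent: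
 assumes m: "lie_module br \<rho>" "lie_module br \<sigma>" and nil: "!!v. EX n. (\<rho> g ^^ n) v = 0" "!!u. EX n. (\<sigma> g ^^ n) u = 0"
 shows "EX n. (tensor_act \<rho> \<sigma> g ^^ n) t = 0"
proof -
 note lin = clinear_tensor_act[OF m]
 have sub: "cvec.subspace {t. EX n. (tensor_act \<rho> \<sigma> g ^^ n) t : {0}}"
  by (rule subspace_nil[OF lin cvec.subspace_single_0]) (simp add: clinear_0[OF lin])
 have "t : {t. EX n. (tensor_act \<rho> \<sigma> g ^^ n) t : {0}}" proof (induction t rule: tensor_induct)
  case (pure v u)
  obtain p q where "(\<rho> g ^^ p) v = 0" "(\<sigma> g ^^ q) u = 0" using nil by meson
  from tensor_pow_zero[OF m order_refl this] show ?case by blast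
 qed (rule cvec.subspace_add[OF sub] cvec.subspace_scale[OF sub], assumption+)+
 then show ?thesis by simp
qed

locale kma = km "gcm \<gg>" "simple_root \<gg>" "simple_coroot \<gg>" "bracket \<gg>" "cartan \<gg>" "gen_e \<gg>" "gen_f \<gg>" d
 for \<gg> :: "('i::finite, 'h::complex_vector, 'g::complex_vector) kac_moody" and d
begin

lemma wt_up_cone: "wt (up n) : positive_cone \<gg>"
 unfolding positive_cone_def by (auto simp: ad.wt_def sum_fun_apply fun_eq_iff intro!: exI[of _ n])

text \<open>The spaces \<open>D n\<close>, spanned by products of words of total content
  \<open>n\<close>, are finite-dimensional, have distinct weights below the sum of the top weights,
  and contain the weight spaces of every submodule.\<close>

lemma tensor_integrable_O:
 assumes V: "hw_gen (gcm \<gg>) (simple_root \<gg>) (simple_coroot \<gg>) (bracket \<gg>) (cartan \<gg>) (gen_e \<gg>) (gen_f \<gg>) d \<rho> v \<Lambda> l"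
  and U: "hw_gen (gcm \<gg>) (simple_root \<gg>) (simple_coroot \<gg>) (bracket \<gg>) (cartan \<gg>) (gen_e \<gg>) (gen_f \<gg>) d \<sigma> u \<mu> k"
  and S: "submodule (tensor_act \<rho> \<sigma>) S"
 shows "integrable_module \<gg> (tensor_act \<rho> \<sigma>) S & category_O \<gg> (tensor_act \<rho> \<sigma>) S"
proof -
 interpret V: hw_gen "gcm \<gg>" "simple_root \<gg>" "simple_coroot \<gg>" "bracket \<gg>" "cartan \<gg>" "gen_e \<gg>" "gen_f \<gg>" d \<rho> v \<Lambda> l by (rule V)
 interpret U: hw_gen "gcm \<gg>" "simple_root \<gg>" "simple_coroot \<gg>" "bracket \<gg>" "cartan \<gg>" "gen_e \<gg>" "gen_f \<gg>" d \<sigma> u \<mu> k by (rule U)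
 interpret p: hwm "gcm \<gg>" "simple_root \<gg>" "simple_coroot \<gg>" "bracket \<gg>" "cartan \<gg>" "gen_e \<gg>" "gen_f \<gg>" d \<rho> v \<Lambda> by (rule hw_module[OF V.m V.v(2,3)])
 interpret q: hwm "gcm \<gg>" "simple_root \<gg>" "simple_coroot \<gg>" "bracket \<gg>" "cartan \<gg>" "gen_e \<gg>" "gen_f \<gg>" d \<sigma> u \<mu> by (rule hw_module[OF U.m U.v(2,3)])
 let ?t = "tensor_act \<rho> \<sigma>" and ?H = "%h. tensor_act \<rho> \<sigma> (cartan \<gg> h)"
 note lin = clinear_tensor_act[OF V.m U.m]
 have sS: "cvec.subspace S" and st: "!!g x. x : S ==> ?t g x : S" using S by (auto simp: submodule_def)
 define D where "D n = cvec.span {Fw p.F w v \<otimes> Fw q.F w' u |w w'. cnt w + cnt w' = n}" for n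
 define tw where "tw n h = \<Lambda> h + \<mu> h - wt (up n) h" for n h
 have tw_inj: "inj tw" proof (rule injI)
  fix n n' assume "tw n = tw n'"
  then have "wt (up n) = wt (up n')" by (simp add: tw_def fun_eq_iff)
  then have "up n = up n'" using wt_inj by (rule injD[rotated])
  then show "n = n'" by (simp add: fun_eq_iff)
 qed
 have D_wt: "?H h x = tw n h *. x" if "x : D n" for x n h proof -
  have "D n \<subseteq> {x. ?H h x = tw n h *. x}" unfolding D_def
  proof (rule cvec.span_minimal[OF _ subspace_eigen[OF lin]], clarify)
   fix w w' assume n: "n = cnt w + cnt w'"
   have "p.dwt (cnt w) h + q.dwt (cnt w') h = tw (cnt w + cnt w') h"
    unfolding tw_def up_shift(4) ad.wt_add p.dwt_wt q.dwt_wt by simp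
   then show "?H h (Fw p.F w v \<otimes> Fw q.F w' u) = tw (cnt w + cnt w') h *. (Fw p.F w v \<otimes> Fw q.F w' u)"
    by (simp only: tensor_act_pure[OF V.m U.m] p.H_Fw q.H_Fw tensor_scale_left tensor_scale_right scaleC_add_left[symmetric])
  qed
  then show ?thesis using that by blast
 qed
 have D_fin: "finite_dim (D n)" for n proof -
  have "{Fw p.F w v \<otimes> Fw q.F w' u |w w'. cnt w + cnt w' = n}
   \<subseteq> (%(w, w'). Fw p.F w v \<otimes> Fw q.F w' u) ` ({w. set w \<subseteq> UNIV & length w <= height n} \<times> {w. set w \<subseteq> UNIV & length w <= height n})"
   by (auto simp: height_cnt[symmetric] height_def sum.distrib)
  then have "finite {Fw p.F w v \<otimes> Fw q.F w' u |w w'. cnt w + cnt w' = n}"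
   by (rule finite_subset) (intro finite_imageI finite_cartesian_product finite_lists_length_le finite_class.finite_UNIV)
  then show ?thesis unfolding finite_dim_def D_def by blast
 qed
 have D_sub: "cvec.subspace (D n)" for n by (simp add: D_def)
 have span: "t : cvec.span (\<Union>n\<in>UNIV. D n)" for t proof (induction t rule: tensor_induct)
  case (pure y x)
  let ?T = "cvec.span (\<Union>n\<in>UNIV. D n)"
  have "Fw p.F w v \<otimes> Fw q.F w' u : ?T" for w w'
   by (intro cvec.span_base UN_I[of "cnt w + cnt w'"]) (auto simp: D_def intro!: cvec.span_base)
  moreover have "clinear (%x. Fw p.F w v \<otimes> x)" for w by (rule clinearI) (simp_all add: tensor_simps)
  ultimately have "cvec.span {Fw q.F w' u |w'. True} \<subseteq> {x. Fw p.F w v \<otimes> x : ?T}" for w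
   by (intro cvec.span_minimal subspace_preimage cvec.subspace_span) auto
  then have "Fw p.F w v \<otimes> x : ?T" for w unfolding U.gen by blast
  moreover have "clinear (%y. y \<otimes> x)" by (rule clinearI) (simp_all add: tensor_simps)
  ultimately have "cvec.span {Fw p.F w v |w. True} \<subseteq> {y. y \<otimes> x : ?T}"
   by (intro cvec.span_minimal subspace_preimage cvec.subspace_span) auto
  then show ?case unfolding V.gen by blast
 qed (rule cvec.span_add cvec.span_scale, assumption+)+
 have comp: "EX N g. finite N & (ALL n:N. g n : D n) & t = (SUM n:N. g n)" for t
  using span_UN_decomp[of D t UNIV, OF D_sub span] by blast
 have diag: "diagonalizable \<gg> ?t S" unfolding diagonalizable_def proof (rule subset_antisym)
  show "cvec.span (\<Union>\<kappa>. weight_space \<gg> ?t S \<kappa>) \<subseteq> S"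
   by (rule cvec.span_minimal[OF _ sS]) (auto simp: weight_space_def)
  show "S \<subseteq> cvec.span (\<Union>\<kappa>. weight_space \<gg> ?t S \<kappa>)" proof
   fix s assume s: "s : S"
   obtain N g where N: "finite N" "ALL n:N. g n : D n" "s = (SUM n:N. g n)" using comp[of s] by (elim exE conjE)
   have "g n : cvec.span (\<Union>\<kappa>. weight_space \<gg> ?t S \<kappa>)" if n: "n : N" for n
   proof (rule cvec.span_base, rule UN_I[of "tw n"])
    have "g n : S" proof (rule weight_components[where H = ?H and wt = tw and K = N and v = g, OF N(1) _ sS lin _ _ _ n])
     show "inj_on tw N" using tw_inj by (rule inj_on_subset) simp
    qed (use N D_wt st s in auto)
    then show "g n : weight_space \<gg> ?t S (tw n)" using N(2) n D_wt by (auto simp: weight_space_def)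
   qed simp
   then show "s : cvec.span (\<Union>\<kappa>. weight_space \<gg> ?t S \<kappa>)" unfolding N(3) by (rule cvec.span_sum)
  qed
 qed
 have wsp: "s = 0 | (EX n. \<kappa> = tw n & s : D n)" if s: "s : weight_space \<gg> ?t S \<kappa>" for s \<kappa> proof -
  obtain N g where N: "finite N" "ALL n:N. g n : D n" "s = (SUM n:N. g n)" using comp[of s] by (elim exE conjE)
  have sw: "?H h s = \<kappa> h *. s" for h using s by (simp add: weight_space_def)
  have gD: "?H h (g n) = tw n h *. g n" if "n : N" for n h by (rule D_wt) (use N(2) that in blast)
  have g0: "(tw n h - \<kappa> h) *. g n = 0" if n: "n : N" for n h proof -
   have "(SUM n:N. (tw n h - \<kappa> h) *. g n) = ?H h s - \<kappa> h *. s" unfolding N(3)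
    by (simp add: gD clinear_sum[OF lin] cvec.scale_left_diff_distrib sum_subtractf cvec.scale_sum_right)
   then have z: "(SUM n:N. (tw n h - \<kappa> h) *. g n) : {0}" by (simp add: sw)
   have "(tw n h - \<kappa> h) *. g n : {0}"
   proof (rule weight_components[where H = ?H and wt = tw and K = N and v = "%n. (tw n h - \<kappa> h) *. g n",
      OF N(1) _ cvec.subspace_single_0 lin _ _ z n])
    show "inj_on tw N" using tw_inj by (rule inj_on_subset) simp
   qed (auto simp: gD clinear_0[OF lin] clinear_scale[OF lin] cvec.scale_left_commute)
   then show ?thesis by simp
  qed
  show ?thesis proof (cases "EX n:N. tw n = \<kappa>")
   case True
   then obtain n where n: "n : N" "tw n = \<kappa>" by blast
   have "g n' = 0" if "n' : N - {n}" for n' proof -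
    have "tw n' ~= \<kappa>" using that n tw_inj by (auto simp: inj_def)
    then obtain h where "tw n' h ~= \<kappa> h" by (auto simp: fun_eq_iff)
    then show ?thesis using g0[of n' h] that by simp
   qed
   then have "s = g n" unfolding N(3) using N(1) n(1) by (simp add: sum.remove)
   then show ?thesis using N(2) n by blast
  next case False
   have "g n = 0" if "n : N" for n proof -
    have "tw n ~= \<kappa>" using False that by blast
    then obtain h where "tw n h ~= \<kappa> h" by (auto simp: fun_eq_iff)
    then show ?thesis using g0[OF that, of h] by simp
   qed
   then show ?thesis unfolding N(3) by simp
  qed
 qed
 have findim: "finite_dim (weight_space \<gg> ?t S \<kappa>)" for \<kappa> proof (cases "EX n. \<kappa> = tw n")
  case True
  then obtain n where n: "\<kappa> = tw n" by blast
  have "weight_space \<gg> ?t S \<kappa> \<subseteq> D n" proof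
   fix s assume "s : weight_space \<gg> ?t S \<kappa>"
   from wsp[OF this] show "s : D n" using n tw_inj cvec.subspace_0[OF D_sub] by (auto simp: inj_def)
  qed
  then show ?thesis using D_fin[of n] unfolding finite_dim_def by blast
 next case False
  then have "weight_space \<gg> ?t S \<kappa> \<subseteq> cvec.span {}" using wsp by auto
  then show ?thesis unfolding finite_dim_def by blast
 qed
 have "\<exists>\<nu>\<in>{%h. \<Lambda> h + \<mu> h}. \<nu> - \<kappa> : positive_cone \<gg>" if ne: "weight_space \<gg> ?t S \<kappa> ~= {0}" for \<kappa>
 proof -
  have "0 : weight_space \<gg> ?t S \<kappa>" using cvec.subspace_0[OF sS] by (simp add: weight_space_def clinear_0[OF lin])
  then obtain s where "s : weight_space \<gg> ?t S \<kappa>" "s ~= 0" using ne by blast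
  with wsp obtain n where n: "\<kappa> = tw n" by blast
  have "(%h. \<Lambda> h + \<mu> h) - \<kappa> = wt (up n)" by (simp add: n tw_def fun_eq_iff)
  then show ?thesis using wt_up_cone[of n] by simp
 qed
 then have "EX F. finite F & (\<forall>\<kappa>. weight_space \<gg> ?t S \<kappa> ~= {0} --> (\<exists>\<nu>\<in>F. \<nu> - \<kappa> : positive_cone \<gg>))"
  by (intro exI[of _ "{%h. \<Lambda> h + \<mu> h}"]) simp
 moreover have "EX n. (?t (gen_e \<gg> i) ^^ n) x = 0" "EX n. (?t (gen_f \<gg> i) ^^ n) x = 0" for i x
  by (rule tensor_nilpotent[OF V.m U.m V.nil(1) U.nil(1)], rule tensor_nilpotent[OF V.m U.m V.nil(2) U.nil(2)])
 ultimately show ?thesis unfolding integrable_module_def category_O_def using S diag findim by (intro conjI allI ballI)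
qed

section \<open>The Weyl group as words in simple reflections\<close>

lemma srf_reflection: "simple_reflection \<gg> i = srf i" by (simp add: fun_eq_iff simple_reflection_def srf_def)

lemma swd_weyl: "foldr srf u : weyl_group \<gg>"
proof (induction u)
 case Nil
 have "foldr srf [] = id" by (simp add: fun_eq_iff)
 then show ?case using weyl_group.weyl_id by metis
next case (Cons i u)
 have "foldr srf (i # u) = simple_reflection \<gg> i \<circ> foldr srf u" by (simp only: foldr.simps srf_reflection)
 then show ?case using weyl_group.weyl_step[OF Cons, of i] by metis
qed

lemma weyl_word: "w : weyl_group \<gg> ==> EX u. w = foldr srf u"
proof (induction rule: weyl_group.induct)
 case weyl_id
 show ?case by (rule exI[of _ "[]"]) (simp add: fun_eq_iff)
next case (weyl_step w i)
 then obtain u where "w = foldr srf u" by blast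
 then show ?case by (intro exI[of _ "i # u"]) (simp only: foldr.simps srf_reflection)
qed

lemma wt_real_root: "wt (rfw u (ze i)) : real_roots \<gg>"
proof -
 have "wt (rfw u (ze i)) = foldr srf u (simple_root \<gg> i)" using swd_wt[of u "ze i"] by (simp only: wt_ze)
 then show ?thesis unfolding real_roots_def using swd_weyl by blast
qed

lemma wt_pos_cone: "pos z ==> wt z : positive_cone \<gg>"
proof -
 assume "pos z"
 then have "z = up (%i. nat (z i))" by (simp add: fun_eq_iff)
 then show ?thesis using wt_up_cone[of "%i. nat (z i)"] by simp
qed

text \<open>Undoing the reduced word on this root first gives the simple root \<open>i\<close>; the
  letter \<open>i\<close> then makes it negative, and the suffix leaves the negative of a positive
  root.\<close>

lemma inversion:
 assumes u: "u = pre @ i # suf" and pos: "pos (rfw pre (ze i))" "pos (rfw (rev suf) (ze i))"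
 shows "wt (rfw pre (ze i)) : inversions \<gg> (foldr srf u)"
proof -
 let ?b = "rfw pre (ze i)"
 have "inv (foldr srf u) (wt ?b) = swd (rev u) (wt ?b)" proof (rule inv_f_eq)
  show "inj (foldr srf u)" by (rule inj_on_inverseI[of _ "foldr srf (rev u)"]) simp
  show "swd u (swd (rev u) (wt ?b)) = wt ?b" by simp
 qed
 also have "... = wt (rfw (rev u) ?b)" by (rule swd_wt)
 finally have inv: "inv (foldr srf u) (wt ?b) = wt (rfw (rev u @ pre) (ze i))" by simp
 have "rfw (rev u @ pre) (ze i) = - rfw (rev suf) (ze i)" by (simp add: u rf_ze rfw_uminus)
 then have "wt (rfw (rev u @ pre) (ze i)) = - wt (rfw (rev suf) (ze i))" by (simp add: ad.wt_def sum_negf fun_eq_iff)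
 then have "wt (rfw (rev u @ pre) (ze i)) : negative_real_roots \<gg>"
  unfolding negative_real_roots_def using wt_real_root[of "rev u @ pre" i] wt_pos_cone[OF pos(2)] by blast
 then show ?thesis unfolding inversions_def positive_real_roots_def using inv wt_real_root[of pre i] wt_pos_cone[OF pos(1)] by simp
qed

text \<open>Whatever representative \<open>coroot\<close> selects,
  \<open>transported_coroot_value\<close> compares it with the one given by \<open>pre\<close> and
  \<open>i\<close>.\<close>

lemma coroot_value:
 assumes "clinear \<nu>"
 shows "\<nu> (coroot \<gg> (wt (rfw pre (ze i)))) = swd (rev pre) \<nu> (simple_coroot \<gg> i)"
proof -
 let ?b = "wt (rfw pre (ze i))" and ?c = "coroot \<gg> (wt (rfw pre (ze i)))"
 have "?b = foldr srf pre (simple_root \<gg> i)" using swd_wt[of pre "ze i"] by (simp only: wt_ze)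
 then have "EX c. EX w:weyl_group \<gg>. EX j. ?b = w (simple_root \<gg> j) & c = weyl_on_cartan w (simple_coroot \<gg> j)"
  using swd_weyl by blast
 from someI_ex[OF this] obtain w j where w: "w : weyl_group \<gg>" "?b = w (simple_root \<gg> j)" "?c = weyl_on_cartan w (simple_coroot \<gg> j)"
  unfolding coroot_def[symmetric] by blast
 obtain u' where u': "w = foldr srf u'" using weyl_word[OF w(1)] by blast
 have tr: "\<forall>\<mu>. clinear \<mu> --> swd u' \<mu> ?c = \<mu> (simple_coroot \<gg> j)"
  unfolding w(3) weyl_on_cartan_def u' by (rule theI'[OF coroot_transport])
 have "\<nu> ?c = swd u' (swd (rev u') \<nu>) ?c" by simp
 also have "... = swd (rev u') \<nu> (simple_coroot \<gg> j)" using tr swd_clinear[OF assms] by blast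
 finally have 1: "\<nu> ?c = swd (rev u') \<nu> (simple_coroot \<gg> j)" .
 have "wt (rfw u' (ze j)) = ?b" using swd_wt[of u' "ze j"] by (simp only: wt_ze w(2) u')
 then have "rfw u' (ze j) = rfw pre (ze i)" using wt_inj by (rule injD[rotated])
 from transported_coroot_value[OF 1 this] show ?thesis .
qed

lemma dominant_value:
 assumes "\<Lambda> : dominant_weights \<gg>"
 shows "\<Lambda> (simple_coroot \<gg> i) = of_nat (nat \<lfloor>Re (\<Lambda> (simple_coroot \<gg> i))\<rfloor>)"
proof -
 have "\<Lambda> (simple_coroot \<gg> i) : \<int>" "0 <= Re (\<Lambda> (simple_coroot \<gg> i))"
  using assms by (auto simp: dominant_weights_def integral_weights_def)
 then show ?thesis by (auto elim!: Ints_cases)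
qed

lemma dominant_clinear: "\<Lambda> : dominant_weights \<gg> ==> clinear \<Lambda>"
 by (simp add: dominant_weights_def integral_weights_def)

text \<open>The top weight space is a line, so the given vector is itself a highest weight vector,
  and irreducibility makes the words on it span the module.\<close>

lemma is_V_hw_gen:
 assumes V: "is_V \<gg> \<Lambda> \<rho>" and dom: "\<Lambda> : dominant_weights \<gg>" and v: "is_weight_vector \<gg> \<rho> \<Lambda> v"
 shows "hw_gen (gcm \<gg>) (simple_root \<gg>) (simple_coroot \<gg>) (bracket \<gg>) (cartan \<gg>) (gen_e \<gg>) (gen_f \<gg>) d \<rho> v \<Lambda>
  (%i. nat \<lfloor>Re (\<Lambda> (simple_coroot \<gg> i))\<rfloor>)"
proof -
 have m: "lie_module (bracket \<gg>) \<rho>" and irr: "irreducible_module \<rho>" and int: "integrable_module \<gg> \<rho> UNIV"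
  using V by (auto simp: is_V_def)
 obtain v0 where v0: "v0 ~= 0" "!!h. \<rho> (cartan \<gg> h) v0 = \<Lambda> h *. v0" "!!i. \<rho> (gen_e \<gg> i) v0 = 0" "U_span \<rho> v0 = UNIV"
  using V by (auto simp: is_V_def highest_weight_module_def weight_space_def)
 have vv: "v ~= 0" "!!h. \<rho> (cartan \<gg> h) v = \<Lambda> h *. v" using v by (auto simp: is_weight_vector_def weight_space_def)
 interpret p: hwm "gcm \<gg>" "simple_root \<gg>" "simple_coroot \<gg>" "bracket \<gg>" "cartan \<gg>" "gen_e \<gg>" "gen_f \<gg>" d \<rho> v0 \<Lambda>
  by (rule hw_module[OF m v0(3,2)])
 have gen0: "cvec.span {Fw p.F w v0 |w. True} = UNIV" using U_span_minimal[OF p.submodule_U p.y_U] v0(4) unfolding p.U_def by blast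
 obtain c where c: "v = c *. v0" using top_weight_space[OF m v0(3,2) gen0 vv(2)] by blast
 have ev: "\<rho> (gen_e \<gg> i) v = 0" for i by (simp add: c clinear_scale[OF lie_module_linear[OF m]] v0(3))
 interpret q: hwm "gcm \<gg>" "simple_root \<gg>" "simple_coroot \<gg>" "bracket \<gg>" "cartan \<gg>" "gen_e \<gg>" "gen_f \<gg>" d \<rho> v \<Lambda>
  by (rule hw_module[OF m ev vv(2)])
 have "q.U = UNIV" using irr q.submodule_U q.y_U vv(1) unfolding irreducible_module_def by blast
 then show ?thesis
  using int by (intro hw_gen.intro hw_gen_axioms.intro km_axioms m vv ev irr dominant_clinear[OF dom] dominant_value[OF dom])
   (auto simp: q.U_def integrable_module_def)
qed

lemma theorem_from_wtmod:
 fixes \<rho>1 :: "'g => 'v1::complex_vector => 'v1" and \<sigma>1 :: "'g => 'u1::complex_vector => 'u1"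
  and \<rho>2 :: "'g => 'v2::complex_vector => 'v2" and \<sigma>2 :: "'g => 'u2::complex_vector => 'u2"
  and \<tau> :: "'g => 'm::complex_vector => 'm"
 assumes dom: "\<Lambda>1 : dominant_weights \<gg>" "\<Lambda>2 : dominant_weights \<gg>" "\<mu>1 : dominant_weights \<gg>" "\<mu>2 : dominant_weights \<gg>"
  and w: "w : weyl_group \<gg>" "\<Lambda>1 - \<Lambda>2 = w (\<mu>2 - \<mu>1)" "\<Lambda>1 - \<Lambda>2 : dominant_weights_wrt \<gg> w"
  and V: "is_V \<gg> \<Lambda>1 \<rho>1" "is_V \<gg> \<mu>1 \<sigma>1" "is_V \<gg> \<Lambda>2 \<rho>2" "is_V \<gg> \<mu>2 \<sigma>2"
  and v: "is_weight_vector \<gg> \<rho>1 \<Lambda>1 v1" "is_weight_vector \<gg> \<sigma>1 (w \<mu>1) u1"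
   "is_weight_vector \<gg> \<rho>2 \<Lambda>2 v2" "is_weight_vector \<gg> \<sigma>2 (w \<mu>2) u2"
  and M: "wtmod (gcm \<gg>) (simple_root \<gg>) (simple_coroot \<gg>) (bracket \<gg>) (cartan \<gg>) (gen_e \<gg>) (gen_f \<gg>) d \<tau> pj (\<mu>2 - \<mu>1) a nv"
 shows "(\<exists>\<phi>. canonical_morphism \<rho>1 \<sigma>1 v1 u1 \<rho>2 \<sigma>2 v2 u2 \<phi> \<and>
      \<phi> ` kostant_kumar \<rho>1 \<sigma>1 v1 u1 = kostant_kumar \<rho>2 \<sigma>2 v2 u2) \<and>
    schur_positive \<gg> (tensor_act \<rho>1 \<sigma>1) (kostant_kumar \<rho>1 \<sigma>1 v1 u1)
      (tensor_act \<rho>2 \<sigma>2) (kostant_kumar \<rho>2 \<sigma>2 v2 u2)"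
proof -
 interpret M: wtmod "gcm \<gg>" "simple_root \<gg>" "simple_coroot \<gg>" "bracket \<gg>" "cartan \<gg>" "gen_e \<gg>" "gen_f \<gg>" d \<tau> pj "\<mu>2 - \<mu>1" a nv
  by (rule M)
 obtain x1 where x1: "is_weight_vector \<gg> \<sigma>1 \<mu>1 x1"
  using V(2) by (auto simp: is_V_def highest_weight_module_def is_weight_vector_def)
 obtain x2 where x2: "is_weight_vector \<gg> \<sigma>2 \<mu>2 x2"
  using V(4) by (auto simp: is_V_def highest_weight_module_def is_weight_vector_def)
 note hg = is_V_hw_gen[OF V(1) dom(1) v(1)] is_V_hw_gen[OF V(3) dom(2) v(3)] is_V_hw_gen[OF V(2) dom(3) x1] is_V_hw_gen[OF V(4) dom(4) x2]
 obtain u0 where u0: "w = foldr srf u0" using weyl_word[OF w(1)] by blast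
 obtain u where u: "foldr srf u = foldr srf u0"
  and red: "ALL pre i suf. u = pre @ i # suf --> pos (rfw pre (ze i)) & pos (rfw (rev suf) (ze i))"
  by (rule reduced_word[of u0], rule that)
 have wu: "w = foldr srf u" by (simp only: u0 u)
 have diff: "swd s (\<mu>2 - \<mu>1) h = swd s \<mu>2 h - swd s \<mu>1 h" for s h proof -
  have "\<mu>2 - \<mu>1 = (%h. \<mu>2 h + (- 1) * \<mu>1 h)" by (simp add: fun_eq_iff)
  then show ?thesis using fun_cong[OF swd_add[of s \<mu>2 "- 1" \<mu>1], of h] by simp
 qed
 have \<nu>: "\<Lambda>1 h - \<Lambda>2 h = swd u \<mu>2 h - swd u \<mu>1 h" for h
  using fun_cong[OF w(2), of h] by (simp only: wu diff minus_apply)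
 \<comment> \<open>At a letter \<open>i\<close> of the reduced word, the value of \<Lambda>1 -
   \<Lambda>2 on the coroot of the inversion \<open>rfw pre (ze i)\<close> is \<open>p - q\<close>.
   Dominance on the inversions is therefore the inequality \<open>q <= p\<close> that
   \<open>chain\<close> consumes.\<close>
 have steps: "ALL pre i suf. u = pre @ i # suf -->
   (EX p q. swd suf \<mu>1 (simple_coroot \<gg> i) = of_nat p & swd suf \<mu>2 (simple_coroot \<gg> i) = of_nat q & q <= p)"
 proof (intro allI impI)
  fix pre i suf assume s: "u = pre @ i # suf"
  note pos = conjunct1[OF red[rule_format, OF s]] conjunct2[OF red[rule_format, OF s]]
  obtain p where p: "swd suf \<mu>1 (simple_coroot \<gg> i) = of_nat p"
   using swd_nonneg[where \<mu> = \<mu>1, OF dominant_value[OF dom(3)] pos(2)] by blast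
  obtain q where q: "swd suf \<mu>2 (simple_coroot \<gg> i) = of_nat q"
   using swd_nonneg[where \<mu> = \<mu>2, OF dominant_value[OF dom(4)] pos(2)] by blast
  have lin: "clinear (\<Lambda>1 - \<Lambda>2)" using w(3) by (simp add: dominant_weights_wrt_def integral_weights_def)
  have "swd (rev pre) (\<Lambda>1 - \<Lambda>2) = swd (i # suf) (\<mu>2 - \<mu>1)" unfolding w(2) wu s by simp
  then have "(\<Lambda>1 - \<Lambda>2) (coroot \<gg> (wt (rfw pre (ze i)))) = srf i (swd suf (\<mu>2 - \<mu>1)) (simple_coroot \<gg> i)"
   unfolding coroot_value[OF lin] by simp
  also have "... = of_nat p - of_nat q" by (simp add: srf_def sr_cr A_diag diff p q)
  finally have val: "(\<Lambda>1 - \<Lambda>2) (coroot \<gg> (wt (rfw pre (ze i)))) = of_nat p - of_nat q" .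
  have "wt (rfw pre (ze i)) : inversions \<gg> w" unfolding wu by (rule inversion[OF s pos])
  then have "0 <= Re ((\<Lambda>1 - \<Lambda>2) (coroot \<gg> (wt (rfw pre (ze i)))))" using w(3) unfolding dominant_weights_wrt_def by blast
  then have "q <= p" unfolding val by simp
  then show "EX p q. swd suf \<mu>1 (simple_coroot \<gg> i) = of_nat p & swd suf \<mu>2 (simple_coroot \<gg> i) = of_nat q & q <= p"
   using p q by blast
 qed
 have u1: "\<sigma>1 (cartan \<gg> h) u1 = swd u \<mu>1 h *. u1" "u1 ~= 0" for h
  using v(2) by (auto simp: is_weight_vector_def weight_space_def wu)
 have u2: "\<sigma>2 (cartan \<gg> h) u2 = swd u \<mu>2 h *. u2" "u2 ~= 0" for h
  using v(4) by (auto simp: is_weight_vector_def weight_space_def wu)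
 have \<omega>: "(\<mu>2 - \<mu>1) h = \<mu>2 h - \<mu>1 h" for h by simp
 obtain \<phi> where \<phi>: "canonical_morphism \<rho>1 \<sigma>1 v1 u1 \<rho>2 \<sigma>2 v2 u2 \<phi>"
  "\<phi> ` kostant_kumar \<rho>1 \<sigma>1 v1 u1 = kostant_kumar \<rho>2 \<sigma>2 v2 u2"
  by (rule M.canonical_morphism_exists[OF hg \<omega> \<nu> steps u1 u2], rule that)
 have lm: "lie_module (bracket \<gg>) \<rho>1" "lie_module (bracket \<gg>) \<sigma>1" "lie_module (bracket \<gg>) \<rho>2" "lie_module (bracket \<gg>) \<sigma>2"
  using V by (auto simp: is_V_def)
 have K1: "submodule (tensor_act \<rho>1 \<sigma>1) (kostant_kumar \<rho>1 \<sigma>1 v1 u1)"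
  and K2: "submodule (tensor_act \<rho>2 \<sigma>2) (kostant_kumar \<rho>2 \<sigma>2 v2 u2)"
  unfolding kostant_kumar_def by (rule submodule_U_span[OF clinear_tensor_act[OF lm(1,2)]], rule submodule_U_span[OF clinear_tensor_act[OF lm(3,4)]])
 have "U_linear (tensor_act \<rho>1 \<sigma>1) (kostant_kumar \<rho>1 \<sigma>1 v1 u1) (tensor_act \<rho>2 \<sigma>2) (kostant_kumar \<rho>2 \<sigma>2 v2 u2) \<phi>"
  using \<phi>(1) by (simp add: canonical_morphism_def)
 then have "schur_positive \<gg> (tensor_act \<rho>1 \<sigma>1) (kostant_kumar \<rho>1 \<sigma>1 v1 u1) (tensor_act \<rho>2 \<sigma>2) (kostant_kumar \<rho>2 \<sigma>2 v2 u2)"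
  using tensor_integrable_O[OF hg(1,3) K1] tensor_integrable_O[OF hg(2,4) K2] \<phi>(2)
  unfolding schur_positive_def by (intro conjI exI) simp_all
 then show ?thesis using \<phi> by (intro conjI exI)
qed

end

lemma kac_moody_km0:
 "kac_moody_algebra \<gg> ==> km0 (gcm \<gg>) (simple_root \<gg>) (simple_coroot \<gg>) (bracket \<gg>) (cartan \<gg>) (gen_e \<gg>) (gen_f \<gg>)"
 unfolding kac_moody_algebra_def generalized_cartan_matrix_def realization_def by (intro km0.intro) simp_all

theorem proposition6p5:
  fixes \<gg> :: "('i::finite, 'h::complex_vector, 'g::complex_vector) kac_moody"
    and \<rho>1 :: "'g \<Rightarrow> 'v1::complex_vector \<Rightarrow> 'v1" and \<sigma>1 :: "'g \<Rightarrow> 'u1::complex_vector \<Rightarrow> 'u1"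
    and \<rho>2 :: "'g \<Rightarrow> 'v2::complex_vector \<Rightarrow> 'v2" and \<sigma>2 :: "'g \<Rightarrow> 'u2::complex_vector \<Rightarrow> 'u2"
    and \<Lambda>1 \<Lambda>2 \<mu>1 \<mu>2 :: "'h \<Rightarrow> complex"
    and w :: "('h \<Rightarrow> complex) \<Rightarrow> 'h \<Rightarrow> complex"
    and v1 :: 'v1 and u1 :: 'u1 and v2 :: 'v2 and u2 :: 'u2
  assumes "kac_moody_algebra \<gg>"
    and "finite_dim_semisimple \<gg> \<or> symmetric_kac_moody \<gg>"
    and "\<Lambda>1 \<in> dominant_weights \<gg>" and "\<Lambda>2 \<in> dominant_weights \<gg>"
    and "\<mu>1 \<in> dominant_weights \<gg>" and "\<mu>2 \<in> dominant_weights \<gg>"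
    and "w \<in> weyl_group \<gg>"
    and "\<Lambda>1 - \<Lambda>2 = w (\<mu>2 - \<mu>1)"
    and "\<Lambda>1 - \<Lambda>2 \<in> dominant_weights_wrt \<gg> w"
    and "is_V \<gg> \<Lambda>1 \<rho>1" and "is_V \<gg> \<mu>1 \<sigma>1"
    and "is_V \<gg> \<Lambda>2 \<rho>2" and "is_V \<gg> \<mu>2 \<sigma>2"
    and "is_weight_vector \<gg> \<rho>1 \<Lambda>1 v1" and "is_weight_vector \<gg> \<sigma>1 (w \<mu>1) u1"
    and "is_weight_vector \<gg> \<rho>2 \<Lambda>2 v2" and "is_weight_vector \<gg> \<sigma>2 (w \<mu>2) u2"
  shows "(\<exists>\<phi>. canonical_morphism \<rho>1 \<sigma>1 v1 u1 \<rho>2 \<sigma>2 v2 u2 \<phi> \<and>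
            \<phi> ` kostant_kumar \<rho>1 \<sigma>1 v1 u1 = kostant_kumar \<rho>2 \<sigma>2 v2 u2) \<and>
         schur_positive \<gg> (tensor_act \<rho>1 \<sigma>1) (kostant_kumar \<rho>1 \<sigma>1 v1 u1)
            (tensor_act \<rho>2 \<sigma>2) (kostant_kumar \<rho>2 \<sigma>2 v2 u2)"
proof -
 define k where "k \<mu> i = nat \<lfloor>Re (\<mu> (simple_coroot \<gg> i))\<rfloor>" for \<mu> :: "'h => complex" and i
 interpret km0 "gcm \<gg>" "simple_root \<gg>" "simple_coroot \<gg>" "bracket \<gg>" "cartan \<gg>" "gen_e \<gg>" "gen_f \<gg>"
  by (rule kac_moody_km0[OF assms(1)])
 have lin: "clinear (\<mu>2 - \<mu>1)" proof -
  have "clinear \<mu>1" "clinear \<mu>2" using assms(5,6) by (auto simp: dominant_weights_def integral_weights_def)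
  from clinear_simps[OF this(1)] clinear_simps[OF this(2)] show ?thesis by (intro clinearI) (simp_all add: algebra_simps)
 qed
 note hyps = assms(3-17)
 from assms(2) show ?thesis proof
  assume "finite_dim_semisimple \<gg>"
  then interpret fkm "gcm \<gg>" "simple_root \<gg>" "simple_coroot \<gg>" "bracket \<gg>" "cartan \<gg>" "gen_e \<gg>" "gen_f \<gg>"
   by unfold_locales (simp add: finite_dim_semisimple_def)
  obtain d where "km (gcm \<gg>) (simple_root \<gg>) (simple_coroot \<gg>) (bracket \<gg>) (cartan \<gg>) (gen_e \<gg>) (gen_f \<gg>) d"
   using symmetrizable by blast
  then interpret K: kma \<gg> d by (rule kma.intro)
  have val: "(\<mu>2 - \<mu>1) (simple_coroot \<gg> i) = of_int (int (k \<mu>2 i) - int (k \<mu>1 i))" for i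
   using K.dominant_value[OF assms(5), of i] K.dominant_value[OF assms(6), of i] by (simp flip: k_def)
  from K.wtmod_finite_type[OF finite_roots lin val]
  obtain \<tau> :: "'g => ('i list => complex) => 'i list => complex" and pj nv where
   "wtmod (gcm \<gg>) (simple_root \<gg>) (simple_coroot \<gg>) (bracket \<gg>) (cartan \<gg>) (gen_e \<gg>) (gen_f \<gg>) d \<tau> pj (\<mu>2 - \<mu>1)
    (%i. int (k \<mu>2 i) - int (k \<mu>1 i)) nv" by (elim exE conjE)
  from K.theorem_from_wtmod[OF hyps this] show ?thesis .
 \<comment> \<open>A symmetric matrix is symmetrized by the constant 1, the normalization that the
   lattice construction requires.\<close>
 next assume "symmetric_kac_moody \<gg>"
  then interpret K: kma \<gg> "%_. 1" by (intro kma.intro km.intro km_axioms.intro km0_axioms) (auto simp: symmetric_kac_moody_def)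
  have val: "(\<mu>2 - \<mu>1) (simple_coroot \<gg> i) = of_int (int (k \<mu>2 i) - int (k \<mu>1 i))" for i
   using K.dominant_value[OF assms(5), of i] K.dominant_value[OF assms(6), of i] by (simp flip: k_def)
  interpret fock "gcm \<gg>" "simple_root \<gg>" "simple_coroot \<gg>" "bracket \<gg>" "cartan \<gg>" "gen_e \<gg>" "gen_f \<gg>" "%_. 1" "\<mu>2 - \<mu>1"
   "%i. int (k \<mu>2 i) - int (k \<mu>1 i)" by (intro fock.intro fock_axioms.intro K.km_axioms lin val refl)
  obtain \<tau> :: "'g => (('i => int) => 'i slice) => ('i => int) => 'i slice" and pj nv where
   "wtmod (gcm \<gg>) (simple_root \<gg>) (simple_coroot \<gg>) (bracket \<gg>) (cartan \<gg>) (gen_e \<gg>) (gen_f \<gg>) (%_. 1) \<tau> pj (\<mu>2 - \<mu>1)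
    (%i. int (k \<mu>2 i) - int (k \<mu>1 i)) nv" using wtmod_symmetric by (elim exE conjE)
  from K.theorem_from_wtmod[OF hyps this] show ?thesis .
 qed
qed

end
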